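(* Consider the risk process $$X(t)=x+ct-\sum_{j=1}^{N(t)}X_j+\sigma B(t),\qquad t\ge 0,$$ with initial capital $x\ge 0$, premium rate $c$, and $\sigma\ge 0$, where $\{N(t)\}$ is a Poisson process with parameter $\lambda$, $\{X_k\}_{k\ge 1}$ are i.i.d. with distribution function $P=1-\overline P$ having a density $p$, mean $\mu$ and $P(0)=0$, $\{B(t)\}$ is a Brownian motion, the three being independent, and $c>\lambda\mu$. (The case $\sigma=0$ is the Cramér–Lundberg risk process, the case $\sigma\ne 0$ the jump-diffusion risk process.) Let $q\ge 0$ and let $f_q(y|x)$ be the discounted density of the surplus immediately before ruin. Then, both for $\sigma=0$ and for $\sigma\neq0$, $$f_q(y|x)=\begin{cases}\lambda\overline P(y)\,\dfrac{e^{\Phi(q)(x-y)}}{\varphi'(\Phi(q))}\,P_x^{(\Phi(q))}(T=\infty), & y>x\ge 0,\\[3mm] \lambda\overline P(y)\,\dfrac{e^{\Phi(q)(x-y)}}{\varphi'(\Phi(q))}\left(P_x^{(\Phi(q))}(T=\infty)-P_{x-y}^{(\Phi(q))}(T=\infty)\right), & 0<y\le x.\end{cases}$$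
   Context: $P_x$ denotes the law of the process started at $X(0)=x$ and $E_x$ its expectation. The Laplace exponent is $\varphi(\alpha)=c\alpha+\frac12\sigma^2\alpha^2+\lambda\{\hat p(\alpha)-1\}$, where $\hat p(\alpha)=\int_0^\infty e^{-\alpha u}p(u)du$, so that $E_x e^{\alpha(X(t)-x)}=e^{t\varphi(\alpha)}$. For $q\ge 0$, $\Phi(q)=\sup\{\alpha\ge 0:\varphi(\alpha)=q\}$. $T=\inf\{t\ge 0:X(t)<0\}$ (with $\inf\emptyset=\infty$) is the ruin time. For $y,z>0$ the joint density $f$ is defined by $f(y,z,t|x)\,dy\,dz\,dt=P_x(T\in dt,\ X(T-)\in dy,\ |X(T)|\in dz)$, and $f_q(y|x)=\int_0^\infty\int_0^\infty e^{-qt}f(y,z,t|x)\,dt\,dz$. For $\theta\ge0$ with $\varphi(\theta)$ finite, $P_x^{(\theta)}$ is the probability measure defined by $\frac{dP_x^{(\theta)}}{dP_x}\big|_{\mathcal F_t}=\exp\{\theta(X(t)-x)-\varphi(\theta)t\}$ for all $0\le t<\infty$, where $\mathcal F_t$ is the filtration of $X$; under $P_x^{(\theta)}$, $X$ is again a spectrally negative Lévy process started at $x$, with Laplace exponent $\varphi_\theta(\alpha)=\varphi(\alpha+\theta)-\varphi(\theta)$. *)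

theory Defs
  imports "HOL-Probability.Probability"
begin

section \<open>Driving processes\<close>

definition independent_increments :: "'a measure \<Rightarrow> (real \<Rightarrow> 'a \<Rightarrow> real) \<Rightarrow> bool" where
  "independent_increments M Z \<longleftrightarrow>
     (\<forall>(n::nat) (s::nat \<Rightarrow> real). 0 \<le> s 0 \<and> (\<forall>i<n. s i \<le> s (Suc i)) \<longrightarrow>
        prob_space.indep_vars M (\<lambda>_. borel) (\<lambda>i \<omega>. Z (s (Suc i)) \<omega> - Z (s i) \<omega>) {..<n})"

text \<open>Time is a real parameter; only the values at times \<open>t \<ge> 0\<close> matter. The path
  properties are required for every \<open>\<omega>\<close>, so that the paths below are cadlag
  and the ruin time is measurable without completing the probability space.\<close>

definition poisson_process :: "'a measure \<Rightarrow> real \<Rightarrow> (real \<Rightarrow> 'a \<Rightarrow> nat) \<Rightarrow> bool" where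
  "poisson_process M lam N \<longleftrightarrow>
     0 < lam \<and>
     (\<forall>t\<ge>0. N t \<in> M \<rightarrow>\<^sub>M count_space UNIV) \<and>
     (\<forall>\<omega>\<in>space M. N 0 \<omega> = 0 \<and>
        (\<forall>s t. 0 \<le> s \<and> s \<le> t \<longrightarrow> N s \<omega> \<le> N t \<omega>) \<and>
        (\<forall>t\<ge>0. ((\<lambda>s. real (N s \<omega>)) \<longlongrightarrow> real (N t \<omega>)) (at_right t))) \<and>
     independent_increments M (\<lambda>t \<omega>. real (N t \<omega>)) \<and>
     (\<forall>s t. 0 \<le> s \<and> s < t \<longrightarrow>
        distr M (count_space UNIV) (\<lambda>\<omega>. N t \<omega> - N s \<omega>) = measure_pmf (poisson_pmf (lam * (t - s))))"

definition brownian_motion :: "'a measure \<Rightarrow> (real \<Rightarrow> 'a \<Rightarrow> real) \<Rightarrow> bool" where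
  "brownian_motion M B \<longleftrightarrow>
     (\<forall>t\<ge>0. B t \<in> borel_measurable M) \<and>
     (\<forall>\<omega>\<in>space M. B 0 \<omega> = 0 \<and> continuous_on {0..} (\<lambda>t. B t \<omega>)) \<and>
     independent_increments M B \<and>
     (\<forall>s t. 0 \<le> s \<and> s < t \<longrightarrow>
        distributed M lborel (\<lambda>\<omega>. B t \<omega> - B s \<omega>)
          (\<lambda>u. ennreal (normal_density 0 (sqrt (t - s)) u)))"

text \<open>The \<open>\<sigma>\<close>-algebra on \<open>\<Omega>\<close> generated by the family \<open>(Z i)\<^sub>i\<^sub>\<in>\<^sub>I\<close>.\<close>

definition generated_by :: "'a measure \<Rightarrow> 'i set \<Rightarrow> 'b measure \<Rightarrow> ('i \<Rightarrow> 'a \<Rightarrow> 'b) \<Rightarrow> 'a set set" where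
  "generated_by M I S Z = sigma_sets (space M) {Z i -` A \<inter> space M | i A. i \<in> I \<and> A \<in> sets S}"

definition three_independent ::
  "'a measure \<Rightarrow> (real \<Rightarrow> 'a \<Rightarrow> nat) \<Rightarrow> (nat \<Rightarrow> 'a \<Rightarrow> real) \<Rightarrow> (real \<Rightarrow> 'a \<Rightarrow> real) \<Rightarrow> bool" where
  "three_independent M N Y B \<longleftrightarrow>
     prob_space.indep_sets M
       (\<lambda>k. [generated_by M {0..} (count_space UNIV) N,
             generated_by M {1..} borel Y,
             generated_by M {0..} borel B] ! k) {0, 1, 2}"


section \<open>Path space\<close>

text \<open>The laws \<open>P\<^sub>x\<close> and \<open>P\<^sub>x\<^sup>(\<^sup>\<theta>\<^sup>)\<close> are measures on the space of
  cadlag paths over \<open>[0, \<infinity>)\<close>, with \<open>X\<close> the coordinate process; on this space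
  the measures \<open>P\<^sub>x\<^sup>(\<^sup>\<theta>\<^sup>)\<close> always exist.\<close>

definition cadlag_paths :: "(real \<Rightarrow> real) set" where
  "cadlag_paths = {\<omega> \<in> extensional {0..}.
     (\<forall>t\<ge>0. (\<omega> \<longlongrightarrow> \<omega> t) (at_right t)) \<and> (\<forall>t>0. \<exists>l. (\<omega> \<longlongrightarrow> l) (at_left t))}"

definition path_space :: "(real \<Rightarrow> real) measure" where
  "path_space = restrict_space (Pi\<^sub>M {0..} (\<lambda>_. borel)) cadlag_paths"

definition path_filtration :: "real \<Rightarrow> (real \<Rightarrow> real) measure" where
  "path_filtration t =
     vimage_algebra cadlag_paths (\<lambda>\<omega>. restrict \<omega> {0..t}) (Pi\<^sub>M {0..t} (\<lambda>_. borel))"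

definition risk_law ::
  "'a measure \<Rightarrow> (real \<Rightarrow> 'a \<Rightarrow> nat) \<Rightarrow> (nat \<Rightarrow> 'a \<Rightarrow> real) \<Rightarrow> (real \<Rightarrow> 'a \<Rightarrow> real) \<Rightarrow>
   real \<Rightarrow> real \<Rightarrow> real \<Rightarrow> (real \<Rightarrow> real) measure" where
  "risk_law M N Y B c \<sigma> x =
     distr M path_space (\<lambda>\<omega>. \<lambda>t\<in>{0..}. x + c * t - (\<Sum>j=1..N t \<omega>. Y j \<omega>) + \<sigma> * B t \<omega>)"


section \<open>Laplace exponent and change of measure\<close>

definition laplace_exponent :: "real \<Rightarrow> real \<Rightarrow> real \<Rightarrow> (real \<Rightarrow> real) \<Rightarrow> real \<Rightarrow> real" where
  "laplace_exponent c \<sigma> lam p \<alpha> =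
     c * \<alpha> + 1/2 * \<sigma>\<^sup>2 * \<alpha>\<^sup>2 + lam * ((LBINT u:{0<..}. exp (- \<alpha> * u) * p u) - 1)"

definition right_inverse :: "(real \<Rightarrow> real) \<Rightarrow> real \<Rightarrow> real" where
  "right_inverse \<phi> q = Sup {\<alpha>. 0 \<le> \<alpha> \<and> \<phi> \<alpha> = q}"

text \<open>Derivative on \<open>[0, \<infinity>)\<close>: at \<open>0\<close> it is one-sided, because the Laplace exponent may be
  infinite to the left of \<open>0\<close>; this matters for \<open>q = 0\<close>.\<close>

definition deriv_nonneg :: "(real \<Rightarrow> real) \<Rightarrow> real \<Rightarrow> real" where
  "deriv_nonneg \<phi> \<alpha> = vector_derivative \<phi> (at \<alpha> within {0..})"

definition exponential_tilt ::
  "(real \<Rightarrow> real) \<Rightarrow> real \<Rightarrow> real \<Rightarrow> (real \<Rightarrow> real) measure \<Rightarrow> (real \<Rightarrow> real) measure \<Rightarrow> bool" where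
  "exponential_tilt \<phi> \<theta> x L Q \<longleftrightarrow>
     prob_space Q \<and> sets Q = sets path_space \<and>
     (\<forall>t\<ge>0. restr_to_subalg Q (path_filtration t) =
        density (restr_to_subalg L (path_filtration t))
          (\<lambda>\<omega>. ennreal (exp (\<theta> * (\<omega> t - x) - \<phi> \<theta> * t))))"


section \<open>Ruin\<close>

definition ruin_time :: "(real \<Rightarrow> real) \<Rightarrow> ereal" where
  "ruin_time \<omega> = Inf {ereal t | t. 0 \<le> t \<and> \<omega> t < 0}"

text \<open>Law of \<open>(X(T-), |X(T)|, T)\<close> on \<open>{T < \<infinity>}\<close> under the path law \<open>L\<close>.\<close>

definition ruin_law :: "(real \<Rightarrow> real) measure \<Rightarrow> (real \<times> real \<times> real) measure" where
  "ruin_law L = distr (restrict_space L {\<omega>. ruin_time \<omega> < \<infinity>}) borel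
     (\<lambda>\<omega>. let T = real_of_ereal (ruin_time \<omega>) in (Lim (at_left T) \<omega>, \<bar>\<omega> T\<bar>, T))"

abbreviation positive_octant :: "(real \<times> real \<times> real) set" where
  "positive_octant \<equiv> {0<..} \<times> {0<..} \<times> {0<..}"

definition joint_ruin_density :: "(real \<Rightarrow> real) measure \<Rightarrow> (real \<Rightarrow> real \<Rightarrow> real \<Rightarrow> real) \<Rightarrow> bool" where
  "joint_ruin_density L f \<longleftrightarrow>
     (\<lambda>(y, z, t). f y z t) \<in> borel_measurable borel \<and> (\<forall>y z t. 0 \<le> f y z t) \<and>
     density (ruin_law L) (indicator positive_octant) =
     density lborel (\<lambda>(y, z, t). ennreal (f y z t) * indicator positive_octant (y, z, t))"

text \<open>For \<open>\<sigma> = 0\<close> the joint law has no Lebesgue density in general: ruin by the first claim is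
  carried by the surface \<open>y = x + c t\<close>. The symbol \<open>f(y, z, t|x) dy dz dt\<close> therefore denotes
  the joint law itself, and \<open>f\<^sub>q(\<cdot>|x)\<close> is the density of the measure obtained from it by
  integrating out \<open>e\<^sup>-\<^sup>q\<^sup>t\<close> over \<open>z, t > 0\<close>. If a joint density \<open>f\<close> exists, this is its iterated
  integral (lemma \<open>discounted_density_eq_iterated_integral\<close>).\<close>

definition discounted_pre_ruin_measure :: "real \<Rightarrow> (real \<Rightarrow> real) measure \<Rightarrow> real measure" where
  "discounted_pre_ruin_measure q L =
     distr (density (ruin_law L)
       (\<lambda>(y, z, t). ennreal (exp (- q * t)) * indicator positive_octant (y, z, t))) borel fst"

definition discounted_density :: "real \<Rightarrow> (real \<Rightarrow> real) measure \<Rightarrow> real \<Rightarrow> real" where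
  "discounted_density q L y = enn2real (RN_deriv lborel (discounted_pre_ruin_measure q L) y)"


lemma discounted_density_eq_iterated_integral:
  assumes fin_law: "finite_measure (ruin_law L)"
    and f: "joint_ruin_density L f" and q: "0 \<le> q"
  shows "AE y in lborel. 0 < y \<longrightarrow> discounted_density q L y =
    (LBINT z:{0<..}. LBINT t:{0<..}. exp (- q * t) * f y z t)"
proof -
  let ?O = "positive_octant"
  define h :: "real \<times> real \<times> real \<Rightarrow> real" where
    "h = (\<lambda>(y, z, t). indicator ?O (y, z, t) * (exp (- q * t) * f y z t))"
  have fm[measurable]: "(\<lambda>(y, z, t). f y z t) \<in> borel_measurable borel"
    and f0: "\<And>y z t. 0 \<le> f y z t"
    and fd: "density (ruin_law L) (indicator ?O) =
      density lborel (\<lambda>(y, z, t). ennreal (f y z t) * indicator ?O (y, z, t))"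
    using f unfolding joint_ruin_density_def by auto
  have Om[measurable]: "?O \<in> sets borel"
    by (intro borel_open open_Times) auto
  have em[measurable]: "(\<lambda>(y::real, z::real, t). exp (- q * t)) \<in> borel_measurable borel"
    unfolding split_beta by (intro borel_measurable_continuous_onI continuous_intros)
  have hm[measurable]: "h \<in> borel_measurable borel"
  proof -
    have "h = (\<lambda>w. indicator ?O w * ((case w of (y, z, t) \<Rightarrow> exp (- q * t)) * (case w of (y, z, t) \<Rightarrow> f y z t)))"
      by (auto simp: h_def)
    also have "\<dots> \<in> borel_measurable borel" by measurable
    finally show ?thesis .
  qed
  have h0: "0 \<le> h w" for w by (auto simp: h_def f0 split: prod.split)
  have sR: "sets (ruin_law L) = sets borel" by (simp add: ruin_law_def)
  have emR: "(\<lambda>(y::real, z::real, t). ennreal (exp (- q * t))) \<in> borel_measurable borel"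
  proof -
    have "(\<lambda>w. ennreal (case w of (y::real, z::real, t) \<Rightarrow> exp (- q * t))) \<in> borel_measurable borel"
      by measurable
    then show ?thesis by (simp add: split_beta)
  qed
  have fmR: "(\<lambda>(y, z, t). ennreal (f y z t)) \<in> borel_measurable borel"
  proof -
    have "(\<lambda>w. ennreal (case w of (y, z, t) \<Rightarrow> f y z t)) \<in> borel_measurable borel"
      by measurable
    then show ?thesis by (simp add: split_beta)
  qed
  have mR: "borel_measurable (ruin_law L) = borel_measurable borel"
    by (rule measurable_cong_sets[OF sR refl])
  define e where "e = (\<lambda>(y::real, z::real, t). ennreal (exp (- q * t)))"
  define g where "g = (\<lambda>(y, z, t). ennreal (f y z t))"
  have e[measurable]: "e \<in> borel_measurable borel" and g[measurable]: "g \<in> borel_measurable borel"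
    unfolding e_def g_def by (rule emR fmR)+
  have integrand: "(\<lambda>(y, z, t). ennreal (exp (- q * t)) * indicator ?O (y, z, t)) = (\<lambda>w. indicator ?O w * e w)"
    "(\<lambda>(y, z, t). ennreal (f y z t) * indicator ?O (y, z, t)) = (\<lambda>w. g w * indicator ?O w)"
    by (auto simp: e_def g_def mult.commute)
  have hge: "(\<lambda>w. (g w * indicator ?O w) * e w) = (\<lambda>w. ennreal (h w))"
    by (auto simp: fun_eq_iff h_def e_def g_def f0 ennreal_mult mult.commute split: split_indicator)
  have dens: "density (ruin_law L) (\<lambda>(y, z, t). ennreal (exp (- q * t)) * indicator ?O (y, z, t))
      = density lborel (\<lambda>w. ennreal (h w))"
  proof -
    have "density (ruin_law L) (\<lambda>w. indicator ?O w * e w) = density (density (ruin_law L) (indicator ?O)) e"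
      by (rule density_density_eq[symmetric]) (simp_all add: mR)
    also have "\<dots> = density lborel (\<lambda>w. (g w * indicator ?O w) * e w)"
      unfolding fd integrand by (rule density_density_eq) simp_all
    finally show ?thesis unfolding integrand hge .
  qed
  let ?k = "\<lambda>y. \<integral>\<^sup>+ zt. ennreal (h (y, zt)) \<partial>lborel"
  have lp: "lborel \<Otimes>\<^sub>M lborel = (lborel :: (real \<times> real \<times> real) measure)"
      "lborel \<Otimes>\<^sub>M lborel = (lborel :: (real \<times> real) measure)"
    by (rule lborel_prod)+
  have hp[measurable]: "h \<in> borel_measurable (lborel \<Otimes>\<^sub>M lborel)"
    unfolding lp by simp
  have km[measurable]: "?k \<in> borel_measurable borel" by measurable
  have nu: "discounted_pre_ruin_measure q L = density lborel ?k"
  proof (rule measure_eqI)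
    show "sets (discounted_pre_ruin_measure q L) = sets (density lborel ?k)"
      by (simp add: discounted_pre_ruin_measure_def)
    fix A assume "A \<in> sets (discounted_pre_ruin_measure q L)"
    then have A[measurable]: "A \<in> sets borel" by (simp add: discounted_pre_ruin_measure_def)
    have fstm: "fst \<in> borel_measurable (borel :: (real \<times> real \<times> real) measure)"
      by (intro borel_measurable_continuous_onI continuous_intros)
    have FA: "fst -` A \<in> sets (borel :: (real \<times> real \<times> real) measure)"
      using measurable_sets[OF fstm A] by simp
    have "emeasure (discounted_pre_ruin_measure q L) A = (\<integral>\<^sup>+ w. ennreal (h w) * indicator (fst -` A) w \<partial>lborel)"
      unfolding discounted_pre_ruin_measure_def dens using fstm FA
      by (simp add: emeasure_distr emeasure_density)
    also have "\<dots> = (\<integral>\<^sup>+ w. ennreal (h w) * indicator A (fst w) \<partial>(lborel \<Otimes>\<^sub>M lborel))"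
      unfolding lp by (intro nn_integral_cong) (simp add: indicator_def)
    also have "\<dots> = (\<integral>\<^sup>+ y. \<integral>\<^sup>+ zt. ennreal (h (y, zt)) * indicator A y \<partial>lborel \<partial>lborel)"
      by (subst lborel.nn_integral_fst[symmetric]) auto
    also have "\<dots> = (\<integral>\<^sup>+ y. ?k y * indicator A y \<partial>lborel)"
      by (intro nn_integral_cong nn_integral_multc) measurable
    also have "\<dots> = emeasure (density lborel ?k) A"
      by (simp add: emeasure_density)
    finally show "emeasure (discounted_pre_ruin_measure q L) A = emeasure (density lborel ?k) A" .
  qed
  have RN: "AE y in lborel. ?k y = RN_deriv lborel (discounted_pre_ruin_measure q L) y"
    unfolding nu by (rule sigma_finite_measure.RN_deriv_unique[OF sigma_finite_lborel]) auto
  have fin: "(\<integral>\<^sup>+ w. ennreal (h w) \<partial>lborel) < \<infinity>"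
  proof -
    have "(\<integral>\<^sup>+ w. ennreal (h w) \<partial>lborel) = emeasure (density lborel (\<lambda>w. ennreal (h w))) UNIV"
      by (simp add: emeasure_density)
    also have "\<dots> = (\<integral>\<^sup>+ (y, z, t). ennreal (exp (- q * t)) * indicator ?O (y, z, t) \<partial>ruin_law L)"
      unfolding dens[symmetric] integrand by (simp add: emeasure_density sR mR)
    also have "\<dots> \<le> (\<integral>\<^sup>+ w. 1 \<partial>ruin_law L)"
      using q by (intro nn_integral_mono) (auto split: split_indicator)
    also have "\<dots> < \<infinity>"
      using finite_measure.emeasure_finite[OF fin_law] by (simp add: less_top[symmetric])
    finally show ?thesis .
  qed
  have hi: "integrable (lborel \<Otimes>\<^sub>M lborel) h"
    unfolding lp using fin h0 by (intro integrableI_nonneg) auto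
  have i1: "AE y in lborel. integrable lborel (\<lambda>zt. h (y, zt))"
    by (rule lborel_pair.AE_integrable_fst'[OF hi])
  show ?thesis using RN i1
  proof eventually_elim
    case (elim y)
    show ?case
    proof
      assume y: "0 < y"
      have "discounted_density q L y = enn2real (?k y)"
        using elim(1) by (simp add: discounted_density_def)
      also have "?k y = ennreal (\<integral> zt. h (y, zt) \<partial>lborel)"
        using elim(2) h0 by (intro nn_integral_eq_integral) auto
      also have "enn2real \<dots> = (\<integral> zt. h (y, zt) \<partial>lborel)"
        using h0 by (intro enn2real_ennreal integral_nonneg) auto
      also have "\<dots> = (\<integral> zt. h (y, zt) \<partial>(lborel \<Otimes>\<^sub>M lborel))" unfolding lp ..
      also have "\<dots> = (\<integral> z. \<integral> t. h (y, z, t) \<partial>lborel \<partial>lborel)"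
        using elim(2) unfolding lp[symmetric]
        by (subst lborel_pair.integral_fst'[symmetric]) auto
      also have "\<dots> = (LBINT z:{0<..}. LBINT t:{0<..}. exp (- q * t) * f y z t)"
        unfolding set_lebesgue_integral_def
      proof (intro Bochner_Integration.integral_cong refl)
        fix z :: real
        show "(\<integral> t. h (y, z, t) \<partial>lborel) =
          indicator {0<..} z *\<^sub>R (\<integral> t. indicator {0<..} t *\<^sub>R (exp (- q * t) * f y z t) \<partial>lborel)"
          using y by (cases "0 < z") (auto simp: h_def indicator_def)
      qed
      finally show "discounted_density q L y = (LBINT z:{0<..}. LBINT t:{0<..}. exp (- q * t) * f y z t)" .
    qed
  qed
qed

end

theory Submission
  imports Defs "HOL-Real_Asymp.Real_Asymp"
begin

text \<open>Everything is read off the random walks obtained by sampling the surplus at the times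
  \<open>k 2\<^sup>-\<^sup>n\<close>, so that neither stochastic calculus nor the strong Markov property is used.

  Killing such a walk below \<open>0\<close> has an explicit adjoint for the weight \<open>e\<^sup>-\<^sup>b\<^sup>x dx\<close>. Comparing
  the exit masses of the adjoint walk at two exponents and letting the step tend to \<open>0\<close> yields, with
  \<open>q = \<phi>(\<theta>)\<close>, the Laplace transform in \<open>x\<close> of the \<open>q\<close>-potential of the killed process, and an
  Abelian limit shows that \<open>W(x) = e\<^sup>\<theta>\<^sup>x P\<^sub>x\<^sup>(\<^sup>\<theta>\<^sup>)(T = \<infinity>) / \<phi>'(\<theta>)\<close> has transform
  \<open>1 / (\<phi>(b) - q)\<close>. By uniqueness of Laplace transforms the potential has the density
  \<open>e\<^sup>-\<^sup>\<theta>\<^sup>y W(x) - W(x - y)\<close>.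

  Ruin with a positive surplus immediately before happens by a claim, and claims arrive at
  rate \<open>\<lambda>\<close>. Summing over the steps of the walk the probability of being alive at \<open>y\<close> and negative
  one step later, and refining the mesh, shows that the discounted law of the surplus before
  ruin is the potential density times \<open>\<lambda> (1 - P(y))\<close>.\<close>


section \<open>Killed random walks and their adjoints\<close>

text \<open>The adjoint walk moves against the increments of the surplus, so it leaves the half-line
  only when the surplus moves up. Claims only push the surplus down; within a short step an upward
  move comes from the premium and the Brownian motion alone and is small. Hence there is no
  overshoot in the limit, and the exit mass at exponent \<open>b\<close> becomes explicit. Three
  obstacles shape the rest. At level 0 nothing is damped by discounting, so limits of grid sums are
  taken at positive levels and level 0 is reached by monotone convergence. Laplace uniqueness yields
  identities only for almost every initial capital, while the result concerns a fixed one; right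
  continuity of survival and of the potential in the initial capital repairs this. With a Brownian
  component ruin may also happen by creeping, with \<open>X(T) = 0\<close>; test functions of the
  deficit that vanish on the half-line remove it, and test functions of the prior surplus that
  vanish near 0 keep the claim rate uniform. Values lie in \<open>ennreal\<close>, so identities are
  kept as sums and subtraction waits for finiteness.\<close>

definition killed_step :: "real measure \<Rightarrow> (real \<Rightarrow> ennreal) \<Rightarrow> real \<Rightarrow> ennreal" where
  "killed_step F f x = (\<integral>\<^sup>+u. f (x + u) * indicator {0..} (x + u) \<partial>F)"

text \<open>The adjoint of the killed step for the weight \<open>e\<^sup>-\<^sup>b\<^sup>x dx\<close>; see \<open>killed_step_dual\<close>.\<close>

definition dual_step :: "real \<Rightarrow> real measure \<Rightarrow> (real \<Rightarrow> ennreal) \<Rightarrow> real \<Rightarrow> ennreal" where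
  "dual_step b F k y = indicator {0..} y * (\<integral>\<^sup>+u. ennreal (exp (b * u)) * k (y - u) \<partial>F)"

text \<open>Density, relative to \<open>exp (- b * y) dy\<close>, of the killed walk after
  \<open>i\<close> steps when its start is distributed as \<open>exp (- b * x) dx\<close> on the
  half-line. Read backwards, it is the tilted mass of adjoint paths from \<open>y\<close> that make
  \<open>i\<close> steps without leaving the half-line.\<close>

definition dual_iter :: "real \<Rightarrow> real measure \<Rightarrow> nat \<Rightarrow> real \<Rightarrow> ennreal" where
  "dual_iter b F i = (dual_step b F ^^ i) (indicator {0..})"

text \<open>The mass that the adjoint walk loses across \<open>0\<close> in step \<open>i + 1\<close>.\<close>

definition exit_iter :: "real \<Rightarrow> real measure \<Rightarrow> nat \<Rightarrow> real \<Rightarrow> ennreal" where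
  "exit_iter b F i = (dual_step b F ^^ i)
     (\<lambda>y. indicator {0..} y * (\<integral>\<^sup>+u. ennreal (exp (b * u)) * indicator {y<..} u \<partial>F))"

lemma ennreal_exp_add: "ennreal (exp (a + b)) = ennreal (exp a) * ennreal (exp b)"
  by (simp add: exp_add ennreal_mult)

lemma dual_iter_0: "dual_iter b F 0 = indicator {0..}"
  and dual_iter_Suc: "dual_iter b F (Suc i) = dual_step b F (dual_iter b F i)"
  and exit_iter_Suc: "exit_iter b F (Suc i) = dual_step b F (exit_iter b F i)"
  by (simp_all add: dual_iter_def exit_iter_def)

section \<open>A single step law: adjoint walk, change of exponent, exit masses\<close>

locale step_law = prob_space F for F :: "real measure" +
  assumes sets_F[measurable_cong, simp]: "sets F = sets borel"
begin

lemma space_F[simp]: "space F = UNIV"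
  using sets_eq_imp_space_eq[OF sets_F] by simp

lemma measurable_killed_step[measurable]:
  assumes [measurable]: "f \<in> borel_measurable borel"
  shows "killed_step F f \<in> borel_measurable borel"
  unfolding killed_step_def by measurable

lemma measurable_dual_step[measurable]:
  assumes [measurable]: "k \<in> borel_measurable borel"
  shows "dual_step b F k \<in> borel_measurable borel"
  unfolding dual_step_def by measurable

lemma measurable_exit0[measurable]:
  "(\<lambda>y. indicator {0..} y * (\<integral>\<^sup>+u. ennreal (exp (b * u)) * indicator {y<..} u \<partial>F))
    \<in> borel_measurable borel"
proof -
  have [measurable]: "(\<lambda>(y::real, u). indicator {y<..} u :: ennreal) \<in> borel_measurable (borel \<Otimes>\<^sub>M F)"
  proof -
    have "(\<lambda>(y::real, u). indicator {y<..} u :: ennreal) = (\<lambda>p. indicator {p. fst p < snd p} p)"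
      by (auto simp: indicator_def)
    also have "\<dots> \<in> borel_measurable (borel \<Otimes>\<^sub>M F)" by measurable
    finally show ?thesis .
  qed
  show ?thesis by measurable
qed

lemma measurable_dual_iter[measurable]: "dual_iter b F i \<in> borel_measurable borel"
  by (induction i) (simp_all add: dual_iter_def)

lemma measurable_exit_iter[measurable]: "exit_iter b F i \<in> borel_measurable borel"
  by (induction i) (simp_all add: exit_iter_def)

lemma measurable_killed_iter[measurable]:
  "f \<in> borel_measurable borel \<Longrightarrow> (killed_step F ^^ i) f \<in> borel_measurable borel"
  by (induction i) simp_all

text \<open>Fubini and the substitution \<open>x = y - u\<close>: translating the weight by
  \<open>u\<close> costs the factor \<open>exp (b * u)\<close>, which is the tilt in
  \<open>dual_step\<close>. Killing acts on the arrival point of the walk, hence on the starting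
  point of its adjoint.\<close>

lemma killed_step_dual:
  assumes [measurable]: "f \<in> borel_measurable borel" "k \<in> borel_measurable borel"
  shows "(\<integral>\<^sup>+x. ennreal (exp (- b * x)) * k x * killed_step F f x \<partial>lborel) =
    (\<integral>\<^sup>+y. ennreal (exp (- b * y)) * dual_step b F k y * f y \<partial>lborel)"
proof -
  interpret P: pair_sigma_finite lborel F ..
  have "(\<integral>\<^sup>+x. ennreal (exp (- b * x)) * k x * killed_step F f x \<partial>lborel) =
      (\<integral>\<^sup>+x. \<integral>\<^sup>+u. ennreal (exp (- b * x)) * k x * (f (x + u) * indicator {0..} (x + u)) \<partial>F \<partial>lborel)"
    unfolding killed_step_def by (subst nn_integral_cmult) auto
  also have "\<dots> = (\<integral>\<^sup>+u. \<integral>\<^sup>+x. ennreal (exp (- b * x)) * k x * (f (x + u) * indicator {0..} (x + u)) \<partial>lborel \<partial>F)"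
    by (rule P.Fubini'[symmetric]) measurable
  also have "\<dots> = (\<integral>\<^sup>+u. \<integral>\<^sup>+y. ennreal (exp (- b * (y - u))) * k (y - u) * (f y * indicator {0..} y) \<partial>lborel \<partial>F)"
  proof (rule nn_integral_cong)
    fix u
    show "(\<integral>\<^sup>+x. ennreal (exp (- b * x)) * k x * (f (x + u) * indicator {0..} (x + u)) \<partial>lborel)
      = (\<integral>\<^sup>+y. ennreal (exp (- b * (y - u))) * k (y - u) * (f y * indicator {0..} y) \<partial>lborel)"
      by (subst nn_integral_real_affine[where c=1 and t="-u"]) (auto simp: algebra_simps)
  qed
  also have "\<dots> = (\<integral>\<^sup>+y. \<integral>\<^sup>+u. ennreal (exp (- b * (y - u))) * k (y - u) * (f y * indicator {0..} y) \<partial>F \<partial>lborel)"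
    by (rule P.Fubini') measurable
  also have "\<dots> = (\<integral>\<^sup>+y. ennreal (exp (- b * y)) * dual_step b F k y * f y \<partial>lborel)"
  proof (rule nn_integral_cong)
    fix y :: real
    have "(\<integral>\<^sup>+u. ennreal (exp (- b * (y - u))) * k (y - u) * (f y * indicator {0..} y) \<partial>F)
      = (\<integral>\<^sup>+u. (ennreal (exp (- b * y)) * f y * indicator {0..} y) * (ennreal (exp (b * u)) * k (y - u)) \<partial>F)"
    proof (rule nn_integral_cong)
      fix u :: real
      have "- b * (y - u) = - b * y + b * u" by (simp add: algebra_simps)
      then show "ennreal (exp (- b * (y - u))) * k (y - u) * (f y * indicator {0..} y)
        = (ennreal (exp (- b * y)) * f y * indicator {0..} y) * (ennreal (exp (b * u)) * k (y - u))"
        by (simp only: ennreal_exp_add ac_simps)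
    qed
    also have "\<dots> = (ennreal (exp (- b * y)) * f y * indicator {0..} y) * (\<integral>\<^sup>+u. ennreal (exp (b * u)) * k (y - u) \<partial>F)"
      by (rule nn_integral_cmult) measurable
    finally show "(\<integral>\<^sup>+u. ennreal (exp (- b * (y - u))) * k (y - u) * (f y * indicator {0..} y) \<partial>F)
      = ennreal (exp (- b * y)) * dual_step b F k y * f y"
      by (simp add: dual_step_def ac_simps)
  qed
  finally show ?thesis .
qed

lemma killed_iter_dual:
  assumes "f \<in> borel_measurable borel"
  shows "(\<integral>\<^sup>+x. ennreal (exp (- b * x)) * indicator {0..} x * (killed_step F ^^ i) f x \<partial>lborel) =
    (\<integral>\<^sup>+y. ennreal (exp (- b * y)) * dual_iter b F i y * f y \<partial>lborel)"
  using assms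
proof (induction i arbitrary: f)
  case 0
  then show ?case by (simp add: dual_iter_def)
next
  case (Suc i)
  have [measurable]: "f \<in> borel_measurable borel" by fact
  have "(killed_step F ^^ Suc i) f = (killed_step F ^^ i) (killed_step F f)"
    by (simp add: funpow_swap1)
  then have "(\<integral>\<^sup>+x. ennreal (exp (- b * x)) * indicator {0..} x * (killed_step F ^^ Suc i) f x \<partial>lborel) =
    (\<integral>\<^sup>+y. ennreal (exp (- b * y)) * dual_iter b F i y * killed_step F f y \<partial>lborel)"
    using Suc.IH[of "killed_step F f"] by simp
  also have "\<dots> = (\<integral>\<^sup>+y. ennreal (exp (- b * y)) * dual_step b F (dual_iter b F i) y * f y \<partial>lborel)"
    by (rule killed_step_dual) measurable
  finally show ?case by (simp add: dual_iter_def)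
qed

lemma dual_step_mono: "(\<And>z. f z \<le> g z) \<Longrightarrow> dual_step b F f y \<le> dual_step b F g y"
  unfolding dual_step_def by (intro mult_left_mono nn_integral_mono) auto

lemma dual_step_add:
  assumes [measurable]: "f \<in> borel_measurable borel" "g \<in> borel_measurable borel"
  shows "dual_step b F (\<lambda>z. f z + g z) y = dual_step b F f y + dual_step b F g y"
  unfolding dual_step_def
  by (simp add: distrib_left nn_integral_add del: distrib_left[symmetric])

lemma dual_step_cmult:
  assumes [measurable]: "f \<in> borel_measurable borel"
  shows "dual_step b F (\<lambda>z. a * f z) y = a * dual_step b F f y"
proof -
  have "(\<integral>\<^sup>+u. ennreal (exp (b * u)) * (a * f (y - u)) \<partial>F) = a * (\<integral>\<^sup>+u. ennreal (exp (b * u)) * f (y - u) \<partial>F)"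
    by (subst nn_integral_cmult[symmetric]) (auto simp: ac_simps)
  then show ?thesis
    unfolding dual_step_def by (simp add: ac_simps)
qed

text \<open>Changing the exponent from \<open>b\<close> to \<open>t\<close> is conjugation with an
  exponential (a Doob transform), since
  \<open>(b - t) * (y - u) + b * u = (b - t) * y + t * u\<close>. The shift \<open>e\<close> is
  carried along for the overshoot in \<open>exit_iter_upper\<close>.\<close>

lemma dual_step_exp:
  assumes [measurable]: "f \<in> borel_measurable borel"
  shows "dual_step b F (\<lambda>z. ennreal (exp ((b - t) * (z + e))) * f z) y
    = ennreal (exp ((b - t) * (y + e))) * dual_step t F f y"
proof -
  have "(\<integral>\<^sup>+u. ennreal (exp (b * u)) * (ennreal (exp ((b - t) * (y - u + e))) * f (y - u)) \<partial>F)
    = (\<integral>\<^sup>+u. ennreal (exp ((b - t) * (y + e))) * (ennreal (exp (t * u)) * f (y - u)) \<partial>F)"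
    by (intro nn_integral_cong)
       (simp add: mult.assoc[symmetric] ennreal_exp_add[symmetric] del: ennreal_exp_add, simp add: algebra_simps)
  also have "\<dots> = ennreal (exp ((b - t) * (y + e))) * (\<integral>\<^sup>+u. ennreal (exp (t * u)) * f (y - u) \<partial>F)"
    by (rule nn_integral_cmult) measurable
  finally show ?thesis
    unfolding dual_step_def by (simp add: ac_simps)
qed

text \<open>Conservation of mass: an increment \<open>u\<close> either keeps the adjoint walk in the
  half-line (\<open>u \<le> y\<close>) or takes it out (\<open>u > y\<close>). This splits the mass
  for \<open>i = 0\<close>; applying the linear operator \<open>dual_step\<close> repeatedly carries
  it to every \<open>i\<close>.\<close>

lemma mgf_dual_iter:
  "(\<integral>\<^sup>+u. ennreal (exp (b * u)) \<partial>F) * dual_iter b F i y = dual_iter b F (Suc i) y + exit_iter b F i y"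
proof (induction i arbitrary: y)
  case 0
  have "(\<integral>\<^sup>+u. ennreal (exp (b * u)) \<partial>F) =
    (\<integral>\<^sup>+u. ennreal (exp (b * u)) * indicator {0..} (y - u) + ennreal (exp (b * u)) * indicator {y<..} u \<partial>F)"
    by (intro nn_integral_cong) (auto simp: indicator_def)
  also have "\<dots> = (\<integral>\<^sup>+u. ennreal (exp (b * u)) * indicator {0..} (y - u) \<partial>F) +
     (\<integral>\<^sup>+u. ennreal (exp (b * u)) * indicator {y<..} u \<partial>F)"
    by (rule nn_integral_add) measurable
  finally show ?case
    by (simp add: dual_iter_def exit_iter_def dual_step_def distrib_left mult.commute
        del: distrib_left[symmetric])
next
  case (Suc i)
  have "(\<integral>\<^sup>+u. ennreal (exp (b * u)) \<partial>F) * dual_iter b F (Suc i) y =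
     dual_step b F (\<lambda>z. (\<integral>\<^sup>+u. ennreal (exp (b * u)) \<partial>F) * dual_iter b F i z) y"
    by (subst dual_step_cmult) (auto simp: dual_iter_Suc)
  also have "\<dots> = dual_step b F (\<lambda>z. dual_iter b F (Suc i) z + exit_iter b F i z) y"
    by (simp only: Suc.IH)
  also have "\<dots> = dual_iter b F (Suc (Suc i)) y + exit_iter b F (Suc i) y"
    by (subst dual_step_add) (auto simp: dual_iter_Suc exit_iter_Suc)
  finally show ?case .
qed

text \<open>In one step the mass may grow by the moment generating function, yet the bound is
  uniform in \<open>i\<close>: \<open>exp (b * z)\<close> dominates the initial indicator, and after
  changing the exponent to 0 a step is seen to map this exponential below itself.\<close>

lemma dual_iter_le: "dual_iter b F i y \<le> ennreal (exp (b * y))" if "0 \<le> b"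
proof (induction i arbitrary: y)
  case 0
  then show ?case using that by (auto simp: dual_iter_def indicator_def)
next
  case (Suc i)
  have "dual_iter b F (Suc i) y \<le> dual_step b F (\<lambda>z. ennreal (exp (b * z))) y"
    using Suc by (auto simp: dual_iter_def intro!: dual_step_mono)
  also have "\<dots> = dual_step b F (\<lambda>z. ennreal (exp ((b - 0) * (z + 0))) * 1) y" by simp
  also have "\<dots> = ennreal (exp (b * y)) * dual_step 0 F (\<lambda>z. 1) y"
    by (subst dual_step_exp) auto
  also have "\<dots> \<le> ennreal (exp (b * y)) * 1"
    by (intro mult_left_mono) (auto simp: dual_step_def emeasure_space_1[simplified] indicator_def)
  finally show ?case by simp
qed

text \<open>An exit from \<open>y\<close> uses an increment \<open>u > y\<close>, so replacing the
  tilt \<open>t\<close> by the larger \<open>b\<close> gains at least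
  \<open>exp ((b - t) * y)\<close>. The change of exponent transports this factor through the steps
  before the exit.\<close>

lemma exit_iter_lower:
  assumes bt: "t \<le> b"
  shows "ennreal (exp ((b - t) * y)) * exit_iter t F i y \<le> exit_iter b F i y"
proof (induction i arbitrary: y)
  case 0
  have "ennreal (exp ((b - t) * y)) * (\<integral>\<^sup>+u. ennreal (exp (t * u)) * indicator {y<..} u \<partial>F)
    = (\<integral>\<^sup>+u. ennreal (exp ((b - t) * y)) * (ennreal (exp (t * u)) * indicator {y<..} u) \<partial>F)"
    by (rule nn_integral_cmult[symmetric]) measurable
  also have "\<dots> \<le> (\<integral>\<^sup>+u. ennreal (exp (b * u)) * indicator {y<..} u \<partial>F)"
  proof (rule nn_integral_mono)
    fix u
    show "ennreal (exp ((b - t) * y)) * (ennreal (exp (t * u)) * indicator {y<..} u)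
        \<le> ennreal (exp (b * u)) * indicator {y<..} u"
    proof (cases "y < u")
      case True
      have "(b - t) * y \<le> (b - t) * u" using True bt by (intro mult_left_mono) auto
      then have "(b - t) * y + t * u \<le> b * u" by (simp add: algebra_simps)
      then show ?thesis using True by (simp add: ennreal_exp_add[symmetric])
    qed auto
  qed
  finally show ?case
    by (auto simp: exit_iter_def indicator_def)
next
  case (Suc i)
  have "ennreal (exp ((b - t) * y)) * exit_iter t F (Suc i) y
    = dual_step b F (\<lambda>z. ennreal (exp ((b - t) * (z + 0))) * exit_iter t F i z) y"
    by (subst dual_step_exp) (auto simp: exit_iter_Suc)
  also have "\<dots> \<le> dual_step b F (exit_iter b F i) y"
    using Suc by (intro dual_step_mono) auto
  finally show ?case by (simp add: exit_iter_def)
qed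

text \<open>An increment of size at most \<open>e\<close> overshoots by at most \<open>e\<close>,
  which costs the factor \<open>exp ((b - t) * e)\<close>; larger increments are charged wholesale
  to the tail \<open>H\<close>. Truncating the increment, and not the overshoot, makes
  \<open>H\<close> independent of the position.\<close>

lemma exit_iter_upper:
  assumes bt: "t \<le> b" and e: "0 \<le> e"
  defines "H \<equiv> (\<integral>\<^sup>+u. ennreal (exp (b * u)) * indicator {e<..} u \<partial>F)"
  shows "exit_iter b F i y \<le> ennreal (exp ((b - t) * (y + e))) * exit_iter t F i y + H * dual_iter b F i y"
proof (induction i arbitrary: y)
  case 0
  show ?case
  proof (cases "0 \<le> y")
    case y: True
    have "(\<integral>\<^sup>+u. ennreal (exp (b * u)) * indicator {y<..} u \<partial>F)
      \<le> (\<integral>\<^sup>+u. ennreal (exp ((b - t) * (y + e))) * (ennreal (exp (t * u)) * indicator {y<..} u) +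
          ennreal (exp (b * u)) * indicator {e<..} u \<partial>F)"
    proof (rule nn_integral_mono)
      fix u
      show "ennreal (exp (b * u)) * indicator {y<..} u
         \<le> ennreal (exp ((b - t) * (y + e))) * (ennreal (exp (t * u)) * indicator {y<..} u) +
          ennreal (exp (b * u)) * indicator {e<..} u"
      proof (cases "y < u \<and> u \<le> e")
        case True
        have "(b - t) * u \<le> (b - t) * (y + e)" using True bt y by (intro mult_left_mono) auto
        then have "b * u \<le> (b - t) * (y + e) + t * u" by (simp add: algebra_simps)
        then show ?thesis using True by (simp add: ennreal_exp_add[symmetric])
      qed (use y in \<open>auto simp: indicator_def\<close>)
    qed
    also have "\<dots> = ennreal (exp ((b - t) * (y + e))) * (\<integral>\<^sup>+u. (ennreal (exp (t * u)) * indicator {y<..} u) \<partial>F) + H"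
      unfolding H_def by (subst nn_integral_add) (auto simp: nn_integral_cmult)
    finally show ?thesis
      using y by (simp add: exit_iter_def dual_iter_def)
  qed (simp add: exit_iter_def)
next
  case (Suc i)
  have "exit_iter b F (Suc i) y = dual_step b F (exit_iter b F i) y" by (simp add: exit_iter_def)
  also have "\<dots> \<le> dual_step b F (\<lambda>y. ennreal (exp ((b - t) * (y + e))) * exit_iter t F i y + H * dual_iter b F i y) y"
    using Suc by (intro dual_step_mono) auto
  also have "\<dots> = ennreal (exp ((b - t) * (y + e))) * exit_iter t F (Suc i) y + H * dual_iter b F (Suc i) y"
    by (subst dual_step_add, measurable, subst dual_step_exp, measurable, subst dual_step_cmult, measurable)
       (simp add: exit_iter_Suc dual_iter_Suc)
  finally show ?case .
qed

text \<open>Generating function of \<open>mgf_dual_iter\<close>: multiply by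
  \<open>r ^ Suc i\<close> and sum. The two resolvent sums differ by their term of index 0, which is
  the summand 1. No finiteness is known at this stage, hence the form without subtraction.\<close>

lemma resolvent_balance:
  assumes y: "0 \<le> y"
  shows "ennreal r * (\<integral>\<^sup>+u. ennreal (exp (b * u)) \<partial>F) * (\<Sum>i. ennreal r ^ i * dual_iter b F i y) + 1
    = (\<Sum>i. ennreal r ^ i * dual_iter b F i y) + (\<Sum>i. ennreal r ^ Suc i * exit_iter b F i y)"
proof -
  let ?r = "ennreal r" and ?k = "\<lambda>i. dual_iter b F i y" and ?g = "(\<integral>\<^sup>+u. ennreal (exp (b * u)) \<partial>F)"
  have k0: "?k 0 = 1" using y by (simp add: dual_iter_def)
  have "?r * ?g * (\<Sum>i. ?r ^ i * ?k i) = (\<Sum>i. ?r ^ Suc i * (?g * ?k i))"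
    by (subst ennreal_suminf_cmult[symmetric]) (simp add: ac_simps)
  also have "\<dots> = (\<Sum>i. ?r ^ Suc i * ?k (Suc i) + ?r ^ Suc i * exit_iter b F i y)"
    by (simp only: mgf_dual_iter distrib_left)
  also have "\<dots> = (\<Sum>i. ?r ^ Suc i * ?k (Suc i)) + (\<Sum>i. ?r ^ Suc i * exit_iter b F i y)"
    by (rule suminf_add[symmetric]) auto
  finally have *: "?r * ?g * (\<Sum>i. ?r ^ i * ?k i) = \<dots>" .
  have "(\<Sum>i. ?r ^ i * ?k i) = 1 + (\<Sum>i. ?r ^ Suc i * ?k (Suc i))"
    using suminf_offset[of "\<lambda>i. ?r ^ i * ?k i" 1] k0 by simp
  then show ?thesis using * by (simp add: ac_simps)
qed

text \<open>If \<open>r\<close> is the inverse of the moment generating function at \<open>t\<close>, the total discounted exit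
  mass at exponent \<open>t\<close> equals \<open>1\<close>. Changing the exponent to \<open>b\<close> multiplies the exit mass from \<open>y\<close> by
  \<open>e\<^sup>(\<^sup>b\<^sup>-\<^sup>t\<^sup>)\<^sup>y\<close> up to the overshoot, which is what squeezes the resolvent at \<open>b\<close>.\<close>

lemma resolvent_bounds:
  assumes y: "0 \<le> y" and r: "0 < r" "r < 1" and t: "0 \<le> t" and bt: "t \<le> b" and e: "0 \<le> e"
    and gt: "(\<integral>\<^sup>+u. ennreal (exp (t * u)) \<partial>F) = ennreal (inverse r)"
    and gb: "(\<integral>\<^sup>+u. ennreal (exp (b * u)) \<partial>F) = ennreal g" and g: "0 \<le> g"
    and H: "(\<integral>\<^sup>+u. ennreal (exp (b * u)) * indicator {e<..} u \<partial>F) \<le> ennreal H" and H0: "0 \<le> H"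
  shows "\<exists>K. (\<Sum>i. ennreal r ^ i * dual_iter b F i y) = ennreal K \<and> 0 \<le> K \<and> K \<le> exp (b * y) / (1 - r) \<and>
    exp ((b - t) * y) - 1 \<le> (r * g - 1) * K \<and>
    (r * g - 1) * K \<le> exp ((b - t) * (y + e)) - 1 + H * r * K"
proof -
  let ?r = "ennreal r"
  define S where "S a = (\<Sum>i. ?r ^ i * dual_iter a F i y)" for a
  define J where "J a = (\<Sum>i. ?r ^ Suc i * exit_iter a F i y)" for a
  have Sle: "S a \<le> ennreal (exp (a * y) / (1 - r))" if "0 \<le> a" for a
  proof -
    have "S a \<le> (\<Sum>i. ennreal (exp (a * y) * r ^ i))"
      unfolding S_def
      using dual_iter_le[OF that, of _ y] r
      by (intro suminf_le) (auto simp: ennreal_mult ennreal_power mult.commute intro!: mult_left_mono)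
    also have "\<dots> = ennreal (exp (a * y) / (1 - r))"
      using r by (intro suminf_ennreal_eq) (auto intro!: sums_mult geometric_sums[THEN sums_mult, of r "exp (a*y)", simplified])
    finally show ?thesis .
  qed
  \<comment> \<open>Only because \<open>S t\<close> is finite may it be cancelled from both sides of
    the balance, which leaves \<open>J t = 1\<close>.\<close>
  have "S t < top" using Sle[OF t] by (metis ennreal_less_top le_less_trans)
  moreover have "?r * ennreal (inverse r) * S t + 1 = S t + J t"
    using resolvent_balance[OF y, of r t] unfolding S_def J_def gt by simp
  moreover have "?r * ennreal (inverse r) = 1"
    using r by (simp add: ennreal_mult[symmetric])
  ultimately have Jt: "J t = 1"
    by (metis ennreal_add_left_cancel infinity_ennreal_def less_irrefl mult_1)
  have "S b < top" using Sle[of b] t bt by (metis ennreal_less_top le_less_trans order_trans)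
  then obtain K where K: "S b = ennreal K" "0 \<le> K" by (cases "S b") auto
  have bal: "ennreal (r * g * K + 1) = ennreal K + J b"
    using resolvent_balance[OF y, of r b] K g r unfolding S_def[symmetric] J_def[symmetric] gb
    by (simp add: ennreal_mult)
  then have "J b < top" by (metis ennreal_add_eq_top ennreal_less_top less_top)
  then obtain j where j: "J b = ennreal j" "0 \<le> j" by (cases "J b") auto
  have jeq: "(r * g - 1) * K = j - 1"
    using bal j K g r by (simp add: ennreal_plus[symmetric] algebra_simps del: ennreal_plus)
  have "ennreal (exp ((b - t) * y)) * J t \<le> J b"
    unfolding J_def ennreal_suminf_cmult[symmetric]
    using exit_iter_lower[OF bt, of y]
    by (intro suminf_le) (auto simp: mult.left_commute[of "ennreal (exp _)"] simp del: power_Suc intro!: mult_left_mono)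
  then have low: "exp ((b - t) * y) \<le> j" using Jt j by simp
  have "J b \<le> (\<Sum>i. ennreal (exp ((b - t) * (y + e))) * (?r ^ Suc i * exit_iter t F i y) + ennreal H * ?r * (?r ^ i * dual_iter b F i y))"
    unfolding J_def
  proof (intro suminf_le)
    fix i
    have "exit_iter b F i y \<le> ennreal (exp ((b - t) * (y + e))) * exit_iter t F i y + ennreal H * dual_iter b F i y"
      using exit_iter_upper[OF bt e, of i y] H by (meson add_left_mono mult_right_mono order_trans zero_le)
    then have "?r ^ Suc i * exit_iter b F i y \<le> ?r ^ Suc i * (ennreal (exp ((b - t) * (y + e))) * exit_iter t F i y + ennreal H * dual_iter b F i y)"
      by (rule mult_left_mono) simp
    then show "?r ^ Suc i * exit_iter b F i y \<le> ennreal (exp ((b - t) * (y + e))) * (?r ^ Suc i * exit_iter t F i y) + ennreal H * ?r * (?r ^ i * dual_iter b F i y)"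
      by (simp add: distrib_left ac_simps)
  qed auto
  also have "\<dots> = ennreal (exp ((b - t) * (y + e))) * J t + ennreal H * ?r * S b"
    unfolding J_def S_def by (subst suminf_add[symmetric]) (auto simp: ennreal_suminf_cmult)
  finally have "ennreal j \<le> ennreal (exp ((b - t) * (y + e)) + H * r * K)"
    using j K H0 r Jt by (simp add: ennreal_mult)
  then have "j \<le> exp ((b - t) * (y + e)) + H * r * K"
    using H0 K r by (subst (asm) ennreal_le_iff) auto
  moreover have "K \<le> exp (b * y) / (1 - r)"
    using Sle[of b] K t bt r by (simp add: ennreal_le_iff)
  ultimately show ?thesis using K low jeq by (intro exI[of _ K]) (auto simp: S_def)
qed

end

text \<open>\<open>F h\<close> will be the law of the surplus increment over time \<open>h\<close>,
  and \<open>d\<close> will be \<open>c - lam * mu\<close>. The quadratic bound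
  \<open>phi_le\<close> feeds the Chernoff estimate for upward moves; \<open>phi_diff\<close> makes
  \<open>phi\<close> strictly increasing and keeps it above a line of positive slope.\<close>

locale step_family =
  fixes F :: "real \<Rightarrow> real measure" and phi :: "real \<Rightarrow> real" and c v d :: real
  assumes step_law: "0 < h \<Longrightarrow> step_law (F h)"
    and mgf: "0 < h \<Longrightarrow> 0 \<le> b \<Longrightarrow> (\<integral>\<^sup>+u. ennreal (exp (b * u)) \<partial>F h) = ennreal (exp (h * phi b))"
    and phi_0: "phi 0 = 0"
    and phi_cont: "continuous_on {0..} phi"
    and v_nonneg: "0 \<le> v"
    and phi_le: "0 \<le> b \<Longrightarrow> phi b \<le> c * b + v * b\<^sup>2"
    and d_pos: "0 < d"
    and phi_diff: "0 \<le> a \<Longrightarrow> a \<le> b \<Longrightarrow> d * (b - a) \<le> phi b - phi a"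
begin

section \<open>Vanishing step: overshoot and the limit of the adjoint resolvent\<close>

lemma phi_strict: "0 \<le> a \<Longrightarrow> a < b \<Longrightarrow> phi a < phi b"
  using phi_diff[of a b] d_pos by (smt (verit) mult_pos_pos)

lemma phi_pos: "0 < a \<Longrightarrow> 0 < phi a"
  using phi_strict[of 0 a] phi_0 by simp

lemma phi_nonneg: "0 \<le> a \<Longrightarrow> 0 \<le> phi a"
  using phi_pos[of a] phi_0 by (cases "a = 0") auto

text \<open>A Chernoff bound with exponent \<open>b + h\<^sup>-\<^sup>1\<^sup>/\<^sup>2\<close>, for which \<open>h \<phi>\<close> stays bounded.\<close>

lemma step_overshoot:
  assumes h: "0 < h" "h \<le> 1" and b: "0 \<le> b"
  shows "(\<integral>\<^sup>+u. ennreal (exp (b * u)) * indicator {h powr (1/4)<..} u \<partial>F h)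
    \<le> ennreal (exp (\<bar>c\<bar> * (b + 1) + v * (b + 1)\<^sup>2 - h powr (-1/4)))"
proof -
  interpret step_law "F h" by (rule step_law) fact
  define k where "k = h powr (-1/2)"
  \<comment> \<open>The threshold has to tend to 0 with \<open>h\<close> while \<open>k * e\<close>
    tends to infinity; with \<open>k = h powr (-1/2)\<close> the exponent 1/4 gives
    \<open>k * e = h powr (-1/4)\<close>.\<close>
  define e where "e = h powr (1/4)"
  have k: "0 < k" using h by (simp add: k_def)
  have kk: "k\<^sup>2 = h powr (-1)"
    unfolding k_def power2_eq_square powr_add[symmetric] by simp
  then have hkk: "h * k\<^sup>2 = 1" using h by (simp add: powr_minus_divide)
  have "1 \<le> k" using h by (simp add: k_def powr_minus_divide powr_le1)
  then have "h * k \<le> h * k\<^sup>2" using h by (intro mult_left_mono) (auto simp: power2_eq_square)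
  then have hk: "h * k \<le> 1" using hkk by simp
  have ke: "k * e = h powr (-1/4)"
    unfolding k_def e_def powr_add[symmetric] by simp
  have "(\<integral>\<^sup>+u. ennreal (exp (b * u)) * indicator {e<..} u \<partial>F h) \<le> (\<integral>\<^sup>+u. ennreal (exp (- k * e)) * ennreal (exp ((b + k) * u)) \<partial>F h)"
  proof (rule nn_integral_mono)
    fix u
    show "ennreal (exp (b * u)) * indicator {e<..} u \<le> ennreal (exp (- k * e)) * ennreal (exp ((b + k) * u))"
    proof (cases "e < u")
      case True
      then have "k * e \<le> k * u" using k by simp
      then show ?thesis using True by (simp add: ennreal_exp_add[symmetric] algebra_simps)
    qed auto
  qed
  also have "\<dots> = ennreal (exp (- k * e)) * ennreal (exp (h * phi (b + k)))"
    using h b k by (simp add: nn_integral_cmult mgf)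
  also have "\<dots> = ennreal (exp (- k * e + h * phi (b + k)))"
    by (rule ennreal_exp_add[symmetric])
  also have "\<dots> \<le> ennreal (exp (\<bar>c\<bar> * (b + 1) + v * (b + 1)\<^sup>2 - h powr (-1/4)))"
  proof -
    have "h * phi (b + k) \<le> h * (c * (b + k) + v * (b + k)\<^sup>2)"
      using phi_le[of "b + k"] b k h by (intro mult_left_mono) auto
    also have "\<dots> = c * (h * b + h * k) + v * (h * b\<^sup>2 + 2 * (h * k) * b + h * k\<^sup>2)"
      by (simp add: power2_eq_square algebra_simps)
    also have "\<dots> \<le> \<bar>c\<bar> * (b + 1) + v * (b\<^sup>2 + 2 * 1 * b + 1)"
    proof (intro add_mono mult_left_mono)
      have "h * b + h * k \<le> 1 * b + 1" using h b hk by (intro add_mono mult_right_mono) auto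
      then have "\<bar>c\<bar> * (h * b + h * k) \<le> \<bar>c\<bar> * (b + 1)"
        by (intro mult_left_mono) auto
      moreover have "c * (h * b + h * k) \<le> \<bar>c\<bar> * (h * b + h * k)"
        using h b k by (intro mult_right_mono) auto
      ultimately show "c * (h * b + h * k) \<le> \<bar>c\<bar> * (b + 1)" by simp
      show "h * b\<^sup>2 \<le> b\<^sup>2" using h by (simp add: mult_left_le_one_le)
      show "2 * (h * k) * b \<le> 2 * 1 * b" using hk b by (intro mult_right_mono) auto
    qed (use v_nonneg hkk in auto)
    also have "\<dots> = \<bar>c\<bar> * (b + 1) + v * (b + 1)\<^sup>2"
      by (simp add: power2_eq_square algebra_simps)
    finally show ?thesis using ke by (intro ennreal_leI) simp
  qed
  finally show ?thesis by (simp add: e_def)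
qed

text \<open>The sum starts with the first step and omits step 0. It will be matched with a Riemann
  sum in time evaluated at the right ends of the grid cells, where right continuity of the paths
  applies.\<close>

definition dual_resolvent :: "real \<Rightarrow> real \<Rightarrow> real \<Rightarrow> real \<Rightarrow> ennreal" where
  "dual_resolvent b q h y = ennreal h * (\<Sum>i. ennreal (exp (- (h * q))) ^ Suc i * dual_iter b (F h) (Suc i) y)"

text \<open>The geometric series with ratio \<open>exp (- (h * q))\<close> is about
  \<open>1 / (h * q)\<close>; \<open>exp v \<ge> 1 + v\<close> turns this into a bound on
  \<open>h\<close> times the series that is uniform for \<open>h \<le> 1\<close>.\<close>

lemma mesh_bound: "0 < (q::real) \<Longrightarrow> 0 < h \<Longrightarrow> h / (1 - exp (- (h * q))) \<le> 1 / q + h"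
proof -
  assume q: "0 < q" and h: "0 < h"
  have "(1 + h * q) * exp (- (h * q)) \<le> exp (h * q) * exp (- (h * q))"
    using exp_ge_add_one_self[of "h * q"] by (intro mult_right_mono) (auto simp: add.commute)
  then have "(1 + h * q) * exp (- (h * q)) \<le> 1" by (simp add: exp_minus)
  then have "h * q \<le> (1 + h * q) * (1 - exp (- (h * q)))" by (simp add: algebra_simps)
  moreover have "0 < 1 - exp (- (h * q))" using q h by simp
  ultimately show ?thesis using q by (simp add: field_simps)
qed

lemma dual_resolvent_le:
  assumes h: "0 < h" "h \<le> 1" and q: "0 < q" and b: "0 \<le> b"
  shows "dual_resolvent b q h y \<le> ennreal (exp (b * y) * (1 / q + 1))"
proof -
  interpret step_law "F h" by (rule step_law) fact
  let ?r = "exp (- (h * q))"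
  have r: "0 < ?r" "?r < 1" using h q by auto
  have "dual_resolvent b q h y \<le> ennreal h * (\<Sum>i. ennreal (exp (b * y) * ?r ^ i))"
    unfolding dual_resolvent_def
  proof (intro mult_left_mono suminf_le)
    fix i
    have "ennreal ?r ^ Suc i * dual_iter b (F h) (Suc i) y \<le> ennreal ?r ^ i * ennreal (exp (b * y))"
      using r by (intro mult_mono dual_iter_le b) (auto simp: ennreal_power simp flip: ennreal_mult intro!: ennreal_leI mult_left_le_one_le)
    then show "ennreal ?r ^ Suc i * dual_iter b (F h) (Suc i) y \<le> ennreal (exp (b * y) * ?r ^ i)"
      by (simp add: ennreal_mult ennreal_power mult.commute del: power_Suc)
  qed auto
  also have "(\<Sum>i. ennreal (exp (b * y) * ?r ^ i)) = ennreal (exp (b * y) / (1 - ?r))"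
    using r by (intro suminf_ennreal_eq) (auto intro!: geometric_sums[THEN sums_mult, of ?r "exp (b*y)", simplified])
  also have "ennreal h * \<dots> = ennreal (exp (b * y) * (h / (1 - ?r)))"
    using h r by (simp add: ennreal_mult[symmetric])
  also have "\<dots> \<le> ennreal (exp (b * y) * (1 / q + 1))"
    using mesh_bound[OF q h(1)] h by (intro ennreal_leI mult_left_mono) auto
  finally show ?thesis .
qed

text \<open>For the discount \<open>r = exp (- (h * phi t))\<close> and
  \<open>D = phi b - phi t\<close>, \<open>resolvent_bounds\<close> squeezes
  \<open>(exp (h * D) - 1) * K\<close> to \<open>exp ((b - t) * y) - 1\<close>, and
  \<open>h / (exp (h * D) - 1)\<close> tends to \<open>1 / D\<close>. The condition
  \<open>0 < t\<close> makes the level positive, which bounds \<open>K\<close>.\<close>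

lemma dual_resolvent_tendsto:
  assumes t: "0 < t" "t < b" and y: "0 \<le> y"
  shows "((\<lambda>h. dual_resolvent b (phi t) h y) \<longlongrightarrow> ennreal ((exp ((b - t) * y) - 1) / (phi b - phi t))) (at_right 0)"
proof -
  define q where "q = phi t"
  define D where "D = phi b - phi t"
  have q: "0 < q" using phi_pos t by (simp add: q_def)
  have D: "0 < D" using phi_strict[of t b] t by (simp add: D_def)
  define C where "C = \<bar>c\<bar> * (b + 1) + v * (b + 1)\<^sup>2"
  define H where "H h = exp (C - h powr (-1/4))" for h :: real
  define r where "r h = exp (- (h * q))" for h
  have ex: "\<exists>K. (\<Sum>i. ennreal (r h) ^ i * dual_iter b (F h) i y) = ennreal K \<and> 0 \<le> K \<and> K \<le> exp (b * y) / (1 - r h) \<and>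
    exp ((b - t) * y) - 1 \<le> (exp (h * D) - 1) * K \<and>
    (exp (h * D) - 1) * K \<le> exp ((b - t) * (y + h powr (1/4))) - 1 + H h * r h * K"
    if h: "0 < h" "h < 1" for h
  proof -
    interpret step_law "F h" by (rule step_law) fact
    have rg: "r h * exp (h * phi b) = exp (h * D)"
      by (simp add: r_def q_def D_def exp_add[symmetric] algebra_simps)
    have 1: "0 < r h" "r h < 1" using h q by (auto simp: r_def)
    have 2: "(\<integral>\<^sup>+u. ennreal (exp (t * u)) \<partial>F h) = ennreal (inverse (r h))"
      using mgf[of h t] t h by (simp add: r_def q_def exp_minus)
    show ?thesis
      using resolvent_bounds[OF y 1 _ _ _ 2 mgf[of h b], of "h powr (1/4)" "H h"] t h
         step_overshoot[of h b] by (simp add: H_def C_def rg)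
  qed
  define K where "K h = enn2real (\<Sum>i. ennreal (r h) ^ i * dual_iter b (F h) i y)" for h
  have K: "(\<Sum>i. ennreal (r h) ^ i * dual_iter b (F h) i y) = ennreal (K h)" "0 \<le> K h"
      "K h \<le> exp (b * y) / (1 - r h)"
      "exp ((b - t) * y) - 1 \<le> (exp (h * D) - 1) * K h"
      "(exp (h * D) - 1) * K h \<le> exp ((b - t) * (y + h powr (1/4))) - 1 + H h * r h * K h"
    if "0 < h" "h < 1" for h
    using ex[OF that] by (auto simp: K_def)
  have ev: "eventually (\<lambda>h::real. 0 < h \<and> h < 1) (at_right 0)"
    by (auto simp: eventually_at_right_field intro!: exI[of _ 1])
  have "((\<lambda>h. (exp (h * D) - 1) * K h) \<longlongrightarrow> exp ((b - t) * y) - 1) (at_right 0)"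
  proof (rule tendsto_sandwich)
    show "eventually (\<lambda>h. exp ((b - t) * y) - 1 \<le> (exp (h * D) - 1) * K h) (at_right 0)"
      using ev by eventually_elim (use K in blast)
    show "eventually (\<lambda>h. (exp (h * D) - 1) * K h \<le> exp ((b - t) * (y + h powr (1/4))) - 1
        + exp (C + b * y) * (exp (- (h powr (-1/4))) / (1 - exp (- (h * q))))) (at_right 0)"
      using ev
    proof eventually_elim
      case (elim h)
      then have h: "0 < h" "h < 1" by auto
      have r: "0 < r h" "r h \<le> 1" "r h < 1" using h q by (auto simp: r_def)
      have "H h * r h * K h \<le> H h * 1 * (exp (b * y) / (1 - r h))"
        using K[OF h] r by (intro mult_mono) (auto simp: H_def)
      also have "\<dots> = exp (C + b * y) * (exp (- (h powr (-1/4))) / (1 - exp (- (h * q))))"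
        by (simp add: H_def r_def exp_add exp_diff exp_minus field_simps)
      finally show ?case using K(5)[OF h] by simp
    qed
    \<comment> \<open>The crude bound on \<open>K\<close> blows up like \<open>1 / h\<close>, but
      the mass of large increments decays like \<open>exp (- (h powr (-1/4)))\<close> and
      wins.\<close>
    have "((\<lambda>h. exp (- (h powr (-1/4))) / (1 - exp (- (h * q)))) \<longlongrightarrow> 0) (at_right 0)"
      using q by real_asymp
    moreover have "((\<lambda>h::real. h powr (1/4)) \<longlongrightarrow> 0) (at_right 0)" by real_asymp
    ultimately have "((\<lambda>h. exp ((b - t) * (y + h powr (1/4))) - 1
        + exp (C + b * y) * (exp (- (h powr (-1/4))) / (1 - exp (- (h * q))))) \<longlongrightarrow>
        exp ((b - t) * (y + 0)) - 1 + exp (C + b * y) * 0) (at_right 0)"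
      by (intro tendsto_intros)
    then show "((\<lambda>h. exp ((b - t) * (y + h powr (1/4))) - 1
        + exp (C + b * y) * (exp (- (h powr (-1/4))) / (1 - exp (- (h * q))))) \<longlongrightarrow> exp ((b - t) * y) - 1) (at_right 0)"
      by simp
  qed simp
  moreover have "((\<lambda>h. h / (exp (h * D) - 1)) \<longlongrightarrow> 1 / D) (at_right 0)"
    using D by (real_asymp simp: field_simps)
  ultimately have "((\<lambda>h. h / (exp (h * D) - 1) * ((exp (h * D) - 1) * K h)) \<longlongrightarrow> 1 / D * (exp ((b - t) * y) - 1)) (at_right 0)"
    by (rule tendsto_mult[rotated])
  moreover have "((\<lambda>h::real. h) \<longlongrightarrow> 0) (at_right 0)" by real_asymp
  ultimately have "((\<lambda>h. h / (exp (h * D) - 1) * ((exp (h * D) - 1) * K h) - h) \<longlongrightarrow> 1 / D * (exp ((b - t) * y) - 1) - 0) (at_right 0)"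
    by (rule tendsto_diff)
  then have "((\<lambda>h. ennreal (h / (exp (h * D) - 1) * ((exp (h * D) - 1) * K h) - h)) \<longlongrightarrow> ennreal (1 / D * (exp ((b - t) * y) - 1) - 0)) (at_right 0)"
    by (rule tendsto_ennrealI)
  then have lim: "((\<lambda>h. ennreal (h / (exp (h * D) - 1) * ((exp (h * D) - 1) * K h) - h)) \<longlongrightarrow> ennreal ((exp ((b - t) * y) - 1) / (phi b - phi t))) (at_right 0)"
    by (simp add: D_def)
  show ?thesis
  proof (rule Lim_transform_eventually[OF lim])
    show "eventually (\<lambda>h. ennreal (h / (exp (h * D) - 1) * ((exp (h * D) - 1) * K h) - h) = dual_resolvent b (phi t) h y) (at_right 0)"
      using ev
    proof eventually_elim
      case (elim h)
      then have h: "0 < h" "h < 1" by auto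
      \<comment> \<open>\<open>K\<close> still contains the term of step 0. Removing it changes
        \<open>h * K\<close> by \<open>h\<close>, which disappears in the limit.\<close>
      have "ennreal (K h) = (\<Sum>i. ennreal (r h) ^ Suc i * dual_iter b (F h) (Suc i) y) + 1"
        using suminf_offset[of "\<lambda>i. ennreal (r h) ^ i * dual_iter b (F h) i y" 1] y K(1)[OF h]
        by (simp add: dual_iter_0 add.commute)
      then have "(\<Sum>i. ennreal (r h) ^ Suc i * dual_iter b (F h) (Suc i) y) = ennreal (K h) - 1"
        by simp
      also have "\<dots> = ennreal (K h - 1)"
        by (simp add: ennreal_minus flip: ennreal_1)
      finally have "dual_resolvent b (phi t) h y = ennreal h * ennreal (K h - 1)"
        by (simp add: dual_resolvent_def r_def q_def)
      moreover have "1 \<le> K h"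
        using \<open>ennreal (K h) = _ + 1\<close> K(2)[OF h]
        by (metis add.commute ennreal_1 ennreal_le_iff le_iff_add)
      moreover have "h / (exp (h * D) - 1) * ((exp (h * D) - 1) * K h) = h * K h"
        using h D by simp
      ultimately show ?case using h
        by (simp add: ennreal_mult[symmetric] algebra_simps)
    qed
  qed
qed

end

section \<open>Dyadic skeletons and the killed potential\<close>

definition mesh :: "nat \<Rightarrow> real" where "mesh n = (1/2) ^ n"

text \<open>The first grid point strictly after \<open>t\<close>. Floor plus one is taken in place
  of a ceiling so that grid points \<open>t\<close> are moved as well and the limit is one along
  \<open>at_right t\<close>.\<close>

definition mesh_up :: "nat \<Rightarrow> real \<Rightarrow> real" where
  "mesh_up n t = real (Suc (nat \<lfloor>t / mesh n\<rfloor>)) * mesh n"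

lemma mesh_pos[simp]: "0 < mesh n" and mesh_le_1: "mesh n \<le> 1"
  by (auto simp: mesh_def power_le_one)

lemma mesh_tendsto: "mesh \<longlonglongrightarrow> 0"
  unfolding mesh_def[abs_def] by (rule LIMSEQ_realpow_zero) auto

lemma filterlim_mesh: "filterlim mesh (at_right 0) sequentially"
  unfolding filterlim_at using mesh_tendsto by (simp add: always_eventually less_imp_neq[symmetric])

lemma mesh_up_bounds:
  assumes "0 \<le> t" shows "t < mesh_up n t" "mesh_up n t \<le> t + mesh n"
proof -
  have "0 \<le> t / mesh n" using assms by (simp add: less_imp_le)
  then have *: "real (nat \<lfloor>t / mesh n\<rfloor>) = of_int \<lfloor>t / mesh n\<rfloor>" by simp
  show "t < mesh_up n t" "mesh_up n t \<le> t + mesh n"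
    using floor_divide_upper[of "mesh n" t] floor_divide_lower[of "mesh n" t]
    by (simp_all add: mesh_up_def * algebra_simps)
qed

lemma mesh_up_tendsto: "0 \<le> t \<Longrightarrow> (\<lambda>n. mesh_up n t) \<longlonglongrightarrow> t"
  by (rule tendsto_sandwich[of "\<lambda>_. t" _ _ "\<lambda>n. t + mesh n"])
     (auto simp: mesh_up_bounds less_imp_le intro!: tendsto_eq_intros mesh_tendsto)

lemma filterlim_mesh_up: "0 \<le> t \<Longrightarrow> filterlim (\<lambda>n. mesh_up n t) (at_right t) sequentially"
  unfolding filterlim_at using mesh_up_tendsto mesh_up_bounds by (auto simp: less_imp_neq[symmetric])

lemma mesh_refine: "m \<le> n \<Longrightarrow> real k * mesh m = real (k * 2 ^ (n - m)) * mesh n"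
proof -
  assume "m \<le> n"
  then have "(2::real) ^ n = 2 ^ m * 2 ^ (n - m)" by (simp add: power_add[symmetric])
  then show ?thesis by (simp add: mesh_def power_one_over)
qed

text \<open>Turns sums over grid steps into integrals over time, so that dominated convergence can
  be applied with the time fixed while the grid is refined.\<close>

lemma nn_integral_floor:
  assumes h: "0 < h"
  shows "(\<integral>\<^sup>+t. indicator {0..} t * f (nat \<lfloor>t / h\<rfloor>) \<partial>lborel) = (\<Sum>i. ennreal h * f i)"
proof -
  have "indicator {0..} t * f (nat \<lfloor>t / h\<rfloor>) = (\<Sum>i. f i * indicator {real i * h..<real (Suc i) * h} t)" for t
  proof (cases "0 \<le> t")
    case True
    have eq: "t \<in> {real i * h..<real (Suc i) * h} \<longleftrightarrow> i = nat \<lfloor>t / h\<rfloor>" for i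
    proof -
      have "t \<in> {real i * h..<real (Suc i) * h} \<longleftrightarrow> real i \<le> t / h \<and> t / h < real i + 1"
        using h by (auto simp: field_simps)
      also have "\<dots> \<longleftrightarrow> \<lfloor>t / h\<rfloor> = int i" by linarith
      also have "\<dots> \<longleftrightarrow> i = nat \<lfloor>t / h\<rfloor>" using True h by (auto simp: nat_eq_iff)
      finally show ?thesis .
    qed
    have "(\<Sum>i. f i * indicator {real i * h..<real (Suc i) * h} t) = (\<Sum>i\<in>{nat \<lfloor>t / h\<rfloor>}. f i * indicator {real i * h..<real (Suc i) * h} t)"
      by (rule suminf_finite) (use eq in \<open>auto simp: indicator_def simp del: atLeastLessThan_iff\<close>)
    also have "\<dots> = f (nat \<lfloor>t / h\<rfloor>)" using eq by (simp del: atLeastLessThan_iff)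
    finally show ?thesis using True by simp
  next
    case False
    have "t \<notin> {real i * h..<real (Suc i) * h}" for i
    proof -
      have "0 \<le> real i * h" using h by simp
      then show ?thesis using False by auto
    qed
    then have "(\<Sum>i. f i * indicator {real i * h..<real (Suc i) * h} t) = 0"
      by (simp del: atLeastLessThan_iff)
    then show ?thesis using False by simp
  qed
  then have "(\<integral>\<^sup>+t. indicator {0..} t * f (nat \<lfloor>t / h\<rfloor>) \<partial>lborel) =
      (\<integral>\<^sup>+t. (\<Sum>i. f i * indicator {real i * h..<real (Suc i) * h} t) \<partial>lborel)"
    by simp
  also have "\<dots> = (\<Sum>i. \<integral>\<^sup>+t. f i * indicator {real i * h..<real (Suc i) * h} t \<partial>lborel)"
    by (rule nn_integral_suminf) measurable
  also have "\<dots> = (\<Sum>i. ennreal h * f i)"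
    using h by (intro suminf_cong) (simp add: nn_integral_cmult_indicator algebra_simps)
  finally show ?thesis .
qed

lemma nn_integral_exp_decay: "0 < (q::real) \<Longrightarrow> (\<integral>\<^sup>+t. indicator {0..} t * ennreal (exp (- q * t)) \<partial>lborel) = ennreal (1 / q)"
proof -
  assume q: "0 < q"
  have lim: "((\<lambda>t. - exp (- q * t) / q) \<longlongrightarrow> 0) at_top"
    using q by real_asymp
  have "(\<integral>\<^sup>+t. ennreal (exp (- q * t)) * indicator {0..} t \<partial>lborel) = ennreal (0 - - exp (- q * 0) / q)"
    by (rule nn_integral_FTC_atLeast[OF _ _ _ lim])
       (use q in \<open>auto intro!: derivative_eq_intros simp: field_simps\<close>)
  then show ?thesis by (simp add: mult.commute)
qed

text \<open>Apart from path regularity, the only probabilistic input is \<open>markov\<close>: a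
  grid increment has law \<open>F h\<close> and is independent of the grid past. The functional
  \<open>w\<close> sees the whole past because killing depends on all earlier grid values.\<close>

locale skeleton_process = prob_space M + step_family F phi c v d
  for M :: "'a measure" and F phi c v d +
  fixes S :: "real \<Rightarrow> 'a \<Rightarrow> real"
  assumes S_measurable: "0 \<le> t \<Longrightarrow> S t \<in> borel_measurable M"
    and S_0: "\<omega> \<in> space M \<Longrightarrow> S 0 \<omega> = 0"
    and S_right: "\<omega> \<in> space M \<Longrightarrow> 0 \<le> t \<Longrightarrow> ((\<lambda>s. S s \<omega>) \<longlongrightarrow> S t \<omega>) (at_right t)"
    and S_left: "\<omega> \<in> space M \<Longrightarrow> 0 < t \<Longrightarrow> \<exists>l. ((\<lambda>s. S s \<omega>) \<longlongrightarrow> l) (at_left t)"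
    and markov: "\<lbrakk>0 < h; w \<in> borel_measurable (Pi\<^sub>M {..i} (\<lambda>_. borel) \<Otimes>\<^sub>M borel)\<rbrakk> \<Longrightarrow>
      (\<integral>\<^sup>+\<omega>. w (\<lambda>k\<in>{..i}. S (real k * h) \<omega>, S (real (Suc i) * h) \<omega> - S (real i * h) \<omega>) \<partial>M) =
      (\<integral>\<^sup>+\<omega>. \<integral>\<^sup>+u. w (\<lambda>k\<in>{..i}. S (real k * h) \<omega>, u) \<partial>F h \<partial>M)"
begin

text \<open>Only dyadic times are tested, which keeps this event measurable; by right continuity it says
  that there is no ruin before \<open>t\<close>.\<close>

definition alive :: "real \<Rightarrow> real \<Rightarrow> 'a \<Rightarrow> bool" where
  "alive x t \<omega> \<longleftrightarrow> (\<forall>n k. real k * mesh n < t \<longrightarrow> 0 \<le> x + S (real k * mesh n) \<omega>)"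

definition skel_alive :: "real \<Rightarrow> real \<Rightarrow> nat \<Rightarrow> 'a \<Rightarrow> bool" where
  "skel_alive x h i \<omega> \<longleftrightarrow> (\<forall>k\<le>i. 0 \<le> x + S (real k * h) \<omega>)"

definition skel_expect :: "real \<Rightarrow> nat \<Rightarrow> (real \<Rightarrow> ennreal) \<Rightarrow> real \<Rightarrow> ennreal" where
  "skel_expect h i f x = (\<integral>\<^sup>+\<omega>. f (x + S (real i * h) \<omega>) * indicator {\<omega>. skel_alive x h i \<omega>} \<omega> \<partial>M)"

definition potential :: "real \<Rightarrow> (real \<Rightarrow> ennreal) \<Rightarrow> real \<Rightarrow> ennreal" where
  "potential q f x = (\<integral>\<^sup>+\<omega>. \<integral>\<^sup>+t. indicator {0..} t * ennreal (exp (- q * t)) *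
      (f (x + S t \<omega>) * indicator {\<omega>. alive x t \<omega>} \<omega>) \<partial>lborel \<partial>M)"

section \<open>Grid walks as Riemann sums for the killed potential\<close>

lemma S_measurable_skel[measurable]: "0 \<le> h \<Longrightarrow> S (real k * h) \<in> borel_measurable M"
  "S (real k * mesh n) \<in> borel_measurable M"
  by (rule S_measurable; simp add: less_imp_le)+

lemma skel_step:
  assumes h: "0 < h" and [measurable]: "(\<lambda>(z, u). G z u) \<in> borel_measurable (borel \<Otimes>\<^sub>M borel)"
  shows "(\<integral>\<^sup>+\<omega>. indicator {\<omega>. skel_alive x h i \<omega>} \<omega> *
       G (x + S (real i * h) \<omega>) (S (real (Suc i) * h) \<omega> - S (real i * h) \<omega>) \<partial>M) =
     (\<integral>\<^sup>+\<omega>. indicator {\<omega>. skel_alive x h i \<omega>} \<omega> * (\<integral>\<^sup>+u. G (x + S (real i * h) \<omega>) u \<partial>F h) \<partial>M)"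
proof -
  interpret F: step_law "F h" by (rule step_law) fact
  define w :: "(nat \<Rightarrow> real) \<times> real \<Rightarrow> ennreal" where
    "w = (\<lambda>(p, u). indicator {p. \<forall>k\<le>i. 0 \<le> x + p k} p * G (x + p i) u)"
  have Gm: "(\<lambda>p. case_prod G (x + fst p i, snd p)) \<in> borel_measurable (Pi\<^sub>M {..i} (\<lambda>_. borel) \<Otimes>\<^sub>M borel)"
    by measurable
  have "(\<lambda>p. (indicator {p. \<forall>k\<le>i. 0 \<le> x + p k} (fst p) :: ennreal)) \<in> borel_measurable (Pi\<^sub>M {..i} (\<lambda>_. borel :: real measure) \<Otimes>\<^sub>M (borel :: real measure))"
  proof -
    have "(\<lambda>p. (indicator {p. \<forall>k\<le>i. 0 \<le> x + p k} (fst p) :: ennreal)) = (\<lambda>p. \<Prod>k\<le>i. indicator {0..} (x + fst p k))"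
      by (auto simp: fun_eq_iff indicator_def)
    also have "\<dots> \<in> borel_measurable (Pi\<^sub>M {..i} (\<lambda>_. borel :: real measure) \<Otimes>\<^sub>M (borel :: real measure))"
    proof (rule borel_measurable_prod_ennreal)
      fix k assume k: "k \<in> {..i}"
      have [measurable]: "(\<lambda>p. fst p k) \<in> borel_measurable (Pi\<^sub>M {..i} (\<lambda>_. borel :: real measure) \<Otimes>\<^sub>M (borel :: real measure))"
        using k by measurable
      show "(\<lambda>p. indicator {0..} (x + fst p k) :: ennreal) \<in> borel_measurable (Pi\<^sub>M {..i} (\<lambda>_. borel :: real measure) \<Otimes>\<^sub>M (borel :: real measure))"
        by measurable
    qed
    finally show ?thesis .
  qed
  then have wm: "w \<in> borel_measurable (Pi\<^sub>M {..i} (\<lambda>_. borel) \<Otimes>\<^sub>M borel)"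
    using borel_measurable_times_ennreal[OF _ Gm] by (simp add: w_def case_prod_beta')
  have "(\<integral>\<^sup>+\<omega>. indicator {\<omega>. skel_alive x h i \<omega>} \<omega> *
       G (x + S (real i * h) \<omega>) (S (real (Suc i) * h) \<omega> - S (real i * h) \<omega>) \<partial>M) =
    (\<integral>\<^sup>+\<omega>. w (\<lambda>k\<in>{..i}. S (real k * h) \<omega>, S (real (Suc i) * h) \<omega> - S (real i * h) \<omega>) \<partial>M)"
    by (intro nn_integral_cong) (auto simp: w_def skel_alive_def indicator_def)
  also have "\<dots> = (\<integral>\<^sup>+\<omega>. \<integral>\<^sup>+u. w (\<lambda>k\<in>{..i}. S (real k * h) \<omega>, u) \<partial>F h \<partial>M)"
    by (rule markov[OF h wm])
  also have "\<dots> = (\<integral>\<^sup>+\<omega>. \<integral>\<^sup>+u. indicator {\<omega>. skel_alive x h i \<omega>} \<omega> * G (x + S (real i * h) \<omega>) u \<partial>F h \<partial>M)"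
    by (intro nn_integral_cong) (auto simp: w_def skel_alive_def indicator_def)
  also have "\<dots> = (\<integral>\<^sup>+\<omega>. indicator {\<omega>. skel_alive x h i \<omega>} \<omega> * (\<integral>\<^sup>+u. G (x + S (real i * h) \<omega>) u \<partial>F h) \<partial>M)"
  proof (intro nn_integral_cong nn_integral_cmult)
    fix \<omega>
    have "(\<lambda>u. case_prod G (x + S (real i * h) \<omega>, u)) \<in> borel_measurable (F h)" by measurable
    then show "G (x + S (real i * h) \<omega>) \<in> borel_measurable (F h)" by simp
  qed
  finally show ?thesis .
qed

text \<open>Induction removes the last step, which \<open>skel_step\<close> integrates out; so the
  test function changes while the starting point stays fixed. \<open>0 \<le> x\<close> is what makes
  the walk alive at time 0.\<close>

lemma skel_expect_eq:
  assumes h: "0 < h" and x: "0 \<le> x" and "f \<in> borel_measurable borel"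
  shows "skel_expect h i f x = (killed_step (F h) ^^ i) f x"
  using assms(3)
proof (induction i arbitrary: f)
  case 0
  have "skel_expect h 0 f x = (\<integral>\<^sup>+\<omega>. f x \<partial>M)"
    unfolding skel_expect_def
    by (intro nn_integral_cong) (use x in \<open>auto simp: skel_alive_def S_0\<close>)
  then show ?case by (simp add: emeasure_space_1)
next
  case (Suc i)
  interpret F: step_law "F h" by (rule step_law) fact
  have [measurable]: "f \<in> borel_measurable borel" by fact
  have "skel_expect h (Suc i) f x =
    (\<integral>\<^sup>+\<omega>. indicator {\<omega>. skel_alive x h i \<omega>} \<omega> *
       (\<lambda>z u. f (z + u) * indicator {0..} (z + u)) (x + S (real i * h) \<omega>) (S (real (Suc i) * h) \<omega> - S (real i * h) \<omega>) \<partial>M)"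
    unfolding skel_expect_def
    by (intro nn_integral_cong) (auto simp: skel_alive_def indicator_def le_Suc_eq)
  also have "\<dots> = (\<integral>\<^sup>+\<omega>. indicator {\<omega>. skel_alive x h i \<omega>} \<omega> * (\<integral>\<^sup>+u. f (x + S (real i * h) \<omega> + u) * indicator {0..} (x + S (real i * h) \<omega> + u) \<partial>F h) \<partial>M)"
    by (rule skel_step[OF h]) measurable
  also have "\<dots> = skel_expect h i (killed_step (F h) f) x"
    unfolding skel_expect_def killed_step_def by (simp add: mult.commute)
  also have "\<dots> = (killed_step (F h) ^^ i) (killed_step (F h) f) x"
    by (rule Suc.IH) measurable
  finally show ?case by (simp add: funpow_swap1)
qed

lemma S_mesh_up_tendsto:
  "\<omega> \<in> space M \<Longrightarrow> 0 \<le> t \<Longrightarrow> (\<lambda>n. S (mesh_up n t) \<omega>) \<longlonglongrightarrow> S t \<omega>"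
  using filterlim_compose[OF S_right filterlim_mesh_up] by blast

lemma measurable_S_mesh_up: "(\<lambda>(t, \<omega>). S (mesh_up n t) \<omega>) \<in> borel_measurable (borel \<Otimes>\<^sub>M M)"
proof -
  have "(\<lambda>p. (\<lambda>i p. S (real (Suc i) * mesh n) (snd p)) (nat \<lfloor>fst p / mesh n\<rfloor>) p) \<in> borel_measurable (borel \<Otimes>\<^sub>M M)"
    by (rule measurable_compose_countable) measurable
  then show ?thesis by (simp add: mesh_up_def case_prod_beta')
qed

text \<open>Right continuity makes the process a limit of step functions in time. The argument
  \<open>max 0 t\<close> is there because nothing is assumed about negative times.\<close>

lemma measurable_S_joint: "(\<lambda>(t, \<omega>). S (max 0 t) \<omega>) \<in> borel_measurable (borel \<Otimes>\<^sub>M M)"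
proof (rule borel_measurable_LIMSEQ_real[where u="\<lambda>n (t, \<omega>). S (mesh_up n (max 0 t)) \<omega>"])
  fix n
  show "(\<lambda>(t, \<omega>). S (mesh_up n (max 0 t)) \<omega>) \<in> borel_measurable (borel \<Otimes>\<^sub>M M)"
    using measurable_compose[OF _ measurable_S_mesh_up, of "\<lambda>p. (max 0 (fst p), snd p)" "borel \<Otimes>\<^sub>M M"]
    by (simp add: case_prod_beta')
qed (auto simp: space_pair_measure S_mesh_up_tendsto)

lemma measurable_alive: "Measurable.pred (borel \<Otimes>\<^sub>M M) (\<lambda>(t, \<omega>). alive x t \<omega>)"
  unfolding alive_def case_prod_beta' by measurable

lemma measurable_potential_integrand:
  assumes [measurable]: "f \<in> borel_measurable borel"
  shows "(\<lambda>(t, \<omega>). indicator {0..} t * ennreal (exp (- q * t)) *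
      (f (x + S t \<omega>) * indicator {\<omega>. alive x t \<omega>} \<omega>)) \<in> borel_measurable (lborel \<Otimes>\<^sub>M M)"
proof -
  note measurable_S_joint[measurable] measurable_alive[measurable]
  have [measurable]: "(\<lambda>p. S (max 0 (fst p)) (snd p)) \<in> borel_measurable (borel \<Otimes>\<^sub>M M)"
    "Measurable.pred (borel \<Otimes>\<^sub>M M) (\<lambda>p. alive x (fst p) (snd p))"
    using measurable_S_joint measurable_alive[of x] by (simp_all add: case_prod_beta')
  have "(\<lambda>p. indicator {0..} (fst p) * ennreal (exp (- q * fst p)) *
      (f (x + S (max 0 (fst p)) (snd p)) * indicator {p. alive x (fst p) (snd p)} p)) \<in> borel_measurable (borel \<Otimes>\<^sub>M M)"
    by measurable
  also have "(\<lambda>p. indicator {0..} (fst p) * ennreal (exp (- q * fst p)) *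
      (f (x + S (max 0 (fst p)) (snd p)) * indicator {p. alive x (fst p) (snd p)} p)) = (\<lambda>(t, \<omega>). indicator {0..} t * ennreal (exp (- q * t)) *
      (f (x + S t \<omega>) * indicator {\<omega>. alive x t \<omega>} \<omega>))"
    by (auto simp: fun_eq_iff indicator_def)
  finally show ?thesis by (simp add: measurable_lborel1 cong: measurable_cong_sets)
qed

text \<open>Let \<open>D\<close> be the set of dyadic times at which the path is negative. If
  \<open>t < Inf D\<close>, then the grid points up to \<open>mesh_up n t\<close> eventually stay
  below \<open>Inf D\<close>. If \<open>t > Inf D\<close>, some point of \<open>D\<close> lies
  before \<open>t\<close> and belongs to every finer grid. Only \<open>t = Inf D\<close> is
  undecided, and one point is a null set.\<close>

lemma skel_alive_tendsto:
  assumes \<omega>: "\<omega> \<in> space M"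
  shows "AE t in lborel. 0 \<le> t \<longrightarrow>
    eventually (\<lambda>n. skel_alive x (mesh n) (Suc (nat \<lfloor>t / mesh n\<rfloor>)) \<omega> \<longleftrightarrow> alive x t \<omega>) sequentially"
proof -
  define D where "D = {s. \<exists>n k. s = real k * mesh n \<and> x + S s \<omega> < 0}"
  have D0: "s \<in> D \<Longrightarrow> 0 \<le> s" for s by (auto simp: D_def less_imp_le)
  then have bdd: "bdd_below D" by (meson bdd_below.I)
  have "eventually (\<lambda>n. skel_alive x (mesh n) (Suc (nat \<lfloor>t / mesh n\<rfloor>)) \<omega> \<longleftrightarrow> alive x t \<omega>) sequentially"
    if t: "0 \<le> t" "D \<noteq> {} \<longrightarrow> t \<noteq> Inf D" for t
  proof (cases "D = {}")
    case True
    then have "0 \<le> x + S (real k * mesh n) \<omega>" for k n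
      by (force simp: D_def not_less)
    then show ?thesis
      by (simp add: skel_alive_def alive_def)
  next
    case D: False
    show ?thesis
    proof (cases "t < Inf D")
      case True
      have al: "0 \<le> x + S (real k * mesh n) \<omega>" if "real k * mesh n < Inf D" for k n
        using that cInf_lower[OF _ bdd] by (force simp: D_def not_less[symmetric])
      have "eventually (\<lambda>n. mesh_up n t < Inf D) sequentially"
        using order_tendstoD(2)[OF mesh_up_tendsto True] t by simp
      then show ?thesis
      proof eventually_elim
        case (elim n)
        have "real k * mesh n < Inf D" if "k \<le> Suc (nat \<lfloor>t / mesh n\<rfloor>)" for k
        proof -
          have "real k * mesh n \<le> real (Suc (nat \<lfloor>t / mesh n\<rfloor>)) * mesh n"
            using that by (intro mult_right_mono) (auto simp: less_imp_le)
          then show ?thesis using elim unfolding mesh_up_def by (rule le_less_trans)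
        qed
        then show ?case using al True by (auto simp: skel_alive_def alive_def)
      qed
    next
      case False
      then have "Inf D < t" using t D by auto
      then obtain s where s: "s \<in> D" "s < t" using cInf_lessD[OF D] by blast
      then obtain m k where mk: "s = real k * mesh m" "x + S s \<omega> < 0" by (auto simp: D_def)
      have "\<not> alive x t \<omega>" using mk s by (force simp: alive_def not_le)
      moreover have "\<not> skel_alive x (mesh n) (Suc (nat \<lfloor>t / mesh n\<rfloor>)) \<omega>" if n: "m \<le> n" for n
      proof -
        have eq: "s = real (k * 2 ^ (n - m)) * mesh n" using mk mesh_refine[OF n] by simp
        have "real (k * 2 ^ (n - m)) * mesh n < real (Suc (nat \<lfloor>t / mesh n\<rfloor>)) * mesh n"
          using less_trans[OF s(2) mesh_up_bounds(1)[OF t(1), of n]] unfolding eq mesh_up_def .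
        then have "k * 2 ^ (n - m) \<le> Suc (nat \<lfloor>t / mesh n\<rfloor>)"
          by (subst (asm) mult_less_cancel_right_pos) (auto simp del: of_nat_mult of_nat_Suc)
        then show ?thesis using mk eq by (force simp: skel_alive_def not_le)
      qed
      ultimately show ?thesis by (auto simp: eventually_sequentially)
    qed
  qed
  moreover have "AE t in lborel. t \<noteq> Inf D"
    by (rule AE_lborel_singleton)
  ultimately show ?thesis by auto
qed

text \<open>The test functions may vary with the grid, provided they converge continuously
  (\<open>conv\<close>). This serves both the Laplace transform of the potential, with a constant
  sequence, and the passage from one-step ruin probabilities to the claim rate. The factor
  \<open>exp (- q * t)\<close> is the integrable majorant, hence \<open>0 < q\<close>.\<close>

lemma skel_sum_tendsto:
  fixes G :: "real \<Rightarrow> real" and Gn :: "nat \<Rightarrow> real \<Rightarrow> real"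
  assumes q: "0 < q" and G[measurable]: "G \<in> borel_measurable borel" and Gn[measurable]: "\<And>n. Gn n \<in> borel_measurable borel"
    and Gn_nonneg: "\<And>n z. 0 \<le> Gn n z" and Gn_le: "\<And>n z. Gn n z \<le> C"
    and conv: "\<And>z zn. zn \<longlonglongrightarrow> z \<Longrightarrow> (\<lambda>n. Gn n (zn n)) \<longlonglongrightarrow> G z"
  shows "(\<lambda>n. ennreal (mesh n) * (\<Sum>i. ennreal (exp (- (mesh n * q))) ^ Suc i * skel_expect (mesh n) (Suc i) (\<lambda>z. ennreal (Gn n z)) x))
    \<longlonglongrightarrow> potential q (\<lambda>z. ennreal (G z)) x"
proof -
  have C: "0 \<le> C" using Gn_nonneg Gn_le by (meson order_trans)
  define Z where "Z n t \<omega> = indicator {0..} t * (ennreal (exp (- q * mesh_up n t)) * (ennreal (Gn n (x + S (mesh_up n t) \<omega>)) *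
     indicator {\<omega>. skel_alive x (mesh n) (Suc (nat \<lfloor>t / mesh n\<rfloor>)) \<omega>} \<omega>))" for n t \<omega>
  define Z' where "Z' t \<omega> = indicator {0..} t * ennreal (exp (- q * t)) *
      (ennreal (G (x + S t \<omega>)) * indicator {\<omega>. alive x t \<omega>} \<omega>)" for t \<omega>
  have term_m[measurable]: "(\<lambda>\<omega>. ennreal (Gn n (x + S (real i * mesh n) \<omega>)) * indicator {\<omega>. skel_alive x (mesh n) i \<omega>} \<omega>) \<in> borel_measurable M" for n i
    unfolding skel_alive_def by measurable
  have Z_m: "(\<lambda>p. Z n (fst p) (snd p)) \<in> borel_measurable (lborel \<Otimes>\<^sub>M M)" for n
  proof -
    have "(\<lambda>p. (\<lambda>i p. (ennreal (exp (- q * (real (Suc i) * mesh n))) * (ennreal (Gn n (x + S (real (Suc i) * mesh n) (snd p))) *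
     indicator {\<omega>. skel_alive x (mesh n) (Suc i) \<omega>} (snd p)))) (nat \<lfloor>fst p / mesh n\<rfloor>) p) \<in> borel_measurable (lborel \<Otimes>\<^sub>M M)"
      by (rule measurable_compose_countable) measurable
    then show ?thesis unfolding Z_def mesh_up_def by measurable
  qed
  have Z'_m: "(\<lambda>(t, \<omega>). Z' t \<omega>) \<in> borel_measurable (lborel \<Otimes>\<^sub>M M)"
    unfolding Z'_def by (rule measurable_potential_integrand) measurable
  have Z_le: "Z n t \<omega> \<le> indicator {0..} t * ennreal (exp (- q * t)) * ennreal C" for n t \<omega>
  proof (cases "0 \<le> t")
    case True
    have "exp (- q * mesh_up n t) \<le> exp (- q * t)" using mesh_up_bounds(1)[OF True, of n] q by simp
    then have "ennreal (exp (- q * mesh_up n t)) * (ennreal (Gn n (x + S (mesh_up n t) \<omega>)) *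
     indicator {\<omega>. skel_alive x (mesh n) (Suc (nat \<lfloor>t / mesh n\<rfloor>)) \<omega>} \<omega>) \<le> ennreal (exp (- q * t)) * (ennreal C * 1)"
      by (intro mult_mono ennreal_leI Gn_le) (auto simp: indicator_def)
    then show ?thesis using True by (simp add: Z_def)
  qed (simp add: Z_def)
  have bound: "(\<integral>\<^sup>+t. indicator {0..} t * ennreal (exp (- q * t)) * ennreal C \<partial>lborel) = ennreal (C / q)"
    using nn_integral_exp_decay[OF q] C q by (simp add: nn_integral_multc ennreal_mult[symmetric])
  have inner: "(\<lambda>n. \<integral>\<^sup>+t. Z n t \<omega> \<partial>lborel) \<longlonglongrightarrow> (\<integral>\<^sup>+t. Z' t \<omega> \<partial>lborel)" if \<omega>: "\<omega> \<in> space M" for \<omega>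
  proof (rule nn_integral_dominated_convergence[where w="\<lambda>t. indicator {0..} t * ennreal (exp (- q * t)) * ennreal C"])
    show "(\<lambda>t. Z n t \<omega>) \<in> borel_measurable lborel" for n
      using measurable_compose[OF measurable_Pair2'[OF \<omega>] Z_m] by simp
    show "(\<lambda>t. Z' t \<omega>) \<in> borel_measurable lborel"
      using measurable_compose[OF measurable_Pair2'[OF \<omega>] Z'_m] by simp
    show "AE t in lborel. (\<lambda>n. Z n t \<omega>) \<longlonglongrightarrow> Z' t \<omega>"
      using skel_alive_tendsto[OF \<omega>, of x]
    proof eventually_elim
      case (elim t)
      show ?case
      proof (cases "0 \<le> t")
        case t: True
        have a: "(\<lambda>n. ennreal (exp (- q * mesh_up n t))) \<longlonglongrightarrow> ennreal (exp (- q * t))"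
          using mesh_up_tendsto[OF t] by (intro tendsto_intros tendsto_ennrealI)
        have b: "(\<lambda>n. ennreal (Gn n (x + S (mesh_up n t) \<omega>))) \<longlonglongrightarrow> ennreal (G (x + S t \<omega>))"
          by (intro tendsto_ennrealI conv tendsto_intros S_mesh_up_tendsto \<omega> t)
        have "(\<lambda>n. ennreal (exp (- q * mesh_up n t)) * (ennreal (Gn n (x + S (mesh_up n t) \<omega>)) * indicator {\<omega>. alive x t \<omega>} \<omega>))
          \<longlonglongrightarrow> ennreal (exp (- q * t)) * (ennreal (G (x + S t \<omega>)) * indicator {\<omega>. alive x t \<omega>} \<omega>)"
          by (intro tendsto_mult_ennreal a b tendsto_const) (auto simp: indicator_def)
        then have "(\<lambda>n. Z n t \<omega>) \<longlonglongrightarrow> ennreal (exp (- q * t)) * (ennreal (G (x + S t \<omega>)) * indicator {\<omega>. alive x t \<omega>} \<omega>)"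
          by (rule Lim_transform_eventually)
             (use elim t in \<open>auto elim!: eventually_mono simp: Z_def indicator_def\<close>)
        then show ?thesis using t by (simp add: Z'_def)
      qed (simp add: Z_def Z'_def)
    qed
  qed (use Z_le bound in auto)
  have "(\<lambda>n. \<integral>\<^sup>+\<omega>. \<integral>\<^sup>+t. Z n t \<omega> \<partial>lborel \<partial>M) \<longlonglongrightarrow> (\<integral>\<^sup>+\<omega>. \<integral>\<^sup>+t. Z' t \<omega> \<partial>lborel \<partial>M)"
  proof (rule nn_integral_dominated_convergence[where w="\<lambda>_. ennreal (C / q)"])
    show "(\<lambda>\<omega>. \<integral>\<^sup>+t. Z n t \<omega> \<partial>lborel) \<in> borel_measurable M" for n
      by (rule lborel.borel_measurable_nn_integral)
         (use measurable_compose[OF measurable_pair_swap' Z_m[of n]] in \<open>simp add: case_prod_beta'\<close>)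
    show "(\<lambda>\<omega>. \<integral>\<^sup>+t. Z' t \<omega> \<partial>lborel) \<in> borel_measurable M"
      by (rule lborel.borel_measurable_nn_integral)
         (use measurable_compose[OF measurable_pair_swap' Z'_m] in \<open>simp add: case_prod_beta'\<close>)
    show "AE \<omega> in M. (\<integral>\<^sup>+t. Z n t \<omega> \<partial>lborel) \<le> ennreal (C / q)" for n
      unfolding bound[symmetric] by (intro AE_I2 nn_integral_mono Z_le)
    show "AE \<omega> in M. (\<lambda>n. \<integral>\<^sup>+t. Z n t \<omega> \<partial>lborel) \<longlonglongrightarrow> (\<integral>\<^sup>+t. Z' t \<omega> \<partial>lborel)"
      by (intro AE_I2 inner)
  qed (auto simp: emeasure_space_1)
  moreover have "(\<integral>\<^sup>+\<omega>. \<integral>\<^sup>+t. Z n t \<omega> \<partial>lborel \<partial>M) = ennreal (mesh n) * (\<Sum>i. ennreal (exp (- (mesh n * q))) ^ Suc i * skel_expect (mesh n) (Suc i) (\<lambda>z. ennreal (Gn n z)) x)" for n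
  proof -
    have "(\<integral>\<^sup>+t. Z n t \<omega> \<partial>lborel) = (\<Sum>i. ennreal (mesh n) * (ennreal (exp (- q * (real (Suc i) * mesh n))) * (ennreal (Gn n (x + S (real (Suc i) * mesh n) \<omega>)) *
     indicator {\<omega>. skel_alive x (mesh n) (Suc i) \<omega>} \<omega>)))" for \<omega>
      unfolding Z_def mesh_up_def by (subst nn_integral_floor[symmetric]) auto
    then have "(\<integral>\<^sup>+\<omega>. \<integral>\<^sup>+t. Z n t \<omega> \<partial>lborel \<partial>M) = (\<integral>\<^sup>+\<omega>. (\<Sum>i. ennreal (mesh n) * (ennreal (exp (- q * (real (Suc i) * mesh n))) * (ennreal (Gn n (x + S (real (Suc i) * mesh n) \<omega>)) *
     indicator {\<omega>. skel_alive x (mesh n) (Suc i) \<omega>} \<omega>))) \<partial>M)"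
      by simp
    also have "\<dots> = (\<Sum>i. \<integral>\<^sup>+\<omega>. ennreal (mesh n) * (ennreal (exp (- q * (real (Suc i) * mesh n))) * (ennreal (Gn n (x + S (real (Suc i) * mesh n) \<omega>)) *
     indicator {\<omega>. skel_alive x (mesh n) (Suc i) \<omega>} \<omega>)) \<partial>M)"
      by (rule nn_integral_suminf) measurable
    also have "\<dots> = (\<Sum>i. ennreal (mesh n) * (ennreal (exp (- (mesh n * q))) ^ Suc i * skel_expect (mesh n) (Suc i) (\<lambda>z. ennreal (Gn n z)) x))"
    proof (rule suminf_cong)
      fix i
      have "ennreal (exp (- q * (real (Suc i) * mesh n))) = ennreal (exp (- (mesh n * q))) ^ Suc i"
        by (simp only: ennreal_power exp_ge_zero exp_of_nat_mult[symmetric]) (simp add: algebra_simps)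
      then have "ennreal (exp (- q * (real (Suc i) * mesh n))) * y = ennreal (exp (- (mesh n * q))) ^ Suc i * y" for y
        by simp
      moreover note term_m[of n "Suc i", measurable]
      ultimately show "(\<integral>\<^sup>+\<omega>. ennreal (mesh n) * (ennreal (exp (- q * (real (Suc i) * mesh n))) * (ennreal (Gn n (x + S (real (Suc i) * mesh n) \<omega>)) *
     indicator {\<omega>. skel_alive x (mesh n) (Suc i) \<omega>} \<omega>)) \<partial>M) = ennreal (mesh n) * (ennreal (exp (- (mesh n * q))) ^ Suc i * skel_expect (mesh n) (Suc i) (\<lambda>z. ennreal (Gn n z)) x)"
        unfolding skel_expect_def
        by (subst nn_integral_cmult, intro borel_measurable_times_ennreal term_m borel_measurable_const)
           (subst nn_integral_cmult, rule term_m, simp)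
    qed
    also have "\<dots> = ennreal (mesh n) * (\<Sum>i. ennreal (exp (- (mesh n * q))) ^ Suc i * skel_expect (mesh n) (Suc i) (\<lambda>z. ennreal (Gn n z)) x)"
      by (rule ennreal_suminf_cmult)
    finally show ?thesis .
  qed
  ultimately show ?thesis by (simp add: potential_def Z'_def)
qed

lemma measurable_potential_inner:
  assumes f: "f \<in> borel_measurable borel"
  shows "(\<lambda>\<omega>. \<integral>\<^sup>+t. indicator {0..} t * ennreal (exp (- q * t)) *
      (f (x + S t \<omega>) * indicator {\<omega>. alive x t \<omega>} \<omega>) \<partial>lborel) \<in> borel_measurable M"
    and "\<omega> \<in> space M \<Longrightarrow> (\<lambda>t. indicator {0..} t * ennreal (exp (- q * t)) *
      (f (x + S t \<omega>) * indicator {\<omega>. alive x t \<omega>} \<omega>)) \<in> borel_measurable lborel"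
  using lborel.borel_measurable_nn_integral[of "\<lambda>\<omega> t. indicator {0..} t * ennreal (exp (- q * t)) *
      (f (x + S t \<omega>) * indicator {\<omega>. alive x t \<omega>} \<omega>)" M]
    measurable_compose[OF measurable_pair_swap' measurable_potential_integrand[OF f, of q x]]
    measurable_compose[OF measurable_Pair2'[of \<omega> M lborel] measurable_potential_integrand[OF f, of q x]]
  by (auto simp: case_prod_beta')

text \<open>Two monotone convergences, in time and on the probability space. Level and test function
  may move together, so the same lemma serves to lower the level to its limit and to remove
  truncations.\<close>

lemma potential_tendsto:
  assumes fm[measurable]: "\<And>k. f k \<in> borel_measurable borel" and gm[measurable]: "g \<in> borel_measurable borel"
    and mono: "\<And>s z. 0 \<le> s \<Longrightarrow> incseq (\<lambda>k. ennreal (exp (- q k * s)) * f k z)"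
    and lim: "\<And>s z. 0 \<le> s \<Longrightarrow> (\<lambda>k. ennreal (exp (- q k * s)) * f k z) \<longlonglongrightarrow> ennreal (exp (- p * s)) * g z"
  shows "(\<lambda>k. potential (q k) (f k) x) \<longlonglongrightarrow> potential p g x" "incseq (\<lambda>k. potential (q k) (f k) x)"
proof -
  define Z where "Z k t \<omega> = indicator {0..} t * ennreal (exp (- q k * t)) *
      (f k (x + S t \<omega>) * indicator {\<omega>. alive x t \<omega>} \<omega>)" for k t \<omega>
  have Zm: "Z k t \<omega> \<le> Z l t \<omega>" if "k \<le> l" for k l t \<omega>
    using incseqD[OF mono that, of t "x + S t \<omega>"] by (auto simp: Z_def indicator_def)
  have inc: "incseq (\<lambda>k \<omega>. \<integral>\<^sup>+t. Z k t \<omega> \<partial>lborel)"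
    by (auto simp: incseq_def le_fun_def intro!: nn_integral_mono Zm)
  show "incseq (\<lambda>k. potential (q k) (f k) x)"
    unfolding potential_def Z_def[symmetric]
    by (auto simp: incseq_def le_fun_def intro!: nn_integral_mono Zm)
  define Z' where "Z' t \<omega> = indicator {0..} t * ennreal (exp (- p * t)) *
      (g (x + S t \<omega>) * indicator {\<omega>. alive x t \<omega>} \<omega>)" for t \<omega>
  have inner: "(\<lambda>k. \<integral>\<^sup>+t. Z k t \<omega> \<partial>lborel) \<longlonglongrightarrow> (\<integral>\<^sup>+t. Z' t \<omega> \<partial>lborel)" if \<omega>: "\<omega> \<in> space M" for \<omega>
  proof (rule nn_integral_LIMSEQ)
    show "(\<lambda>k. Z k t \<omega>) \<longlonglongrightarrow> Z' t \<omega>" for t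
      using lim[of t "x + S t \<omega>"] by (cases "0 \<le> t") (auto simp: Z_def Z'_def indicator_def)
    show "(\<lambda>t. Z k t \<omega>) \<in> borel_measurable lborel" for k
      unfolding Z_def by (rule measurable_potential_inner) fact+
  qed (auto simp: incseq_def le_fun_def Zm)
  have "(\<lambda>k. \<integral>\<^sup>+\<omega>. (\<integral>\<^sup>+t. Z k t \<omega> \<partial>lborel) * indicator (space M) \<omega> \<partial>M) \<longlonglongrightarrow> (\<integral>\<^sup>+\<omega>. (\<integral>\<^sup>+t. Z' t \<omega> \<partial>lborel) * indicator (space M) \<omega> \<partial>M)"
  proof (rule nn_integral_LIMSEQ)
    show "incseq (\<lambda>k \<omega>. (\<integral>\<^sup>+t. Z k t \<omega> \<partial>lborel) * indicator (space M) \<omega>)"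
      using inc by (auto simp: incseq_def le_fun_def indicator_def)
    show "(\<lambda>\<omega>. (\<integral>\<^sup>+t. Z k t \<omega> \<partial>lborel) * indicator (space M) \<omega>) \<in> borel_measurable M" for k
      unfolding Z_def using measurable_potential_inner(1)[OF fm] by measurable
    show "(\<lambda>k. (\<integral>\<^sup>+t. Z k t \<omega> \<partial>lborel) * indicator (space M) \<omega>) \<longlonglongrightarrow> (\<integral>\<^sup>+t. Z' t \<omega> \<partial>lborel) * indicator (space M) \<omega>" for \<omega>
      using inner[of \<omega>] by (cases "\<omega> \<in> space M") auto
  qed
  then show "(\<lambda>k. potential (q k) (f k) x) \<longlonglongrightarrow> potential p g x"
    unfolding potential_def Z_def[symmetric] Z'_def[symmetric] by (simp cong: nn_integral_cong_simp)
qed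

lemma measurable_potential[measurable]:
  assumes [measurable]: "f \<in> borel_measurable borel"
  shows "potential q f \<in> borel_measurable borel"
proof -
  have [measurable]: "(\<lambda>p. S (max 0 (snd (snd p))) (fst (snd p))) \<in> borel_measurable (borel \<Otimes>\<^sub>M (M \<Otimes>\<^sub>M borel))"
    using measurable_compose[OF _ measurable_S_joint, of "\<lambda>p. (snd (snd p), fst (snd p))" "borel \<Otimes>\<^sub>M (M \<Otimes>\<^sub>M borel)"]
    by simp
  have [measurable]: "Measurable.pred (borel \<Otimes>\<^sub>M (M \<Otimes>\<^sub>M borel)) (\<lambda>p. alive (fst p) (snd (snd p)) (fst (snd p)))"
    unfolding alive_def by measurable
  have "(\<lambda>p. indicator {0..} (snd (snd p)) * ennreal (exp (- q * snd (snd p))) *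
      (f (fst p + S (max 0 (snd (snd p))) (fst (snd p))) * indicator {p. alive (fst p) (snd (snd p)) (fst (snd p))} p)) \<in> borel_measurable (borel \<Otimes>\<^sub>M (M \<Otimes>\<^sub>M borel))"
    by measurable
  also have "(\<lambda>p. indicator {0..} (snd (snd p)) * ennreal (exp (- q * snd (snd p))) *
      (f (fst p + S (max 0 (snd (snd p))) (fst (snd p))) * indicator {p. alive (fst p) (snd (snd p)) (fst (snd p))} p))
     = (\<lambda>(x, \<omega>, t). indicator {0..} t * ennreal (exp (- q * t)) *
      (f (x + S t \<omega>) * indicator {\<omega>. alive x t \<omega>} \<omega>))"
    by (auto simp: fun_eq_iff indicator_def)
  finally have *: "(\<lambda>(x, \<omega>, t). indicator {0..} t * ennreal (exp (- q * t)) *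
      (f (x + S t \<omega>) * indicator {\<omega>. alive x t \<omega>} \<omega>)) \<in> borel_measurable (borel \<Otimes>\<^sub>M (M \<Otimes>\<^sub>M borel))" .
  have "(\<lambda>((x, \<omega>), t). indicator {0..} t * ennreal (exp (- q * t)) *
      (f (x + S t \<omega>) * indicator {\<omega>. alive x t \<omega>} \<omega>)) \<in> borel_measurable ((borel \<Otimes>\<^sub>M M) \<Otimes>\<^sub>M lborel)"
    using measurable_compose[OF _ *, of "\<lambda>p. (fst (fst p), snd (fst p), snd p)" "(borel \<Otimes>\<^sub>M M) \<Otimes>\<^sub>M lborel"]
    by (simp add: case_prod_beta')
  from lborel.borel_measurable_nn_integral_fst[OF this]
  have "(\<lambda>(x, \<omega>). \<integral>\<^sup>+t. indicator {0..} t * ennreal (exp (- q * t)) *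
      (f (x + S t \<omega>) * indicator {\<omega>. alive x t \<omega>} \<omega>) \<partial>lborel) \<in> borel_measurable (borel \<Otimes>\<^sub>M M)"
    by (simp add: case_prod_beta')
  then show ?thesis
    unfolding potential_def by (rule borel_measurable_nn_integral)
qed

section \<open>Laplace transform of the potential in the initial capital\<close>

lemma skel_expect_le:
  assumes "\<And>z. f z \<le> C" shows "skel_expect h i f x \<le> C"
proof -
  have "skel_expect h i f x \<le> (\<integral>\<^sup>+\<omega>. C \<partial>M)"
    unfolding skel_expect_def using assms by (intro nn_integral_mono) (auto simp: indicator_def)
  then show ?thesis by (simp add: emeasure_space_1)
qed

lemma skel_sum_le:
  assumes q: "0 < q" and h: "0 < h" "h \<le> 1" and C: "0 \<le> C" and le: "\<And>i. a i \<le> ennreal C"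
  shows "ennreal h * (\<Sum>i. ennreal (exp (- (h * q))) ^ Suc i * a i) \<le> ennreal (C * (1 / q + 1))"
proof -
  let ?r = "exp (- (h * q))"
  have r: "0 < ?r" "?r < 1" using h q by auto
  have "ennreal h * (\<Sum>i. ennreal ?r ^ Suc i * a i) \<le> ennreal h * (\<Sum>i. ennreal (C * ?r ^ i))"
  proof (intro mult_left_mono suminf_le)
    fix i
    have "ennreal ?r ^ Suc i * a i \<le> ennreal ?r ^ i * ennreal C"
      using r by (intro mult_mono le) (auto simp: ennreal_power simp flip: ennreal_mult intro!: ennreal_leI mult_left_le_one_le)
    then show "ennreal ?r ^ Suc i * a i \<le> ennreal (C * ?r ^ i)"
      using C by (simp add: ennreal_mult ennreal_power mult.commute del: power_Suc)
  qed auto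
  also have "(\<Sum>i. ennreal (C * ?r ^ i)) = ennreal (C / (1 - ?r))"
    using r C by (intro suminf_ennreal_eq) (auto intro!: geometric_sums[THEN sums_mult, of ?r C, simplified])
  also have "ennreal h * \<dots> = ennreal (C * (h / (1 - ?r)))"
    using h r C by (simp add: ennreal_mult[symmetric])
  also have "\<dots> \<le> ennreal (C * (1 / q + 1))"
    using mesh_bound[OF q h(1)] h C by (intro ennreal_leI mult_left_mono) auto
  finally show ?thesis .
qed

text \<open>Both sides are limits of one sequence \<open>?I\<close>. Refining the grid for fixed
  \<open>x\<close> gives the potential; moving the killed steps onto the adjoint first and then
  refining for fixed \<open>y\<close> gives the explicit kernel. In \<open>y\<close> the majorant of
  the weighted resolvent is merely a constant, so \<open>g\<close> must vanish beyond
  \<open>R\<close>.\<close>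

lemma potential_transform_compact:
  fixes g :: "real \<Rightarrow> real"
  assumes t: "0 < t" "t < b" and g: "continuous_on UNIV g" "\<And>z. 0 \<le> g z" "\<And>z. g z \<le> C" "\<And>z. R < z \<Longrightarrow> g z = 0"
  shows "(\<integral>\<^sup>+x. ennreal (exp (- b * x)) * indicator {0..} x * potential (phi t) (\<lambda>z. ennreal (g z)) x \<partial>lborel) =
    (\<integral>\<^sup>+y. indicator {0..} y * ennreal (g y * ((exp (- t * y) - exp (- b * y)) / (phi b - phi t))) \<partial>lborel)"
proof (rule LIMSEQ_unique)
  have q: "0 < phi t" using phi_pos t by simp
  have gm[measurable]: "g \<in> borel_measurable borel" using g(1) by (rule borel_measurable_continuous_onI)
  have C: "0 \<le> C" using g(2,3) order_trans by blast
  have [measurable]: "(killed_step (F (mesh n)) ^^ i) (\<lambda>z. ennreal (g z)) \<in> borel_measurable borel"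
    "dual_iter b (F (mesh n)) i \<in> borel_measurable borel" for n i
    by (intro step_law.measurable_killed_iter step_law.measurable_dual_iter step_law; simp)+
  let ?A = "\<lambda>n x. ennreal (mesh n) * (\<Sum>i. ennreal (exp (- (mesh n * phi t))) ^ Suc i * (killed_step (F (mesh n)) ^^ Suc i) (\<lambda>z. ennreal (g z)) x)"
  let ?I = "\<lambda>n. \<integral>\<^sup>+x. ennreal (exp (- b * x)) * indicator {0..} x * ?A n x \<partial>lborel"
  have A_le: "?A n x \<le> ennreal (C * (1 / phi t + 1))" if "0 \<le> x" for n x
  proof (rule skel_sum_le[OF q _ mesh_le_1 C])
    show "(killed_step (F (mesh n)) ^^ Suc i) (\<lambda>z. ennreal (g z)) x \<le> ennreal C" for i
      by (subst skel_expect_eq[symmetric]) (auto intro!: skel_expect_le ennreal_leI g that)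
  qed simp
  show "?I \<longlonglongrightarrow> (\<integral>\<^sup>+x. ennreal (exp (- b * x)) * indicator {0..} x * potential (phi t) (\<lambda>z. ennreal (g z)) x \<partial>lborel)"
  proof (rule nn_integral_dominated_convergence[where w="\<lambda>x. indicator {0..} x * ennreal (exp (- b * x)) * ennreal (C * (1 / phi t + 1))"])
    show "AE x in lborel. ennreal (exp (- b * x)) * indicator {0..} x * ?A n x \<le> indicator {0..} x * ennreal (exp (- b * x)) * ennreal (C * (1 / phi t + 1))" for n
      using A_le by (intro AE_I2) (auto simp: indicator_def intro!: mult_left_mono)
    show "(\<integral>\<^sup>+x. indicator {0..} x * ennreal (exp (- b * x)) * ennreal (C * (1 / phi t + 1)) \<partial>lborel) < \<infinity>"
      using nn_integral_exp_decay[of b] t by (subst nn_integral_multc) (auto simp: ennreal_mult_less_top)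
    show "AE x in lborel. (\<lambda>n. ennreal (exp (- b * x)) * indicator {0..} x * ?A n x) \<longlonglongrightarrow>
       ennreal (exp (- b * x)) * indicator {0..} x * potential (phi t) (\<lambda>z. ennreal (g z)) x"
    proof (rule AE_I2)
      fix x :: real
      show "(\<lambda>n. ennreal (exp (- b * x)) * indicator {0..} x * ?A n x) \<longlonglongrightarrow>
        ennreal (exp (- b * x)) * indicator {0..} x * potential (phi t) (\<lambda>z. ennreal (g z)) x"
      proof (cases "0 \<le> x")
        case True
        have "(\<lambda>n. ennreal (mesh n) * (\<Sum>i. ennreal (exp (- (mesh n * phi t))) ^ Suc i * skel_expect (mesh n) (Suc i) (\<lambda>z. ennreal (g z)) x))
            \<longlonglongrightarrow> potential (phi t) (\<lambda>z. ennreal (g z)) x"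
          by (rule skel_sum_tendsto[OF q gm gm g(2,3)])
             (use g(1) in \<open>auto simp: continuous_on_eq_continuous_at isCont_def intro: isCont_tendsto_compose\<close>)
        then have "(\<lambda>n. ?A n x) \<longlonglongrightarrow> potential (phi t) (\<lambda>z. ennreal (g z)) x"
          using True by (simp add: skel_expect_eq del: power_Suc funpow.simps)
        then show ?thesis
          using True by (intro tendsto_mult_ennreal tendsto_const) auto
      qed simp
    qed
  qed measurable
  have I_eq: "?I n = (\<integral>\<^sup>+y. ennreal (exp (- b * y)) * dual_resolvent b (phi t) (mesh n) y * ennreal (g y) \<partial>lborel)" for n
  proof -
    interpret F: step_law "F (mesh n)" by (rule step_law) simp
    let ?r = "ennreal (exp (- (mesh n * phi t)))" and ?g = "\<lambda>z. ennreal (g z)"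
    have "?I n = (\<integral>\<^sup>+x. (\<Sum>i. ennreal (mesh n) * (?r ^ Suc i * (ennreal (exp (- b * x)) * indicator {0..} x * (killed_step (F (mesh n)) ^^ Suc i) ?g x))) \<partial>lborel)"
      by (simp add: ennreal_suminf_cmult[symmetric] ac_simps del: power_Suc funpow.simps ennreal_suminf_cmult)
    also have "\<dots> = (\<Sum>i. \<integral>\<^sup>+x. ennreal (mesh n) * (?r ^ Suc i * (ennreal (exp (- b * x)) * indicator {0..} x * (killed_step (F (mesh n)) ^^ Suc i) ?g x)) \<partial>lborel)"
      by (rule nn_integral_suminf) measurable
    also have "\<dots> = (\<Sum>i. ennreal (mesh n) * (?r ^ Suc i * (\<integral>\<^sup>+x. ennreal (exp (- b * x)) * indicator {0..} x * (killed_step (F (mesh n)) ^^ Suc i) ?g x \<partial>lborel)))"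
      by (subst nn_integral_cmult, measurable, subst nn_integral_cmult, measurable)
    also have "\<dots> = (\<Sum>i. ennreal (mesh n) * (?r ^ Suc i * (\<integral>\<^sup>+y. ennreal (exp (- b * y)) * dual_iter b (F (mesh n)) (Suc i) y * ?g y \<partial>lborel)))"
      by (subst F.killed_iter_dual) auto
    also have "\<dots> = (\<Sum>i. \<integral>\<^sup>+y. ennreal (mesh n) * (?r ^ Suc i * (ennreal (exp (- b * y)) * dual_iter b (F (mesh n)) (Suc i) y * ?g y)) \<partial>lborel)"
      by (subst nn_integral_cmult, measurable, subst nn_integral_cmult, measurable)
    also have "\<dots> = (\<integral>\<^sup>+y. (\<Sum>i. ennreal (mesh n) * (?r ^ Suc i * (ennreal (exp (- b * y)) * dual_iter b (F (mesh n)) (Suc i) y * ?g y))) \<partial>lborel)"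
      by (rule nn_integral_suminf[symmetric]) measurable
    also have "\<dots> = (\<integral>\<^sup>+y. ennreal (exp (- b * y)) * dual_resolvent b (phi t) (mesh n) y * ?g y \<partial>lborel)"
    proof (rule nn_integral_cong)
      fix y
      have "(\<Sum>i. ennreal (mesh n) * (?r ^ Suc i * (ennreal (exp (- b * y)) * dual_iter b (F (mesh n)) (Suc i) y * ?g y)))
        = (\<Sum>i. (ennreal (exp (- b * y)) * ?g y * ennreal (mesh n)) * (?r ^ Suc i * dual_iter b (F (mesh n)) (Suc i) y))"
        by (simp only: ac_simps)
      also have "\<dots> = (ennreal (exp (- b * y)) * ?g y * ennreal (mesh n)) * (\<Sum>i. ?r ^ Suc i * dual_iter b (F (mesh n)) (Suc i) y)"
        by (rule ennreal_suminf_cmult)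
      finally show "(\<Sum>i. ennreal (mesh n) * (?r ^ Suc i * (ennreal (exp (- b * y)) * dual_iter b (F (mesh n)) (Suc i) y * ?g y)))
        = ennreal (exp (- b * y)) * dual_resolvent b (phi t) (mesh n) y * ?g y"
        by (simp only: dual_resolvent_def ac_simps)
    qed
    finally show ?thesis .
  qed
  have neg: "dual_resolvent b (phi t) h y = 0" if "y < 0" for h y
    using that by (simp add: dual_resolvent_def dual_iter_Suc dual_step_def)
  show "?I \<longlonglongrightarrow> (\<integral>\<^sup>+y. indicator {0..} y * ennreal (g y * ((exp (- t * y) - exp (- b * y)) / (phi b - phi t))) \<partial>lborel)"
    unfolding I_eq
  proof (rule nn_integral_dominated_convergence[where w="\<lambda>y. ennreal (C * (1 / phi t + 1)) * indicator {0..R} y"])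
    show "(\<lambda>y. ennreal (exp (- b * y)) * dual_resolvent b (phi t) (mesh n) y * ennreal (g y)) \<in> borel_measurable lborel" for n
      unfolding dual_resolvent_def by measurable
    show "AE y in lborel. ennreal (exp (- b * y)) * dual_resolvent b (phi t) (mesh n) y * ennreal (g y) \<le> ennreal (C * (1 / phi t + 1)) * indicator {0..R} y" for n
    proof (rule AE_I2)
      fix y
      show "ennreal (exp (- b * y)) * dual_resolvent b (phi t) (mesh n) y * ennreal (g y) \<le> ennreal (C * (1 / phi t + 1)) * indicator {0..R} y"
      proof (cases "0 \<le> y \<and> y \<le> R")
        case True
        have "ennreal (exp (- b * y)) * dual_resolvent b (phi t) (mesh n) y * ennreal (g y) \<le>
          ennreal (exp (- b * y)) * ennreal (exp (b * y) * (1 / phi t + 1)) * ennreal C"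
          using t q by (intro mult_mono dual_resolvent_le ennreal_leI g mesh_le_1) auto
        also have "\<dots> = ennreal (C * (1 / phi t + 1))"
          using q C by (simp add: ennreal_mult[symmetric] exp_minus field_simps)
        finally show ?thesis using True by simp
      qed (use neg g(4)[of y] in \<open>auto simp: not_le\<close>)
    qed
    show "(\<integral>\<^sup>+y. ennreal (C * (1 / phi t + 1)) * indicator {0..R} y \<partial>lborel) < \<infinity>"
      by (subst nn_integral_cmult_indicator) (auto simp: ennreal_mult_less_top emeasure_lborel_Icc_eq)
    show "AE y in lborel. (\<lambda>n. ennreal (exp (- b * y)) * dual_resolvent b (phi t) (mesh n) y * ennreal (g y)) \<longlonglongrightarrow>
      indicator {0..} y * ennreal (g y * ((exp (- t * y) - exp (- b * y)) / (phi b - phi t)))"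
    proof (rule AE_I2)
      fix y :: real
      show "(\<lambda>n. ennreal (exp (- b * y)) * dual_resolvent b (phi t) (mesh n) y * ennreal (g y)) \<longlonglongrightarrow>
        indicator {0..} y * ennreal (g y * ((exp (- t * y) - exp (- b * y)) / (phi b - phi t)))"
      proof (cases "0 \<le> y")
        case y: True
        have "(\<lambda>n. dual_resolvent b (phi t) (mesh n) y) \<longlonglongrightarrow> ennreal ((exp ((b - t) * y) - 1) / (phi b - phi t))"
          using filterlim_compose[OF dual_resolvent_tendsto[OF t y] filterlim_mesh] .
        then have "(\<lambda>n. ennreal (exp (- b * y)) * dual_resolvent b (phi t) (mesh n) y * ennreal (g y)) \<longlonglongrightarrow>
          ennreal (exp (- b * y)) * ennreal ((exp ((b - t) * y) - 1) / (phi b - phi t)) * ennreal (g y)"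
          by (intro tendsto_mult_ennreal tendsto_const) (auto simp: ennreal_mult_eq_top_iff)
        also have "ennreal (exp (- b * y)) * ennreal ((exp ((b - t) * y) - 1) / (phi b - phi t)) * ennreal (g y)
          = ennreal (exp (- b * y) * ((exp ((b - t) * y) - 1) / (phi b - phi t)) * g y)"
        proof -
          define A where "A = (exp ((b - t) * y) - 1) / (phi b - phi t)"
          have "0 \<le> A" using phi_strict[of t b] t y by (simp add: A_def)
          then show ?thesis unfolding A_def[symmetric] using g(2) by (simp add: ennreal_mult)
        qed
        also have "exp (- b * y) * ((exp ((b - t) * y) - 1) / (phi b - phi t)) * g y = g y * ((exp (- t * y) - exp (- b * y)) / (phi b - phi t))"
          by (simp add: algebra_simps exp_diff exp_minus) (simp add: field_simps)
        finally show ?thesis using y by simp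
      qed (use neg in simp)
    qed
  qed measurable
qed

text \<open>What is gained is \<open>t = 0\<close>, that is, level 0. Levels
  \<open>phi (th n)\<close> decrease to \<open>phi t\<close>, so the discount factors increase and
  the potentials converge monotonically; the explicit side converges by domination on the bounded
  support.\<close>

lemma potential_transform_bounded:
  fixes g :: "real \<Rightarrow> real"
  assumes t: "0 \<le> t" "t < b" and g: "continuous_on UNIV g" "\<And>z. 0 \<le> g z" "\<And>z. g z \<le> C" "\<And>z. R < z \<Longrightarrow> g z = 0"
  shows "(\<integral>\<^sup>+x. ennreal (exp (- b * x)) * indicator {0..} x * potential (phi t) (\<lambda>z. ennreal (g z)) x \<partial>lborel) =
    (\<integral>\<^sup>+y. indicator {0..} y * ennreal (g y * ((exp (- t * y) - exp (- b * y)) / (phi b - phi t))) \<partial>lborel)"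
proof (rule LIMSEQ_unique)
  have gm[measurable]: "g \<in> borel_measurable borel" using g(1) by (rule borel_measurable_continuous_onI)
  have C: "0 \<le> C" using g(2,3) order_trans by blast
  \<comment> \<open>The denominator \<open>n + 2\<close> keeps \<open>th n\<close> strictly between
    \<open>t\<close> and \<open>b\<close> already for \<open>n = 0\<close>; so
    \<open>phi b - phi (th n)\<close> is bounded below by its value at \<open>n = 0\<close>.\<close>
  define th where "th n = t + (b - t) / real (Suc (Suc n))" for n
  have th: "t < th n" "th n < b" "0 < th n" "th n \<le> th 0" for n
  proof -
    show "t < th n" "0 < th n" using t by (auto simp: th_def intro: add_nonneg_pos)
    have "(b - t) / real (Suc (Suc n)) \<le> (b - t) / 2" using t by (intro divide_left_mono) auto
    moreover have "(b - t) / 2 < b - t" using t by simp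
    ultimately have "(b - t) / real (Suc (Suc n)) < b - t" by linarith
    then show "th n < b" unfolding th_def by linarith
    show "th n \<le> th 0" using \<open>_ \<le> (b - t) / 2\<close> unfolding th_def by simp
  qed
  have th_mono: "th l \<le> th k" if "k \<le> l" for k l
    using that t by (auto simp: th_def intro!: divide_left_mono)
  have th_lim: "th \<longlonglongrightarrow> t"
    unfolding th_def by real_asymp
  have phi_lim: "(\<lambda>n. phi (th n)) \<longlonglongrightarrow> phi t"
    by (rule continuous_on_tendsto_compose[OF phi_cont th_lim]) (use t th in \<open>auto simp: less_imp_le\<close>)
  let ?L = "\<lambda>n. \<integral>\<^sup>+x. ennreal (exp (- b * x)) * indicator {0..} x * potential (phi (th n)) (\<lambda>z. ennreal (g z)) x \<partial>lborel"
  have mono: "incseq (\<lambda>k. ennreal (exp (- phi (th k) * s)) * ennreal (g z))" if "0 \<le> s" for s z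
    using that th th_mono t phi_strict
    by (auto simp: incseq_def intro!: mult_right_mono ennreal_leI) (metis less_eq_real_def)
  have lim: "(\<lambda>k. ennreal (exp (- phi (th k) * s)) * ennreal (g z)) \<longlonglongrightarrow> ennreal (exp (- phi t * s)) * ennreal (g z)" for s z
    by (intro tendsto_mult_ennreal tendsto_ennrealI tendsto_intros phi_lim) auto
  have pot: "(\<lambda>k. potential (phi (th k)) (\<lambda>z. ennreal (g z)) x) \<longlonglongrightarrow> potential (phi t) (\<lambda>z. ennreal (g z)) x"
     "incseq (\<lambda>k. potential (phi (th k)) (\<lambda>z. ennreal (g z)) x)" for x
    by (rule potential_tendsto[OF _ _ mono lim]; measurable)+
  show "?L \<longlonglongrightarrow> (\<integral>\<^sup>+x. ennreal (exp (- b * x)) * indicator {0..} x * potential (phi t) (\<lambda>z. ennreal (g z)) x \<partial>lborel)"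
  proof (rule nn_integral_LIMSEQ)
    show "(\<lambda>i. ennreal (exp (- b * x)) * indicator {0..} x * potential (phi (th i)) (\<lambda>z. ennreal (g z)) x) \<longlonglongrightarrow>
         ennreal (exp (- b * x)) * indicator {0..} x * potential (phi t) (\<lambda>z. ennreal (g z)) x" for x
      by (cases "0 \<le> x", intro tendsto_mult_ennreal tendsto_const pot) auto
  qed (use pot(2) in \<open>auto simp: incseq_def le_fun_def intro!: mult_left_mono\<close>)
  have "?L n = (\<integral>\<^sup>+y. indicator {0..} y * ennreal (g y * ((exp (- th n * y) - exp (- b * y)) / (phi b - phi (th n)))) \<partial>lborel)" for n
    by (rule potential_transform_compact[OF th(3,2) g])
  moreover have "(\<lambda>n. \<integral>\<^sup>+y. indicator {0..} y * ennreal (g y * ((exp (- th n * y) - exp (- b * y)) / (phi b - phi (th n)))) \<partial>lborel)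
     \<longlonglongrightarrow> (\<integral>\<^sup>+y. indicator {0..} y * ennreal (g y * ((exp (- t * y) - exp (- b * y)) / (phi b - phi t))) \<partial>lborel)"
  proof (rule nn_integral_dominated_convergence[where w="\<lambda>y. ennreal (C * (1 / (phi b - phi (th 0)))) * indicator {0..R} y"])
    show "(\<integral>\<^sup>+y. ennreal (C * (1 / (phi b - phi (th 0)))) * indicator {0..R} y \<partial>lborel) < \<infinity>"
      by (subst nn_integral_cmult_indicator) (auto simp: ennreal_mult_less_top emeasure_lborel_Icc_eq)
    show "AE y in lborel. indicator {0..} y * ennreal (g y * ((exp (- th n * y) - exp (- b * y)) / (phi b - phi (th n))))
       \<le> ennreal (C * (1 / (phi b - phi (th 0)))) * indicator {0..R} y" for n
    proof (rule AE_I2)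
      fix y
      show "indicator {0..} y * ennreal (g y * ((exp (- th n * y) - exp (- b * y)) / (phi b - phi (th n))))
         \<le> ennreal (C * (1 / (phi b - phi (th 0)))) * indicator {0..R} y"
      proof (cases "0 \<le> y \<and> y \<le> R")
        case True
        have 1: "phi (th 0) < phi b" "phi (th n) \<le> phi (th 0)"
          using phi_strict[of "th 0" b] phi_strict[of "th n" "th 0"] th[of 0] th[of n] by (auto simp: less_eq_real_def)
        have "exp (- th n * y) \<le> 1" using th[of n] True by (simp add: mult_nonneg_nonneg less_imp_le)
        then have "exp (- th n * y) - exp (- b * y) \<le> 1" by (smt (verit) exp_gt_zero)
        moreover have "exp (- b * y) \<le> exp (- th n * y)" using th[of n] True by (auto intro!: mult_right_mono)
        ultimately have "g y * ((exp (- th n * y) - exp (- b * y)) / (phi b - phi (th n))) \<le> C * (1 / (phi b - phi (th 0)))"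
          using 1 C g by (intro mult_mono frac_le) auto
        then show ?thesis using True by (auto intro: ennreal_leI)
      qed (use g(4)[of y] in auto)
    qed
    show "AE y in lborel. (\<lambda>n. indicator {0..} y * ennreal (g y * ((exp (- th n * y) - exp (- b * y)) / (phi b - phi (th n)))))
       \<longlonglongrightarrow> indicator {0..} y * ennreal (g y * ((exp (- t * y) - exp (- b * y)) / (phi b - phi t)))"
      using phi_strict[of t b] t
      by (intro AE_I2 tendsto_mult_ennreal tendsto_const tendsto_ennrealI tendsto_intros phi_lim th_lim) (auto simp: indicator_def)
  qed measurable
  ultimately show "?L \<longlonglongrightarrow> (\<integral>\<^sup>+y. indicator {0..} y * ennreal (g y * ((exp (- t * y) - exp (- b * y)) / (phi b - phi t))) \<partial>lborel)"
    by simp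
qed

text \<open>Unbounded \<open>g\<close> is needed for the choice \<open>exp (th * z)\<close> later.
  The functions \<open>gk k\<close> cap \<open>g\<close> at height \<open>k\<close> and cut it off
  continuously before \<open>k\<close>; they increase, and at each point they eventually equal
  \<open>g\<close>.\<close>

lemma potential_transform:
  fixes g :: "real \<Rightarrow> real"
  assumes t: "0 \<le> t" "t < b" and g: "continuous_on UNIV g" "\<And>z. 0 \<le> g z"
  shows "(\<integral>\<^sup>+x. ennreal (exp (- b * x)) * indicator {0..} x * potential (phi t) (\<lambda>z. ennreal (g z)) x \<partial>lborel) =
    (\<integral>\<^sup>+y. indicator {0..} y * ennreal (g y * ((exp (- t * y) - exp (- b * y)) / (phi b - phi t))) \<partial>lborel)"
proof (rule LIMSEQ_unique)
  have gm[measurable]: "g \<in> borel_measurable borel" using g(1) by (rule borel_measurable_continuous_onI)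
  define gk where "gk k z = min (real k) (g z * max 0 (min 1 (real k - z)))" for k z
  have cont: "continuous_on UNIV (gk k)" for k
    unfolding gk_def[abs_def] using g(1) by (intro continuous_intros)
  then have gkm[measurable]: "gk k \<in> borel_measurable borel" for k by (rule borel_measurable_continuous_onI)
  have gk0: "0 \<le> gk k z" and gkle: "gk k z \<le> real k" and gkR: "real k < z \<Longrightarrow> gk k z = 0" for k z
    using g(2)[of z] by (auto simp: gk_def)
  have gk_mono: "gk k z \<le> gk l z" if "k \<le> l" for k l z
    unfolding gk_def using that g(2)[of z] by (intro min.mono mult_left_mono) auto
  have gk_lim: "(\<lambda>k. gk k z) \<longlonglongrightarrow> g z" for z
  proof (rule tendsto_eventually)
    have "eventually (\<lambda>k. real k \<ge> max (g z) (z + 1)) sequentially"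
      using filterlim_real_sequentially eventually_ge_at_top filterlim_at_top by blast
    then show "eventually (\<lambda>k. gk k z = g z) sequentially"
      by eventually_elim (auto simp: gk_def)
  qed
  let ?L = "\<lambda>n. \<integral>\<^sup>+x. ennreal (exp (- b * x)) * indicator {0..} x * potential (phi t) (\<lambda>z. ennreal (gk n z)) x \<partial>lborel"
  have mono: "incseq (\<lambda>k. ennreal (exp (- phi t * s)) * ennreal (gk k z))" for s z
    using gk_mono by (auto simp: incseq_def intro!: mult_left_mono ennreal_leI)
  have lim: "(\<lambda>k. ennreal (exp (- phi t * s)) * ennreal (gk k z)) \<longlonglongrightarrow> ennreal (exp (- phi t * s)) * ennreal (g z)" for s z
    by (intro tendsto_mult_ennreal tendsto_ennrealI tendsto_intros gk_lim) auto
  have pot: "(\<lambda>k. potential (phi t) (\<lambda>z. ennreal (gk k z)) x) \<longlonglongrightarrow> potential (phi t) (\<lambda>z. ennreal (g z)) x"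
     "incseq (\<lambda>k. potential (phi t) (\<lambda>z. ennreal (gk k z)) x)" for x
    by (rule potential_tendsto[OF _ _ mono lim]; measurable)+
  show "?L \<longlonglongrightarrow> (\<integral>\<^sup>+x. ennreal (exp (- b * x)) * indicator {0..} x * potential (phi t) (\<lambda>z. ennreal (g z)) x \<partial>lborel)"
  proof (rule nn_integral_LIMSEQ)
    show "(\<lambda>i. ennreal (exp (- b * x)) * indicator {0..} x * potential (phi t) (\<lambda>z. ennreal (gk i z)) x) \<longlonglongrightarrow>
         ennreal (exp (- b * x)) * indicator {0..} x * potential (phi t) (\<lambda>z. ennreal (g z)) x" for x
      by (cases "0 \<le> x", intro tendsto_mult_ennreal tendsto_const pot) auto
  qed (use pot(2) in \<open>auto simp: incseq_def le_fun_def intro!: mult_left_mono\<close>)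
  have "?L n = (\<integral>\<^sup>+y. indicator {0..} y * ennreal (gk n y * ((exp (- t * y) - exp (- b * y)) / (phi b - phi t))) \<partial>lborel)" for n
    by (rule potential_transform_bounded[OF t cont gk0 gkle gkR])
  moreover have "(\<lambda>n. \<integral>\<^sup>+y. indicator {0..} y * ennreal (gk n y * ((exp (- t * y) - exp (- b * y)) / (phi b - phi t))) \<partial>lborel)
     \<longlonglongrightarrow> (\<integral>\<^sup>+y. indicator {0..} y * ennreal (g y * ((exp (- t * y) - exp (- b * y)) / (phi b - phi t))) \<partial>lborel)"
  proof (rule nn_integral_LIMSEQ)
    have *: "0 \<le> (exp (- t * y) - exp (- b * y)) / (phi b - phi t)" if "0 \<le> y" for y
      using that t phi_strict[of t b] by (intro divide_nonneg_pos) (auto intro!: mult_right_mono)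
    show "incseq (\<lambda>n y. indicator {0..} y * ennreal (gk n y * ((exp (- t * y) - exp (- b * y)) / (phi b - phi t))))"
      unfolding incseq_def le_fun_def
    proof (intro allI impI)
      fix m n y assume "m \<le> (n::nat)"
      show "indicator {0..} y * ennreal (gk m y * ((exp (- t * y) - exp (- b * y)) / (phi b - phi t)))
        \<le> indicator {0..} y * ennreal (gk n y * ((exp (- t * y) - exp (- b * y)) / (phi b - phi t)))"
        by (cases "0 \<le> y", intro mult_left_mono ennreal_leI mult_right_mono gk_mono * \<open>m \<le> n\<close>) auto
    qed
    show "(\<lambda>n. indicator {0..} y * ennreal (gk n y * ((exp (- t * y) - exp (- b * y)) / (phi b - phi t))))
       \<longlonglongrightarrow> indicator {0..} y * ennreal (g y * ((exp (- t * y) - exp (- b * y)) / (phi b - phi t)))" for y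
      by (intro tendsto_mult_ennreal tendsto_const tendsto_ennrealI tendsto_mult gk_lim) (auto simp: indicator_def)
  qed measurable
  ultimately show "?L \<longlonglongrightarrow> (\<integral>\<^sup>+y. indicator {0..} y * ennreal (g y * ((exp (- t * y) - exp (- b * y)) / (phi b - phi t))) \<partial>lborel)"
    by simp
qed

end

section \<open>Uniqueness of Laplace transforms\<close>

text \<open>On \<open>[0, 1]\<close> all powers are bounded by 1, so the exponential series is
  dominated by that of \<open>exp \<bar>t\<bar>\<close> and can be integrated term by term.\<close>

lemma char_moment_series:
  fixes N :: "real measure"
  assumes N: "real_distribution N" and AE: "AE u in N. 0 \<le> u \<and> u \<le> 1"
  shows "char N t = (\<Sum>n. (\<i> * of_real t) ^ n /\<^sub>R fact n * of_real (\<integral>u. u ^ n \<partial>N))"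
proof -
  interpret real_distribution N by fact
  have int: "integrable N (\<lambda>u. (of_real (u ^ n) :: complex))" for n
    by (intro integrable_const_bound[where B=1] eventually_mono[OF AE])
       (auto simp: norm_power power_le_one)
  have eq: "iexp (t * u) = (\<Sum>n. (\<i> * of_real t) ^ n /\<^sub>R fact n * of_real (u ^ n))" for u :: real
    unfolding exp_def by (intro suminf_cong) (simp add: power_mult_distrib scaleR_conv_of_real)
  have sm: "summable (\<lambda>n. \<bar>t\<bar> ^ n / fact n)"
    using summable_norm_exp[of t] by (simp add: power_abs abs_mult divide_inverse mult.commute)
  have nm: "norm ((\<i> * of_real t) ^ n /\<^sub>R fact n * of_real (u ^ n)) = \<bar>t\<bar> ^ n / fact n * \<bar>u\<bar> ^ n" for n and u :: real
    by (simp add: norm_mult norm_power norm_divide divide_inverse mult.commute power_abs)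
  have "char N t = (\<integral>u. (\<Sum>n. (\<i> * of_real t) ^ n /\<^sub>R fact n * of_real (u ^ n)) \<partial>N)"
    unfolding char_def eq ..
  also have "\<dots> = (\<Sum>n. \<integral>u. (\<i> * of_real t) ^ n /\<^sub>R fact n * of_real (u ^ n) \<partial>N)"
  proof (rule integral_suminf)
    show "integrable N (\<lambda>u. (\<i> * of_real t) ^ n /\<^sub>R fact n * of_real (u ^ n))" for n
      using int by (rule integrable_mult_right)
    show "AE u in N. summable (\<lambda>n. norm ((\<i> * of_real t) ^ n /\<^sub>R fact n * of_real (u ^ n)))"
      using AE
    proof eventually_elim
      case (elim u)
      show ?case unfolding nm
        using elim by (intro summable_comparison_test'[OF sm, of 0])
           (auto simp: abs_mult power_abs intro!: mult_right_le_one_le divide_right_mono power_le_one)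
    qed
    show "summable (\<lambda>n. \<integral>u. norm ((\<i> * of_real t) ^ n /\<^sub>R fact n * of_real (u ^ n)) \<partial>N)"
    proof (rule summable_comparison_test'[OF sm, of 0])
      fix n :: nat
      have "(\<integral>u. norm ((\<i> * of_real t) ^ n /\<^sub>R fact n * of_real (u ^ n)) \<partial>N) \<le> (\<integral>u. \<bar>t\<bar> ^ n / fact n \<partial>N)"
      proof (rule integral_mono_AE)
        show "integrable N (\<lambda>u. norm ((\<i> * of_real t) ^ n /\<^sub>R fact n * of_real (u ^ n)))"
          using int by (intro integrable_norm integrable_mult_right)
        show "AE u in N. norm ((\<i> * of_real t) ^ n /\<^sub>R fact n * of_real (u ^ n)) \<le> \<bar>t\<bar> ^ n / fact n"
          using AE unfolding nm
        proof eventually_elim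
          case (elim u)
          have "\<bar>t\<bar> ^ n / fact n * \<bar>u\<bar> ^ n \<le> \<bar>t\<bar> ^ n / fact n * 1"
            using elim by (intro mult_left_mono power_le_one) auto
          then show ?case by simp
        qed
      qed simp
      moreover have "0 \<le> (\<integral>u. norm ((\<i> * of_real t) ^ n /\<^sub>R fact n * of_real (u ^ n)) \<partial>N)"
        by (rule Bochner_Integration.integral_nonneg) auto
      ultimately show "norm (\<integral>u. norm ((\<i> * of_real t) ^ n /\<^sub>R fact n * of_real (u ^ n)) \<partial>N) \<le> \<bar>t\<bar> ^ n / fact n"
        using prob_space by simp
    qed
  qed
  also have "\<dots> = (\<Sum>n. (\<i> * of_real t) ^ n /\<^sub>R fact n * of_real (\<integral>u. u ^ n \<partial>N))"
    by (intro suminf_cong) (subst integral_mult_right_zero, simp add: integral_complex_of_real del: of_real_power)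
  finally show ?thesis .
qed

lemma moments_determine_distribution:
  fixes N N' :: "real measure"
  assumes "real_distribution N" "real_distribution N'"
    and "AE u in N. 0 \<le> u \<and> u \<le> 1" "AE u in N'. 0 \<le> u \<and> u \<le> 1"
    and "\<And>n. (\<integral>u. u ^ n \<partial>N) = (\<integral>u. u ^ n \<partial>N')"
  shows "N = N'"
  by (rule Levy_uniqueness) (use assms in \<open>auto simp: fun_eq_iff char_moment_series\<close>)

text \<open>Weighting by \<open>exp (- (a + 1) * x)\<close> makes the mass \<open>c\<close> finite.
  After normalisation and the substitution \<open>u = exp (- x)\<close> both functions become
  probability laws on \<open>[0, 1]\<close> whose moments are the transforms at
  \<open>a + 1 + n\<close>. If \<open>c = 0\<close> there is nothing to normalise, and both
  functions vanish almost everywhere on the half-line.\<close>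

lemma laplace_determines_function:
  fixes f g :: "real \<Rightarrow> ennreal"
  assumes f[measurable]: "f \<in> borel_measurable borel" and g[measurable]: "g \<in> borel_measurable borel"
    and eq: "\<And>b. a < b \<Longrightarrow> (\<integral>\<^sup>+x. indicator {0..} x * ennreal (exp (- b * x)) * f x \<partial>lborel) =
         (\<integral>\<^sup>+x. indicator {0..} x * ennreal (exp (- b * x)) * g x \<partial>lborel)"
    and fin: "\<And>b. a < b \<Longrightarrow> (\<integral>\<^sup>+x. indicator {0..} x * ennreal (exp (- b * x)) * f x \<partial>lborel) < \<infinity>"
  shows "AE x in lborel. 0 \<le> x \<longrightarrow> f x = g x"
proof -
  define D where "D f = density lborel (\<lambda>x. indicator {0..} x * ennreal (exp (- (a + 1) * x)) * f x)" for f :: "real \<Rightarrow> ennreal"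
  define c where "c = (\<integral>\<^sup>+x. indicator {0..} x * ennreal (exp (- (a + 1) * x)) * f x \<partial>lborel)"
  have c_fin: "c < \<infinity>" and c_g: "c = (\<integral>\<^sup>+x. indicator {0..} x * ennreal (exp (- (a + 1) * x)) * g x \<partial>lborel)"
    using fin[of "a + 1"] eq[of "a + 1"] by (auto simp: c_def)
  show ?thesis
  proof (cases "c = 0")
    case True
    have "AE x in lborel. indicator {0..} x * ennreal (exp (- (a + 1) * x)) * f x = 0"
      using True unfolding c_def by (subst (asm) nn_integral_0_iff_AE) auto
    moreover have "AE x in lborel. indicator {0..} x * ennreal (exp (- (a + 1) * x)) * g x = 0"
      using True unfolding c_g by (subst (asm) nn_integral_0_iff_AE) auto
    ultimately show ?thesis by eventually_elim (auto simp: indicator_def split: if_splits)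
  next
    case c0: False
    define P where "P f = distr (density lborel (\<lambda>x. indicator {0..} x * ennreal (exp (- (a + 1) * x)) * f x / c)) borel (\<lambda>x. exp (- x))" for f :: "real \<Rightarrow> ennreal"
    have P_nn: "(\<integral>\<^sup>+u. k u \<partial>P h) = (\<integral>\<^sup>+x. indicator {0..} x * ennreal (exp (- (a + 1) * x)) * h x * k (exp (- x)) \<partial>lborel) / c"
      if [measurable]: "h \<in> borel_measurable borel" "k \<in> borel_measurable borel" for h k
    proof -
      have "(\<integral>\<^sup>+u. k u \<partial>P h) = (\<integral>\<^sup>+x. indicator {0..} x * ennreal (exp (- (a + 1) * x)) * h x / c * k (exp (- x)) \<partial>lborel)"
        unfolding P_def by (subst nn_integral_distr, measurable, subst nn_integral_density, measurable)
      also have "\<dots> = (\<integral>\<^sup>+x. indicator {0..} x * ennreal (exp (- (a + 1) * x)) * h x * k (exp (- x)) * inverse c \<partial>lborel)"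
        by (intro nn_integral_cong) (simp add: divide_ennreal_def ac_simps)
      also have "\<dots> = (\<integral>\<^sup>+x. indicator {0..} x * ennreal (exp (- (a + 1) * x)) * h x * k (exp (- x)) \<partial>lborel) * inverse c"
        by (rule nn_integral_multc) measurable
      finally show ?thesis by (simp add: divide_ennreal_def)
    qed
    have P1: "real_distribution (P h)" "AE u in P h. 0 \<le> u \<and> u \<le> 1"
      if [measurable]: "h \<in> borel_measurable borel" and h: "c = (\<integral>\<^sup>+x. indicator {0..} x * ennreal (exp (- (a + 1) * x)) * h x \<partial>lborel)" for h
    proof -
      have "emeasure (P h) (space (P h)) = (\<integral>\<^sup>+u. 1 \<partial>P h)" by simp
      also have "\<dots> = 1"
        by (subst P_nn) (use h c0 c_fin in \<open>auto simp: ennreal_divide_self\<close>)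
      finally have "prob_space (P h)" by (rule prob_spaceI)
      then show "real_distribution (P h)"
        by (simp add: real_distribution_def real_distribution_axioms_def P_def)
      show "AE u in P h. 0 \<le> u \<and> u \<le> 1"
        unfolding P_def by (subst AE_distr_iff, measurable, subst AE_density, measurable)
           (auto simp: indicator_def)
    qed
    have "P f = P g"
    proof (rule moments_determine_distribution)
      fix n :: nat
      have mom: "(\<integral>u. u ^ n \<partial>P h) = enn2real ((\<integral>\<^sup>+x. indicator {0..} x * ennreal (exp (- (a + 1 + real n) * x)) * h x \<partial>lborel) / c)"
        if [measurable]: "h \<in> borel_measurable borel" and h: "c = (\<integral>\<^sup>+x. indicator {0..} x * ennreal (exp (- (a + 1) * x)) * h x \<partial>lborel)" for h
      proof -
        have "(\<integral>u. u ^ n \<partial>P h) = enn2real (\<integral>\<^sup>+u. ennreal (u ^ n) \<partial>P h)"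
          using P1(2)[OF that] by (intro integral_eq_nn_integral) (auto simp: P_def elim!: eventually_mono)
        also have "(\<integral>\<^sup>+u. ennreal (u ^ n) \<partial>P h) = (\<integral>\<^sup>+x. indicator {0..} x * ennreal (exp (- (a + 1) * x)) * h x * ennreal (exp (- x) ^ n) \<partial>lborel) / c"
          by (rule P_nn) measurable
        also have "(\<lambda>x. indicator {0..} x * ennreal (exp (- (a + 1) * x)) * h x * ennreal (exp (- x) ^ n)) =
           (\<lambda>x. indicator {0..} x * ennreal (exp (- (a + 1 + real n) * x)) * h x)"
        proof
          fix x :: real
          have "- (a + 1 + real n) * x = - (a + 1) * x + real n * (- x)" by (simp add: algebra_simps)
          then have "ennreal (exp (- (a + 1 + real n) * x)) = ennreal (exp (- (a + 1) * x)) * ennreal (exp (- x) ^ n)"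
            by (simp only: exp_add exp_of_nat_mult ennreal_mult exp_ge_zero zero_le_power)
          then show "indicator {0..} x * ennreal (exp (- (a + 1) * x)) * h x * ennreal (exp (- x) ^ n) =
             indicator {0..} x * ennreal (exp (- (a + 1 + real n) * x)) * h x"
            by (simp only: ac_simps)
        qed
        finally show ?thesis .
      qed
      show "(\<integral>u. u ^ n \<partial>P f) = (\<integral>u. u ^ n \<partial>P g)"
        using mom[OF f c_def] mom[OF g c_g] eq[of "a + 1 + real n"] by simp
    qed (use P1[OF f c_def] P1[OF g c_g] in auto)
    then have "distr (P f) borel (\<lambda>u. - ln u) = distr (P g) borel (\<lambda>u. - ln u)" by simp
    then have "distr (density lborel (\<lambda>x. indicator {0..} x * ennreal (exp (- (a + 1) * x)) * f x / c)) borel (\<lambda>x. x)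
      = distr (density lborel (\<lambda>x. indicator {0..} x * ennreal (exp (- (a + 1) * x)) * g x / c)) borel (\<lambda>x. x)"
      unfolding P_def by (subst (asm) (1 2) distr_distr) (auto simp: comp_def)
    then have deq: "density lborel (\<lambda>x. indicator {0..} x * ennreal (exp (- (a + 1) * x)) * f x / c)
      = density lborel (\<lambda>x. indicator {0..} x * ennreal (exp (- (a + 1) * x)) * g x / c)"
      by (subst (asm) (1 2) distr_id2) auto
    have "AE x in lborel. indicator {0..} x * ennreal (exp (- (a + 1) * x)) * f x / c = indicator {0..} x * ennreal (exp (- (a + 1) * x)) * g x / c"
      by (rule sigma_finite_measure.density_unique[OF sigma_finite_lborel _ _ deq]) measurable
    then show ?thesis
    proof eventually_elim
      case (elim x)
      show ?case
      proof
        assume "0 \<le> x"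
        then have "(ennreal (exp (- (a + 1) * x)) * f x) / c * c = (ennreal (exp (- (a + 1) * x)) * g x) / c * c"
          using arg_cong[OF elim, of "\<lambda>y. y * c"] by (simp del: ennreal_times_divide)
        moreover have "y / c * c = y" for y
          using c0 c_fin by (simp add: ennreal_divide_times ennreal_divide_self)
        ultimately have "ennreal (exp (- (a + 1) * x)) * f x = ennreal (exp (- (a + 1) * x)) * g x"
          by (simp only:)
        then show "f x = g x"
          by (simp add: ennreal_mult_cancel_left)
      qed
    qed
  qed
qed

section \<open>The potential density\<close>

text \<open>The substitution \<open>v = e n * s\<close> turns the Abel mean into the integral of
  \<open>f (v / e n)\<close> against the exponential law, and \<open>v / e n\<close> tends to
  infinity for every \<open>v > 0\<close>.\<close>

lemma abel_limit:
  fixes f :: "real \<Rightarrow> real"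
  assumes f: "f \<in> borel_measurable borel" "\<And>s. 0 \<le> s \<Longrightarrow> 0 \<le> f s \<and> f s \<le> 1"
    and lim: "(f \<longlongrightarrow> l) at_top" and e: "e \<longlonglongrightarrow> 0" "\<And>n. 0 < e n"
  shows "(\<lambda>n. ennreal (e n) * (\<integral>\<^sup>+s. indicator {0..} s * ennreal (exp (- e n * s)) * ennreal (f s) \<partial>lborel)) \<longlonglongrightarrow> ennreal l"
proof -
  note f(1)[measurable]
  have eq: "ennreal (e n) * (\<integral>\<^sup>+s. indicator {0..} s * ennreal (exp (- e n * s)) * ennreal (f s) \<partial>lborel)
    = (\<integral>\<^sup>+v. indicator {0..} v * ennreal (exp (- v)) * ennreal (f (v / e n)) \<partial>lborel)" for n
  proof -
    have "(\<integral>\<^sup>+s. indicator {0..} s * ennreal (exp (- e n * s)) * ennreal (f s) \<partial>lborel)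
      = ennreal (1 / e n) * (\<integral>\<^sup>+v. indicator {0..} v * ennreal (exp (- v)) * ennreal (f (v / e n)) \<partial>lborel)"
      using e(2)[of n]
      by (subst nn_integral_real_affine[where c="1 / e n" and t=0])
         (auto simp: indicator_def zero_le_divide_iff intro!: arg_cong2[where f="(*)"] nn_integral_cong)
    then show ?thesis
      using e(2)[of n] by (simp add: mult.assoc[symmetric] ennreal_mult[symmetric])
  qed
  have "(\<lambda>n. \<integral>\<^sup>+v. indicator {0..} v * ennreal (exp (- v)) * ennreal (f (v / e n)) \<partial>lborel) \<longlonglongrightarrow>
     (\<integral>\<^sup>+v. indicator {0..} v * ennreal (exp (- v)) * ennreal l \<partial>lborel)"
  proof (rule nn_integral_dominated_convergence[where w="\<lambda>v. indicator {0..} v * ennreal (exp (- v))"])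
    show "(\<integral>\<^sup>+v. indicator {0..} v * ennreal (exp (- v)) \<partial>lborel) < \<infinity>"
      using nn_integral_exp_decay[of 1] by simp
    show "AE v in lborel. indicator {0..} v * ennreal (exp (- v)) * ennreal (f (v / e n)) \<le> indicator {0..} v * ennreal (exp (- v))" for n
    proof (rule AE_I2)
      fix v :: real
      show "indicator {0..} v * ennreal (exp (- v)) * ennreal (f (v / e n)) \<le> indicator {0..} v * ennreal (exp (- v))"
      proof (cases "0 \<le> v")
        case True
        have "ennreal (exp (- v)) * ennreal (f (v / e n)) \<le> ennreal (exp (- v)) * 1"
          using f(2)[of "v / e n"] True e(2)[of n] by (intro mult_left_mono) auto
        then show ?thesis using True by simp
      qed simp
    qed
    show "AE v in lborel. (\<lambda>n. indicator {0..} v * ennreal (exp (- v)) * ennreal (f (v / e n))) \<longlonglongrightarrow> indicator {0..} v * ennreal (exp (- v)) * ennreal l"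
      using AE_lborel_singleton[of 0]
    proof eventually_elim
      case (elim v)
      show ?case
      proof (cases "0 < v")
        case True
        have "filterlim (\<lambda>n. inverse (e n)) at_top sequentially"
          using e by (intro filterlim_inverse_at_top) (auto simp: always_eventually)
        then have "filterlim (\<lambda>n. v * inverse (e n)) at_top sequentially"
          using True by (intro filterlim_tendsto_pos_mult_at_top[OF tendsto_const])
        then have "(\<lambda>n. f (v / e n)) \<longlonglongrightarrow> l"
          using filterlim_compose[OF lim, of "\<lambda>n. v * inverse (e n)"] by (simp add: divide_inverse)
        then show ?thesis
          using True by (intro tendsto_mult_ennreal tendsto_const tendsto_ennrealI) auto
      qed (use elim in simp)
    qed
  qed measurable
  then show ?thesis
    unfolding eq using nn_integral_exp_decay[of 1] by (simp add: nn_integral_multc)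
qed

text \<open>\<open>surv x s\<close> is \<open>P\<^sub>x\<^sup>(\<^sup>\<theta>\<^sup>)(T \<ge> s)\<close> and \<open>sv x\<close> is \<open>P\<^sub>x\<^sup>(\<^sup>\<theta>\<^sup>)(T = \<infinity>)\<close>.\<close>

locale tilted_survival = skeleton_process M F phi c v d S
  for M :: "'a measure" and F phi c v d S +
  fixes th m :: real and surv :: "real \<Rightarrow> real \<Rightarrow> real" and sv :: "real \<Rightarrow> real"
  assumes th: "0 \<le> th" and m: "0 < m" and deriv: "(phi has_real_derivative m) (at th within {0..})"
    and surv: "0 \<le> x \<Longrightarrow> 0 \<le> s \<Longrightarrow>
      (\<integral>\<^sup>+\<omega>. ennreal (exp (th * S s \<omega> - phi th * s)) * indicator {\<omega>. alive x s \<omega>} \<omega> \<partial>M) = ennreal (surv x s)"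
    and surv_bounds: "0 \<le> x \<Longrightarrow> 0 \<le> s \<Longrightarrow> 0 \<le> surv x s \<and> surv x s \<le> 1"
    and surv_antimono: "0 \<le> x \<Longrightarrow> 0 \<le> s \<Longrightarrow> s \<le> s' \<Longrightarrow> surv x s' \<le> surv x s"
    and surv_lim: "0 \<le> x \<Longrightarrow> (surv x \<longlongrightarrow> sv x) at_top"
begin

section \<open>Regularity of the survival probability in time and initial capital\<close>

lemma sv_bounds: assumes "0 \<le> x" shows "0 \<le> sv x" "sv x \<le> 1"
proof -
  have "eventually (\<lambda>s. 0 \<le> surv x s \<and> surv x s \<le> 1) at_top"
    using eventually_ge_at_top[of 0] by eventually_elim (use surv_bounds assms in blast)
  then have *: "eventually (\<lambda>s. 0 \<le> surv x s) at_top" "eventually (\<lambda>s. surv x s \<le> 1) at_top"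
    by (auto elim: eventually_mono)
  show "0 \<le> sv x" using tendsto_lowerbound[OF surv_lim[OF assms] *(1)] by simp
  show "sv x \<le> 1" using tendsto_upperbound[OF surv_lim[OF assms] *(2)] by simp
qed

lemma sv_le_surv: "0 \<le> x \<Longrightarrow> 0 \<le> s \<Longrightarrow> sv x \<le> surv x s"
  by (rule tendsto_upperbound[OF surv_lim])
     (auto intro!: eventually_mono[OF eventually_ge_at_top[of s]] surv_antimono)

lemma surv_mono: "0 \<le> x \<Longrightarrow> x \<le> y \<Longrightarrow> 0 \<le> s \<Longrightarrow> surv x s \<le> surv y s"
proof -
  assume x: "0 \<le> x" "x \<le> y" "0 \<le> s"
  have "alive x s \<omega> \<Longrightarrow> alive y s \<omega>" for \<omega>
    using x(2) by (fastforce simp: alive_def)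
  then have "ennreal (surv x s) \<le> ennreal (surv y s)"
    using x by (subst (1 2) surv[symmetric]) (auto intro!: nn_integral_mono mult_left_mono simp: indicator_def)
  then show ?thesis using x surv_bounds[of y s] by simp
qed

lemma sv_mono: "0 \<le> x \<Longrightarrow> x \<le> y \<Longrightarrow> sv x \<le> sv y"
  by (rule tendsto_le[OF _ surv_lim surv_lim])
     (auto intro!: eventually_mono[OF eventually_ge_at_top[of 0]] surv_mono)

text \<open>Provides the integrable majorant for \<open>surv_right\<close>. The law of
  \<open>S s\<close> is read off from \<open>markov\<close> with step \<open>s\<close> and no past
  (\<open>i = 0\<close>).\<close>

lemma tilt_mass: assumes "0 < s" shows "(\<integral>\<^sup>+\<omega>. ennreal (exp (th * S s \<omega> - phi th * s)) \<partial>M) = 1"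
proof -
  interpret F: step_law "F s" by (rule step_law) fact
  note S_measurable[of s, measurable]
  have "(\<integral>\<^sup>+\<omega>. ennreal (exp (th * S s \<omega> - phi th * s)) \<partial>M) =
    (\<integral>\<^sup>+\<omega>. (\<lambda>(p::nat \<Rightarrow> real, u). ennreal (exp (th * u - phi th * s))) (\<lambda>k\<in>{..0}. S (real k * s) \<omega>, S (real (Suc 0) * s) \<omega> - S (real 0 * s) \<omega>) \<partial>M)"
    by (intro nn_integral_cong) (simp add: S_0)
  also have "\<dots> = (\<integral>\<^sup>+\<omega>. \<integral>\<^sup>+u. ennreal (exp (th * u - phi th * s)) \<partial>F s \<partial>M)"
    by (subst markov[OF assms]) measurable
  also have "(\<integral>\<^sup>+u. ennreal (exp (th * u - phi th * s)) \<partial>F s) = (\<integral>\<^sup>+u. ennreal (exp (- phi th * s)) * ennreal (exp (th * u)) \<partial>F s)"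
    by (intro nn_integral_cong) (simp add: ennreal_exp_add[symmetric])
  also have "\<dots> = ennreal (exp (- phi th * s)) * ennreal (exp (s * phi th))"
    unfolding mgf[OF assms th, symmetric] by (rule nn_integral_cmult) measurable
  also have "\<dots> = 1"
    by (simp add: ennreal_exp_add[symmetric] mult.commute)
  finally show ?thesis by (simp add: emeasure_space_1)
qed

text \<open>Being alive is preserved when the capital grows, while not being alive is witnessed by
  one strict inequality and hence persists under a small increase of the capital. The argument is
  one-sided: it says nothing about approach from the left.\<close>

lemma alive_right:
  assumes xn: "xn \<longlonglongrightarrow> x" "\<And>n. x < xn n"
  shows "eventually (\<lambda>n. alive (xn n) s \<omega> \<longleftrightarrow> alive x s \<omega>) sequentially"
proof (cases "alive x s \<omega>")
  case True
  then have "alive (xn n) s \<omega>" for n using xn(2)[of n] by (fastforce simp: alive_def)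
  then show ?thesis using True by simp
next
  case False
  then obtain n0 k where k: "real k * mesh n0 < s" "x + S (real k * mesh n0) \<omega> < 0"
    by (auto simp: alive_def not_le)
  have "eventually (\<lambda>n. xn n + S (real k * mesh n0) \<omega> < 0) sequentially"
    by (rule order_tendstoD(2)[OF tendsto_add[OF xn(1) tendsto_const] k(2)])
  then have "eventually (\<lambda>n. \<not> alive (xn n) s \<omega>) sequentially"
    by eventually_elim (use k in \<open>force simp: alive_def not_le\<close>)
  then show ?thesis using False by simp
qed

lemma surv_right:
  assumes x: "0 \<le> x" and s: "0 < s" and xn: "xn \<longlonglongrightarrow> x" "\<And>n. x < xn n"
  shows "(\<lambda>n. surv (xn n) s) \<longlonglongrightarrow> surv x s"
proof -
  note S_measurable[of s, measurable]
  have pos: "0 \<le> xn n" for n using x xn(2)[of n] by simp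
  have am[measurable]: "Measurable.pred M (\<lambda>\<omega>. alive y s \<omega>)" for y
    unfolding alive_def by measurable
  have "(\<lambda>n. \<integral>\<^sup>+\<omega>. ennreal (exp (th * S s \<omega> - phi th * s)) * indicator {\<omega>. alive (xn n) s \<omega>} \<omega> \<partial>M) \<longlonglongrightarrow>
    (\<integral>\<^sup>+\<omega>. ennreal (exp (th * S s \<omega> - phi th * s)) * indicator {\<omega>. alive x s \<omega>} \<omega> \<partial>M)"
  proof (rule nn_integral_dominated_convergence[where w="\<lambda>\<omega>. ennreal (exp (th * S s \<omega> - phi th * s))"])
    show "AE \<omega> in M. (\<lambda>n. ennreal (exp (th * S s \<omega> - phi th * s)) * indicator {\<omega>. alive (xn n) s \<omega>} \<omega>) \<longlonglongrightarrow>
      ennreal (exp (th * S s \<omega> - phi th * s)) * indicator {\<omega>. alive x s \<omega>} \<omega>"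
    proof (intro AE_I2 tendsto_mult_ennreal tendsto_const)
      fix \<omega>
      show "(\<lambda>n. indicator {\<omega>. alive (xn n) s \<omega>} \<omega> :: ennreal) \<longlonglongrightarrow> indicator {\<omega>. alive x s \<omega>} \<omega>"
        using alive_right[OF xn, of s \<omega>]
        by (intro tendsto_eventually, elim eventually_mono) (auto simp: indicator_def)
    qed (auto simp: indicator_def)
  qed (use s in \<open>auto simp: indicator_def tilt_mass\<close>)
  then have "(\<lambda>n. ennreal (surv (xn n) s)) \<longlonglongrightarrow> ennreal (surv x s)"
    using x s xn(2) by (subst (asm) (1 2) surv) (auto intro: order_trans less_imp_le)
  then show ?thesis
    using surv_bounds[of x s] surv_bounds[OF pos] x s
    by (subst (asm) tendsto_ennreal_iff) auto
qed

text \<open>\<open>sv\<close> lies below every \<open>surv\<close> with fixed \<open>s\<close>, and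
  these are continuous from the right, which bounds the limit from above; monotonicity in the
  capital bounds it from below.\<close>

lemma sv_right:
  assumes x: "0 \<le> x" and xn: "xn \<longlonglongrightarrow> x" "\<And>n. x < xn n"
  shows "(\<lambda>n. sv (xn n)) \<longlonglongrightarrow> sv x"
proof (rule order_tendstoI)
  fix a assume "a < sv x"
  then show "eventually (\<lambda>n. a < sv (xn n)) sequentially"
    using sv_mono[OF x] xn(2) by (intro always_eventually) (metis less_imp_le less_le_trans)
next
  fix a assume "sv x < a"
  then have "eventually (\<lambda>s. surv x s < a) at_top" using order_tendstoD(2)[OF surv_lim[OF x]] by blast
  then have "eventually (\<lambda>s. surv x s < a \<and> 0 < s) at_top"
    using eventually_gt_at_top by (rule eventually_conj)
  then obtain s where s: "0 < s" "surv x s < a" by (auto dest: eventually_happens)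
  have "eventually (\<lambda>n. surv (xn n) s < a) sequentially"
    by (rule order_tendstoD(2)[OF surv_right[OF x s(1) xn] s(2)])
  then show "eventually (\<lambda>n. sv (xn n) < a) sequentially"
  proof eventually_elim
    case (elim n)
    have "sv (xn n) \<le> surv (xn n) s" using x xn(2)[of n] s by (intro sv_le_surv) auto
    then show ?case using elim by simp
  qed
qed

text \<open>This is the scale function of the process at level \<open>\<phi>(\<theta>)\<close>.\<close>

definition W :: "real \<Rightarrow> real" where "W x = (if 0 \<le> x then exp (th * x) * sv x / m else 0)"

lemma W_nonneg: "0 \<le> W x"
  using sv_bounds[of x] m by (simp add: W_def)

lemma W_measurable[measurable]: "W \<in> borel_measurable borel"
proof -
  have "mono (\<lambda>x. if 0 \<le> x then sv x else 0)"
    using sv_mono sv_bounds by (auto simp: mono_def)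
  then have "(\<lambda>x. if 0 \<le> x then sv x else 0) \<in> borel_measurable borel"
    by (rule borel_measurable_mono)
  then have "(\<lambda>x. exp (th * x) * (if 0 \<le> x then sv x else 0) / m) \<in> borel_measurable borel"
    by measurable
  also have "(\<lambda>x. exp (th * x) * (if 0 \<le> x then sv x else 0) / m) = W"
    by (auto simp: W_def)
  finally show ?thesis .
qed

lemma W_right:
  assumes x: "0 \<le> x" and xn: "xn \<longlonglongrightarrow> x" "\<And>n. x < xn n"
  shows "(\<lambda>n. W (xn n)) \<longlonglongrightarrow> W x"
proof -
  have "(\<lambda>n. exp (th * xn n) * sv (xn n) / m) \<longlonglongrightarrow> exp (th * x) * sv x / m"
    using m by (intro tendsto_intros xn sv_right[OF x]) auto
  moreover have "0 \<le> xn n" for n using x xn(2)[of n] by simp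
  ultimately show ?thesis using x by (simp add: W_def)
qed

lemma W_le: "W x \<le> exp (th * x) / m"
  using sv_bounds[of x] m by (auto simp: W_def divide_right_mono)

lemma surv_measurable: "0 \<le> x \<Longrightarrow> (\<lambda>s. surv x (max 0 s)) \<in> borel_measurable borel"
proof -
  assume "0 \<le> x"
  then have "mono (\<lambda>s. - surv x (max 0 s))"
    by (auto simp: mono_def intro!: surv_antimono)
  then have "(\<lambda>s. - (- surv x (max 0 s))) \<in> borel_measurable borel"
    by (intro borel_measurable_uminus borel_measurable_mono)
  then show ?thesis by simp
qed

text \<open>Fubini recognises the tilting density inside the expectation: the potential of
  \<open>exp (th * z)\<close> at level \<open>p\<close> is \<open>exp (th * x)\<close> times the
  Laplace transform of survival in time, at \<open>p - phi th\<close>. This prepares the Abelian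
  limit as \<open>p\<close> approaches \<open>phi th\<close>.\<close>

lemma potential_exp:
  assumes x: "0 \<le> x"
  shows "potential p (\<lambda>z. ennreal (exp (th * z))) x =
    ennreal (exp (th * x)) * (\<integral>\<^sup>+s. indicator {0..} s * ennreal (exp (- (p - phi th) * s)) * ennreal (surv x (max 0 s)) \<partial>lborel)"
proof -
  interpret P: pair_sigma_finite lborel M ..
  let ?Z = "\<lambda>t \<omega>. indicator {0..} t * ennreal (exp (- p * t)) * (ennreal (exp (th * (x + S t \<omega>))) * indicator {\<omega>. alive x t \<omega>} \<omega>)"
  have "potential p (\<lambda>z. ennreal (exp (th * z))) x = (\<integral>\<^sup>+s. \<integral>\<^sup>+\<omega>. ?Z s \<omega> \<partial>M \<partial>lborel)"
    unfolding potential_def by (rule P.Fubini') (rule measurable_potential_integrand, measurable)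
  also have "\<dots> = (\<integral>\<^sup>+s. ennreal (exp (th * x)) * (indicator {0..} s * ennreal (exp (- (p - phi th) * s)) * ennreal (surv x (max 0 s))) \<partial>lborel)"
  proof (rule nn_integral_cong)
    fix s :: real
    show "(\<integral>\<^sup>+\<omega>. ?Z s \<omega> \<partial>M) = ennreal (exp (th * x)) * (indicator {0..} s * ennreal (exp (- (p - phi th) * s)) * ennreal (surv x (max 0 s)))"
    proof (cases "0 \<le> s")
      case True
      note S_measurable[OF True, measurable]
      have am[measurable]: "Measurable.pred M (\<lambda>\<omega>. alive x s \<omega>)"
        unfolding alive_def by measurable
      have "(\<integral>\<^sup>+\<omega>. ?Z s \<omega> \<partial>M) = (\<integral>\<^sup>+\<omega>. (ennreal (exp (th * x)) * ennreal (exp (- (p - phi th) * s))) *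
         (ennreal (exp (th * S s \<omega> - phi th * s)) * indicator {\<omega>. alive x s \<omega>} \<omega>) \<partial>M)"
        using True
        by (intro nn_integral_cong) (auto simp: indicator_def ennreal_exp_add[symmetric] algebra_simps)
      also have "\<dots> = (ennreal (exp (th * x)) * ennreal (exp (- (p - phi th) * s))) * ennreal (surv x s)"
        unfolding surv[OF x True, symmetric] by (rule nn_integral_cmult) measurable
      finally show ?thesis using True by (simp add: ac_simps)
    qed simp
  qed
  also have "\<dots> = ennreal (exp (th * x)) * (\<integral>\<^sup>+s. indicator {0..} s * ennreal (exp (- (p - phi th) * s)) * ennreal (surv x (max 0 s)) \<partial>lborel)"
    using surv_measurable[OF x] by (intro nn_integral_cmult) measurable
  finally show ?thesis .
qed


text \<open>The transform of \<open>e n\<close> times the potential of \<open>exp (th * z)\<close>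
  at level \<open>phi (t n)\<close> is evaluated twice. By \<open>potential_exp\<close> and
  \<open>abel_limit\<close> the integrand tends to \<open>exp (th * x) * sv x = m * W x\<close>. By
  \<open>potential_transform\<close> the integral is explicit and tends to
  \<open>m / (phi b - phi th)\<close>. The detour through \<open>t n > th\<close> is needed for
  \<open>exp (th * y) * exp (- t n * y)\<close> to be integrable.\<close>

lemma W_transform:
  assumes b: "th < b"
  shows "(\<integral>\<^sup>+x. indicator {0..} x * ennreal (exp (- b * x)) * ennreal (W x) \<partial>lborel) = ennreal (1 / (phi b - phi th))"
proof -
  define t where "t n = th + (b - th) / real (Suc (Suc n))" for n
  have t: "th < t n" "t n < b" "0 < t n" for n
  proof -
    show "th < t n" "0 < t n" using th b by (auto simp: t_def intro: add_nonneg_pos)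
    have "(b - th) / real (Suc (Suc n)) < (b - th) / 1" using b by (intro divide_strict_left_mono) auto
    then show "t n < b" by (simp add: t_def)
  qed
  have t_lim: "t \<longlonglongrightarrow> th" unfolding t_def by real_asymp
  have phi_lim: "(\<lambda>n. phi (t n)) \<longlonglongrightarrow> phi th"
    by (rule continuous_on_tendsto_compose[OF phi_cont t_lim]) (use t th in \<open>auto simp: less_imp_le\<close>)
  define e where "e n = phi (t n) - phi th" for n
  have e: "e \<longlonglongrightarrow> 0" "\<And>n. 0 < e n"
    using tendsto_diff[OF phi_lim tendsto_const[of "phi th"]] phi_strict[OF th t(1)] by (auto simp: e_def[abs_def])
  let ?E = "\<lambda>z. ennreal (exp (th * z))"
  let ?L = "\<lambda>n. \<integral>\<^sup>+x. ennreal (exp (- b * x)) * indicator {0..} x * (ennreal (e n) * potential (phi (t n)) ?E x) \<partial>lborel"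
  have pe: "ennreal (e n) * potential (phi (t n)) ?E x =
     ennreal (exp (th * x)) * (ennreal (e n) * (\<integral>\<^sup>+s. indicator {0..} s * ennreal (exp (- e n * s)) * ennreal (surv x (max 0 s)) \<partial>lborel))"
    if "0 \<le> x" for n x
    unfolding potential_exp[OF that] e_def[symmetric] by (simp add: ac_simps)
  have pe_le: "ennreal (e n) * potential (phi (t n)) ?E x \<le> ennreal (exp (th * x))" if "0 \<le> x" for n x
  proof -
    have "(\<integral>\<^sup>+s. indicator {0..} s * ennreal (exp (- e n * s)) * ennreal (surv x (max 0 s)) \<partial>lborel)
       \<le> (\<integral>\<^sup>+s. indicator {0..} s * ennreal (exp (- e n * s)) \<partial>lborel)"
    proof (rule nn_integral_mono)
      fix s :: real
      have "ennreal (surv x (max 0 s)) \<le> 1" using surv_bounds[OF that, of "max 0 s"] by simp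
      then show "indicator {0..} s * ennreal (exp (- e n * s)) * ennreal (surv x (max 0 s)) \<le> indicator {0..} s * ennreal (exp (- e n * s))"
        using mult_left_mono[of "ennreal (surv x (max 0 s))" 1 "indicator {0..} s * ennreal (exp (- e n * s))"] by simp
    qed
    also have "\<dots> = ennreal (1 / e n)" by (rule nn_integral_exp_decay[OF e(2)])
    finally have "ennreal (e n) * potential (phi (t n)) ?E x \<le> ennreal (exp (th * x)) * (ennreal (e n) * ennreal (1 / e n))"
      unfolding pe[OF that] by (intro mult_left_mono) auto
    then show ?thesis using e(2)[of n] by (simp add: ennreal_mult[symmetric])
  qed
  have A: "?L \<longlonglongrightarrow> (\<integral>\<^sup>+x. ennreal (exp (- b * x)) * indicator {0..} x * ennreal (m * W x) \<partial>lborel)"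
  proof (rule nn_integral_dominated_convergence[where w="\<lambda>x. indicator {0..} x * ennreal (exp (- (b - th) * x))"])
    show "(\<integral>\<^sup>+x. indicator {0..} x * ennreal (exp (- (b - th) * x)) \<partial>lborel) < \<infinity>"
      using b by (subst nn_integral_exp_decay) auto
    show "AE x in lborel. ennreal (exp (- b * x)) * indicator {0..} x * (ennreal (e n) * potential (phi (t n)) ?E x) \<le> indicator {0..} x * ennreal (exp (- (b - th) * x))" for n
    proof (rule AE_I2)
      fix x :: real
      show "ennreal (exp (- b * x)) * indicator {0..} x * (ennreal (e n) * potential (phi (t n)) ?E x) \<le> indicator {0..} x * ennreal (exp (- (b - th) * x))"
      proof (cases "0 \<le> x")
        case True
        have "ennreal (exp (- b * x)) * (ennreal (e n) * potential (phi (t n)) ?E x) \<le> ennreal (exp (- b * x)) * ennreal (exp (th * x))"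
          by (intro mult_left_mono pe_le True) auto
        also have "\<dots> = ennreal (exp (- (b - th) * x))"
          by (simp add: ennreal_exp_add[symmetric] algebra_simps)
        finally show ?thesis using True by simp
      qed simp
    qed
    show "AE x in lborel. (\<lambda>n. ennreal (exp (- b * x)) * indicator {0..} x * (ennreal (e n) * potential (phi (t n)) ?E x)) \<longlonglongrightarrow>
        ennreal (exp (- b * x)) * indicator {0..} x * ennreal (m * W x)"
    proof (rule AE_I2)
      fix x :: real
      show "(\<lambda>n. ennreal (exp (- b * x)) * indicator {0..} x * (ennreal (e n) * potential (phi (t n)) ?E x)) \<longlonglongrightarrow>
        ennreal (exp (- b * x)) * indicator {0..} x * ennreal (m * W x)"
      proof (cases "0 \<le> x")
        case True
        have "((\<lambda>s. surv x (max 0 s)) \<longlongrightarrow> sv x) at_top"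
          by (rule Lim_transform_eventually[OF surv_lim[OF True]])
             (auto intro!: eventually_mono[OF eventually_ge_at_top[of 0]] simp: max_def)
        then have "(\<lambda>n. ennreal (e n) * (\<integral>\<^sup>+s. indicator {0..} s * ennreal (exp (- e n * s)) * ennreal (surv x (max 0 s)) \<partial>lborel)) \<longlonglongrightarrow> ennreal (sv x)"
          by (intro abel_limit surv_measurable e True) (use surv_bounds True in auto)
        then have "(\<lambda>n. ennreal (e n) * potential (phi (t n)) ?E x) \<longlonglongrightarrow> ennreal (exp (th * x)) * ennreal (sv x)"
          unfolding pe[OF True] by (intro tendsto_mult_ennreal tendsto_const) auto
        also have "ennreal (exp (th * x)) * ennreal (sv x) = ennreal (m * W x)"
          using True m sv_bounds[OF True] by (simp add: W_def ennreal_mult)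
        finally show ?thesis using True by (intro tendsto_mult_ennreal tendsto_const) auto
      qed simp
    qed
  qed measurable
  have L_eq: "?L n = ennreal (((phi (t n) - phi th) / (t n - th) - (phi (t n) - phi th) / (b - th)) / (phi b - phi (t n)))" for n
  proof -
    define D where "D = phi b - phi (t n)"
    have D: "0 < D" using phi_strict[OF less_imp_le[OF t(3)] t(2), of n] by (simp add: D_def)
    have "?L n = (\<integral>\<^sup>+x. ennreal (e n) * (ennreal (exp (- b * x)) * indicator {0..} x * potential (phi (t n)) ?E x) \<partial>lborel)"
      by (simp only: ac_simps)
    also have "\<dots> = ennreal (e n) * (\<integral>\<^sup>+x. ennreal (exp (- b * x)) * indicator {0..} x * potential (phi (t n)) ?E x \<partial>lborel)"
      by (rule nn_integral_cmult) measurable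
    also have "(\<integral>\<^sup>+x. ennreal (exp (- b * x)) * indicator {0..} x * potential (phi (t n)) ?E x \<partial>lborel)
      = (\<integral>\<^sup>+y. indicator {0..} y * ennreal (exp (th * y) * ((exp (- t n * y) - exp (- b * y)) / (phi b - phi (t n)))) \<partial>lborel)"
      using t[of n] by (intro potential_transform continuous_intros) (auto simp: less_imp_le)
    also have "\<dots> = (\<integral>\<^sup>+y. ennreal (exp (th * y) * ((exp (- t n * y) - exp (- b * y)) / D)) * indicator {0..} y \<partial>lborel)"
      by (simp add: D_def mult.commute)
    also have "\<dots> = ennreal (0 - (exp (- (b - th) * 0) / (b - th) - exp (- (t n - th) * 0) / (t n - th)) / D)"
    proof (rule nn_integral_FTC_atLeast)
      show "((\<lambda>y. (exp (- (b - th) * y) / (b - th) - exp (- (t n - th) * y) / (t n - th)) / D) \<longlongrightarrow> 0) at_top"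
      proof -
        have "((\<lambda>y. exp (- u * y)) \<longlongrightarrow> 0) at_top" if "0 < u" for u :: real
          using that by real_asymp
        from this[of "b - th"] this[of "t n - th"] b t(1)[of n]
        have "((\<lambda>y. (exp (- (b - th) * y) / (b - th) - exp (- (t n - th) * y) / (t n - th)) / D) \<longlongrightarrow> (0 / (b - th) - 0 / (t n - th)) / D) at_top"
          using D by (intro tendsto_intros) auto
        then show ?thesis by simp
      qed
      fix y :: real assume y: "0 \<le> y"
      show "0 \<le> exp (th * y) * ((exp (- t n * y) - exp (- b * y)) / D)"
        using D t(2)[of n] y by (intro mult_nonneg_nonneg divide_nonneg_pos) (auto intro!: mult_right_mono)
      have "exp (th * y) * ((exp (- t n * y) - exp (- b * y)) / D) = (exp (- (t n - th) * y) - exp (- (b - th) * y)) / D"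
        by (simp add: right_diff_distrib exp_add[symmetric] algebra_simps diff_divide_distrib)
      moreover have der: "((\<lambda>y. exp (- u * y) / u) has_real_derivative - exp (- u * y)) (at y)" if "u \<noteq> 0" for u
        using that by (auto intro!: derivative_eq_intros)
      have "((\<lambda>y. (exp (- (b - th) * y) / (b - th) - exp (- (t n - th) * y) / (t n - th)) / D) has_real_derivative
         (exp (- (t n - th) * y) - exp (- (b - th) * y)) / D) (at y)"
        using DERIV_cdivide[OF DERIV_diff[OF der[of "b - th"] der[of "t n - th"]], of D] b t(1)[of n] by simp
      ultimately show "((\<lambda>y. (exp (- (b - th) * y) / (b - th) - exp (- (t n - th) * y) / (t n - th)) / D) has_real_derivative
         exp (th * y) * ((exp (- t n * y) - exp (- b * y)) / D)) (at y)" by (simp only:)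
    qed measurable
    also have "ennreal (e n) * \<dots> = ennreal (e n * (0 - (exp (- (b - th) * 0) / (b - th) - exp (- (t n - th) * 0) / (t n - th)) / D))"
    proof -
      have "1 / (b - th) \<le> 1 / (t n - th)" using t[of n] by (intro divide_left_mono) auto
      then show ?thesis using e(2)[of n] D
        by (intro ennreal_mult[symmetric]) (auto simp: divide_nonpos_pos)
    qed
    also have "e n * (0 - (exp (- (b - th) * 0) / (b - th) - exp (- (t n - th) * 0) / (t n - th)) / D) =
      ((phi (t n) - phi th) / (t n - th) - (phi (t n) - phi th) / (b - th)) / (phi b - phi (t n))"
    proof -
      have "E * (0 - (exp (- B * 0) / B - exp (- T * 0) / T) / D) = (E / T - E / B) / D" for E B T :: real
        by (simp add: divide_inverse algebra_simps)
      then show ?thesis unfolding e_def D_def[symmetric] .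
    qed
    finally show ?thesis .
  qed
  have "((\<lambda>y. (phi y - phi th) / (y - th)) \<longlongrightarrow> m) (at th within {0..})"
    using deriv by (simp add: has_field_derivative_iff)
  moreover have "filterlim t (at th within {0..}) sequentially"
    unfolding filterlim_at using t t_lim by (auto simp: less_imp_le less_imp_neq[symmetric])
  \<comment> \<open>The explicit value contains the difference quotient of \<open>phi\<close> at
    \<open>th\<close>; this is where the derivative \<open>m\<close>, and thus the normalisation of
    \<open>W\<close>, comes from.\<close>
  ultimately have quot: "(\<lambda>n. (phi (t n) - phi th) / (t n - th)) \<longlonglongrightarrow> m"
    by (rule filterlim_compose)
  have "?L \<longlonglongrightarrow> ennreal ((m - (phi th - phi th) / (b - th)) / (phi b - phi th))"
    unfolding L_eq using b phi_strict[OF th b]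
    by (intro tendsto_ennrealI tendsto_intros quot phi_lim) auto
  from LIMSEQ_unique[OF A this]
  have "(\<integral>\<^sup>+x. ennreal (exp (- b * x)) * indicator {0..} x * ennreal (m * W x) \<partial>lborel) = ennreal (m / (phi b - phi th))"
    by simp
  also have "(\<integral>\<^sup>+x. ennreal (exp (- b * x)) * indicator {0..} x * ennreal (m * W x) \<partial>lborel) =
    (\<integral>\<^sup>+x. ennreal m * (indicator {0..} x * ennreal (exp (- b * x)) * ennreal (W x)) \<partial>lborel)"
    using m W_nonneg by (simp add: ennreal_mult ac_simps)
  also have "\<dots> = ennreal m * (\<integral>\<^sup>+x. indicator {0..} x * ennreal (exp (- b * x)) * ennreal (W x) \<partial>lborel)"
    by (rule nn_integral_cmult) measurable
  also have "ennreal (m / (phi b - phi th)) = ennreal m * ennreal (1 / (phi b - phi th))"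
    using m phi_strict[OF th b] by (simp add: ennreal_mult[symmetric])
  finally show ?thesis
    using m by (simp add: ennreal_mult_cancel_left)
qed


text \<open>Write \<open>G b\<close> for the Laplace transform of \<open>g\<close> on the half-line
  and \<open>D = phi b - phi th\<close>. The potential has transform
  \<open>(G th - G b) / D\<close>, the convolution of \<open>g\<close> with \<open>W\<close> has
  \<open>G b / D\<close>, and the sum \<open>G th / D\<close> is the transform of \<open>W\<close>
  times the constant \<open>G th\<close>. The formula for the potential density is thus stated
  without subtraction.\<close>

lemma renewal_AE:
  fixes g :: "real \<Rightarrow> real"
  assumes g: "continuous_on UNIV g" "\<And>z. 0 \<le> g z" "\<And>z. g z \<le> C" "\<And>z. R < z \<Longrightarrow> g z = 0"
  shows "AE x in lborel. 0 \<le> x \<longrightarrow>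
    potential (phi th) (\<lambda>z. ennreal (g z)) x + (\<integral>\<^sup>+y. indicator {0..} y * ennreal (g y * W (x - y)) \<partial>lborel)
    = ennreal (W x) * (\<integral>\<^sup>+y. indicator {0..} y * ennreal (g y * exp (- th * y)) \<partial>lborel)"
proof (rule laplace_determines_function[where a=th])
  have gm[measurable]: "g \<in> borel_measurable borel" using g(1) by (rule borel_measurable_continuous_onI)
  have C: "0 \<le> C" using g(2,3) order_trans by blast
  let ?U = "potential (phi th) (\<lambda>z. ennreal (g z))"
  let ?V = "\<lambda>x. \<integral>\<^sup>+y. indicator {0..} y * ennreal (g y * W (x - y)) \<partial>lborel"
  define I where "I = (\<integral>\<^sup>+y. indicator {0..} y * ennreal (g y * exp (- th * y)) \<partial>lborel)"
  have I_fin: "I < \<infinity>"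
  proof -
    have "I \<le> (\<integral>\<^sup>+y. ennreal C * indicator {0..R} y \<partial>lborel)"
      unfolding I_def
    proof (rule nn_integral_mono)
      fix y
      show "indicator {0..} y * ennreal (g y * exp (- th * y)) \<le> ennreal C * indicator {0..R} y"
      proof (cases "0 \<le> y \<and> y \<le> R")
        case True
        have "g y * exp (- th * y) \<le> C * 1" using True th C by (intro mult_mono g) auto
        then show ?thesis using True by (auto intro: ennreal_leI)
      qed (use g(4)[of y] in auto)
    qed
    also have "\<dots> < \<infinity>"
      by (subst nn_integral_cmult_indicator) (auto simp: ennreal_mult_less_top emeasure_lborel_Icc_eq)
    finally show ?thesis .
  qed
  show Vm: "(\<lambda>x. ?U x + ?V x) \<in> borel_measurable borel"
    by measurable
  show "(\<lambda>x. ennreal (W x) * (\<integral>\<^sup>+y. indicator {0..} y * ennreal (g y * exp (- th * y)) \<partial>lborel)) \<in> borel_measurable borel"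
    by measurable
  fix b assume b: "th < b"
  define D where "D = phi b - phi th"
  have D: "0 < D" using phi_strict[OF th b] by (simp add: D_def)
  have "(\<integral>\<^sup>+x. indicator {0..} x * ennreal (exp (- b * x)) * ?V x \<partial>lborel)
     = (\<integral>\<^sup>+x. \<integral>\<^sup>+y. indicator {0..} x * ennreal (exp (- b * x)) * (indicator {0..} y * ennreal (g y * W (x - y))) \<partial>lborel \<partial>lborel)"
    by (intro nn_integral_cong nn_integral_cmult[symmetric]) measurable
  also have "\<dots> = (\<integral>\<^sup>+y. \<integral>\<^sup>+x. indicator {0..} x * ennreal (exp (- b * x)) * (indicator {0..} y * ennreal (g y * W (x - y))) \<partial>lborel \<partial>lborel)"
    by (rule lborel_pair.Fubini'[symmetric]) measurable
  also have "\<dots> = (\<integral>\<^sup>+y. indicator {0..} y * ennreal (g y * exp (- b * y)) * ennreal (1 / D) \<partial>lborel)"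
  proof (rule nn_integral_cong)
    fix y :: real
    show "(\<integral>\<^sup>+x. indicator {0..} x * ennreal (exp (- b * x)) * (indicator {0..} y * ennreal (g y * W (x - y))) \<partial>lborel)
       = indicator {0..} y * ennreal (g y * exp (- b * y)) * ennreal (1 / D)"
    proof (cases "0 \<le> y")
      case True
      have "(\<integral>\<^sup>+x. indicator {0..} x * ennreal (exp (- b * x)) * (indicator {0..} y * ennreal (g y * W (x - y))) \<partial>lborel)
        = (\<integral>\<^sup>+z. indicator {0..} (y + z) * ennreal (exp (- b * (y + z))) * ennreal (g y * W z) \<partial>lborel)"
        using True by (subst nn_integral_real_affine[where c=1 and t=y]) auto
      also have "\<dots> = (\<integral>\<^sup>+z. ennreal (g y * exp (- b * y)) * (indicator {0..} z * ennreal (exp (- b * z)) * ennreal (W z)) \<partial>lborel)"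
      proof (rule nn_integral_cong)
        fix z :: real
        show "indicator {0..} (y + z) * ennreal (exp (- b * (y + z))) * ennreal (g y * W z)
          = ennreal (g y * exp (- b * y)) * (indicator {0..} z * ennreal (exp (- b * z)) * ennreal (W z))"
        proof (cases "0 \<le> z")
          case z: True
          have "exp (- b * (y + z)) * (g y * W z) = (g y * exp (- b * y)) * (exp (- b * z) * W z)"
            by (simp add: exp_add[symmetric] algebra_simps)
          then show ?thesis using z True g(2) W_nonneg by (simp add: ennreal_mult[symmetric])
        qed (simp add: W_def)
      qed
      also have "\<dots> = ennreal (g y * exp (- b * y)) * ennreal (1 / (phi b - phi th))"
        unfolding W_transform[OF b, symmetric] by (rule nn_integral_cmult) measurable
      finally show ?thesis using True by (simp add: D_def)
    qed simp
  qed
  finally have V: "(\<integral>\<^sup>+x. indicator {0..} x * ennreal (exp (- b * x)) * ?V x \<partial>lborel) =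
    (\<integral>\<^sup>+y. indicator {0..} y * ennreal (g y * exp (- b * y)) * ennreal (1 / D) \<partial>lborel)" .
  have U: "(\<integral>\<^sup>+x. indicator {0..} x * ennreal (exp (- b * x)) * ?U x \<partial>lborel) =
    (\<integral>\<^sup>+y. indicator {0..} y * ennreal (g y * ((exp (- th * y) - exp (- b * y)) / D)) \<partial>lborel)"
    using potential_transform[OF th b g(1,2)] by (simp add: D_def mult.commute)
  have "(\<integral>\<^sup>+x. indicator {0..} x * ennreal (exp (- b * x)) * (?U x + ?V x) \<partial>lborel) =
    (\<integral>\<^sup>+x. indicator {0..} x * ennreal (exp (- b * x)) * ?U x \<partial>lborel) + (\<integral>\<^sup>+x. indicator {0..} x * ennreal (exp (- b * x)) * ?V x \<partial>lborel)"
    unfolding distrib_left by (rule nn_integral_add) measurable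
  also have "\<dots> = (\<integral>\<^sup>+y. indicator {0..} y * ennreal (g y * ((exp (- th * y) - exp (- b * y)) / D)) + indicator {0..} y * ennreal (g y * exp (- b * y)) * ennreal (1 / D) \<partial>lborel)"
    unfolding U V by (rule nn_integral_add[symmetric]) measurable
  also have "\<dots> = (\<integral>\<^sup>+y. ennreal (1 / D) * (indicator {0..} y * ennreal (g y * exp (- th * y))) \<partial>lborel)"
  proof (rule nn_integral_cong)
    fix y :: real
    show "indicator {0..} y * ennreal (g y * ((exp (- th * y) - exp (- b * y)) / D)) + indicator {0..} y * ennreal (g y * exp (- b * y)) * ennreal (1 / D)
      = ennreal (1 / D) * (indicator {0..} y * ennreal (g y * exp (- th * y)))"
    proof (cases "0 \<le> y")
      case True
      have "0 \<le> (exp (- th * y) - exp (- b * y)) / D"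
        using b D True by (intro divide_nonneg_pos) (auto intro!: mult_right_mono)
      then have "ennreal (g y * ((exp (- th * y) - exp (- b * y)) / D)) + ennreal (g y * exp (- b * y)) * ennreal (1 / D)
        = ennreal (g y * ((exp (- th * y) - exp (- b * y)) / D) + g y * exp (- b * y) * (1 / D))"
        using g(2)[of y] D
        by (subst ennreal_plus) (auto simp del: times_divide_eq_right simp: ennreal_mult[symmetric])
      also have "g y * ((exp (- th * y) - exp (- b * y)) / D) + g y * exp (- b * y) * (1 / D) = 1 / D * (g y * exp (- th * y))"
        by (simp add: algebra_simps diff_divide_distrib)
      finally show ?thesis
        using True g(2)[of y] D by (simp add: ennreal_mult[symmetric])
    qed simp
  qed
  also have "\<dots> = ennreal (1 / D) * I"
    unfolding I_def by (rule nn_integral_cmult) measurable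
  finally have L: "(\<integral>\<^sup>+x. indicator {0..} x * ennreal (exp (- b * x)) * (?U x + ?V x) \<partial>lborel) = ennreal (1 / D) * I" .
  then show "(\<integral>\<^sup>+x. indicator {0..} x * ennreal (exp (- b * x)) * (?U x + ?V x) \<partial>lborel) < \<infinity>"
    using I_fin by (simp add: ennreal_mult_less_top)
  have "(\<integral>\<^sup>+x. indicator {0..} x * ennreal (exp (- b * x)) * (ennreal (W x) * I) \<partial>lborel)
    = (\<integral>\<^sup>+x. indicator {0..} x * ennreal (exp (- b * x)) * ennreal (W x) * I \<partial>lborel)"
    by (simp only: ac_simps)
  also have "\<dots> = ennreal (1 / D) * I"
    unfolding D_def W_transform[OF b, symmetric] by (rule nn_integral_multc) measurable
  finally show "(\<integral>\<^sup>+x. indicator {0..} x * ennreal (exp (- b * x)) * (?U x + ?V x) \<partial>lborel)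
    = (\<integral>\<^sup>+x. indicator {0..} x * ennreal (exp (- b * x)) * (ennreal (W x) * (\<integral>\<^sup>+y. indicator {0..} y * ennreal (g y * exp (- th * y)) \<partial>lborel)) \<partial>lborel)"
    unfolding L I_def by simp
qed

lemma AE_approach_right:
  assumes "AE x in lborel. 0 \<le> x \<longrightarrow> Q (x::real)" and "0 \<le> x" and "0 < r"
  shows "\<exists>y. x < y \<and> y < x + r \<and> Q y"
proof (rule ccontr)
  assume "\<not> ?thesis"
  then have "AE y in lborel. y \<notin> {x<..<x + r}"
    using assms(1) by (auto elim!: eventually_mono) (use \<open>0 \<le> x\<close> in force)
  then have "emeasure lborel {x<..<x + r} = 0"
    by (subst (asm) AE_iff_measurable[where N="{x<..<x + r}"]) auto
  then show False using \<open>0 < r\<close> by simp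
qed

text \<open>Dominated convergence in the starting point. At level 0 no discount supplies a majorant;
  it is the potential of a larger function \<open>k\<close> from a larger capital \<open>x'\<close>,
  whose finiteness is read off from \<open>renewal_AE\<close>.\<close>

lemma potential_right:
  fixes g :: "real \<Rightarrow> real"
  assumes g: "continuous_on UNIV g" "\<And>z. 0 \<le> g z" "\<And>z. g z \<le> C" "\<And>z. R < z \<Longrightarrow> g z = 0"
    and x: "0 \<le> x" and xn: "xn \<longlonglongrightarrow> x" "\<And>n. x < xn n" "\<And>n. xn n \<le> x + 1"
  shows "(\<lambda>n. potential (phi th) (\<lambda>z. ennreal (g z)) (xn n)) \<longlonglongrightarrow> potential (phi th) (\<lambda>z. ennreal (g z)) x"
proof -
  have gm[measurable]: "g \<in> borel_measurable borel" using g(1) by (rule borel_measurable_continuous_onI)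
  have C: "0 \<le> C" using g(2,3) order_trans by blast
  \<comment> \<open>\<open>k\<close> equals \<open>C\<close> up to \<open>\<bar>R\<bar> + 2\<close>.
    Since \<open>x'\<close> exceeds \<open>xn n\<close> by less than 2, the path from
    \<open>x'\<close> still sees the value \<open>C\<close> wherever the path from
    \<open>xn n\<close> meets the support of \<open>g\<close>.\<close>
  define k where "k z = C * max 0 (min 1 (\<bar>R\<bar> + 3 - z))" for z
  have kc: "continuous_on UNIV k" unfolding k_def[abs_def] by (intro continuous_intros)
  then have km[measurable]: "k \<in> borel_measurable borel" by (rule borel_measurable_continuous_onI)
  have k: "0 \<le> k z" "k z \<le> C" "\<bar>R\<bar> + 3 < z \<Longrightarrow> k z = 0" for z
    using C by (auto simp: k_def mult_left_le)
  \<comment> \<open>\<open>renewal_AE\<close> may fail at any prescribed point, so \<open>x'\<close>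
    is chosen among the good points above \<open>x + 1\<close>, which dominates all
    \<open>xn n\<close>.\<close>
  obtain x' where x': "x + 1 < x'" "x' < x + 1 + 1"
    and pot: "potential (phi th) (\<lambda>z. ennreal (k z)) x' + (\<integral>\<^sup>+y. indicator {0..} y * ennreal (k y * W (x' - y)) \<partial>lborel)
    = ennreal (W x') * (\<integral>\<^sup>+y. indicator {0..} y * ennreal (k y * exp (- th * y)) \<partial>lborel)"
    using AE_approach_right[where x="x + 1" and r=1, OF renewal_AE[OF kc k]] x by auto
  have "(\<integral>\<^sup>+y. indicator {0..} y * ennreal (k y * exp (- th * y)) \<partial>lborel) \<le> (\<integral>\<^sup>+y. ennreal C * indicator {0..\<bar>R\<bar> + 3} y \<partial>lborel)"
  proof (rule nn_integral_mono)
    fix y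
    show "indicator {0..} y * ennreal (k y * exp (- th * y)) \<le> ennreal C * indicator {0..\<bar>R\<bar> + 3} y"
    proof (cases "0 \<le> y \<and> y \<le> \<bar>R\<bar> + 3")
      case True
      have "k y * exp (- th * y) \<le> C * 1" using True th C by (intro mult_mono k) auto
      then show ?thesis using True by (auto intro: ennreal_leI)
    qed (use k(3)[of y] in auto)
  qed
  also have "\<dots> < \<infinity>"
    by (subst nn_integral_cmult_indicator) (auto simp: ennreal_mult_less_top emeasure_lborel_Icc_eq)
  finally have "ennreal (W x') * (\<integral>\<^sup>+y. indicator {0..} y * ennreal (k y * exp (- th * y)) \<partial>lborel) < \<infinity>"
    by (simp add: ennreal_mult_less_top)
  then have fin: "potential (phi th) (\<lambda>z. ennreal (k z)) x' < \<infinity>"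
    unfolding pot[symmetric] by simp
  define Z where "Z f y t \<omega> = indicator {0..} t * ennreal (exp (- phi th * t)) *
      (ennreal (f (y + S t \<omega>)) * indicator {\<omega>. alive y t \<omega>} \<omega>)" for f y t \<omega>
  have Zi: "potential (phi th) (\<lambda>z. ennreal (f z)) y = (\<integral>\<^sup>+\<omega>. \<integral>\<^sup>+t. Z f y t \<omega> \<partial>lborel \<partial>M)" for f y
    by (simp add: potential_def Z_def)
  have Zm: "(\<lambda>\<omega>. \<integral>\<^sup>+t. Z f y t \<omega> \<partial>lborel) \<in> borel_measurable M"
    "\<omega> \<in> space M \<Longrightarrow> (\<lambda>t. Z f y t \<omega>) \<in> borel_measurable lborel" if [measurable]: "f \<in> borel_measurable borel" for f y \<omega>
    unfolding Z_def by (rule measurable_potential_inner; measurable)+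
  have dom: "Z g (xn n) t \<omega> \<le> Z k x' t \<omega>" for n t \<omega>
  proof -
    have "g (xn n + S t \<omega>) \<le> k (x' + S t \<omega>)"
    proof (cases "R < xn n + S t \<omega>")
      case True
      then show ?thesis using g(4) k(1) by simp
    next
      case False
      then have "x' + S t \<omega> \<le> \<bar>R\<bar> + 2" using x' xn(2)[of n] by linarith
      then have "k (x' + S t \<omega>) = C" by (simp add: k_def)
      then show ?thesis using g(3) by simp
    qed
    moreover have "alive (xn n) t \<omega> \<Longrightarrow> alive x' t \<omega>"
      using x' xn(3)[of n] by (fastforce simp: alive_def)
    ultimately show ?thesis
      by (auto simp: Z_def indicator_def intro!: mult_left_mono ennreal_leI)
  qed
  have lim: "(\<lambda>n. Z g (xn n) t \<omega>) \<longlonglongrightarrow> Z g x t \<omega>" for t \<omega>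
  proof -
    have "(\<lambda>n. g (xn n + S t \<omega>)) \<longlonglongrightarrow> g (x + S t \<omega>)"
      using g(1) by (intro continuous_on_tendsto_compose[of UNIV g] tendsto_intros xn) auto
    then have "(\<lambda>n. indicator {0..} t * ennreal (exp (- phi th * t)) * (ennreal (g (xn n + S t \<omega>)) * indicator {\<omega>. alive x t \<omega>} \<omega>)) \<longlonglongrightarrow> Z g x t \<omega>"
      unfolding Z_def by (intro tendsto_mult_ennreal tendsto_const tendsto_ennrealI) (auto simp: indicator_def)
    then show ?thesis
    proof (rule Lim_transform_eventually)
      show "eventually (\<lambda>n. indicator {0..} t * ennreal (exp (- phi th * t)) * (ennreal (g (xn n + S t \<omega>)) * indicator {\<omega>. alive x t \<omega>} \<omega>) = Z g (xn n) t \<omega>) sequentially"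
        using alive_right[OF xn(1,2), of t \<omega>] by eventually_elim (simp add: Z_def indicator_def)
    qed
  qed
  have "AE \<omega> in M. (\<integral>\<^sup>+t. Z k x' t \<omega> \<partial>lborel) \<noteq> \<infinity>"
    by (rule nn_integral_PInf_AE[OF Zm(1)[OF km]]) (use fin in \<open>simp add: Zi less_top\<close>)
  then have "AE \<omega> in M. (\<lambda>n. \<integral>\<^sup>+t. Z g (xn n) t \<omega> \<partial>lborel) \<longlonglongrightarrow> (\<integral>\<^sup>+t. Z g x t \<omega> \<partial>lborel)"
    using AE_space
  proof eventually_elim
    case (elim \<omega>)
    then show ?case
      by (intro nn_integral_dominated_convergence[where w="\<lambda>t. Z k x' t \<omega>"] Zm gm km AE_I2 dom lim)
         (auto simp: less_top)
  qed
  then show ?thesis unfolding Zi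
    by (intro nn_integral_dominated_convergence[where w="\<lambda>\<omega>. \<integral>\<^sup>+t. Z k x' t \<omega> \<partial>lborel"] Zm gm km)
       (use fin in \<open>auto simp: Zi[symmetric] intro!: AE_I2 nn_integral_mono dom\<close>)
qed

text \<open>All terms are continuous from the right in \<open>x\<close>, and the points where the
  identity is known accumulate at \<open>x\<close> from the right. Holding at every \<open>x\<close>
  matters because the law of the surplus before ruin is wanted for one given capital.\<close>

theorem renewal:
  fixes g :: "real \<Rightarrow> real"
  assumes g: "continuous_on UNIV g" "\<And>z. 0 \<le> g z" "\<And>z. g z \<le> C" "\<And>z. R < z \<Longrightarrow> g z = 0"
    and x: "0 \<le> x"
  shows "potential (phi th) (\<lambda>z. ennreal (g z)) x + (\<integral>\<^sup>+y. indicator {0..} y * ennreal (g y * W (x - y)) \<partial>lborel)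
    = ennreal (W x) * (\<integral>\<^sup>+y. indicator {0..} y * ennreal (g y * exp (- th * y)) \<partial>lborel)"
proof -
  have gm[measurable]: "g \<in> borel_measurable borel" using g(1) by (rule borel_measurable_continuous_onI)
  have C: "0 \<le> C" using g(2,3) order_trans by blast
  define I where "I = (\<integral>\<^sup>+y. indicator {0..} y * ennreal (g y * exp (- th * y)) \<partial>lborel)"
  let ?V = "\<lambda>x. \<integral>\<^sup>+y. indicator {0..} y * ennreal (g y * W (x - y)) \<partial>lborel"
  have "\<forall>n. \<exists>y. x < y \<and> y < x + 1 / real (Suc n) \<and>
     potential (phi th) (\<lambda>z. ennreal (g z)) y + ?V y = ennreal (W y) * I"
    unfolding I_def by (intro allI AE_approach_right[OF renewal_AE[OF g] x] divide_pos_pos) simp_all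
  from choice[OF this] obtain xn where "\<forall>n. x < xn n \<and> xn n < x + 1 / real (Suc n) \<and>
     potential (phi th) (\<lambda>z. ennreal (g z)) (xn n) + ?V (xn n) = ennreal (W (xn n)) * I" by (elim exE)
  then have xn: "\<And>n. x < xn n" "\<And>n. xn n < x + 1 / real (Suc n)"
     "\<And>n. potential (phi th) (\<lambda>z. ennreal (g z)) (xn n) + ?V (xn n) = ennreal (W (xn n)) * I"
    by simp_all
  have "(\<lambda>n. x + 1 / real (Suc n)) \<longlonglongrightarrow> x" by real_asymp
  then have lim: "xn \<longlonglongrightarrow> x"
    by (rule tendsto_sandwich[rotated 3]) (use xn in \<open>auto intro!: always_eventually less_imp_le\<close>)
  have le1: "xn n \<le> x + 1" for n
  proof -
    have "1 / real (Suc n) \<le> 1" by (simp add: field_simps)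
    then show ?thesis using xn(2)[of n] by linarith
  qed
  have "(\<lambda>n. ?V (xn n)) \<longlonglongrightarrow> ?V x"
  proof (rule nn_integral_dominated_convergence[where w="\<lambda>y. ennreal (C * (exp (th * (x + 1)) / m)) * indicator {0..R} y"])
    show "(\<integral>\<^sup>+y. ennreal (C * (exp (th * (x + 1)) / m)) * indicator {0..R} y \<partial>lborel) < \<infinity>"
      by (subst nn_integral_cmult_indicator) (auto simp: ennreal_mult_less_top emeasure_lborel_Icc_eq)
    show "AE y in lborel. indicator {0..} y * ennreal (g y * W (xn n - y)) \<le> ennreal (C * (exp (th * (x + 1)) / m)) * indicator {0..R} y" for n
    proof (rule AE_I2)
      fix y
      show "indicator {0..} y * ennreal (g y * W (xn n - y)) \<le> ennreal (C * (exp (th * (x + 1)) / m)) * indicator {0..R} y"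
      proof (cases "0 \<le> y \<and> y \<le> R")
        case True
        have "th * (xn n - y) \<le> th * (x + 1)" using th le1[of n] True by (intro mult_left_mono) auto
        then have "exp (th * (xn n - y)) / m \<le> exp (th * (x + 1)) / m" using m by (simp add: divide_right_mono)
        then have "W (xn n - y) \<le> exp (th * (x + 1)) / m"
          using W_le[of "xn n - y"] by simp
        then have "g y * W (xn n - y) \<le> C * (exp (th * (x + 1)) / m)" using C W_nonneg by (intro mult_mono g) auto
        then show ?thesis using True by (auto intro: ennreal_leI)
      qed (use g(4)[of y] in auto)
    qed
    show "AE y in lborel. (\<lambda>n. indicator {0..} y * ennreal (g y * W (xn n - y))) \<longlonglongrightarrow> indicator {0..} y * ennreal (g y * W (x - y))"
    proof (rule AE_I2)
      fix y
      have "(\<lambda>n. W (xn n - y)) \<longlonglongrightarrow> W (x - y)"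
      proof (cases "y \<le> x")
        case True
        then show ?thesis using xn(1) by (intro W_right tendsto_intros lim) auto
      next
        case False
        have "eventually (\<lambda>n. xn n < y) sequentially"
          by (rule order_tendstoD(2)[OF lim]) (use False in simp)
        then have "eventually (\<lambda>n. W (xn n - y) = W (x - y)) sequentially"
          by eventually_elim (use False in \<open>simp add: W_def\<close>)
        then show ?thesis by (rule tendsto_eventually)
      qed
      then show "(\<lambda>n. indicator {0..} y * ennreal (g y * W (xn n - y))) \<longlonglongrightarrow> indicator {0..} y * ennreal (g y * W (x - y))"
        by (intro tendsto_mult_ennreal tendsto_const tendsto_ennrealI tendsto_mult) (auto simp: indicator_def)
    qed
  qed measurable
  then have L: "(\<lambda>n. potential (phi th) (\<lambda>z. ennreal (g z)) (xn n) + ?V (xn n)) \<longlonglongrightarrow> potential (phi th) (\<lambda>z. ennreal (g z)) x + ?V x"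
    by (intro tendsto_add potential_right[OF g x lim xn(1) le1])
  have "I \<le> (\<integral>\<^sup>+y. ennreal C * indicator {0..R} y \<partial>lborel)"
    unfolding I_def
  proof (rule nn_integral_mono)
    fix y
    show "indicator {0..} y * ennreal (g y * exp (- th * y)) \<le> ennreal C * indicator {0..R} y"
    proof (cases "0 \<le> y \<and> y \<le> R")
      case True
      have "g y * exp (- th * y) \<le> C * 1" using True th C by (intro mult_mono g) auto
      then show ?thesis using True by (auto intro: ennreal_leI)
    qed (use g(4)[of y] in auto)
  qed
  also have "\<dots> < \<infinity>"
    by (subst nn_integral_cmult_indicator) (auto simp: ennreal_mult_less_top emeasure_lborel_Icc_eq)
  finally have "I < \<infinity>" .
  then have "(\<lambda>n. ennreal (W (xn n)) * I) \<longlonglongrightarrow> ennreal (W x) * I"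
    by (intro tendsto_mult_ennreal tendsto_const tendsto_ennrealI W_right x lim xn(1)) auto
  then have "potential (phi th) (\<lambda>z. ennreal (g z)) x + ?V x = ennreal (W x) * I"
    using L unfolding xn(3) by (rule LIMSEQ_unique[rotated])
  then show ?thesis by (simp add: I_def)
qed

end

section \<open>Ruin by a claim\<close>

text \<open>\<open>g\<close> weighs the last grid value before ruin and \<open>kap\<close> the first
  one after it. If \<open>kap\<close> vanishes on the half-line, at most one summand is nonzero,
  that of the first passage below 0 on the grid. The discount is taken at the last grid time before
  this passage, which keeps the \<open>i\<close>-th factor independent of step
  \<open>i + 1\<close>.\<close>

definition ruin_sum :: "(real \<Rightarrow> real) \<Rightarrow> real \<Rightarrow> (real \<Rightarrow> real) \<Rightarrow> (real \<Rightarrow> real) \<Rightarrow> real \<Rightarrow> ennreal" where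
  "ruin_sum X q g kap h = (\<Sum>i. ennreal (exp (- (h * q))) ^ i *
     (indicator {i. \<forall>k\<le>i. 0 \<le> X (real k * h)} i * ennreal (g (X (real i * h)) * kap (X (real (Suc i) * h)))))"

definition ruin_value :: "(real \<Rightarrow> real) \<Rightarrow> real \<Rightarrow> (real \<Rightarrow> real) \<Rightarrow> (real \<Rightarrow> real) \<Rightarrow> real" where
  "ruin_value X q g kap = (if ruin_time X < \<infinity> then (let T = real_of_ereal (ruin_time X) in
     exp (- q * T) * (g (Lim (at_left T) X) * kap (X T))) else 0)"

section \<open>A fixed path: ruin seen on the grid\<close>

locale cadlag_path =
  fixes X :: "real \<Rightarrow> real"
  assumes right: "0 \<le> t \<Longrightarrow> (X \<longlongrightarrow> X t) (at_right t)"
    and left: "0 < t \<Longrightarrow> \<exists>l. (X \<longlongrightarrow> l) (at_left t)"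
begin

text \<open>Allows \<open>s n = t\<close>, unlike the filter \<open>at_right t\<close>; grid points
  may hit the ruin time exactly.\<close>

lemma tendsto_from_right:
  assumes "0 \<le> t" "s \<longlonglongrightarrow> t" "\<And>n::nat. t \<le> s n"
  shows "(\<lambda>n. X (s n)) \<longlonglongrightarrow> X t"
proof -
  have "at t within {t..} = at_right t"
    unfolding at_within_def by (rule arg_cong[where f="\<lambda>A. inf (nhds t) (principal A)"]) auto
  then have "(X \<longlongrightarrow> X t) (at t within {t..})" using right[OF assms(1)] by simp
  then have "continuous (at t within {t..}) X" by (simp add: continuous_within)
  then show ?thesis
    by (rule continuous_within_tendsto_compose'[OF _ _ assms(2)]) (use assms(3) in simp)
qed

lemma tendsto_mesh_up:
  assumes "0 \<le> t"
  shows "(\<lambda>n. X (mesh_up n t)) \<longlonglongrightarrow> X t"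
  by (rule tendsto_from_right[OF assms mesh_up_tendsto[OF assms]]) (use mesh_up_bounds assms in \<open>auto intro: less_imp_le\<close>)

lemma ruin_time_nonneg: "0 \<le> ruin_time X"
  unfolding ruin_time_def by (rule Inf_greatest) auto

lemma ruin_le: "0 \<le> t \<Longrightarrow> X t < 0 \<Longrightarrow> ruin_time X \<le> ereal t"
  unfolding ruin_time_def by (rule Inf_lower) auto

lemma before_ruin: "0 \<le> t \<Longrightarrow> ereal t < ruin_time X \<Longrightarrow> 0 \<le> X t"
  using ruin_le[of t] by (force simp: not_le[symmetric])

lemma after_ruin:
  assumes "ruin_time X = ereal T" "T < b"
  shows "\<exists>t\<ge>T. t < b \<and> 0 \<le> t \<and> X t < 0"
proof -
  have "Inf {ereal t |t. 0 \<le> t \<and> X t < 0} < ereal b"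
    using assms by (simp add: ruin_time_def)
  then obtain t where t: "0 \<le> t" "X t < 0" "t < b" by (auto simp: Inf_less_iff)
  then show ?thesis using ruin_le[of t] assms(1) by auto
qed

text \<open>The infimum defining the ruin time need not be attained, for instance when the path
  creeps through 0; so only the weak inequality is available.\<close>

lemma ruin_value_nonpos:
  assumes T: "ruin_time X = ereal T" shows "X T \<le> 0" "0 \<le> T"
proof -
  show T0: "0 \<le> T" using ruin_time_nonneg T by simp
  show "X T \<le> 0"
  proof (rule ccontr)
    assume "\<not> X T \<le> 0"
    then have "eventually (\<lambda>s. 0 < X s) (at_right T)"
      using order_tendstoD(1)[OF right[OF T0], of 0] by simp
    then obtain b where b: "T < b" "\<And>s. T < s \<Longrightarrow> s < b \<Longrightarrow> 0 < X s"
      by (auto simp: eventually_at_right_field)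
    obtain t where "T \<le> t" "t < b" "X t < 0" using after_ruin[OF T b(1)] by auto
    then show False using b(2)[of t] \<open>\<not> X T \<le> 0\<close> by (cases "t = T") auto
  qed
qed

lemma ruin_sum_single:
  assumes kap: "\<And>z. 0 \<le> z \<Longrightarrow> kap z = 0" and j: "X (real (Suc j) * h) < 0" "\<And>k. k \<le> j \<Longrightarrow> 0 \<le> X (real k * h)"
  shows "ruin_sum X q g kap h = ennreal (exp (- (h * q)) ^ j * (g (X (real j * h)) * kap (X (real (Suc j) * h))))"
proof -
  have "ruin_sum X q g kap h = (\<Sum>i\<in>{j}. ennreal (exp (- (h * q))) ^ i *
     (indicator {i. \<forall>k\<le>i. 0 \<le> X (real k * h)} i * ennreal (g (X (real i * h)) * kap (X (real (Suc i) * h)))))"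
    unfolding ruin_sum_def
  proof (rule suminf_finite)
    fix i assume i: "i \<notin> {j}"
    show "ennreal (exp (- (h * q))) ^ i *
     (indicator {i. \<forall>k\<le>i. 0 \<le> X (real k * h)} i * ennreal (g (X (real i * h)) * kap (X (real (Suc i) * h)))) = 0"
    proof (cases "i < j")
      case True
      then have "kap (X (real (Suc i) * h)) = 0" by (intro kap j) simp
      then show ?thesis by simp
    next
      case False
      then have "Suc j \<le> i" using i by auto
      then have "\<not> (\<forall>k\<le>i. 0 \<le> X (real k * h))" using j(1) by (auto simp: not_le intro!: exI[of _ "Suc j"])
      then show ?thesis by (simp del: not_all)
    qed
  qed simp
  also have "\<dots> = ennreal (exp (- (h * q)) ^ j * (g (X (real j * h)) * kap (X (real (Suc j) * h))))"
    using j(2) by (simp add: ennreal_mult' ennreal_power)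
  finally show ?thesis .
qed

lemma ruin_sum_none:
  assumes kap: "\<And>z. 0 \<le> z \<Longrightarrow> kap z = 0" and "\<And>k. 0 \<le> X (real k * h)"
  shows "ruin_sum X q g kap h = 0"
  unfolding ruin_sum_def by (simp only: kap assms mult_zero_right ennreal_0 suminf_zero)

lemma first_below:
  assumes "0 \<le> X 0"
  obtains "\<And>k. 0 \<le> X (real k * h)" | j where "X (real (Suc j) * h) < 0" "\<And>k. k \<le> j \<Longrightarrow> 0 \<le> X (real k * h)"
proof (cases "\<exists>k. X (real k * h) < 0")
  case True
  define i where "i = (LEAST k. X (real k * h) < 0)"
  have i: "X (real i * h) < 0" using True unfolding i_def by (rule LeastI_ex)
  have li: "k < i \<Longrightarrow> 0 \<le> X (real k * h)" for k using not_less_Least[of k "\<lambda>k. X (real k * h) < 0"] by (simp add: i_def not_less)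
  obtain j where "i = Suc j" using i assms by (cases i) auto
  then show ?thesis using that(2)[of j] i li by auto
qed (auto simp: not_less intro: that(1))

lemma ruin_sum_le:
  assumes "0 \<le> X 0" "0 \<le> q" "0 \<le> h" and kap: "\<And>z. 0 \<le> z \<Longrightarrow> kap z = 0" "\<And>z. 0 \<le> kap z" "\<And>z. kap z \<le> 1"
    and g: "\<And>z. 0 \<le> g z" "\<And>z. g z \<le> C"
  shows "ruin_sum X q g kap h \<le> ennreal C"
  using assms(1)
proof (rule first_below[of h])
  assume "\<And>k. 0 \<le> X (real k * h)"
  then show ?thesis using ruin_sum_none[of kap h q g] kap by simp
next
  fix j assume j: "X (real (Suc j) * h) < 0" "\<And>k. k \<le> j \<Longrightarrow> 0 \<le> X (real k * h)"
  have "exp (- (h * q)) ^ j * (g (X (real j * h)) * kap (X (real (Suc j) * h))) \<le> 1 * (C * 1)"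
    using assms order_trans[OF g] by (intro mult_mono power_le_one g kap) auto
  moreover have "ruin_sum X q g kap h = ennreal (exp (- (h * q)) ^ j * (g (X (real j * h)) * kap (X (real (Suc j) * h))))"
    by (rule ruin_sum_single[OF kap(1) j])
  ultimately show ?thesis by (simp add: ennreal_leI)
qed

text \<open>The first grid time with a negative value tends to \<open>T\<close> from the right, so
  the grid deficit converges. The last grid value before it tends to the left limit if
  \<open>X T < 0\<close>; if \<open>X T = 0\<close> it may fail to, but then \<open>kap\<close>
  tends to 0 and the bound \<open>C\<close> on \<open>g\<close> suffices.\<close>

lemma ruin_sum_tendsto:
  assumes X0: "0 \<le> X 0" and q: "0 \<le> q" and kap: "\<And>z. 0 \<le> z \<Longrightarrow> kap z = 0" "continuous_on UNIV kap"
    and g: "continuous_on UNIV g" "\<And>z. 0 \<le> g z" "\<And>z. g z \<le> C"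
  shows "(\<lambda>n. ruin_sum X q g kap (mesh n)) \<longlonglongrightarrow> ennreal (ruin_value X q g kap)"
proof (cases "ruin_time X < \<infinity>")
  case False
  then have inf: "ruin_time X = \<infinity>" by simp
  have "0 \<le> X (real k * mesh n)" for k n
    by (rule before_ruin) (auto simp: inf less_imp_le)
  then have "ruin_sum X q g kap (mesh n) = 0" for n by (intro ruin_sum_none kap)
  then show ?thesis using False by (simp add: ruin_value_def)
next
  case True
  then obtain T where T: "ruin_time X = ereal T" using ruin_time_nonneg by (cases "ruin_time X") auto
  have T0: "0 \<le> T" and XT: "X T \<le> 0" using ruin_value_nonpos[OF T] by auto
  have below_ge: "T \<le> t" if "0 \<le> t" "X t < 0" for t using ruin_le[OF that] T by simp
  have ev_below: "eventually (\<lambda>n. \<exists>k. X (real k * mesh n) < 0 \<and> real k * mesh n < T + e) sequentially" if e: "0 < e" for e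
  proof -
    obtain t where t: "T \<le> t" "t < T + e" "0 \<le> t" "X t < 0" using after_ruin[OF T, of "T + e"] e by auto
    have "(\<lambda>n. X (mesh_up n t)) \<longlonglongrightarrow> X t"
      by (rule tendsto_mesh_up[OF t(3)])
    then have "eventually (\<lambda>n. X (mesh_up n t) < 0) sequentially" using t(4) by (rule order_tendstoD(2))
    moreover have "eventually (\<lambda>n. mesh_up n t < T + e) sequentially"
      by (rule order_tendstoD(2)[OF mesh_up_tendsto[OF t(3)] t(2)])
    ultimately show ?thesis unfolding mesh_up_def by eventually_elim blast
  qed
  define i where "i n = (LEAST k. X (real k * mesh n) < 0)" for n
  have ex: "eventually (\<lambda>n. \<exists>k. X (real k * mesh n) < 0) sequentially"
    using ev_below[of 1] by (auto elim!: eventually_mono)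
  have iD: "X (real (i n) * mesh n) < 0" "k < i n \<Longrightarrow> 0 \<le> X (real k * mesh n)" "0 < i n" "T \<le> real (i n) * mesh n"
     "X (real l * mesh n) < 0 \<Longrightarrow> i n \<le> l"
    if "\<exists>k. X (real k * mesh n) < 0" for n k l
  proof -
    show 1: "X (real (i n) * mesh n) < 0" using that unfolding i_def by (rule LeastI_ex)
    show "k < i n \<Longrightarrow> 0 \<le> X (real k * mesh n)" using not_less_Least[of k "\<lambda>k. X (real k * mesh n) < 0"] by (simp add: i_def not_less)
    show "0 < i n" using 1 X0 by (cases "i n") auto
    show "T \<le> real (i n) * mesh n" using 1 by (intro below_ge) (auto simp: less_imp_le)
    show "X (real l * mesh n) < 0 \<Longrightarrow> i n \<le> l" unfolding i_def by (rule Least_le)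
  qed
  \<comment> \<open>\<open>LEAST\<close> is unspecified when no grid value is negative. The maximum
    keeps \<open>s n\<close> on the right of \<open>T\<close> for every \<open>n\<close> and changes
    nothing for large \<open>n\<close>.\<close>
  define s where "s n = max T (real (i n) * mesh n)" for n
  have s_eq: "eventually (\<lambda>n. s n = real (i n) * mesh n) sequentially"
    using ex by eventually_elim (use iD in \<open>auto simp: s_def\<close>)
  have s_lim: "s \<longlonglongrightarrow> T"
  proof (rule order_tendstoI)
    fix a assume "a < T" then show "eventually (\<lambda>n. a < s n) sequentially"
      by (intro always_eventually) (auto simp: s_def)
  next
    fix a assume "T < a"
    then have "eventually (\<lambda>n. \<exists>k. X (real k * mesh n) < 0 \<and> real k * mesh n < a) sequentially"
      using ev_below[of "a - T"] by simp
    then show "eventually (\<lambda>n. s n < a) sequentially"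
    proof eventually_elim
      case (elim n)
      then obtain k where k: "X (real k * mesh n) < 0" "real k * mesh n < a" by auto
      have "real (i n) * mesh n \<le> real k * mesh n"
        using iD(5)[of n k] k by (intro mult_right_mono) (auto simp: less_imp_le)
      from le_less_trans[OF this k(2)] show ?case using \<open>T < a\<close> by (simp add: s_def)
    qed
  qed
  have Xs: "(\<lambda>n. X (s n)) \<longlonglongrightarrow> X T"
    by (rule tendsto_from_right[OF T0 s_lim]) (simp add: s_def)
  have ks: "(\<lambda>n. kap (X (s n))) \<longlonglongrightarrow> kap (X T)"
    using kap(2) by (intro continuous_on_tendsto_compose[OF kap(2) Xs]) auto
  let ?v = "\<lambda>n. exp (- (mesh n * q)) ^ (i n - 1) * (g (X (real (i n - 1) * mesh n)) * kap (X (s n)))"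
  have sum_eq: "eventually (\<lambda>n. ruin_sum X q g kap (mesh n) = ennreal (?v n)) sequentially"
    using ex s_eq
  proof eventually_elim
    case (elim n)
    note iD = iD[OF elim(1)]
    obtain j where j: "i n = Suc j" using iD(3) by (cases "i n") auto
    have "ruin_sum X q g kap (mesh n) = ennreal (exp (- (mesh n * q)) ^ j * (g (X (real j * mesh n)) * kap (X (real (Suc j) * mesh n))))"
      by (rule ruin_sum_single[OF kap(1)]) (use iD j in auto)
    then show ?case using elim(2) j by simp
  qed
  have v_lim: "?v \<longlonglongrightarrow> exp (- q * T) * (g (Lim (at_left T) X) * kap (X T))"
  proof (cases "X T = 0")
    case True
    \<comment> \<open>Creeping: the product vanishes in the limit whatever the prior surplus does,
      since \<open>kap 0 = 0\<close> and \<open>kap\<close> is continuous.\<close>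
    have "(\<lambda>n. C * \<bar>kap (X (s n))\<bar>) \<longlonglongrightarrow> C * \<bar>kap (X T)\<bar>"
      by (intro tendsto_intros ks)
    then have z: "(\<lambda>n. C * \<bar>kap (X (s n))\<bar>) \<longlonglongrightarrow> 0" using True kap(1)[of 0] by simp
    have "?v \<longlonglongrightarrow> 0"
    proof (rule Lim_null_comparison[OF _ z])
      show "eventually (\<lambda>n. norm (?v n) \<le> C * \<bar>kap (X (s n))\<bar>) sequentially"
      proof (intro always_eventually allI)
        fix n
        have "\<bar>exp (- (mesh n * q)) ^ (i n - 1)\<bar> * (\<bar>g (X (real (i n - 1) * mesh n))\<bar> * \<bar>kap (X (s n))\<bar>) \<le> 1 * (C * \<bar>kap (X (s n))\<bar>)"
          using q g(2,3) order_trans[OF g(2,3)] mesh_pos[of n]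
          by (intro mult_mono) (auto intro!: power_le_one simp: less_imp_le)
        then show "norm (?v n) \<le> C * \<bar>kap (X (s n))\<bar>" by (simp add: abs_mult)
      qed
    qed
    then show ?thesis using True kap(1)[of 0] by simp
  next
    case False
    then have neg: "X T < 0" using XT by simp
    then have "0 < T" using X0 T0 by (cases "T = 0") auto
    then obtain l where l: "(X \<longlongrightarrow> l) (at_left T)" using left by blast
    then have L: "Lim (at_left T) X = l" by (intro tendsto_Lim) auto
    define w where "w n = real (i n - 1) * mesh n" for n
    \<comment> \<open>\<open>u n\<close> is the first grid point at or after \<open>T\<close>. By
      right continuity \<open>X\<close> is negative there for large \<open>n\<close>, so the first
      negative grid value comes no later and its predecessor \<open>w n\<close> lies within one mesh
      to the left of \<open>T\<close>.\<close>
    define u where "u n = real (nat \<lceil>T / mesh n\<rceil>) * mesh n" for n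
    have u: "T \<le> u n" "u n < T + mesh n" for n
    proof -
      have "0 \<le> T / mesh n" using T0 by (simp add: less_imp_le)
      then have "0 \<le> \<lceil>T / mesh n\<rceil>" by linarith
      then have "u n = of_int \<lceil>T / mesh n\<rceil> * mesh n" by (simp add: u_def)
      then show "T \<le> u n" "u n < T + mesh n"
        using ceiling_divide_upper[of "mesh n" T] ceiling_divide_lower[of "mesh n" T] by (auto simp: algebra_simps)
    qed
    have "u \<longlonglongrightarrow> T"
    proof (rule tendsto_sandwich[of "\<lambda>_. T" _ _ "\<lambda>n. T + mesh n"])
      show "(\<lambda>n. T + mesh n) \<longlonglongrightarrow> T"
        using tendsto_add[OF tendsto_const mesh_tendsto, of T] by simp
    qed (use u in \<open>auto intro!: always_eventually less_imp_le\<close>)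
    then have "(\<lambda>n. X (u n)) \<longlonglongrightarrow> X T" using u by (intro tendsto_from_right T0)
    then have "eventually (\<lambda>n. X (u n) < 0) sequentially" using neg by (rule order_tendstoD(2))
    then have w: "eventually (\<lambda>n. T - mesh n \<le> w n \<and> w n < T) sequentially"
    proof eventually_elim
      case (elim n)
      have exn: "\<exists>k. X (real k * mesh n) < 0" using elim by (auto simp: u_def)
      note iD = iD[OF exn]
      have "real (i n) * mesh n \<le> u n"
        using iD(5) elim unfolding u_def by (intro mult_right_mono) (auto simp: less_imp_le)
      moreover have "w n = real (i n) * mesh n - mesh n"
        using iD(3) by (simp add: w_def of_nat_diff algebra_simps)
      ultimately show ?case using iD(4) u(2)[of n] by simp
    qed
    have w_lim: "w \<longlonglongrightarrow> T"
    proof (rule tendsto_sandwich[OF _ _ _ tendsto_const])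
      show "(\<lambda>n. T - mesh n) \<longlonglongrightarrow> T"
        using tendsto_diff[OF tendsto_const mesh_tendsto, of T] by simp
      show "eventually (\<lambda>n. T - mesh n \<le> w n) sequentially" "eventually (\<lambda>n. w n \<le> T) sequentially"
        using w by (auto elim!: eventually_mono)
    qed
    have "filterlim w (at_left T) sequentially"
      unfolding filterlim_at using w w_lim by (auto elim!: eventually_mono)
    then have "(\<lambda>n. X (w n)) \<longlonglongrightarrow> l" using l by (rule filterlim_compose[rotated])
    then have "(\<lambda>n. g (X (w n))) \<longlonglongrightarrow> g l"
      by (intro continuous_on_tendsto_compose[OF g(1)]) auto
    moreover have "exp (- (mesh n * q)) ^ (i n - 1) = exp (- q * w n)" for n
      unfolding w_def by (subst exp_of_nat_mult[symmetric]) (simp add: algebra_simps)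
    ultimately show ?thesis
      unfolding L w_def[symmetric] by (auto intro!: tendsto_intros w_lim ks)
  qed
  have rv: "ruin_value X q g kap = exp (- q * T) * (g (Lim (at_left T) X) * kap (X T))"
    by (simp add: ruin_value_def T)
  show ?thesis unfolding rv
    by (rule Lim_transform_eventually[OF tendsto_ennrealI[OF v_lim]])
       (use sum_eq in \<open>auto elim!: eventually_mono\<close>)
qed

end

text \<open>\<open>small_time_jump\<close> says that from a level at least \<open>del\<close>,
  becoming negative within a short time happens by a single claim, at rate \<open>lam\<close>. The
  error is required to be uniform only away from 0: from points near 0 premium and Brownian motion
  compete with the claims.\<close>

locale jump_process = skeleton_process M F phi c v d S
  for M :: "'a measure" and F phi c v d S +
  fixes lam :: real and nu :: "real measure"
  assumes lam: "0 < lam" and nu: "real_distribution nu"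
    and small_time_jump: "\<And>kap K del e. \<lbrakk>\<And>z. 0 \<le> kap z; \<And>z. kap z \<le> 1; \<And>z. 0 \<le> z \<Longrightarrow> kap z = 0; 0 \<le> K;
        \<And>y z. \<bar>kap y - kap z\<bar> \<le> K * \<bar>y - z\<bar>; 0 < del; 0 < e\<rbrakk> \<Longrightarrow>
      eventually (\<lambda>h. \<forall>z\<ge>del. \<bar>(\<integral>u. kap (z + u) \<partial>F h) / h - lam * (\<integral>y. kap (z - y) \<partial>nu)\<bar> \<le> e) (at_right 0)"
begin

section \<open>Expected ruin sums and the claim rate\<close>

definition jump_rate :: "(real \<Rightarrow> real) \<Rightarrow> real \<Rightarrow> real" where
  "jump_rate kap z = lam * (\<integral>y. kap (z - y) \<partial>nu)"

lemma cadlag: "\<omega> \<in> space M \<Longrightarrow> cadlag_path (\<lambda>t. x + S t \<omega>)"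
proof (unfold_locales)
  fix t :: real assume \<omega>: "\<omega> \<in> space M"
  show "0 \<le> t \<Longrightarrow> ((\<lambda>t. x + S t \<omega>) \<longlongrightarrow> x + S t \<omega>) (at_right t)"
    by (intro tendsto_intros S_right \<omega>)
  assume "0 < t"
  then obtain l where "((\<lambda>t. S t \<omega>) \<longlongrightarrow> l) (at_left t)" using S_left[OF \<omega>] by blast
  then have "((\<lambda>t. x + S t \<omega>) \<longlongrightarrow> x + l) (at_left t)" by (intro tendsto_intros)
  then show "\<exists>l. ((\<lambda>t. x + S t \<omega>) \<longlongrightarrow> l) (at_left t)" by blast
qed

text \<open>In each summand the factor \<open>kap\<close> involves only the next increment, so
  \<open>skel_step\<close> replaces it by its mean over \<open>F h\<close>; what remains is a killed
  expectation at the last grid time alive.\<close>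

lemma ruin_sum_expectation:
  assumes x: "0 \<le> x" and h: "0 < h" and q: "0 \<le> q"
    and kap: "\<And>z. 0 \<le> kap z" "\<And>z. kap z \<le> 1" "kap \<in> borel_measurable borel"
    and g: "g \<in> borel_measurable borel" "\<And>z. 0 \<le> g z"
  shows "(\<lambda>\<omega>. ruin_sum (\<lambda>t. x + S t \<omega>) q g kap h) \<in> borel_measurable M" (is ?thesis1)
    and "(\<integral>\<^sup>+\<omega>. ruin_sum (\<lambda>t. x + S t \<omega>) q g kap h \<partial>M) =
    (\<Sum>i. ennreal (exp (- (h * q))) ^ i * skel_expect h i (\<lambda>z. ennreal (g z * (\<integral>u. kap (z + u) \<partial>F h))) x)" (is ?thesis2)
proof -
  interpret F: step_law "F h" by (rule step_law) fact
  note kap(3)[measurable] g(1)[measurable]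
  have hS[measurable]: "S (real k * h) \<in> borel_measurable M" for k using h by (intro S_measurable_skel) simp
  let ?t = "\<lambda>i \<omega>. indicator {i. \<forall>k\<le>i. 0 \<le> x + S (real k * h) \<omega>} i * ennreal (g (x + S (real i * h) \<omega>) * kap (x + S (real (Suc i) * h) \<omega>))"
  have rs: "ruin_sum (\<lambda>t. x + S t \<omega>) q g kap h = (\<Sum>i. ennreal (exp (- (h * q))) ^ i * ?t i \<omega>)" for \<omega>
    by (rule ruin_sum_def)
  have tm[measurable]: "?t i \<in> borel_measurable M" for i
  proof -
    have "?t i = (\<lambda>\<omega>. indicator {\<omega>. \<forall>k\<le>i. 0 \<le> x + S (real k * h) \<omega>} \<omega> * ennreal (g (x + S (real i * h) \<omega>) * kap (x + S (real (Suc i) * h) \<omega>)))"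
      by (auto simp: indicator_def)
    also have "\<dots> \<in> borel_measurable M" by measurable
    finally show ?thesis .
  qed
  have "(\<lambda>\<omega>. \<Sum>i. ennreal (exp (- (h * q))) ^ i * ?t i \<omega>) \<in> borel_measurable M"
    by (intro borel_measurable_suminf_order borel_measurable_times_ennreal tm borel_measurable_const)
  then show ?thesis1 unfolding rs .
  have "(\<integral>\<^sup>+\<omega>. ruin_sum (\<lambda>t. x + S t \<omega>) q g kap h \<partial>M) = (\<integral>\<^sup>+\<omega>. (\<Sum>i. ennreal (exp (- (h * q))) ^ i * ?t i \<omega>) \<partial>M)"
    by (rule nn_integral_cong) (rule rs)
  also have "\<dots> = (\<Sum>i. \<integral>\<^sup>+\<omega>. ennreal (exp (- (h * q))) ^ i * ?t i \<omega> \<partial>M)"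
    by (rule nn_integral_suminf) measurable
  also have "\<dots> = (\<Sum>i. ennreal (exp (- (h * q))) ^ i * skel_expect h i (\<lambda>z. ennreal (g z * (\<integral>u. kap (z + u) \<partial>F h))) x)"
  proof (rule suminf_cong)
    fix i
    have "(\<integral>\<^sup>+\<omega>. ?t i \<omega> \<partial>M) = (\<integral>\<^sup>+\<omega>. indicator {\<omega>. skel_alive x h i \<omega>} \<omega> *
       (\<lambda>z u. ennreal (g z * kap (z + u))) (x + S (real i * h) \<omega>) (S (real (Suc i) * h) \<omega> - S (real i * h) \<omega>) \<partial>M)"
      by (intro nn_integral_cong) (auto simp: skel_alive_def indicator_def)
    also have "\<dots> = (\<integral>\<^sup>+\<omega>. indicator {\<omega>. skel_alive x h i \<omega>} \<omega> * (\<integral>\<^sup>+u. ennreal (g (x + S (real i * h) \<omega>) * kap (x + S (real i * h) \<omega> + u)) \<partial>F h) \<partial>M)"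
      by (rule skel_step[OF h]) measurable
    also have "\<dots> = skel_expect h i (\<lambda>z. ennreal (g z * (\<integral>u. kap (z + u) \<partial>F h))) x"
      unfolding skel_expect_def
    proof (rule nn_integral_cong)
      fix \<omega>
      have "(\<integral>\<^sup>+u. ennreal (g z * kap (z + u)) \<partial>F h) = ennreal (g z * (\<integral>u. kap (z + u) \<partial>F h))" for z
      proof -
        have "integrable (F h) (\<lambda>u. kap (z + u))"
          using kap(1,2) by (intro F.integrable_const_bound[where B=1]) auto
        then show ?thesis
          using kap(1) g(2) by (subst nn_integral_eq_integral) auto
      qed
      then show "indicator {\<omega>. skel_alive x h i \<omega>} \<omega> * (\<integral>\<^sup>+u. ennreal (g (x + S (real i * h) \<omega>) * kap (x + S (real i * h) \<omega> + u)) \<partial>F h)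
        = ennreal (g (x + S (real i * h) \<omega>) * (\<integral>u. kap (x + S (real i * h) \<omega> + u) \<partial>F h)) * indicator {\<omega>. skel_alive x h i \<omega>} \<omega>"
        by (simp add: mult.commute)
    qed
    finally show "(\<integral>\<^sup>+\<omega>. ennreal (exp (- (h * q))) ^ i * ?t i \<omega> \<partial>M) = ennreal (exp (- (h * q))) ^ i * skel_expect h i (\<lambda>z. ennreal (g z * (\<integral>u. kap (z + u) \<partial>F h))) x"
      by (subst nn_integral_cmult[OF tm]) simp
  qed
  finally show ?thesis2 .
qed

lemma kap_integrable_nu:
  assumes "\<And>z. 0 \<le> kap z" "\<And>z. kap z \<le> (1::real)" "kap \<in> borel_measurable borel"
  shows "integrable nu (\<lambda>y. kap (z - y))"
proof -
  interpret N: real_distribution nu by (rule nu)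
  note assms(3)[measurable]
  show ?thesis using assms(1,2) by (intro N.integrable_const_bound[where B=1]) auto
qed

lemma jump_rate_bounds:
  assumes "\<And>z. 0 \<le> kap z" "\<And>z. kap z \<le> (1::real)" "kap \<in> borel_measurable borel"
  shows "0 \<le> jump_rate kap z" "jump_rate kap z \<le> lam"
proof -
  interpret N: real_distribution nu by (rule nu)
  have "(\<integral>y. kap (z - y) \<partial>nu) \<le> (\<integral>y. 1 \<partial>nu)"
    using assms by (intro integral_mono kap_integrable_nu) auto
  then have "(\<integral>y. kap (z - y) \<partial>nu) \<le> 1" using N.prob_space by simp
  then show "jump_rate kap z \<le> lam" using lam by (simp add: jump_rate_def mult_left_le)
  show "0 \<le> jump_rate kap z" using lam assms(1) by (simp add: jump_rate_def)
qed

lemma jump_rate_continuous: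
  assumes kap: "\<And>z. 0 \<le> kap z" "\<And>z. kap z \<le> (1::real)" "kap \<in> borel_measurable borel"
    and K: "0 \<le> K" "\<And>y z. \<bar>kap y - kap z\<bar> \<le> K * \<bar>y - z\<bar>"
  shows "continuous_on UNIV (jump_rate kap)"
proof (rule lipschitz_on_continuous_on[of "lam * K"], rule lipschitz_onI)
  interpret N: real_distribution nu by (rule nu)
  fix a b :: real
  note i = kap_integrable_nu[OF kap]
  have "\<bar>(\<integral>y. kap (a - y) \<partial>nu) - (\<integral>y. kap (b - y) \<partial>nu)\<bar> = \<bar>\<integral>y. kap (a - y) - kap (b - y) \<partial>nu\<bar>"
    using i by simp
  also have "\<dots> \<le> (\<integral>y. \<bar>kap (a - y) - kap (b - y)\<bar> \<partial>nu)"
    by (rule integral_abs_bound)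
  also have "\<dots> \<le> (\<integral>y. K * \<bar>a - b\<bar> \<partial>nu)"
  proof (rule integral_mono)
    show "\<bar>kap (a - y) - kap (b - y)\<bar> \<le> K * \<bar>a - b\<bar>" for y using K(2)[of "a - y" "b - y"] by simp
  qed (use i in auto)
  finally have "\<bar>(\<integral>y. kap (a - y) \<partial>nu) - (\<integral>y. kap (b - y) \<partial>nu)\<bar> \<le> K * \<bar>a - b\<bar>"
    using N.prob_space by simp
  then have "lam * \<bar>(\<integral>y. kap (a - y) \<partial>nu) - (\<integral>y. kap (b - y) \<partial>nu)\<bar> \<le> lam * (K * \<bar>a - b\<bar>)"
    using lam by (intro mult_left_mono) auto
  then show "dist (jump_rate kap a) (jump_rate kap b) \<le> lam * K * dist a b"
    using lam by (simp add: jump_rate_def dist_real_def right_diff_distrib[symmetric] abs_mult)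
qed (use lam K in auto)

text \<open>A compensation formula without stochastic calculus. The expected ruin sums converge to
  the expected ruin value by domination; computed step by step they are Riemann sums for the
  potential, in which the one-step mean of \<open>kap\<close> divided by the mesh tends to
  \<open>jump_rate kap\<close>.\<close>

lemma compensation_pos:
  assumes x: "0 \<le> x" and q: "0 < q"
    and kap: "\<And>z. 0 \<le> kap z" "\<And>z. kap z \<le> 1" "\<And>z. 0 \<le> z \<Longrightarrow> kap z = 0"
    and K: "0 \<le> K" "\<And>y z. \<bar>kap y - kap z\<bar> \<le> K * \<bar>y - z\<bar>"
    and g: "continuous_on UNIV g" "\<And>z. 0 \<le> g z" "\<And>z. g z \<le> C" and del: "0 < del" "\<And>z. z \<le> del \<Longrightarrow> g z = 0"
  shows "(\<lambda>\<omega>. ennreal (ruin_value (\<lambda>t. x + S t \<omega>) q g kap)) \<in> borel_measurable M"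
    and "(\<integral>\<^sup>+\<omega>. ennreal (ruin_value (\<lambda>t. x + S t \<omega>) q g kap) \<partial>M) = potential q (\<lambda>z. ennreal (g z * jump_rate kap z)) x"
proof -
  have kc: "continuous_on UNIV kap"
    by (rule lipschitz_on_continuous_on[of K]) (use K in \<open>auto simp: lipschitz_on_def dist_real_def\<close>)
  have km[measurable]: "kap \<in> borel_measurable borel" using kc by (rule borel_measurable_continuous_onI)
  have gm[measurable]: "g \<in> borel_measurable borel" using g(1) by (rule borel_measurable_continuous_onI)
  have C: "0 \<le> C" using g(2,3) order_trans by blast
  have jc: "continuous_on UNIV (jump_rate kap)" by (rule jump_rate_continuous[OF kap(1,2) km K])
  have jm[measurable]: "jump_rate kap \<in> borel_measurable borel" using jc by (rule borel_measurable_continuous_onI)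
  note jb = jump_rate_bounds[OF kap(1,2) km]
  let ?rs = "\<lambda>n \<omega>. ruin_sum (\<lambda>t. x + S t \<omega>) q g kap (mesh n)"
  let ?rv = "\<lambda>\<omega>. ennreal (ruin_value (\<lambda>t. x + S t \<omega>) q g kap)"
  have conv: "(\<lambda>n. ?rs n \<omega>) \<longlonglongrightarrow> ?rv \<omega>" if "\<omega> \<in> space M" for \<omega>
    by (rule cadlag_path.ruin_sum_tendsto[OF cadlag[OF that] _ _ _ kc g])
       (use x q kap S_0[OF that] in auto)
  have rsm[measurable]: "?rs n \<in> borel_measurable M" for n
    using q by (intro ruin_sum_expectation x kap g km gm) auto
  show rvm: "?rv \<in> borel_measurable M"
  proof -
    have "(\<lambda>\<omega>. limsup (\<lambda>n. ?rs n \<omega>)) \<in> borel_measurable M" by measurable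
    then show ?thesis
      by (rule measurable_cong[THEN iffD1, rotated]) (use conv in \<open>auto intro: lim_imp_Limsup\<close>)
  qed
  have lim1: "(\<lambda>n. \<integral>\<^sup>+\<omega>. ?rs n \<omega> \<partial>M) \<longlonglongrightarrow> (\<integral>\<^sup>+\<omega>. ?rv \<omega> \<partial>M)"
  proof (rule nn_integral_dominated_convergence[where w="\<lambda>_. ennreal C"])
    show "AE \<omega> in M. ?rs n \<omega> \<le> ennreal C" for n
    proof (rule AE_I2)
      fix \<omega> assume \<omega>: "\<omega> \<in> space M"
      show "?rs n \<omega> \<le> ennreal C"
        by (rule cadlag_path.ruin_sum_le[OF cadlag[OF \<omega>]]) (use x q kap g S_0[OF \<omega>] in \<open>auto simp: less_imp_le\<close>)
    qed
    show "AE \<omega> in M. (\<lambda>n. ?rs n \<omega>) \<longlonglongrightarrow> ?rv \<omega>" using conv by (rule AE_I2)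
  qed (auto simp: emeasure_space_1 rvm)
  define Fk where "Fk n z = (\<integral>u. kap (z + u) \<partial>F (mesh n))" for n z
  have Fk: "0 \<le> Fk n z" "Fk n z \<le> 1" "Fk n \<in> borel_measurable borel" for n z
  proof -
    interpret F: step_law "F (mesh n)" by (rule step_law) simp
    show "0 \<le> Fk n z" using kap by (simp add: Fk_def)
    have "Fk n z \<le> (\<integral>u. 1 \<partial>F (mesh n))"
      unfolding Fk_def using kap by (intro integral_mono F.integrable_const_bound[where B=1]) auto
    then show "Fk n z \<le> 1" using F.prob_space by simp
    show "Fk n \<in> borel_measurable borel"
      unfolding Fk_def[abs_def] by measurable
  qed
  \<comment> \<open>\<open>skel_sum_tendsto\<close> asks for one bound valid for all
    \<open>n\<close>, while the rate estimate holds only eventually. The cap is the limit bound with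
    error 1 allowed in the rate, so it is inactive for large \<open>n\<close>.\<close>
  define Gn where "Gn n z = min (C * (lam + 1)) (g z * (Fk n z / mesh n))" for n z
  have Gnm: "Gn n \<in> borel_measurable borel" for n
    unfolding Gn_def[abs_def] using Fk(3)[of n] by measurable
  have unif: "eventually (\<lambda>n. \<forall>z\<ge>del. \<bar>Fk n z / mesh n - jump_rate kap z\<bar> \<le> e) sequentially" if "0 < e" for e
    using filterlim_iff[THEN iffD1, OF filterlim_mesh, rule_format, OF small_time_jump[OF kap K del(1) that]]
    by (simp add: Fk_def jump_rate_def)
  have close: "\<bar>g z * (Fk n z / mesh n) - g z * jump_rate kap z\<bar> \<le> C * e" if "\<forall>z\<ge>del. \<bar>Fk n z / mesh n - jump_rate kap z\<bar> \<le> e" "0 < e" for n z e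
  proof (cases "del \<le> z")
    case True
    have "\<bar>g z\<bar> * \<bar>Fk n z / mesh n - jump_rate kap z\<bar> \<le> C * e"
      using that True C g(2,3) by (intro mult_mono) auto
    then show ?thesis by (simp add: abs_mult[symmetric] right_diff_distrib)
  next
    case False
    then show ?thesis using del(2)[of z] C that by simp
  qed
  have Gn_eq: "eventually (\<lambda>n. \<forall>z. Gn n z = g z * (Fk n z / mesh n)) sequentially"
    using unif[OF zero_less_one]
  proof eventually_elim
    case (elim n)
    show ?case
    proof
      fix z
      have "g z * jump_rate kap z \<le> C * lam" using C g(2,3) jb by (intro mult_mono) auto
      then have "g z * (Fk n z / mesh n) \<le> C * (lam + 1)"
        using close[OF elim zero_less_one, of z] by (simp add: algebra_simps abs_le_iff)
      then show "Gn n z = g z * (Fk n z / mesh n)" by (simp add: Gn_def)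
    qed
  qed
  have Gn_lim: "(\<lambda>n. Gn n (zn n)) \<longlonglongrightarrow> g z * jump_rate kap z" if zn: "zn \<longlonglongrightarrow> z" for z zn
  proof -
    have 1: "(\<lambda>n. g (zn n) * jump_rate kap (zn n)) \<longlonglongrightarrow> g z * jump_rate kap z"
      by (intro tendsto_mult continuous_on_tendsto_compose[OF g(1) zn] continuous_on_tendsto_compose[OF jc zn]) auto
    have 2: "(\<lambda>n. Gn n (zn n) - g (zn n) * jump_rate kap (zn n)) \<longlonglongrightarrow> 0"
    proof (rule tendstoI)
      fix e :: real assume e: "0 < e"
      \<comment> \<open>Dividing by \<open>C + 1\<close> covers the case \<open>C = 0\<close>, and
        the extra factor 2 makes the resulting inequality strict.\<close>
      define e' where "e' = e / (C + 1) / 2"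
      have e': "0 < e'" "C * e' < e"
      proof -
        show pos: "0 < e'" using e C by (simp add: e'_def)
        then have "0 \<le> C * e'" using C by simp
        moreover have "(C + 1) * e' * 2 = 2 * (C * e') + 2 * e'" by (simp add: algebra_simps)
        ultimately have "C * e' < (C + 1) * e' * 2" using pos by linarith
        also have "\<dots> = e" using C by (simp add: e'_def field_simps)
        finally show "C * e' < e" .
      qed
      show "eventually (\<lambda>n. dist (Gn n (zn n) - g (zn n) * jump_rate kap (zn n)) 0 < e) sequentially"
        using unif[OF e'(1)] Gn_eq
      proof eventually_elim
        case (elim n)
        have "\<bar>g (zn n) * (Fk n (zn n) / mesh n) - g (zn n) * jump_rate kap (zn n)\<bar> \<le> C * e'"
          by (rule close[OF elim(1) e'(1)])
        also have "\<dots> < e" by (rule e'(2))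
        finally show ?case using elim(2) by (simp add: dist_real_def)
      qed
    qed
    show ?thesis using tendsto_add[OF 2 1] by simp
  qed
  have lim2: "(\<lambda>n. ennreal (mesh n) * (\<Sum>i. ennreal (exp (- (mesh n * q))) ^ Suc i * skel_expect (mesh n) (Suc i) (\<lambda>z. ennreal (Gn n z)) x))
     \<longlonglongrightarrow> potential q (\<lambda>z. ennreal (g z * jump_rate kap z)) x"
  proof (rule skel_sum_tendsto[OF q _ Gnm _ _ Gn_lim])
    show "0 \<le> Gn n z" for n z using C lam g(2) Fk(1) by (simp add: Gn_def less_imp_le)
    show "Gn n z \<le> C * (lam + 1)" for n z by (simp add: Gn_def)
  qed (auto intro: tendsto_intros)
  have "(\<lambda>n. ennreal (C * ((lam + 1) * mesh n))) \<longlonglongrightarrow> ennreal (C * ((lam + 1) * 0))"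
    by (intro tendsto_ennrealI tendsto_intros mesh_tendsto)
  then have b0: "(\<lambda>n. ennreal (C * ((lam + 1) * mesh n))) \<longlonglongrightarrow> 0" by simp
  \<comment> \<open>The ruin sum starts at step 0, the Riemann sum at step 1. The surplus term is a
    single one-step probability, of the order of the mesh.\<close>
  have lim0: "(\<lambda>n. skel_expect (mesh n) 0 (\<lambda>z. ennreal (g z * Fk n z)) x) \<longlonglongrightarrow> 0"
  proof (rule tendsto_sandwich[OF _ _ tendsto_const b0])
    show "eventually (\<lambda>n. skel_expect (mesh n) 0 (\<lambda>z. ennreal (g z * Fk n z)) x \<le> ennreal (C * ((lam + 1) * mesh n))) sequentially"
      using Gn_eq
    proof eventually_elim
      case (elim n)
      have "g z * Fk n z \<le> C * ((lam + 1) * mesh n)" for z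
      proof -
        have "g z * (Fk n z / mesh n) \<le> C * (lam + 1)" using elim[rule_format, of z] by (simp add: Gn_def)
        then have "g z * (Fk n z / mesh n) * mesh n \<le> C * (lam + 1) * mesh n" by (intro mult_right_mono) (auto simp: less_imp_le)
        then show ?thesis using mesh_pos[of n] by (simp add: algebra_simps del: mesh_pos)
      qed
      then show ?case by (intro skel_expect_le ennreal_leI)
    qed
  qed simp
  have "(\<lambda>n. skel_expect (mesh n) 0 (\<lambda>z. ennreal (g z * Fk n z)) x + ennreal (mesh n) * (\<Sum>i. ennreal (exp (- (mesh n * q))) ^ Suc i * skel_expect (mesh n) (Suc i) (\<lambda>z. ennreal (Gn n z)) x))
     \<longlonglongrightarrow> 0 + potential q (\<lambda>z. ennreal (g z * jump_rate kap z)) x"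
    by (intro tendsto_add lim0 lim2)
  then have lim3: "(\<lambda>n. \<integral>\<^sup>+\<omega>. ?rs n \<omega> \<partial>M) \<longlonglongrightarrow> 0 + potential q (\<lambda>z. ennreal (g z * jump_rate kap z)) x"
  proof (rule Lim_transform_eventually)
    show "eventually (\<lambda>n. skel_expect (mesh n) 0 (\<lambda>z. ennreal (g z * Fk n z)) x + ennreal (mesh n) * (\<Sum>i. ennreal (exp (- (mesh n * q))) ^ Suc i * skel_expect (mesh n) (Suc i) (\<lambda>z. ennreal (Gn n z)) x)
       = (\<integral>\<^sup>+\<omega>. ?rs n \<omega> \<partial>M)) sequentially"
      using Gn_eq
    proof eventually_elim
      case (elim n)
      let ?r = "ennreal (exp (- (mesh n * q)))" and ?s = "\<lambda>i. skel_expect (mesh n) i (\<lambda>z. ennreal (g z * Fk n z)) x"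
      have "(\<integral>\<^sup>+\<omega>. ?rs n \<omega> \<partial>M) = (\<Sum>i. ?r ^ i * ?s i)"
        unfolding Fk_def using q by (intro ruin_sum_expectation x kap g km gm) auto
      also have "\<dots> = ?s 0 + (\<Sum>i. ?r ^ Suc i * ?s (Suc i))"
        using suminf_offset[of "\<lambda>i. ?r ^ i * ?s i" 1] by simp
      also have "(\<lambda>i. ?r ^ Suc i * ?s (Suc i)) = (\<lambda>i. ennreal (mesh n) * (?r ^ Suc i * skel_expect (mesh n) (Suc i) (\<lambda>z. ennreal (Gn n z)) x))"
      proof
        fix i
        have tm: "(\<lambda>\<omega>. ennreal (Gn n (x + S (real (Suc i) * mesh n) \<omega>)) * indicator {\<omega>. skel_alive x (mesh n) (Suc i) \<omega>} \<omega>) \<in> borel_measurable M"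
          using Gnm[of n] unfolding skel_alive_def by measurable
        have "ennreal (g z * Fk n z) = ennreal (mesh n) * ennreal (Gn n z)" for z
          using elim[rule_format, of z] g(2)[of z] Fk(1)[of n z] mesh_pos[of n] by (simp add: ennreal_mult[symmetric] del: mesh_pos)
        then have "?s (Suc i) = ennreal (mesh n) * skel_expect (mesh n) (Suc i) (\<lambda>z. ennreal (Gn n z)) x"
          unfolding skel_expect_def by (subst nn_integral_cmult[symmetric, OF tm]) (simp add: ac_simps)
        then show "?r ^ Suc i * ?s (Suc i) = ennreal (mesh n) * (?r ^ Suc i * skel_expect (mesh n) (Suc i) (\<lambda>z. ennreal (Gn n z)) x)"
          by (simp only: ac_simps)
      qed
      finally show ?case by (simp only: ennreal_suminf_cmult)
    qed
  qed
  show "(\<integral>\<^sup>+\<omega>. ?rv \<omega> \<partial>M) = potential q (\<lambda>z. ennreal (g z * jump_rate kap z)) x"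
    using LIMSEQ_unique[OF lim1 lim3] by simp
qed

text \<open>Level 0 is included by letting positive levels decrease to \<open>q\<close>; both sides
  increase to their limits.\<close>

lemma compensation:
  assumes x: "0 \<le> x" and q: "0 \<le> q"
    and kap: "\<And>z. 0 \<le> kap z" "\<And>z. kap z \<le> 1" "\<And>z. 0 \<le> z \<Longrightarrow> kap z = 0"
    and K: "0 \<le> K" "\<And>y z. \<bar>kap y - kap z\<bar> \<le> K * \<bar>y - z\<bar>"
    and g: "continuous_on UNIV g" "\<And>z. 0 \<le> g z" "\<And>z. g z \<le> C" and del: "0 < del" "\<And>z. z \<le> del \<Longrightarrow> g z = 0"
  shows "(\<lambda>\<omega>. ennreal (ruin_value (\<lambda>t. x + S t \<omega>) q g kap)) \<in> borel_measurable M"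
    and "(\<integral>\<^sup>+\<omega>. ennreal (ruin_value (\<lambda>t. x + S t \<omega>) q g kap) \<partial>M) = potential q (\<lambda>z. ennreal (g z * jump_rate kap z)) x"
proof -
  define qk where "qk k = q + 1 / real (Suc k)" for k
  have qk: "0 < qk k" "q \<le> qk k" for k using q by (auto simp: qk_def intro: add_nonneg_pos)
  have qk_mono: "qk l \<le> qk k" if "k \<le> l" for k l
    using that by (auto simp: qk_def intro!: divide_left_mono)
  have qk_lim: "qk \<longlonglongrightarrow> q" unfolding qk_def by real_asymp
  note comp = compensation_pos[OF x qk(1) kap K g del]
  let ?X = "\<lambda>\<omega> t. x + S t \<omega>"
  have T0: "0 \<le> real_of_ereal (ruin_time X)" for X
    by (intro real_of_ereal_pos) (auto simp: ruin_time_def intro!: Inf_greatest)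
  have mono: "ruin_value X (qk k) g kap \<le> ruin_value X (qk l) g kap" if "k \<le> l" for k l X
    using that g(2) kap(1) qk_mono[OF that] T0[of X]
    by (auto simp: ruin_value_def Let_def intro!: mult_right_mono)
  have lim: "(\<lambda>k. ruin_value X (qk k) g kap) \<longlonglongrightarrow> ruin_value X q g kap" for X
    by (auto simp: ruin_value_def Let_def intro!: tendsto_intros qk_lim)
  have L: "(\<lambda>k. \<integral>\<^sup>+\<omega>. ennreal (ruin_value (?X \<omega>) (qk k) g kap) \<partial>M) \<longlonglongrightarrow> (\<integral>\<^sup>+\<omega>. ennreal (ruin_value (?X \<omega>) q g kap) \<partial>M)"
    by (rule nn_integral_LIMSEQ) (auto simp: incseq_def le_fun_def intro!: ennreal_leI mono comp tendsto_ennrealI lim)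
  have km: "kap \<in> borel_measurable borel"
    by (intro borel_measurable_continuous_onI lipschitz_on_continuous_on[of K]) (use K in \<open>auto simp: lipschitz_on_def dist_real_def\<close>)
  have gm[measurable]: "g \<in> borel_measurable borel" using g(1) by (rule borel_measurable_continuous_onI)
  have jm[measurable]: "jump_rate kap \<in> borel_measurable borel"
    by (intro borel_measurable_continuous_onI jump_rate_continuous[OF kap(1,2) km K])
  have R: "(\<lambda>k. potential (qk k) (\<lambda>z. ennreal (g z * jump_rate kap z)) x) \<longlonglongrightarrow> potential q (\<lambda>z. ennreal (g z * jump_rate kap z)) x"
  proof (rule potential_tendsto)
    show "incseq (\<lambda>k. ennreal (exp (- qk k * s)) * ennreal (g z * jump_rate kap z))" if "0 \<le> s" for s z
      using that qk_mono by (auto simp: incseq_def intro!: mult_right_mono ennreal_leI)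
    show "(\<lambda>k. ennreal (exp (- qk k * s)) * ennreal (g z * jump_rate kap z)) \<longlonglongrightarrow> ennreal (exp (- q * s)) * ennreal (g z * jump_rate kap z)" for s z
      by (intro tendsto_mult_ennreal tendsto_ennrealI tendsto_intros qk_lim) auto
  qed measurable
  show "(\<integral>\<^sup>+\<omega>. ennreal (ruin_value (?X \<omega>) q g kap) \<partial>M) = potential q (\<lambda>z. ennreal (g z * jump_rate kap z)) x"
    using LIMSEQ_unique[OF L] R comp(2) by simp
  show "(\<lambda>\<omega>. ennreal (ruin_value (\<lambda>t. x + S t \<omega>) q g kap)) \<in> borel_measurable M"
  proof -
    have [measurable]: "(\<lambda>\<omega>. ennreal (ruin_value (?X \<omega>) (qk k) g kap)) \<in> borel_measurable M" for k by (rule comp)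
    have "(\<lambda>\<omega>. limsup (\<lambda>n. ennreal (ruin_value (?X \<omega>) (qk n) g kap))) \<in> borel_measurable M" by measurable
    then show ?thesis
      by (rule measurable_cong[THEN iffD1, rotated]) (auto intro!: lim_imp_Limsup tendsto_ennrealI lim)
  qed
qed

end

section \<open>Tails of the discounted law of the surplus before ruin\<close>

locale ruin_model = jump_process M F phi c v d S lam nu + tilted_survival M F phi c v d S th m surv sv
  for M :: "'a measure" and F phi c v d S lam nu th m surv sv
begin

definition ruin_density :: "real \<Rightarrow> real \<Rightarrow> real" where
  "ruin_density x y = lam * measure nu {y<..} * (exp (- th * y) * W x - W (x - y))"

text \<open>After dividing by \<open>exp (th * (x - y)) / m\<close> this is monotonicity of survival
  in the capital. It makes the candidate density nonnegative, so that it survives the passage to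
  \<open>ennreal\<close>.\<close>

lemma W_diff: assumes "0 \<le> x" "0 \<le> y" shows "W (x - y) \<le> exp (- th * y) * W x"
proof (cases "y \<le> x")
  case True
  have "exp (th * (x - y)) * sv (x - y) / m \<le> exp (th * (x - y)) * sv x / m"
    using True assms m by (intro divide_right_mono mult_left_mono sv_mono) auto
  also have "\<dots> = exp (- th * y) * W x"
    using assms by (simp add: W_def exp_add[symmetric] algebra_simps)
  finally show ?thesis using True by (simp add: W_def)
next
  case False
  then show ?thesis using W_nonneg[of x] by (simp add: W_def)
qed

lemma ruin_density_nonneg: "0 \<le> x \<Longrightarrow> 0 \<le> y \<Longrightarrow> 0 \<le> ruin_density x y"
  using W_diff[of x y] lam by (simp add: ruin_density_def)

text \<open>\<open>compensation\<close> and \<open>renewal\<close> require continuous test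
  functions, so the indicators are approximated from below and all limits are monotone. Half-lines
  suffice, since they determine a finite measure.\<close>

lemma ruin_tail:
  assumes x: "0 \<le> x" and a: "0 \<le> a"
  shows "(\<lambda>\<omega>. ennreal (ruin_value (\<lambda>t. x + S t \<omega>) (phi th) (indicator {a<..}) (indicator {..<0}))) \<in> borel_measurable M"
    and "(\<integral>\<^sup>+\<omega>. ennreal (ruin_value (\<lambda>t. x + S t \<omega>) (phi th) (indicator {a<..}) (indicator {..<0})) \<partial>M)
      = (\<integral>\<^sup>+y. ennreal (ruin_density x y) * indicator {a<..} y \<partial>lborel)"
    and "(\<lambda>y. ennreal (ruin_density x y) * indicator {a<..} y) \<in> borel_measurable borel"
proof -
  interpret N: real_distribution nu by (rule nu)
  have q: "0 \<le> phi th" by (rule phi_nonneg[OF th])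
  \<comment> \<open>Lipschitz with constant \<open>k\<close>, zero on the half-line, and increasing
    to the indicator of strict ruin; deficit 0, and with it creeping, never counts.\<close>
  define kap where "kap k z = max 0 (min 1 (- real k * z))" for k and z :: real
  have kap: "0 \<le> kap k z" "kap k z \<le> 1" "0 \<le> z \<Longrightarrow> kap k z = 0" for k z
  proof -
    assume "0 \<le> z"
    then have "0 \<le> real k * z" by simp
    then show "kap k z = 0" by (simp add: kap_def)
  qed (auto simp: kap_def)
  have kapK: "\<bar>kap k y - kap k z\<bar> \<le> real k * \<bar>y - z\<bar>" for k y z
  proof -
    have "\<bar>kap k y - kap k z\<bar> \<le> \<bar>- real k * y - - real k * z\<bar>" unfolding kap_def by linarith
    also have "- real k * y - - real k * z = - (real k * (y - z))" by (simp add: algebra_simps)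
    also have "\<bar>- (real k * (y - z))\<bar> = real k * \<bar>y - z\<bar>" by (simp add: abs_mult)
    finally show ?thesis .
  qed
  have kap_cont: "continuous_on UNIV (kap k)" for k
    unfolding kap_def[abs_def] by (intro continuous_intros)
  then have kapm[measurable]: "kap k \<in> borel_measurable borel" for k by (rule borel_measurable_continuous_onI)
  have kap_mono: "kap k z \<le> kap l z" if "k \<le> l" for k l z
  proof (cases "z < 0")
    case True
    have "real k * - z \<le> real l * - z" using that True by (intro mult_right_mono) auto
    then show ?thesis by (auto simp: kap_def)
  qed (simp add: kap)
  have kap_lim: "(\<lambda>k. kap k z) \<longlonglongrightarrow> indicator {..<0} z" for z
  proof (cases "z < 0")
    case True
    have "eventually (\<lambda>k. real k \<ge> 1 / - z) sequentially"
      using filterlim_real_sequentially filterlim_at_top by blast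
    then have "eventually (\<lambda>k. kap k z = 1) sequentially"
      by eventually_elim (use True in \<open>auto simp: kap_def field_simps\<close>)
    then show ?thesis using True by (auto intro: tendsto_eventually)
  qed (simp add: kap)
  \<comment> \<open>The shift by 1 makes \<open>g k\<close> vanish up to
    \<open>a + 1 / Suc k\<close>, the margin above 0 demanded by \<open>compensation\<close>; the
    second factor gives the bounded support demanded by \<open>renewal\<close>.\<close>
  define g where "g k y = max 0 (min 1 (real (Suc k) * (y - a) - 1)) * max 0 (min 1 (real k - y))" for k y
  have g_cont: "continuous_on UNIV (g k)" for k
    unfolding g_def[abs_def] by (intro continuous_intros)
  then have gm[measurable]: "g k \<in> borel_measurable borel" for k by (rule borel_measurable_continuous_onI)
  have g: "0 \<le> g k y" "g k y \<le> 1" "real k < y \<Longrightarrow> g k y = 0" "y \<le> a + 1 / real (Suc k) \<Longrightarrow> g k y = 0" for k y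
  proof -
    show "0 \<le> g k y" "g k y \<le> 1" by (auto simp: g_def intro!: mult_le_one)
    show "real k < y \<Longrightarrow> g k y = 0" by (simp add: g_def)
    assume "y \<le> a + 1 / real (Suc k)"
    then have "real (Suc k) * (y - a) \<le> real (Suc k) * (1 / real (Suc k))" by (intro mult_left_mono) auto
    then have "real (Suc k) * (y - a) - 1 \<le> 0" by simp
    then show "g k y = 0" by (simp add: g_def del: of_nat_Suc)
  qed
  have g0: "g k y = 0" if "y \<le> a" for k y
  proof (rule g(4))
    have "0 < 1 / real (Suc k)" by simp
    then show "y \<le> a + 1 / real (Suc k)" using that by linarith
  qed
  have g_mono: "g k y \<le> g l y" if "k \<le> l" for k l y
  proof (cases "a < y")
    case True
    have "real (Suc k) * (y - a) \<le> real (Suc l) * (y - a)" using that True by (intro mult_right_mono) auto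
    then show ?thesis unfolding g_def using that by (intro mult_mono) (auto simp del: of_nat_Suc)
  next
    case False
    then show ?thesis using g0[of y k] g(1)[of l y] by simp
  qed
  have g_lim: "(\<lambda>k. g k y) \<longlonglongrightarrow> indicator {a<..} y" for y
  proof (cases "a < y")
    case True
    have "eventually (\<lambda>k. real k \<ge> max (2 / (y - a)) (y + 1)) sequentially"
      using filterlim_real_sequentially filterlim_at_top by blast
    then have "eventually (\<lambda>k. g k y = 1) sequentially"
    proof eventually_elim
      case (elim k)
      have "2 / (y - a) \<le> real (Suc k)" using elim by simp
      then have "2 \<le> real (Suc k) * (y - a)" using True by (simp add: field_simps)
      then show ?case using elim by (simp add: g_def del: of_nat_Suc)
    qed
    then show ?thesis using True by (auto intro: tendsto_eventually)
  next
    case False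
    then have "g k y = 0" for k by (intro g0) simp
    then show ?thesis using False by simp
  qed
  define j where "j k = jump_rate (kap k)" for k
  have jc: "continuous_on UNIV (j k)" for k
    unfolding j_def by (rule jump_rate_continuous[OF kap(1,2) kapm _ kapK]) simp
  then have jm[measurable]: "j k \<in> borel_measurable borel" for k by (rule borel_measurable_continuous_onI)
  have j: "0 \<le> j k y" "j k y \<le> lam" for k y
    unfolding j_def by (rule jump_rate_bounds[OF kap(1,2) kapm])+
  have j_mono: "j k y \<le> j l y" if "k \<le> l" for k l y
    unfolding j_def jump_rate_def using lam
    by (intro mult_left_mono integral_mono kap_integrable_nu kap kapm kap_mono that) auto
  \<comment> \<open>\<open>kap k (y - u)\<close> increases to 1 exactly when the claim
    \<open>u\<close> exceeds the surplus \<open>y\<close>; so the rate converges to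
    \<open>lam\<close> times the claim tail.\<close>
  have j_lim: "(\<lambda>k. j k y) \<longlonglongrightarrow> lam * measure nu {y<..}" for y
  proof -
    have "(\<lambda>k. \<integral>u. kap k (y - u) \<partial>nu) \<longlonglongrightarrow> (\<integral>u. indicator {y<..} u \<partial>nu)"
    proof (rule integral_dominated_convergence[where w="\<lambda>_. 1"])
      show "AE u in nu. (\<lambda>k. kap k (y - u)) \<longlonglongrightarrow> indicator {y<..} u"
        using kap_lim[of "y - _"] by (intro AE_I2) (auto simp: indicator_def)
    qed (use kap in auto)
    then show ?thesis unfolding j_def jump_rate_def by (intro tendsto_mult tendsto_const) simp
  qed
  have gj: "continuous_on UNIV (\<lambda>z. g k z * j k z)" "0 \<le> g k z * j k z" "g k z * j k z \<le> lam" "real k < z \<Longrightarrow> g k z * j k z = 0" for k z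
  proof -
    show "g k z * j k z \<le> lam" using mult_mono[of "g k z" 1 "j k z" lam] g j by simp
  qed (use g j g_cont jc in \<open>auto intro!: continuous_intros\<close>)
  let ?rv = "\<lambda>k \<omega>. ennreal (ruin_value (\<lambda>t. x + S t \<omega>) (phi th) (g k) (kap k))"
  have comp: "?rv k \<in> borel_measurable M" "(\<integral>\<^sup>+\<omega>. ?rv k \<omega> \<partial>M) = potential (phi th) (\<lambda>z. ennreal (g k z * j k z)) x" for k
  proof -
    have "0 < a + 1 / real (Suc k)" using a by (simp add: add_nonneg_pos)
    note * = compensation[OF x q kap _ kapK g_cont g(1,2) this g(4)]
    show "?rv k \<in> borel_measurable M" by (rule *) simp_all
    show "(\<integral>\<^sup>+\<omega>. ?rv k \<omega> \<partial>M) = potential (phi th) (\<lambda>z. ennreal (g k z * j k z)) x"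
      unfolding j_def by (rule *) simp_all
  qed
  have main: "(\<integral>\<^sup>+\<omega>. ?rv k \<omega> \<partial>M) = (\<integral>\<^sup>+y. indicator {0..} y * ennreal (g k y * j k y * (exp (- th * y) * W x - W (x - y))) \<partial>lborel)" for k
  proof -
    let ?A = "\<integral>\<^sup>+y. indicator {0..} y * ennreal (g k y * j k y * (exp (- th * y) * W x - W (x - y))) \<partial>lborel"
    let ?B = "\<integral>\<^sup>+y. indicator {0..} y * ennreal (g k y * j k y * W (x - y)) \<partial>lborel"
    have "(\<integral>\<^sup>+\<omega>. ?rv k \<omega> \<partial>M) + ?B = ennreal (W x) * (\<integral>\<^sup>+y. indicator {0..} y * ennreal (g k y * j k y * exp (- th * y)) \<partial>lborel)"
      unfolding comp(2) by (rule renewal[OF gj x])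
    also have "\<dots> = (\<integral>\<^sup>+y. ennreal (W x) * (indicator {0..} y * ennreal (g k y * j k y * exp (- th * y))) \<partial>lborel)"
      by (rule nn_integral_cmult[symmetric]) measurable
    also have "\<dots> = (\<integral>\<^sup>+y. indicator {0..} y * ennreal (g k y * j k y * (exp (- th * y) * W x - W (x - y))) + indicator {0..} y * ennreal (g k y * j k y * W (x - y)) \<partial>lborel)"
    proof (rule nn_integral_cong)
      fix y
      show "ennreal (W x) * (indicator {0..} y * ennreal (g k y * j k y * exp (- th * y))) =
        indicator {0..} y * ennreal (g k y * j k y * (exp (- th * y) * W x - W (x - y))) + indicator {0..} y * ennreal (g k y * j k y * W (x - y))"
      proof (cases "0 \<le> y")
        case True
        define p where "p = g k y * j k y"
        have p: "0 \<le> p" using gj(2) by (simp add: p_def)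
        have "ennreal (p * (exp (- th * y) * W x - W (x - y))) + ennreal (p * W (x - y)) = ennreal (p * (exp (- th * y) * W x - W (x - y)) + p * W (x - y))"
          using p W_diff[OF x True] W_nonneg by (intro ennreal_plus[symmetric] mult_nonneg_nonneg) auto
        also have "p * (exp (- th * y) * W x - W (x - y)) + p * W (x - y) = W x * (p * exp (- th * y))"
          by (simp add: algebra_simps)
        also have "ennreal \<dots> = ennreal (W x) * ennreal (p * exp (- th * y))"
          using p W_nonneg by (intro ennreal_mult) auto
        finally show ?thesis using True unfolding p_def[symmetric] by simp
      qed simp
    qed
    also have "\<dots> = ?A + ?B" by (rule nn_integral_add) measurable
    finally have eq: "(\<integral>\<^sup>+\<omega>. ?rv k \<omega> \<partial>M) + ?B = ?A + ?B" .
    \<comment> \<open>Only here is the convolution term subtracted; the bounded support of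
      \<open>g k\<close> makes it finite.\<close>
    have "?B \<le> (\<integral>\<^sup>+y. ennreal (lam * (exp (th * x) / m)) * indicator {0..real k} y \<partial>lborel)"
    proof (rule nn_integral_mono)
      fix y
      show "indicator {0..} y * ennreal (g k y * j k y * W (x - y)) \<le> ennreal (lam * (exp (th * x) / m)) * indicator {0..real k} y"
      proof (cases "0 \<le> y \<and> y \<le> real k")
        case True
        have "exp (th * (x - y)) / m \<le> exp (th * x) / m" using True th m by (intro divide_right_mono) (auto intro!: mult_left_mono)
        then have "W (x - y) \<le> exp (th * x) / m" using W_le[of "x - y"] by linarith
        then have "g k y * j k y * W (x - y) \<le> lam * (exp (th * x) / m)"
          using lam W_nonneg by (intro mult_mono gj) auto
        then show ?thesis using True by (auto intro: ennreal_leI)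
      qed (use gj(4)[of k y] in auto)
    qed
    also have "\<dots> < \<infinity>"
      by (subst nn_integral_cmult_indicator) (auto simp: ennreal_mult_less_top emeasure_lborel_Icc_eq)
    finally have "?B < \<infinity>" .
    then show ?thesis
      using eq by (subst (asm) (1 2) add.commute, subst (asm) ennreal_add_left_cancel) auto
  qed
  let ?f = "\<lambda>y. ennreal (ruin_density x y) * indicator {a<..} y"
  have f_lim: "(\<lambda>k. indicator {0..} y * ennreal (g k y * j k y * (exp (- th * y) * W x - W (x - y)))) \<longlonglongrightarrow> ?f y" for y
  proof (cases "0 \<le> y")
    case True
    have "(\<lambda>k. ennreal (g k y * j k y * (exp (- th * y) * W x - W (x - y)))) \<longlonglongrightarrow> ennreal (indicator {a<..} y * (lam * measure nu {y<..}) * (exp (- th * y) * W x - W (x - y)))"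
      by (intro tendsto_ennrealI tendsto_mult g_lim j_lim tendsto_const)
    also have "ennreal (indicator {a<..} y * (lam * measure nu {y<..}) * (exp (- th * y) * W x - W (x - y))) = ?f y"
      by (auto simp: ruin_density_def indicator_def)
    finally show ?thesis using True by simp
  qed (use a in auto)
  show fm: "?f \<in> borel_measurable borel"
  proof -
    have "(\<lambda>y. limsup (\<lambda>k. indicator {0..} y * ennreal (g k y * j k y * (exp (- th * y) * W x - W (x - y))))) \<in> borel_measurable borel"
      by measurable
    then show ?thesis
      by (rule measurable_cong[THEN iffD1, rotated]) (rule lim_imp_Limsup[OF _ f_lim], simp)
  qed
  have "(\<lambda>k. \<integral>\<^sup>+y. indicator {0..} y * ennreal (g k y * j k y * (exp (- th * y) * W x - W (x - y))) \<partial>lborel) \<longlonglongrightarrow> (\<integral>\<^sup>+y. ?f y \<partial>lborel)"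
  proof (rule nn_integral_LIMSEQ[OF _ _ f_lim])
    show "incseq (\<lambda>k y. indicator {0..} y * ennreal (g k y * j k y * (exp (- th * y) * W x - W (x - y))))"
      unfolding incseq_def le_fun_def
    proof (intro allI impI)
      fix k l :: nat and y assume kl: "k \<le> l"
      show "indicator {0..} y * ennreal (g k y * j k y * (exp (- th * y) * W x - W (x - y))) \<le> indicator {0..} y * ennreal (g l y * j l y * (exp (- th * y) * W x - W (x - y)))"
      proof (cases "0 \<le> y")
        case True
        have "g k y * j k y * (exp (- th * y) * W x - W (x - y)) \<le> g l y * j l y * (exp (- th * y) * W x - W (x - y))"
          using W_diff[OF x True] g j by (intro mult_right_mono mult_mono g_mono j_mono kl) auto
        then show ?thesis using True by (simp add: ennreal_leI)
      qed simp
    qed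
  qed measurable
  then have R: "(\<lambda>k. \<integral>\<^sup>+\<omega>. ?rv k \<omega> \<partial>M) \<longlonglongrightarrow> (\<integral>\<^sup>+y. ?f y \<partial>lborel)" unfolding main .
  let ?r = "\<lambda>\<omega>. ennreal (ruin_value (\<lambda>t. x + S t \<omega>) (phi th) (indicator {a<..}) (indicator {..<0}))"
  have r_lim: "(\<lambda>k. ?rv k \<omega>) \<longlonglongrightarrow> ?r \<omega>" for \<omega>
    by (auto simp: ruin_value_def Let_def intro!: tendsto_ennrealI tendsto_intros g_lim kap_lim)
  have r_mono: "incseq ?rv"
    using g(1) kap(1) by (auto simp: incseq_def le_fun_def ruin_value_def Let_def intro!: ennreal_leI mult_left_mono mult_mono g_mono kap_mono)
  have "(\<lambda>k. \<integral>\<^sup>+\<omega>. ?rv k \<omega> \<partial>M) \<longlonglongrightarrow> (\<integral>\<^sup>+\<omega>. ?r \<omega> \<partial>M)"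
    by (rule nn_integral_LIMSEQ[OF r_mono comp(1) r_lim])
  then show "(\<integral>\<^sup>+\<omega>. ?r \<omega> \<partial>M) = (\<integral>\<^sup>+y. ?f y \<partial>lborel)"
    using R by (rule LIMSEQ_unique)
  show "?r \<in> borel_measurable M"
  proof -
    note comp(1)[measurable]
    have "(\<lambda>\<omega>. limsup (\<lambda>n. ?rv n \<omega>)) \<in> borel_measurable M" by measurable
    then show ?thesis
      by (rule measurable_cong[THEN iffD1, rotated]) (rule lim_imp_Limsup[OF _ r_lim], simp)
  qed
qed

end

section \<open>The surplus process\<close>

lemma (in prob_space) indep_vars_reindex_inj:
  assumes X: "indep_vars (\<lambda>_. T) X UNIV" and f: "inj f"
  shows "indep_vars (\<lambda>_. T) (\<lambda>k. X (f k)) UNIV"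
  unfolding indep_vars_def
proof (intro conjI indep_setsI)
  show rv: "\<forall>i\<in>UNIV. random_variable T (X (f i))" using X by (simp add: indep_vars_def)
  show "sigma_sets (space M) {X (f i) -` A \<inter> space M |A. A \<in> sets T} \<subseteq> events" for i
  proof (rule sets.sigma_sets_subset)
    show "{X (f i) -` A \<inter> space M |A. A \<in> sets T} \<subseteq> events"
      using rv measurable_sets by blast
  qed
  fix A J assume J: "J \<noteq> {}" "finite J" and A: "\<forall>j\<in>J. A j \<in> sigma_sets (space M) {X (f j) -` A \<inter> space M |A. A \<in> sets T}"
  define A' where "A' k = A (inv f k)" for k
  have "prob (\<Inter>j\<in>f ` J. A' j) = (\<Prod>j\<in>f ` J. prob (A' j))"
  proof (rule indep_setsD)
    show "indep_sets (\<lambda>i. sigma_sets (space M) {X i -` A \<inter> space M |A. A \<in> sets T}) UNIV"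
      using X by (simp add: indep_vars_def)
    show "\<forall>j\<in>f ` J. A' j \<in> sigma_sets (space M) {X j -` A \<inter> space M |A. A \<in> sets T}"
      using A f by (auto simp: A'_def)
  qed (use J in auto)
  then show "prob (\<Inter>j\<in>J. A j) = (\<Prod>j\<in>J. prob (A j))"
    using f by (simp add: A'_def prod.reindex inj_on_subset[OF f])
qed

locale risk_data = prob_space M for M :: "'a measure" +
  fixes N :: "real \<Rightarrow> 'a \<Rightarrow> nat" and Y :: "nat \<Rightarrow> 'a \<Rightarrow> real" and B :: "real \<Rightarrow> 'a \<Rightarrow> real"
    and c \<sigma> lam :: real and p :: "real \<Rightarrow> real"
  assumes poisson: "poisson_process M lam N" and brownian: "brownian_motion M B"
    and indepY: "indep_vars (\<lambda>_. borel) Y {1..}"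
    and pm[measurable]: "p \<in> borel_measurable borel" and p_nonneg: "\<And>u. 0 \<le> p u"
    and distY: "\<And>k. k \<ge> 1 \<Longrightarrow> distributed M lborel (Y k) (\<lambda>u. ennreal (p u))"
    and three: "three_independent M N Y B"
begin

section \<open>Path regularity of the surplus and independence of its noise\<close>

lemma lam_pos: "0 < lam"
  using poisson by (simp add: poisson_process_def)

lemma N_measurable: "0 \<le> t \<Longrightarrow> N t \<in> M \<rightarrow>\<^sub>M count_space UNIV"
  using poisson by (simp add: poisson_process_def)

lemma N_0: "\<omega> \<in> space M \<Longrightarrow> N 0 \<omega> = 0"
  and N_mono: "\<omega> \<in> space M \<Longrightarrow> 0 \<le> s \<Longrightarrow> s \<le> t \<Longrightarrow> N s \<omega> \<le> N t \<omega>"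
  and N_right: "\<omega> \<in> space M \<Longrightarrow> 0 \<le> t \<Longrightarrow> ((\<lambda>s. real (N s \<omega>)) \<longlongrightarrow> real (N t \<omega>)) (at_right t)"
  using poisson by (auto simp: poisson_process_def)

lemma B_measurable: "0 \<le> t \<Longrightarrow> B t \<in> borel_measurable M"
  and B_0: "\<omega> \<in> space M \<Longrightarrow> B 0 \<omega> = 0"
  and B_cont: "\<omega> \<in> space M \<Longrightarrow> continuous_on {0..} (\<lambda>t. B t \<omega>)"
  using brownian by (auto simp: brownian_motion_def)

lemma Y_measurable[measurable]: "Y (Suc j) \<in> borel_measurable M"
  using distributed_measurable[OF distY[of "Suc j"]] by simp

definition surplus :: "real \<Rightarrow> 'a \<Rightarrow> real" where
  "surplus t \<omega> = c * t - (\<Sum>j=1..N t \<omega>. Y j \<omega>) + \<sigma> * B t \<omega>"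

lemma claims_sum: "(\<Sum>j=1..n. Y j \<omega>) = (\<Sum>j<n. Y (Suc j) \<omega>)"
  by (simp add: sum.atLeast1_atMost_eq)

lemma surplus_measurable: assumes "0 \<le> t" shows "surplus t \<in> borel_measurable M"
proof -
  note N_measurable[OF assms, measurable] B_measurable[OF assms, measurable]
  have "(\<lambda>\<omega>. (\<lambda>n \<omega>. \<Sum>j<n. Y (Suc j) \<omega>) (N t \<omega>) \<omega>) \<in> borel_measurable M"
    by (rule measurable_compose_countable) measurable
  then have [measurable]: "(\<lambda>\<omega>. \<Sum>j=1..N t \<omega>. Y j \<omega>) \<in> borel_measurable M" by (simp only: claims_sum)
  show ?thesis unfolding surplus_def[abs_def] by measurable
qed

lemma surplus_0: "\<omega> \<in> space M \<Longrightarrow> surplus 0 \<omega> = 0"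
  by (simp add: surplus_def N_0 B_0)

lemma B_within: "\<omega> \<in> space M \<Longrightarrow> 0 \<le> t \<Longrightarrow> T \<subseteq> {0..} \<Longrightarrow> ((\<lambda>s. B s \<omega>) \<longlongrightarrow> B t \<omega>) (at t within T)"
  by (rule tendsto_within_subset[of _ _ _ "{0..}"]) (use B_cont[of \<omega>] in \<open>auto simp: continuous_on_def\<close>)

lemma surplus_right:
  assumes \<omega>: "\<omega> \<in> space M" and t: "0 \<le> t"
  shows "((\<lambda>s. surplus s \<omega>) \<longlongrightarrow> surplus t \<omega>) (at_right t)"
proof -
  have "eventually (\<lambda>s. dist (real (N s \<omega>)) (real (N t \<omega>)) < 1) (at_right t)"
    using tendstoD[OF N_right[OF \<omega> t], of 1] by simp
  then have "eventually (\<lambda>s. N s \<omega> = N t \<omega>) (at_right t)"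
    by eventually_elim (auto simp: dist_real_def)
  then have ev: "eventually (\<lambda>s. c * s - (\<Sum>j=1..N t \<omega>. Y j \<omega>) + \<sigma> * B s \<omega> = surplus s \<omega>) (at_right t)"
    by eventually_elim (simp add: surplus_def)
  have "((\<lambda>s. c * s - (\<Sum>j=1..N t \<omega>. Y j \<omega>) + \<sigma> * B s \<omega>) \<longlongrightarrow> surplus t \<omega>) (at_right t)"
    unfolding surplus_def using t by (intro tendsto_intros B_within \<omega>) auto
  then show ?thesis using ev by (rule Lim_transform_eventually)
qed

text \<open>On \<open>[0, t)\<close> the counting path is nondecreasing and bounded by
  \<open>N t\<close>, so it takes finitely many values and equals the largest of them just before
  \<open>t\<close>. The claim sum is constant there, and the rest is continuous.\<close>

lemma surplus_left:
  assumes \<omega>: "\<omega> \<in> space M" and t: "0 < t"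
  shows "\<exists>l. ((\<lambda>s. surplus s \<omega>) \<longlongrightarrow> l) (at_left t)"
proof -
  let ?V = "(\<lambda>s. N s \<omega>) ` {0..<t}"
  have fin: "finite ?V"
    by (rule finite_subset[of _ "{..N t \<omega>}"]) (use N_mono[OF \<omega>] in auto)
  have ne: "?V \<noteq> {}" using t by auto
  define n where "n = Max ?V"
  obtain s0 where s0: "0 \<le> s0" "s0 < t" "N s0 \<omega> = n"
    using Max_in[OF fin ne] by (auto simp: n_def)
  have N_eq: "N s \<omega> = n" if "s0 < s" "s < t" for s
    using N_mono[OF \<omega> s0(1), of s] Max_ge[OF fin, of "N s \<omega>"] that s0 by (auto simp: n_def[symmetric])
  have "eventually (\<lambda>s. s \<in> {s0<..<t}) (at_left t)"
    using s0(2) by (rule eventually_at_left_real)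
  then have ev: "eventually (\<lambda>s. c * s - (\<Sum>j=1..n. Y j \<omega>) + \<sigma> * B s \<omega> = surplus s \<omega>) (at_left t)"
    by eventually_elim (simp add: surplus_def N_eq)
  have "((\<lambda>s. B s \<omega>) \<longlongrightarrow> B t \<omega>) (at_left t)"
  proof -
    have "((\<lambda>s. B s \<omega>) \<longlongrightarrow> B t \<omega>) (at t within {0<..<t})"
      using t by (intro B_within \<omega>) auto
    moreover have "at t within {0<..<t} = at_left t"
      by (rule at_within_nhd[where S="{0<..}"]) (use t in auto)
    ultimately show ?thesis by simp
  qed
  then have "((\<lambda>s. c * s - (\<Sum>j=1..n. Y j \<omega>) + \<sigma> * B s \<omega>) \<longlongrightarrow> c * t - (\<Sum>j=1..n. Y j \<omega>) + \<sigma> * B t \<omega>) (at_left t)"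
    by (intro tendsto_intros)
  then show ?thesis using Lim_transform_eventually[OF _ ev] by blast
qed

text \<open>Collecting all the driving randomness in one family turns the independence of \<open>N\<close>, \<open>Y\<close> and
  \<open>B\<close> into a single statement; the Markov property of the skeleton then follows by splitting the
  index set.\<close>

definition noise :: "real \<Rightarrow> nat + nat + nat \<Rightarrow> 'a \<Rightarrow> real" where
  "noise h k \<omega> = (case k of Inl k \<Rightarrow> real (N (real (Suc k) * h) \<omega>) - real (N (real k * h) \<omega>)
     | Inr (Inl j) \<Rightarrow> Y (Suc j) \<omega>
     | Inr (Inr k) \<Rightarrow> B (real (Suc k) * h) \<omega> - B (real k * h) \<omega>)"

lemma noise_simps[simp]:
  "noise h (Inl k) \<omega> = real (N (real (Suc k) * h) \<omega>) - real (N (real k * h) \<omega>)"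
  "noise h (Inr (Inl j)) \<omega> = Y (Suc j) \<omega>"
  "noise h (Inr (Inr k)) \<omega> = B (real (Suc k) * h) \<omega> - B (real k * h) \<omega>"
  by (simp_all add: noise_def)

lemma noise_measurable[measurable]: assumes h: "0 \<le> h" shows "noise h k \<in> borel_measurable M"
proof -
  have m: "0 \<le> real k * h" for k using h by simp
  note N_measurable[OF m, measurable] B_measurable[OF m, measurable]
  have 1: "noise h (Inl k) \<in> borel_measurable M" for k
  proof -
    have "noise h (Inl k) = (\<lambda>\<omega>. real (N (real (Suc k) * h) \<omega>) - real (N (real k * h) \<omega>))"
      by (rule ext) (rule noise_simps)
    moreover have "\<dots> \<in> borel_measurable M"
      by (intro borel_measurable_diff measurable_compose[OF N_measurable[OF m]]) auto
    ultimately show ?thesis by (simp only:)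
  qed
  have 2: "noise h (Inr (Inl k)) \<in> borel_measurable M" for k
  proof -
    have "noise h (Inr (Inl k)) = Y (Suc k)" by (simp add: fun_eq_iff)
    then show ?thesis by simp
  qed
  have 3: "noise h (Inr (Inr k)) \<in> borel_measurable M" for k
  proof -
    have "noise h (Inr (Inr k)) = (\<lambda>\<omega>. B (real (Suc k) * h) \<omega> - B (real k * h) \<omega>)" by (rule ext) (rule noise_simps)
    moreover have "\<dots> \<in> borel_measurable M"
      by (intro borel_measurable_diff B_measurable m)
    ultimately show ?thesis by (simp only:)
  qed
  show ?thesis
    using 1 2 3 by (metis old.sum.exhaust)
qed

text \<open>\<open>independent_increments\<close> speaks of initial segments of a partition, so
  \<open>J\<close> is enlarged to one. The intersection with \<open>space M\<close> gives the right
  meaning to empty \<open>J\<close>.\<close>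

lemma increments_prob:
  assumes ind: "independent_increments M Z" and Zm: "\<And>t. 0 \<le> t \<Longrightarrow> Z t \<in> borel_measurable M"
    and h: "0 \<le> h" and J: "finite J" and A: "\<And>k. k \<in> J \<Longrightarrow> A k \<in> sets borel"
  shows "prob (space M \<inter> (\<Inter>k\<in>J. (\<lambda>\<omega>. Z (real (Suc k) * h) \<omega> - Z (real k * h) \<omega>) -` A k \<inter> space M))
    = (\<Prod>k\<in>J. prob ((\<lambda>\<omega>. Z (real (Suc k) * h) \<omega> - Z (real k * h) \<omega>) -` A k \<inter> space M))"
proof (cases "J = {}")
  case False
  obtain n where n: "J \<subseteq> {..<n}"
    using finite_nat_set_iff_bounded J by (metis lessThan_iff subsetI)
  have "real i * h \<le> real (Suc i) * h" for i using h by (intro mult_right_mono) auto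
  then have iv: "indep_vars (\<lambda>_. borel) (\<lambda>i \<omega>. Z (real (Suc i) * h) \<omega> - Z (real i * h) \<omega>) {..<n}"
    using ind[unfolded independent_increments_def, rule_format, of "\<lambda>i. real i * h" n] h
    by (simp del: of_nat_Suc)
  have "space M \<inter> (\<Inter>k\<in>J. (\<lambda>\<omega>. Z (real (Suc k) * h) \<omega> - Z (real k * h) \<omega>) -` A k \<inter> space M) =
    (\<Inter>k\<in>J. (\<lambda>\<omega>. Z (real (Suc k) * h) \<omega> - Z (real k * h) \<omega>) -` A k \<inter> space M)"
    using False by auto
  then show ?thesis using indep_varsD[OF iv False J n A] by simp
qed (simp add: prob_space)

text \<open>A finite rectangle factors in two stages: \<open>three_independent\<close> separates the
  counting, claim and Brownian parts \<open>E1\<close>, \<open>E2\<close>, \<open>E3\<close>, and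
  each part then factors by its own independence. For the first stage the increments must be
  measurable for the generated \<open>\<sigma>\<close>-algebras, not just for
  \<open>M\<close>.\<close>

lemma noise_indep:
  assumes h: "0 \<le> h"
  shows "indep_vars (\<lambda>_. borel) (noise h) UNIV"
  unfolding indep_vars_def2
proof (intro conjI ballI indep_setsI)
  show nm: "noise h k \<in> borel_measurable M" for k by (rule noise_measurable[OF h])
  then show "{noise h k -` A \<inter> space M |A. A \<in> sets borel} \<subseteq> events" for k
    by (auto intro: measurable_sets)
  fix J and A assume J: "J \<noteq> {}" "finite J" and A: "\<forall>j\<in>J. A j \<in> {noise h j -` A \<inter> space M |A. A \<in> sets borel}"
  have "\<forall>j\<in>J. \<exists>D. D \<in> sets borel \<and> A j = noise h j -` D \<inter> space M" using A by auto
  then obtain D where D: "\<And>j. j \<in> J \<Longrightarrow> D j \<in> sets borel" "\<And>j. j \<in> J \<Longrightarrow> A j = noise h j -` D j \<inter> space M"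
    by metis
  define J1 where "J1 = {k. Inl k \<in> J}"
  define J2 where "J2 = {k. Inr (Inl k) \<in> J}"
  define J3 where "J3 = {k. Inr (Inr k) \<in> J}"
  have Jeq: "J = Inl ` J1 \<union> (Inr \<circ> Inl) ` J2 \<union> (Inr \<circ> Inr) ` J3"
  proof (rule set_eqI)
    fix x show "x \<in> J \<longleftrightarrow> x \<in> Inl ` J1 \<union> (Inr \<circ> Inl) ` J2 \<union> (Inr \<circ> Inr) ` J3"
      unfolding J1_def J2_def J3_def by (cases x; cases "projr x"; force)
  qed
  have fin: "finite J1" "finite J2" "finite J3"
    unfolding J1_def J2_def J3_def
    using finite_vimageI[OF J(2), of Inl] finite_vimageI[OF J(2), of "Inr \<circ> Inl"] finite_vimageI[OF J(2), of "Inr \<circ> Inr"]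
    by (auto simp: vimage_def inj_on_def inj_def)
  define E1 where "E1 = space M \<inter> (\<Inter>k\<in>J1. A (Inl k))"
  define E2 where "E2 = space M \<inter> (\<Inter>k\<in>J2. A (Inr (Inl k)))"
  define E3 where "E3 = space M \<inter> (\<Inter>k\<in>J3. A (Inr (Inr k)))"
  have A_sub: "j \<in> J \<Longrightarrow> A j \<subseteq> space M" for j using D(2) by auto
  have AI: "(\<Inter>j\<in>J. A j) = E1 \<inter> E2 \<inter> E3"
  proof -
    have "(\<Inter>j\<in>J. A j) = space M \<inter> (\<Inter>j\<in>J. A j)" using J(1) A_sub by blast
    also have "\<dots> = E1 \<inter> E2 \<inter> E3"
      unfolding E1_def E2_def E3_def by (subst Jeq) auto
    finally show ?thesis .
  qed
  have p1: "prob E1 = (\<Prod>k\<in>J1. prob (A (Inl k)))"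
  proof -
    have A1: "A (Inl k) = (\<lambda>\<omega>. real (N (real (Suc k) * h) \<omega>) - real (N (real k * h) \<omega>)) -` D (Inl k) \<inter> space M" if "k \<in> J1" for k
      using that D(2)[of "Inl k"] by (auto simp: J1_def)
    have "independent_increments M (\<lambda>t \<omega>. real (N t \<omega>))" using poisson by (simp add: poisson_process_def)
    note * = increments_prob[OF this _ h fin(1), of "\<lambda>k. D (Inl k)"]
    have e: "E1 = space M \<inter> (\<Inter>k\<in>J1. (\<lambda>\<omega>. real (N (real (Suc k) * h) \<omega>) - real (N (real k * h) \<omega>)) -` D (Inl k) \<inter> space M)"
      unfolding E1_def by (intro arg_cong2[where f="(\<inter>)"] INF_cong refl A1)
    show ?thesis unfolding e
    proof (subst *)
      show "(\<lambda>\<omega>. real (N t \<omega>)) \<in> borel_measurable M" if "0 \<le> t" for t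
        using N_measurable[OF that] by measurable
    qed (use D(1) A1 in \<open>auto simp: J1_def intro!: prod.cong\<close>)
  qed
  have p3: "prob E3 = (\<Prod>k\<in>J3. prob (A (Inr (Inr k))))"
  proof -
    have A3: "A (Inr (Inr k)) = (\<lambda>\<omega>. B (real (Suc k) * h) \<omega> - B (real k * h) \<omega>) -` D (Inr (Inr k)) \<inter> space M" if "k \<in> J3" for k
      using that D(2)[of "Inr (Inr k)"] by (auto simp: J3_def)
    have "independent_increments M B" using brownian by (simp add: brownian_motion_def)
    note * = increments_prob[OF this B_measurable h fin(3), of "\<lambda>k. D (Inr (Inr k))"]
    have e: "E3 = space M \<inter> (\<Inter>k\<in>J3. (\<lambda>\<omega>. B (real (Suc k) * h) \<omega> - B (real k * h) \<omega>) -` D (Inr (Inr k)) \<inter> space M)"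
      unfolding E3_def by (intro arg_cong2[where f="(\<inter>)"] INF_cong refl A3)
    show ?thesis unfolding e
      by (subst *) (use D(1) A3 in \<open>auto simp: J3_def intro!: prod.cong\<close>)
  qed
  have A2: "A (Inr (Inl k)) = Y (Suc k) -` D (Inr (Inl k)) \<inter> space M" if "k \<in> J2" for k
    using that D(2)[of "Inr (Inl k)"] by (auto simp: J2_def)
  have p2: "prob E2 = (\<Prod>k\<in>J2. prob (A (Inr (Inl k))))"
  proof (cases "J2 = {}")
    case False
    have "prob (\<Inter>k\<in>Suc ` J2. Y k -` D (Inr (Inl (k - 1))) \<inter> space M) = (\<Prod>k\<in>Suc ` J2. prob (Y k -` D (Inr (Inl (k - 1))) \<inter> space M))"
      by (rule indep_varsD[OF indepY]) (use False fin D(1) in \<open>auto simp: J2_def\<close>)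
    moreover have "E2 = (\<Inter>k\<in>Suc ` J2. Y k -` D (Inr (Inl (k - 1))) \<inter> space M)"
      unfolding E2_def using False A2 by auto
    ultimately show ?thesis using A2 by (simp add: prod.reindex)
  qed (simp add: E2_def prob_space)
  have g1: "E1 \<in> generated_by M {0..} (count_space UNIV) N"
  proof -
    define G where "G = sigma (space M) {N i -` A \<inter> space M | i A. i \<in> {0..} \<and> A \<in> sets (count_space (UNIV::nat set))}"
    have G: "sets G = generated_by M {0..} (count_space UNIV) N" "space G = space M"
      unfolding G_def generated_by_def by (auto intro!: sets_measure_of space_measure_of)
    have NG: "N t \<in> measurable G (count_space UNIV)" if "0 \<le> t" for t
    proof (rule measurableI)
      fix A
      have "N t -` A \<inter> space M \<in> sets G"
        unfolding G_def by (rule in_measure_of) (use that in auto)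
      then show "N t -` A \<inter> space G \<in> sets G" by (simp add: G(2))
    qed simp
    have "A (Inl k) \<in> sets G" if "k \<in> J1" for k
    proof -
      have m: "0 \<le> real k * h" for k using h by simp
      have "(\<lambda>\<omega>. real (N (real (Suc k) * h) \<omega>) - real (N (real k * h) \<omega>)) \<in> borel_measurable G"
        by (intro borel_measurable_diff measurable_compose[OF NG[OF m]]) auto
      from measurable_sets[OF this D(1)[of "Inl k"]] show ?thesis
        using that D(2)[of "Inl k"] by (simp add: J1_def G(2) vimage_def)
    qed
    then have "E1 \<in> sets G"
      unfolding E1_def G(2)[symmetric] using fin(1) by (cases "J1 = {}") (auto intro!: sets.Int sets.finite_INT)
    then show ?thesis by (simp add: G)
  qed
  have g3: "E3 \<in> generated_by M {0..} borel B"
  proof -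
    define G where "G = sigma (space M) {B i -` A \<inter> space M | i A. i \<in> {0..} \<and> A \<in> sets (borel::real measure)}"
    have G: "sets G = generated_by M {0..} borel B" "space G = space M"
      unfolding G_def generated_by_def by (auto intro!: sets_measure_of space_measure_of)
    have BG: "B t \<in> borel_measurable G" if "0 \<le> t" for t
    proof (rule measurableI)
      fix A :: "real set" assume "A \<in> sets borel"
      then have "B t -` A \<inter> space M \<in> sets G"
        unfolding G_def by (intro in_measure_of) (use that in auto)
      then show "B t -` A \<inter> space G \<in> sets G" by (simp add: G(2))
    qed simp
    have "A (Inr (Inr k)) \<in> sets G" if "k \<in> J3" for k
    proof -
      have m: "0 \<le> real k * h" for k using h by simp
      have "(\<lambda>\<omega>. B (real (Suc k) * h) \<omega> - B (real k * h) \<omega>) \<in> borel_measurable G"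
        by (intro borel_measurable_diff BG m)
      from measurable_sets[OF this D(1)[of "Inr (Inr k)"]] show ?thesis
        using that D(2)[of "Inr (Inr k)"] by (simp add: J3_def G(2) vimage_def)
    qed
    then have "E3 \<in> sets G"
      unfolding E3_def G(2)[symmetric] using fin(3) by (cases "J3 = {}") (auto intro!: sets.Int sets.finite_INT)
    then show ?thesis by (simp add: G)
  qed
  have g2: "E2 \<in> generated_by M {1..} borel Y"
  proof -
    define G where "G = sigma (space M) {Y i -` A \<inter> space M | i A. i \<in> {1..} \<and> A \<in> sets (borel::real measure)}"
    have G: "sets G = generated_by M {1..} borel Y" "space G = space M"
      unfolding G_def generated_by_def by (auto intro!: sets_measure_of space_measure_of)
    have "A (Inr (Inl k)) \<in> sets G" if "k \<in> J2" for k
      unfolding A2[OF that] G_def by (rule in_measure_of) (use that D(1) in \<open>auto simp: J2_def intro!: exI[of _ "Suc k"]\<close>)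
    then have "E2 \<in> sets G"
      unfolding E2_def G(2)[symmetric] using fin(2) by (cases "J2 = {}") (auto intro!: sets.Int sets.finite_INT)
    then show ?thesis by (simp add: G)
  qed
  have "prob (\<Inter>k\<in>{0,1,2}. [E1, E2, E3] ! k) = (\<Prod>k\<in>{0,1,2}. prob ([E1, E2, E3] ! k))"
    by (rule indep_setsD[OF three[unfolded three_independent_def]]) (use g1 g2 g3 in auto)
  then have "prob (E1 \<inter> E2 \<inter> E3) = prob E1 * prob E2 * prob E3"
    by (simp add: Int_assoc mult.assoc numeral_2_eq_2)
  also have "\<dots> = (\<Prod>k\<in>J1. prob (A (Inl k))) * (\<Prod>k\<in>J2. prob (A (Inr (Inl k)))) * (\<Prod>k\<in>J3. prob (A (Inr (Inr k))))"
    by (simp only: p1 p2 p3)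
  also have "\<dots> = (\<Prod>j\<in>J. prob (A j))"
  proof -
    have "(\<Prod>j\<in>J. prob (A j)) = (\<Prod>j\<in>Inl ` J1 \<union> (Inr \<circ> Inl) ` J2. prob (A j)) * (\<Prod>j\<in>(Inr \<circ> Inr) ` J3. prob (A j))"
      by (subst Jeq, rule prod.union_disjoint) (use fin in auto)
    also have "(\<Prod>j\<in>Inl ` J1 \<union> (Inr \<circ> Inl) ` J2. prob (A j)) = (\<Prod>j\<in>Inl ` J1. prob (A j)) * (\<Prod>j\<in>(Inr \<circ> Inl) ` J2. prob (A j))"
      by (rule prod.union_disjoint) (use fin in auto)
    finally show ?thesis by (simp add: prod.reindex inj_on_def)
  qed
  finally show "prob (\<Inter>j\<in>J. A j) = (\<Prod>j\<in>J. prob (A j))" unfolding AI .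
qed

text \<open>Selects the noise driving grid step \<open>i\<close> when \<open>n\<close> claims have
  occurred before: the \<open>i\<close>-th increments of \<open>N\<close> and \<open>B\<close>, and
  all claims after the \<open>n\<close>-th. The claim indices stay infinite because the number of
  claims in the step is random.\<close>

definition pick :: "nat \<Rightarrow> nat \<Rightarrow> unit + nat + unit \<Rightarrow> nat + nat + nat" where
  "pick i n k = (case k of Inl _ \<Rightarrow> Inl i | Inr (Inl j) \<Rightarrow> Inr (Inl (n + j)) | Inr (Inr _) \<Rightarrow> Inr (Inr i))"

definition step_value :: "real \<Rightarrow> (unit + nat + unit \<Rightarrow> real) \<Rightarrow> real" where
  "step_value h r = c * h - (\<Sum>j<nat \<lfloor>r (Inl ())\<rfloor>. r (Inr (Inl j))) + \<sigma> * r (Inr (Inr ()))"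

definition step_distr :: "real \<Rightarrow> real measure" where
  "step_distr h = distr M borel (surplus h)"

section \<open>Markov property on the grid\<close>

lemma inj_pick: "inj (pick i n)"
  by (auto simp: inj_def pick_def split: sum.splits)

lemma step_value_measurable[measurable]: "step_value h \<in> borel_measurable (Pi\<^sub>M UNIV (\<lambda>_. borel))"
proof -
  have [measurable]: "(\<lambda>r. r k) \<in> borel_measurable (Pi\<^sub>M (UNIV :: (unit + nat + unit) set) (\<lambda>_. borel :: real measure))" for k
    by measurable
  have "(\<lambda>r. (\<lambda>n r. \<Sum>j<n. r (Inr (Inl j))) (nat \<lfloor>r (Inl ())\<rfloor>) r) \<in> borel_measurable (Pi\<^sub>M (UNIV :: (unit + nat + unit) set) (\<lambda>_. borel :: real measure))"
    by (rule measurable_compose_countable) measurable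
  then show ?thesis unfolding step_value_def[abs_def] by measurable
qed

lemma surplus_increment:
  assumes \<omega>: "\<omega> \<in> space M" and h: "0 \<le> h" and n: "N (real i * h) \<omega> = n"
  shows "step_value h (\<lambda>k. noise h (pick i n k) \<omega>) = surplus (real (Suc i) * h) \<omega> - surplus (real i * h) \<omega>"
proof -
  have "real i * h \<le> real (Suc i) * h" using h by (intro mult_right_mono) auto
  then have le: "n \<le> N (real (Suc i) * h) \<omega>" using N_mono[OF \<omega>, of "real i * h" "real (Suc i) * h"] n h by simp
  then obtain k where k: "N (real (Suc i) * h) \<omega> = n + k" by (metis le_Suc_ex)
  have "(\<Sum>j<n + k. Y (Suc j) \<omega>) = (\<Sum>j<n. Y (Suc j) \<omega>) + (\<Sum>j<k. Y (Suc (n + j)) \<omega>)"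
    by (induction k) auto
  moreover have "step_value h (\<lambda>k. noise h (pick i n k) \<omega>) = c * h - (\<Sum>j<k. Y (Suc (n + j)) \<omega>) + \<sigma> * (B (real (Suc i) * h) \<omega> - B (real i * h) \<omega>)"
  proof -
    have "nat \<lfloor>real (N (real (Suc i) * h) \<omega>) - real (N (real i * h) \<omega>)\<rfloor> = k" by (simp only: k n) simp
    then show ?thesis by (simp only: step_value_def pick_def noise_simps sum.case)
  qed
  ultimately show ?thesis
    unfolding surplus_def claims_sum k n by (simp add: algebra_simps)
qed

lemma poisson_law:
  assumes "0 \<le> s" "s < t"
  shows "distr M borel (\<lambda>\<omega>. real (N t \<omega>) - real (N s \<omega>)) = distr (measure_pmf (poisson_pmf (lam * (t - s)))) borel real"
proof -
  note N_measurable[OF assms(1), measurable]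
  have [measurable]: "N t \<in> M \<rightarrow>\<^sub>M count_space UNIV" using assms by (intro N_measurable) auto
  have "measure_pmf (poisson_pmf (lam * (t - s))) = distr M (count_space UNIV) (\<lambda>\<omega>. N t \<omega> - N s \<omega>)"
    using poisson assms by (simp add: poisson_process_def)
  then have "distr (measure_pmf (poisson_pmf (lam * (t - s)))) borel real = distr (distr M (count_space UNIV) (\<lambda>\<omega>. N t \<omega> - N s \<omega>)) borel real"
    by simp
  also have "\<dots> = distr M borel (\<lambda>\<omega>. real (N t \<omega> - N s \<omega>))"
    by (subst distr_distr) (auto simp: comp_def)
  also have "\<dots> = distr M borel (\<lambda>\<omega>. real (N t \<omega>) - real (N s \<omega>))"
    using N_mono assms by (intro distr_cong) (auto simp: of_nat_diff)
  finally show ?thesis ..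
qed

lemma noise_law:
  assumes h: "0 < h"
  shows "distr M borel (noise h (pick i n k)) = distr M borel (noise h (pick 0 0 k))"
proof -
  consider "k = Inl ()" | j where "k = Inr (Inl j)" | "k = Inr (Inr ())"
    by (metis old.sum.exhaust old.unit.exhaust)
  then show ?thesis
  proof cases
    case 1
    have "distr M borel (noise h (Inl i)) = distr (measure_pmf (poisson_pmf (lam * h))) borel real" for i
    proof -
      have "real (Suc i) * h - real i * h = h" by (simp add: algebra_simps)
      moreover have "noise h (Inl i) = (\<lambda>\<omega>. real (N (real (Suc i) * h) \<omega>) - real (N (real i * h) \<omega>))"
        by (rule ext) (rule noise_simps)
      ultimately show ?thesis
        using poisson_law[of "real i * h" "real (Suc i) * h"] h by (simp add: mult_strict_right_mono)
    qed
    then show ?thesis using 1 by (simp add: pick_def)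
  next
    case (2 j)
    have "distr M borel (noise h (Inr (Inl j))) = density lborel (\<lambda>u. ennreal (p u))" for j
    proof -
      have "noise h (Inr (Inl j)) = Y (Suc j)" by (rule ext) (rule noise_simps)
      then show ?thesis using distributed_distr_eq_density[OF distY[of "Suc j"]]
        by (simp cong: distr_cong)
    qed
    then show ?thesis using 2 by (simp add: pick_def)
  next
    case 3
    have "distr M borel (noise h (Inr (Inr i))) = density lborel (\<lambda>u. ennreal (normal_density 0 (sqrt h) u))" for i
    proof -
      have "real (Suc i) * h - real i * h = h" by (simp add: algebra_simps)
      moreover have "noise h (Inr (Inr i)) = (\<lambda>\<omega>. B (real (Suc i) * h) \<omega> - B (real i * h) \<omega>)"
        by (rule ext) (rule noise_simps)
      moreover have "distributed M lborel (\<lambda>\<omega>. B (real (Suc i) * h) \<omega> - B (real i * h) \<omega>)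
          (\<lambda>u. ennreal (normal_density 0 (sqrt (real (Suc i) * h - real i * h)) u))"
        using brownian h unfolding brownian_motion_def by (simp add: mult_strict_right_mono del: of_nat_Suc)
      ultimately show ?thesis
        using distributed_distr_eq_density[of M lborel "\<lambda>\<omega>. B (real (Suc i) * h) \<omega> - B (real i * h) \<omega>"]
        by (simp cong: distr_cong)
    qed
    then show ?thesis using 3 by (simp add: pick_def)
  qed
qed

text \<open>Independence turns the law of the selected noise into a product measure, so only its
  marginals matter, and these do not depend on \<open>i\<close> or \<open>n\<close>. The choice
  \<open>i = n = 0\<close> identifies the common law with that of \<open>surplus h\<close>.\<close>

lemma step_value_law:
  assumes h: "0 < h"
  shows "distr M borel (\<lambda>\<omega>. step_value h (\<lambda>k. noise h (pick i n k) \<omega>)) = step_distr h"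
proof -
  have eq: "distr M borel (\<lambda>\<omega>. step_value h (\<lambda>k. noise h (pick i n k) \<omega>)) =
    distr (Pi\<^sub>M UNIV (\<lambda>k. distr M borel (noise h (pick i n k)))) borel (step_value h)" for i n
  proof -
    have rv: "noise h (pick i n k) \<in> borel_measurable M" for k using h by (intro noise_measurable) simp
    have "indep_vars (\<lambda>_. borel) (\<lambda>k. noise h (pick i n k)) UNIV"
      by (rule indep_vars_reindex_inj[OF noise_indep[OF less_imp_le[OF h]] inj_pick])
    then have "distr M (Pi\<^sub>M UNIV (\<lambda>_. borel)) (\<lambda>\<omega>. \<lambda>k\<in>UNIV. noise h (pick i n k) \<omega>) = Pi\<^sub>M UNIV (\<lambda>k. distr M borel (noise h (pick i n k)))"
      by (subst (asm) indep_vars_iff_distr_eq_PiM) (use rv in auto)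
    then have "distr (Pi\<^sub>M UNIV (\<lambda>k. distr M borel (noise h (pick i n k)))) borel (step_value h)
      = distr (distr M (Pi\<^sub>M UNIV (\<lambda>_. borel)) (\<lambda>\<omega>. \<lambda>k\<in>UNIV. noise h (pick i n k) \<omega>)) borel (step_value h)" by simp
    also have "\<dots> = distr M borel (step_value h \<circ> (\<lambda>\<omega>. \<lambda>k\<in>UNIV. noise h (pick i n k) \<omega>))"
      by (rule distr_distr) (use rv in \<open>auto intro!: measurable_restrict\<close>)
    finally show ?thesis by (simp add: comp_def restrict_UNIV)
  qed
  have "distr M borel (\<lambda>\<omega>. step_value h (\<lambda>k. noise h (pick i n k) \<omega>)) = distr M borel (\<lambda>\<omega>. step_value h (\<lambda>k. noise h (pick 0 0 k) \<omega>))"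
    unfolding eq by (intro arg_cong[where f="\<lambda>f. distr (Pi\<^sub>M UNIV f) borel (step_value h)"] ext noise_law[OF h])
  also have "\<dots> = step_distr h"
    unfolding step_distr_def
  proof (rule distr_cong)
    fix \<omega> assume \<omega>: "\<omega> \<in> space M"
    show "step_value h (\<lambda>k. noise h (pick 0 0 k) \<omega>) = surplus h \<omega>"
      using surplus_increment[OF \<omega>, of h 0 0] h by (simp add: N_0 surplus_0 \<omega>)
  qed auto
  finally show ?thesis .
qed

lemma noise_sums:
  assumes \<omega>: "\<omega> \<in> space M"
  shows "(\<Sum>l<k. noise h (Inl l) \<omega>) = real (N (real k * h) \<omega>)" "(\<Sum>l<k. noise h (Inr (Inr l)) \<omega>) = B (real k * h) \<omega>"
  using sum_lessThan_telescope[of "\<lambda>k. real (N (real k * h) \<omega>)" k] sum_lessThan_telescope[of "\<lambda>k. B (real k * h) \<omega>" k]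
  by (simp_all add: N_0 B_0 \<omega> del: of_nat_Suc)

text \<open>How many claims belong to the past is itself random, so no fixed set of noise indices
  carries the past. After splitting according to \<open>N (i h) = n\<close> the past uses the
  indices \<open>A1\<close> and the next step the disjoint set \<open>A2\<close>; the conditional
  law of the step does not depend on \<open>n\<close>, and the pieces sum up again.\<close>

lemma surplus_markov:
  assumes h: "0 < h" and w[measurable]: "w \<in> borel_measurable (Pi\<^sub>M {..i} (\<lambda>_. borel) \<Otimes>\<^sub>M borel)"
  shows "(\<integral>\<^sup>+\<omega>. w (\<lambda>k\<in>{..i}. surplus (real k * h) \<omega>, surplus (real (Suc i) * h) \<omega> - surplus (real i * h) \<omega>) \<partial>M) =
      (\<integral>\<^sup>+\<omega>. \<integral>\<^sup>+u. w (\<lambda>k\<in>{..i}. surplus (real k * h) \<omega>, u) \<partial>step_distr h \<partial>M)"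
proof -
  let ?path = "\<lambda>\<omega>. \<lambda>k\<in>{..i}. surplus (real k * h) \<omega>"
  let ?inc = "\<lambda>\<omega>. surplus (real (Suc i) * h) \<omega> - surplus (real i * h) \<omega>"
  let ?n = "\<lambda>n. {\<omega>. N (real i * h) \<omega> = n}"
  have h0: "0 \<le> real k * h" for k using h by simp
  have sm[measurable]: "surplus (real k * h) \<in> borel_measurable M" for k by (rule surplus_measurable[OF h0])
  have sm'[measurable]: "surplus (real (Suc i) * h) \<in> borel_measurable M" by (rule sm)
  have Nm[measurable]: "N (real i * h) \<in> M \<rightarrow>\<^sub>M count_space UNIV" by (rule N_measurable[OF h0])
  have pm'[measurable]: "?path \<in> M \<rightarrow>\<^sub>M Pi\<^sub>M {..i} (\<lambda>_. borel)" by (intro measurable_restrict sm)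
  have sd[measurable_cong]: "sets (step_distr h) = sets borel" by (simp add: step_distr_def)
  interpret D: prob_space "step_distr h"
    unfolding step_distr_def using h by (intro prob_space_distr surplus_measurable) simp
  have [measurable]: "(\<lambda>\<omega>. w (?path \<omega>, ?inc \<omega>)) \<in> borel_measurable M"
    by measurable
  have [measurable]: "(\<lambda>\<omega>. \<integral>\<^sup>+u. w (?path \<omega>, u) \<partial>step_distr h) \<in> borel_measurable M"
    by measurable
  have [measurable]: "?n n \<inter> space M \<in> sets M" for n
    using measurable_sets[OF Nm, of "{n}"] by (simp add: vimage_def)
  have indm[measurable]: "(indicator (?n n) :: 'a \<Rightarrow> ennreal) \<in> borel_measurable M" for n
  proof -
    have "(\<lambda>\<omega>. indicator {n} (N (real i * h) \<omega>) :: ennreal) \<in> borel_measurable M"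
      by (rule measurable_compose[OF Nm]) simp
    also have "(\<lambda>\<omega>. indicator {n} (N (real i * h) \<omega>) :: ennreal) = indicator (?n n)" by (auto simp: indicator_def)
    finally show ?thesis .
  qed
  have split: "(\<integral>\<^sup>+\<omega>. f \<omega> \<partial>M) = (\<Sum>n. \<integral>\<^sup>+\<omega>. f \<omega> * indicator (?n n) \<omega> \<partial>M)" if [measurable]: "f \<in> borel_measurable M" for f :: "'a \<Rightarrow> ennreal"
  proof -
    have "f \<omega> = (\<Sum>n. f \<omega> * indicator (?n n) \<omega>)" for \<omega>
    proof -
      have "(\<Sum>n. f \<omega> * indicator (?n n) \<omega>) = (\<Sum>n\<in>{N (real i * h) \<omega>}. f \<omega> * indicator (?n n) \<omega>)"
        by (rule suminf_finite) auto
      then show ?thesis by simp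
    qed
    then have "(\<integral>\<^sup>+\<omega>. f \<omega> \<partial>M) = (\<integral>\<^sup>+\<omega>. (\<Sum>n. f \<omega> * indicator (?n n) \<omega>) \<partial>M)" by simp
    also have "\<dots> = (\<Sum>n. \<integral>\<^sup>+\<omega>. f \<omega> * indicator (?n n) \<omega> \<partial>M)"
      by (rule nn_integral_suminf) measurable
    finally show ?thesis .
  qed
  have "(\<integral>\<^sup>+\<omega>. w (?path \<omega>, ?inc \<omega>) * indicator (?n n) \<omega> \<partial>M) = (\<integral>\<^sup>+\<omega>. (\<integral>\<^sup>+u. w (?path \<omega>, u) \<partial>step_distr h) * indicator (?n n) \<omega> \<partial>M)" for n
  proof -
    \<comment> \<open>The indicator of \<open>N (i h) = n\<close> is itself a function of the
      \<open>A1\<close> coordinates, through \<open>cnt\<close>; so it may sit inside the functional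
      of the past.\<close>
    define A1 :: "(nat + nat + nat) set" where "A1 = Inl ` {..<i} \<union> (\<lambda>j. Inr (Inl j)) ` {..<n} \<union> (\<lambda>k. Inr (Inr k)) ` {..<i}"
    define A2 where "A2 = range (pick i n)"
    have disj: "A1 \<inter> A2 = {}" by (auto simp: A1_def A2_def pick_def split: sum.splits)
    have A1_in: "Inl l \<in> A1" "Inr (Inr l) \<in> A1" if "l < i" for l using that by (auto simp: A1_def)
    have A1_in': "Inr (Inl j) \<in> A1" if "j < n" for j using that by (auto simp: A1_def)
    let ?P1 = "Pi\<^sub>M A1 (\<lambda>_. borel :: real measure)" and ?P2 = "Pi\<^sub>M A2 (\<lambda>_. borel :: real measure)"
    let ?R1 = "\<lambda>\<omega>. restrict (\<lambda>k. noise h k \<omega>) A1" and ?R2 = "\<lambda>\<omega>. restrict (\<lambda>k. noise h k \<omega>) A2"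
    \<comment> \<open>On the event considered, at most \<open>n\<close> claims have occurred by any
      earlier grid time. The random claim sum can therefore be written with fixed length
      \<open>n\<close> and a cut-off, which involves \<open>A1\<close> coordinates only.\<close>
    define path where "path r = (\<lambda>k\<in>{..i}. c * (real k * h) - (\<Sum>j<n. if real j < (\<Sum>l<k. r (Inl l)) then r (Inr (Inl j)) else 0) + \<sigma> * (\<Sum>l<k. r (Inr (Inr l))))"
      for r :: "nat + nat + nat \<Rightarrow> real"
    define inc where "inc r = step_value h (\<lambda>k. r (pick i n k))" for r :: "nat + nat + nat \<Rightarrow> real"
    define cnt where "cnt r = (\<Sum>l<i. r (Inl l))" for r :: "nat + nat + nat \<Rightarrow> real"
    have iv: "indep_var ?P1 ?R1 ?P2 ?R2"
      using h disj by (intro indep_var_restrict[OF noise_indep]) auto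
    have R1m: "?R1 \<in> M \<rightarrow>\<^sub>M ?P1" and R2m: "?R2 \<in> M \<rightarrow>\<^sub>M ?P2" and deq: "distr M ?P1 ?R1 \<Otimes>\<^sub>M distr M ?P2 ?R2 = distr M (?P1 \<Otimes>\<^sub>M ?P2) (\<lambda>\<omega>. (?R1 \<omega>, ?R2 \<omega>))"
      using iv unfolding indep_var_distribution_eq by auto
    have pathm: "path \<in> ?P1 \<rightarrow>\<^sub>M Pi\<^sub>M {..i} (\<lambda>_. borel)"
      unfolding path_def
    proof (rule measurable_restrict)
      fix k assume k: "k \<in> {..i}"
      have l: "(\<lambda>r. r (Inl l)) \<in> borel_measurable ?P1" "(\<lambda>r. r (Inr (Inr l))) \<in> borel_measurable ?P1" if "l \<in> {..<k}" for l
        using that k A1_in[of l] by (auto intro!: measurable_component_singleton)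
      have 1[measurable]: "(\<lambda>r. \<Sum>l<k. r (Inl l)) \<in> borel_measurable ?P1" "(\<lambda>r. \<Sum>l<k. r (Inr (Inr l))) \<in> borel_measurable ?P1"
        using l by (auto intro!: borel_measurable_sum)
      have "(\<lambda>r. \<Sum>j<n. if real j < (\<Sum>l<k. r (Inl l)) then r (Inr (Inl j)) else 0) \<in> borel_measurable ?P1"
      proof (rule borel_measurable_sum)
        fix j assume "j \<in> {..<n}"
        then have [measurable]: "(\<lambda>r. r (Inr (Inl j))) \<in> borel_measurable ?P1"
          using A1_in'[of j] by (auto intro!: measurable_component_singleton)
        show "(\<lambda>r. if real j < (\<Sum>l<k. r (Inl l)) then r (Inr (Inl j)) else 0) \<in> borel_measurable ?P1"
          by measurable
      qed
      then show "(\<lambda>r. c * (real k * h) - (\<Sum>j<n. if real j < (\<Sum>l<k. r (Inl l)) then r (Inr (Inl j)) else 0) + \<sigma> * (\<Sum>l<k. r (Inr (Inr l)))) \<in> borel_measurable ?P1"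
        using 1 by measurable
    qed
    have incm: "inc \<in> borel_measurable ?P2"
    proof -
      have "(\<lambda>r. \<lambda>k\<in>UNIV. r (pick i n k)) \<in> ?P2 \<rightarrow>\<^sub>M Pi\<^sub>M UNIV (\<lambda>_. borel)"
        by (rule measurable_restrict) (auto simp: A2_def intro!: measurable_component_singleton)
      from measurable_compose[OF this step_value_measurable[of h]] show ?thesis
        by (simp add: inc_def[abs_def] restrict_UNIV)
    qed
    have cntm: "cnt \<in> borel_measurable ?P1"
      unfolding cnt_def[abs_def] using A1_in by (intro borel_measurable_sum measurable_component_singleton) auto
    define W where "W = (\<lambda>(r1, r2). w (path r1, inc r2) * indicator {real n} (cnt r1))"
    have Wm: "W \<in> borel_measurable (?P1 \<Otimes>\<^sub>M ?P2)"
    proof -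
      note pathm[measurable] incm[measurable] cntm[measurable]
      have "(\<lambda>q. w (path (fst q), inc (snd q)) * indicator {real n} (cnt (fst q))) \<in> borel_measurable (?P1 \<Otimes>\<^sub>M ?P2)"
        by measurable
      then show ?thesis by (simp add: W_def case_prod_beta')
    qed
    have cnt_R1: "cnt (?R1 \<omega>) = real (N (real i * h) \<omega>)" if "\<omega> \<in> space M" for \<omega>
    proof -
      have "cnt (?R1 \<omega>) = (\<Sum>l<i. noise h (Inl l) \<omega>)"
        unfolding cnt_def using A1_in by (intro sum.cong) auto
      then show ?thesis using noise_sums(1)[OF that, where h=h] by simp
    qed
    have path_R1: "path (?R1 \<omega>) = ?path \<omega>" if \<omega>: "\<omega> \<in> space M" and n: "N (real i * h) \<omega> = n" for \<omega>
      unfolding path_def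
    proof (rule restrict_ext)
      fix k assume k: "k \<in> {..i}"
      have 1: "(\<Sum>l<k. ?R1 \<omega> (Inl l)) = real (N (real k * h) \<omega>)"
      proof -
        have "(\<Sum>l<k. ?R1 \<omega> (Inl l)) = (\<Sum>l<k. noise h (Inl l) \<omega>)"
          using k A1_in by (intro sum.cong) auto
        then show ?thesis using noise_sums(1)[OF \<omega>, where h=h] by simp
      qed
      have 2: "(\<Sum>l<k. ?R1 \<omega> (Inr (Inr l))) = B (real k * h) \<omega>"
      proof -
        have "(\<Sum>l<k. ?R1 \<omega> (Inr (Inr l))) = (\<Sum>l<k. noise h (Inr (Inr l)) \<omega>)"
          using k A1_in by (intro sum.cong) auto
        then show ?thesis using noise_sums(2)[OF \<omega>, where h=h] by simp
      qed
      have "real k * h \<le> real i * h" using k h by (intro mult_right_mono) auto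
      from N_mono[OF \<omega> h0[of k] this] have le: "N (real k * h) \<omega> \<le> n" using n by simp
      have "(\<Sum>j<n. if real j < (\<Sum>l<k. ?R1 \<omega> (Inl l)) then ?R1 \<omega> (Inr (Inl j)) else 0) = (\<Sum>j<n. if j < N (real k * h) \<omega> then Y (Suc j) \<omega> else 0)"
        unfolding 1 using A1_in' by (intro sum.cong) auto
      also have "\<dots> = (\<Sum>j\<in>{..<n} \<inter> {..<N (real k * h) \<omega>}. Y (Suc j) \<omega>)"
        by (simp add: sum.inter_restrict)
      also have "{..<n} \<inter> {..<N (real k * h) \<omega>} = {..<N (real k * h) \<omega>}" using le by auto
      finally show "c * (real k * h) - (\<Sum>j<n. if real j < (\<Sum>l<k. ?R1 \<omega> (Inl l)) then ?R1 \<omega> (Inr (Inl j)) else 0) + \<sigma> * (\<Sum>l<k. ?R1 \<omega> (Inr (Inr l)))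
         = surplus (real k * h) \<omega>"
        by (simp only: surplus_def claims_sum 2)
    qed
    have inc_R2: "inc (?R2 \<omega>) = step_value h (\<lambda>k. noise h (pick i n k) \<omega>)" for \<omega>
      by (simp add: inc_def A2_def)
    have "(\<integral>\<^sup>+\<omega>. w (?path \<omega>, ?inc \<omega>) * indicator (?n n) \<omega> \<partial>M) = (\<integral>\<^sup>+\<omega>. W (?R1 \<omega>, ?R2 \<omega>) \<partial>M)"
    proof (rule nn_integral_cong)
      fix \<omega> assume \<omega>: "\<omega> \<in> space M"
      show "w (?path \<omega>, ?inc \<omega>) * indicator (?n n) \<omega> = W (?R1 \<omega>, ?R2 \<omega>)"
      proof (cases "N (real i * h) \<omega> = n")
        case True
        then show ?thesis using h
          unfolding W_def prod.case path_R1[OF \<omega> True] inc_R2 surplus_increment[OF \<omega> less_imp_le[OF h] True] cnt_R1[OF \<omega>]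
          by simp
      qed (simp add: W_def cnt_R1[OF \<omega>])
    qed
    also have "\<dots> = (\<integral>\<^sup>+q. W q \<partial>distr M (?P1 \<Otimes>\<^sub>M ?P2) (\<lambda>\<omega>. (?R1 \<omega>, ?R2 \<omega>)))"
      by (rule nn_integral_distr[symmetric]) (use Wm R1m R2m in auto)
    also have "\<dots> = (\<integral>\<^sup>+r1. \<integral>\<^sup>+r2. W (r1, r2) \<partial>distr M ?P2 ?R2 \<partial>distr M ?P1 ?R1)"
    proof -
      interpret R2: prob_space "distr M ?P2 ?R2" by (rule prob_space_distr[OF R2m])
      show ?thesis unfolding deq[symmetric]
        by (rule R2.nn_integral_fst[symmetric]) (use Wm in \<open>simp cong: measurable_cong_sets sets_pair_measure_cong\<close>)
    qed
    also have "\<dots> = (\<integral>\<^sup>+\<omega>. \<integral>\<^sup>+r2. W (?R1 \<omega>, r2) \<partial>distr M ?P2 ?R2 \<partial>M)"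
    proof -
      interpret R2: prob_space "distr M ?P2 ?R2" by (rule prob_space_distr[OF R2m])
      have "(\<lambda>r1. \<integral>\<^sup>+r2. W (r1, r2) \<partial>distr M ?P2 ?R2) \<in> borel_measurable ?P1"
        by (rule R2.borel_measurable_nn_integral_fst) (use Wm in \<open>simp cong: measurable_cong_sets sets_pair_measure_cong\<close>)
      then show ?thesis by (intro nn_integral_distr[OF R1m]) simp
    qed
    also have "\<dots> = (\<integral>\<^sup>+\<omega>. (\<integral>\<^sup>+u. w (?path \<omega>, u) \<partial>step_distr h) * indicator (?n n) \<omega> \<partial>M)"
    proof (rule nn_integral_cong)
      fix \<omega> assume \<omega>: "\<omega> \<in> space M"
      show "(\<integral>\<^sup>+r2. W (?R1 \<omega>, r2) \<partial>distr M ?P2 ?R2) = (\<integral>\<^sup>+u. w (?path \<omega>, u) \<partial>step_distr h) * indicator (?n n) \<omega>"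
      proof (cases "N (real i * h) \<omega> = n")
        case True
        have wu: "(\<lambda>u. w (?path \<omega>, u)) \<in> borel_measurable borel"
          using measurable_compose[OF measurable_Pair1'[OF measurable_space[OF pm' \<omega>]] w] by simp
        have "(\<integral>\<^sup>+r2. W (?R1 \<omega>, r2) \<partial>distr M ?P2 ?R2) = (\<integral>\<^sup>+r2. w (?path \<omega>, inc r2) \<partial>distr M ?P2 ?R2)"
          unfolding W_def prod.case path_R1[OF \<omega> True] cnt_R1[OF \<omega>] using True by simp
        also have "\<dots> = (\<integral>\<^sup>+\<omega>'. w (?path \<omega>, inc (?R2 \<omega>')) \<partial>M)"
          using measurable_compose[OF incm wu] by (intro nn_integral_distr[OF R2m]) simp
        also have "\<dots> = (\<integral>\<^sup>+u. w (?path \<omega>, u) \<partial>distr M borel (\<lambda>\<omega>'. inc (?R2 \<omega>')))"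
          using wu by (intro nn_integral_distr[OF measurable_compose[OF R2m incm], symmetric]) simp
        also have "distr M borel (\<lambda>\<omega>'. inc (?R2 \<omega>')) = step_distr h"
          unfolding inc_R2 by (rule step_value_law[OF h])
        finally have *: "(\<integral>\<^sup>+r2. W (?R1 \<omega>, r2) \<partial>distr M ?P2 ?R2) = (\<integral>\<^sup>+u. w (?path \<omega>, u) \<partial>step_distr h)" .
        have "indicator (?n n) \<omega> = (1::ennreal)" using True by simp
        then show ?thesis unfolding * by (simp only: mult_1_right)
      qed (simp add: W_def cnt_R1[OF \<omega>])
    qed
    finally show ?thesis .
  qed
  then show ?thesis by (subst (1 2) split) measurable
qed

end

section \<open>Laplace exponent and jump rate\<close>

text \<open>Completing the square: the tilted density is a multiple of the normal density with mean
  \<open>g\<close> times the variance.\<close>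

lemma nn_integral_normal_exp:
  assumes s: "0 < s"
  shows "(\<integral>\<^sup>+u. ennreal (normal_density 0 s u) * ennreal (exp (g * u)) \<partial>lborel) = ennreal (exp (g\<^sup>2 * s\<^sup>2 / 2))"
proof -
  have "normal_density 0 s u * exp (g * u) = exp (g\<^sup>2 * s\<^sup>2 / 2) * normal_density (g * s\<^sup>2) s u" for u
  proof -
    have "- (u - 0)\<^sup>2 / (2 * s\<^sup>2) + g * u = g\<^sup>2 * s\<^sup>2 / 2 + - (u - g * s\<^sup>2)\<^sup>2 / (2 * s\<^sup>2)"
      using s by (simp add: field_simps power2_eq_square)
    then have "exp (- (u - 0)\<^sup>2 / (2 * s\<^sup>2)) * exp (g * u) = exp (g\<^sup>2 * s\<^sup>2 / 2) * exp (- (u - g * s\<^sup>2)\<^sup>2 / (2 * s\<^sup>2))"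
      by (simp only: exp_add[symmetric])
    then show ?thesis unfolding normal_density_def by (simp add: algebra_simps)
  qed
  then have "(\<integral>\<^sup>+u. ennreal (normal_density 0 s u) * ennreal (exp (g * u)) \<partial>lborel)
     = (\<integral>\<^sup>+u. ennreal (exp (g\<^sup>2 * s\<^sup>2 / 2)) * ennreal (normal_density (g * s\<^sup>2) s u) \<partial>lborel)"
    by (simp add: ennreal_mult[symmetric])
  also have "\<dots> = ennreal (exp (g\<^sup>2 * s\<^sup>2 / 2)) * (\<integral>\<^sup>+u. ennreal (normal_density (g * s\<^sup>2) s u) \<partial>lborel)"
    by (rule nn_integral_cmult) measurable
  also have "(\<integral>\<^sup>+u. ennreal (normal_density (g * s\<^sup>2) s u) \<partial>lborel) = ennreal 1"
    using s by (subst nn_integral_eq_integral) auto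
  finally show ?thesis by simp
qed

locale risk_model = risk_data M N Y B c \<sigma> lam p
  for M :: "'a measure" and N Y B c \<sigma> lam p +
  fixes mu :: real
  assumes p_pos: "AE u in lborel. u \<le> 0 \<longrightarrow> p u = 0"
    and p_int: "integrable lborel p" and p_1: "(\<integral>u. p u \<partial>lborel) = 1"
    and p_mean_int: "integrable lborel (\<lambda>u. p u * u)" and p_mean: "(\<integral>u. p u * u \<partial>lborel) = mu"
    and sigma_nonneg: "0 \<le> \<sigma>" and safety: "lam * mu < c"
begin

definition claim_law :: "real measure" where "claim_law = density lborel (\<lambda>u. ennreal (p u))"

definition claim_laplace :: "real \<Rightarrow> real" where "claim_laplace b = (\<integral>u. exp (- b * u) * p u \<partial>lborel)"

definition lexp :: "real \<Rightarrow> real" where "lexp = laplace_exponent c \<sigma> lam p"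

section \<open>Analytic properties of the Laplace exponent\<close>

lemma mu_nonneg: "0 \<le> mu"
proof -
  have "AE u in lborel. 0 \<le> p u * u"
    using p_pos
  proof eventually_elim
    case (elim u)
    then show ?case using p_nonneg[of u] by (cases "u \<le> 0") auto
  qed
  then show ?thesis unfolding p_mean[symmetric] by (rule integral_nonneg_AE)
qed

lemma c_pos: "0 < c"
  using mu_nonneg lam_pos safety by (smt (verit) mult_nonneg_nonneg)

lemma exp_p_bound: "0 \<le> b \<Longrightarrow> AE u in lborel. norm (exp (- b * u) * p u) \<le> p u"
  using p_pos
proof eventually_elim
  case (elim u)
  show ?case
  proof (cases "u \<le> 0")
    case False
    then have "exp (- b * u) \<le> 1" using elim(1) by simp
    then show ?thesis using p_nonneg[of u] by (simp add: abs_mult mult_left_le_one_le)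
  qed (use elim in simp)
qed

lemma exp_p_integrable: "0 \<le> b \<Longrightarrow> integrable lborel (\<lambda>u. exp (- b * u) * p u)"
  by (rule Bochner_Integration.integrable_bound[OF p_int])
     (use exp_p_bound[of b] p_nonneg in \<open>auto elim!: eventually_mono\<close>)

lemma lexp_eq: "lexp b = c * b + \<sigma>\<^sup>2 / 2 * b\<^sup>2 + lam * (claim_laplace b - 1)"
proof -
  have "(LBINT u:{0<..}. exp (- b * u) * p u) = claim_laplace b"
    unfolding set_lebesgue_integral_def claim_laplace_def
    by (rule integral_cong_AE) (use p_pos in \<open>auto elim!: eventually_mono simp: indicator_def\<close>)
  then show ?thesis by (simp add: lexp_def laplace_exponent_def)
qed

lemma claim_laplace_0: "claim_laplace 0 = 1"
  using p_1 by (simp add: claim_laplace_def)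

lemma claim_laplace_nonneg: "0 \<le> claim_laplace b"
  unfolding claim_laplace_def using p_nonneg by (intro integral_nonneg_AE) auto

lemma claim_laplace_le_1: "0 \<le> b \<Longrightarrow> claim_laplace b \<le> 1"
  unfolding claim_laplace_def p_1[symmetric]
  by (rule integral_mono_AE[OF exp_p_integrable p_int]) (use exp_p_bound[of b] in \<open>auto elim!: eventually_mono\<close>)

text \<open>From \<open>1 - exp (- v) \<le> v\<close> under the integral. The claim transform
  decreases with slope at most \<open>mu\<close>, so \<open>lexp\<close> increases with slope at
  least \<open>c - lam * mu\<close>; this is how the safety loading enters.\<close>

lemma claim_laplace_diff:
  assumes a: "0 \<le> a" "a \<le> b" shows "claim_laplace a - claim_laplace b \<le> mu * (b - a)"
proof -
  have "claim_laplace a - claim_laplace b = (\<integral>u. exp (- a * u) * p u - exp (- b * u) * p u \<partial>lborel)"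
    unfolding claim_laplace_def using a by (intro Bochner_Integration.integral_diff[symmetric] exp_p_integrable) auto
  also have "\<dots> \<le> (\<integral>u. (p u * u) * (b - a) \<partial>lborel)"
  proof (rule integral_mono_AE)
    show "AE u in lborel. exp (- a * u) * p u - exp (- b * u) * p u \<le> (p u * u) * (b - a)"
      using p_pos
    proof eventually_elim
      case (elim u)
      show ?case
      proof (cases "u \<le> 0")
        case False
        have "1 - (b - a) * u \<le> exp (- (b - a) * u)" using exp_ge_add_one_self[of "- (b - a) * u"] by (simp add: algebra_simps)
        then have "exp (- a * u) * (1 - exp (- (b - a) * u)) \<le> 1 * ((b - a) * u)"
          using a False by (intro mult_mono) (auto simp: mult_nonpos_nonneg)
        also have "exp (- a * u) * (1 - exp (- (b - a) * u)) = exp (- a * u) - exp (- b * u)"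
          by (simp add: right_diff_distrib exp_add[symmetric] algebra_simps)
        finally have "(exp (- a * u) - exp (- b * u)) * p u \<le> (1 * ((b - a) * u)) * p u"
          using p_nonneg by (intro mult_right_mono) auto
        then show ?thesis by (simp add: algebra_simps)
      qed (use elim in simp)
    qed
  qed (use a exp_p_integrable p_mean_int in auto)
  also have "\<dots> = mu * (b - a)" using p_mean by simp
  finally show ?thesis .
qed

text \<open>Difference quotients of \<open>exp (- b * u)\<close> in \<open>b \<ge> 0\<close> are
  bounded by \<open>u\<close>, so the finite mean provides the majorant \<open>p u * u\<close>.
  Taking the limit within \<open>{0..}\<close> covers \<open>b = 0\<close>, where the transform may
  be infinite on the left.\<close>

lemma claim_laplace_deriv:
  assumes b: "0 \<le> b"
  shows "(claim_laplace has_real_derivative - (\<integral>u. exp (- b * u) * (p u * u) \<partial>lborel)) (at b within {0..})"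
  unfolding has_field_derivative_iff tendsto_at_iff_sequentially comp_def
proof (intro allI impI)
  fix X :: "nat \<Rightarrow> real" assume X: "\<forall>i. X i \<in> {0..} - {b}" "X \<longlonglongrightarrow> b"
  have eq: "(claim_laplace (X n) - claim_laplace b) / (X n - b) = (\<integral>u. (exp (- X n * u) - exp (- b * u)) / (X n - b) * p u \<partial>lborel)" for n
  proof -
    have "claim_laplace (X n) - claim_laplace b = (\<integral>u. exp (- X n * u) * p u - exp (- b * u) * p u \<partial>lborel)"
      unfolding claim_laplace_def using X(1) b by (intro Bochner_Integration.integral_diff[symmetric] exp_p_integrable) auto
    then have "(claim_laplace (X n) - claim_laplace b) / (X n - b) = (\<integral>u. (exp (- X n * u) * p u - exp (- b * u) * p u) / (X n - b) \<partial>lborel)"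
      by simp
    then show ?thesis by (simp add: left_diff_distrib)
  qed
  have "(\<lambda>n. \<integral>u. (exp (- X n * u) - exp (- b * u)) / (X n - b) * p u \<partial>lborel) \<longlonglongrightarrow> (\<integral>u. - (exp (- b * u) * u) * p u \<partial>lborel)"
  proof (rule integral_dominated_convergence[OF _ _ p_mean_int])
    show "AE u in lborel. (\<lambda>n. (exp (- X n * u) - exp (- b * u)) / (X n - b) * p u) \<longlonglongrightarrow> - (exp (- b * u) * u) * p u"
    proof (intro AE_I2 tendsto_mult tendsto_const)
      fix u
      have "((\<lambda>x. exp (- x * u)) has_real_derivative - (exp (- b * u) * u)) (at b)"
        by (auto intro!: derivative_eq_intros)
      then have "((\<lambda>y. (exp (- y * u) - exp (- b * u)) / (y - b)) \<longlongrightarrow> - (exp (- b * u) * u)) (at b)"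
        by (simp add: has_field_derivative_iff)
      moreover have "filterlim X (at b) sequentially" using X by (simp add: filterlim_at)
      ultimately show "(\<lambda>n. (exp (- X n * u) - exp (- b * u)) / (X n - b)) \<longlonglongrightarrow> - (exp (- b * u) * u)"
        by (rule filterlim_compose)
    qed
    show "AE u in lborel. norm ((exp (- X n * u) - exp (- b * u)) / (X n - b) * p u) \<le> p u * u" for n
      using p_pos
    proof eventually_elim
      case (elim u)
      show ?case
      proof (cases "u \<le> 0")
        case u: False
        have *: "\<bar>exp (- x * u) - exp (- y * u)\<bar> \<le> (y - x) * u" if "0 \<le> x" "x \<le> y" for x y
        proof -
          have "1 - (y - x) * u \<le> exp (- (y - x) * u)" using exp_ge_add_one_self[of "- (y - x) * u"] by (simp add: algebra_simps)
          then have "exp (- x * u) * (1 - exp (- (y - x) * u)) \<le> 1 * ((y - x) * u)"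
            using that u by (intro mult_mono) (auto simp: mult_nonpos_nonneg)
          also have "exp (- x * u) * (1 - exp (- (y - x) * u)) = exp (- x * u) - exp (- y * u)"
            by (simp add: right_diff_distrib exp_add[symmetric] algebra_simps)
          finally show ?thesis using that u by simp
        qed
        have Xn: "0 \<le> X n" "X n \<noteq> b" using X(1) by auto
        have "\<bar>exp (- X n * u) - exp (- b * u)\<bar> \<le> \<bar>X n - b\<bar> * u"
          using *[of "X n" b] *[of b "X n"] Xn b by (cases "X n \<le> b") (auto simp: abs_minus_commute)
        then have "\<bar>(exp (- X n * u) - exp (- b * u)) / (X n - b)\<bar> \<le> u"
          using Xn by (simp add: divide_le_eq mult.commute)
        then have "\<bar>(exp (- X n * u) - exp (- b * u)) / (X n - b)\<bar> * p u \<le> u * p u"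
          using p_nonneg by (intro mult_right_mono) auto
        then show ?thesis using p_nonneg[of u] by (simp add: abs_mult mult.commute)
      qed (use elim in simp)
    qed
  qed measurable
  also have "(\<integral>u. - (exp (- b * u) * u) * p u \<partial>lborel) = - (\<integral>u. exp (- b * u) * (p u * u) \<partial>lborel)"
    by (simp add: ac_simps)
  finally show "(\<lambda>n. (claim_laplace (X n) - claim_laplace b) / (X n - b)) \<longlonglongrightarrow> - (\<integral>u. exp (- b * u) * (p u * u) \<partial>lborel)"
    unfolding eq .
qed

text \<open>The lower bound is the point: with positive safety loading the derivative is positive on
  the whole half-line, including 0, so the division by it in the final formula is
  meaningful.\<close>

lemma lexp_deriv:
  assumes b: "0 \<le> b"
  obtains m where "(lexp has_real_derivative m) (at b within {0..})" "c - lam * mu \<le> m"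
proof
  let ?I = "\<integral>u. exp (- b * u) * (p u * u) \<partial>lborel"
  show "(lexp has_real_derivative (c + \<sigma>\<^sup>2 * b + lam * (- ?I))) (at b within {0..})"
    unfolding lexp_eq[abs_def]
    by (rule derivative_eq_intros claim_laplace_deriv[OF b] refl)+ (simp add: power2_eq_square)
  have bd: "AE u in lborel. norm (exp (- b * u) * (p u * u)) \<le> p u * u"
    using p_pos
  proof eventually_elim
    case (elim u)
    show ?case
    proof (cases "u \<le> 0")
      case False
      then have "exp (- b * u) \<le> 1" using b by simp
      then show ?thesis using p_nonneg[of u] False by (simp add: abs_mult mult_left_le_one_le)
    qed (use elim in simp)
  qed
  have "?I \<le> (\<integral>u. p u * u \<partial>lborel)"
  proof (rule integral_mono_AE[OF _ p_mean_int])
    show "integrable lborel (\<lambda>u. exp (- b * u) * (p u * u))"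
      by (rule Bochner_Integration.integrable_bound[OF p_mean_int]) (use bd in \<open>auto elim!: eventually_mono\<close>)
  qed (use bd in \<open>auto elim!: eventually_mono\<close>)
  then have "lam * ?I \<le> lam * mu" using lam_pos p_mean by simp
  moreover have "0 \<le> \<sigma>\<^sup>2 * b" using b by simp
  ultimately show "c - lam * mu \<le> c + \<sigma>\<^sup>2 * b + lam * (- ?I)" by simp
qed

lemma lexp_cont: "continuous_on {0..} lexp"
  unfolding continuous_on_eq_continuous_within
proof
  fix x :: real assume "x \<in> {0..}"
  then obtain m where "(lexp has_real_derivative m) (at x within {0..})" using lexp_deriv[of x] by auto
  then show "continuous (at x within {0..}) lexp" by (rule DERIV_continuous)
qed

section \<open>Exponential moments and small-time behaviour of one step\<close>

lemma noise_0:
  assumes \<omega>: "\<omega> \<in> space M"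
  shows "noise h (Inl 0) \<omega> = real (N h \<omega>)" "noise h (Inr (Inr 0)) \<omega> = B h \<omega>"
  by (simp_all add: N_0 B_0 \<omega>)

lemma claim_nn_integral:
  assumes "f \<in> borel_measurable borel"
  shows "(\<integral>\<^sup>+\<omega>. f (Y (Suc j) \<omega>) \<partial>M) = (\<integral>\<^sup>+u. ennreal (p u) * f u \<partial>lborel)"
  using distributed_nn_integral[OF distY[of "Suc j"], of f] assms by simp

lemma brownian_nn_integral:
  assumes h: "0 < h" and "f \<in> borel_measurable borel"
  shows "(\<integral>\<^sup>+\<omega>. f (B h \<omega>) \<partial>M) = (\<integral>\<^sup>+u. ennreal (normal_density 0 (sqrt h) u) * f u \<partial>lborel)"
proof -
  have "distributed M lborel (\<lambda>\<omega>. B h \<omega> - B 0 \<omega>) (\<lambda>u. ennreal (normal_density 0 (sqrt (h - 0)) u))"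
    using brownian h unfolding brownian_motion_def by blast
  from distributed_nn_integral[OF this, of f] assms(2)
  have "(\<integral>\<^sup>+u. ennreal (normal_density 0 (sqrt h) u) * f u \<partial>lborel) = (\<integral>\<^sup>+\<omega>. f (B h \<omega> - B 0 \<omega>) \<partial>M)" by simp
  also have "\<dots> = (\<integral>\<^sup>+\<omega>. f (B h \<omega>) \<partial>M)"
    by (intro nn_integral_cong) (simp add: B_0)
  finally show ?thesis ..
qed

lemma brownian_exp: "0 < h \<Longrightarrow> (\<integral>\<^sup>+\<omega>. ennreal (exp (g * B h \<omega>)) \<partial>M) = ennreal (exp (g\<^sup>2 * h / 2))"
  by (subst brownian_nn_integral) (auto simp: nn_integral_normal_exp)

lemma N_prob:
  assumes h: "0 < h"
  shows "prob {\<omega>\<in>space M. N h \<omega> = m} = (lam * h) ^ m / fact m * exp (- (lam * h))"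
proof -
  have Nm[measurable]: "N h \<in> M \<rightarrow>\<^sub>M count_space UNIV" using h by (intro N_measurable) simp
  have "distr M (count_space UNIV) (\<lambda>\<omega>. N h \<omega> - N 0 \<omega>) = measure_pmf (poisson_pmf (lam * (h - 0)))"
    using poisson h unfolding poisson_process_def by blast
  moreover have "distr M (count_space UNIV) (\<lambda>\<omega>. N h \<omega> - N 0 \<omega>) = distr M (count_space UNIV) (N h)"
    by (rule distr_cong) (auto simp: N_0)
  ultimately have "measure (distr M (count_space UNIV) (N h)) {m} = pmf (poisson_pmf (lam * h)) m"
    by (simp add: pmf.rep_eq)
  then have "prob (N h -` {m} \<inter> space M) = pmf (poisson_pmf (lam * h)) m"
    by (subst (asm) measure_distr) auto
  moreover have "N h -` {m} \<inter> space M = {\<omega>\<in>space M. N h \<omega> = m}" by auto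
  ultimately show ?thesis using h lam_pos by simp
qed

lemma claim_exp: "0 \<le> b \<Longrightarrow> (\<integral>\<^sup>+\<omega>. ennreal (exp (- b * Y (Suc j) \<omega>)) \<partial>M) = ennreal (claim_laplace b)"
  unfolding claim_laplace_def using p_nonneg exp_p_integrable[of b]
  by (subst claim_nn_integral) (auto simp: ennreal_mult[symmetric] nn_integral_eq_integral mult.commute)

text \<open>Split according to the number \<open>m\<close> of claims. On each piece the exponential
  is a product of functions of independent noise coordinates, and the Poisson weights sum to an
  exponential series.\<close>

lemma surplus_mgf:
  assumes h: "0 < h" and b: "0 \<le> b"
  shows "(\<integral>\<^sup>+u. ennreal (exp (b * u)) \<partial>step_distr h) = ennreal (exp (h * lexp b))"
proof -
  have Nm[measurable]: "N h \<in> M \<rightarrow>\<^sub>M count_space UNIV" and Bm[measurable]: "B h \<in> borel_measurable M"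
    and Sm[measurable]: "surplus h \<in> borel_measurable M"
    using h by (auto intro: N_measurable B_measurable surplus_measurable)
  let ?E = "\<lambda>m \<omega>. ennreal (exp (b * surplus h \<omega>)) * indicator {\<omega>. N h \<omega> = m} \<omega>"
  have indm[measurable]: "(indicator {\<omega>. N h \<omega> = m} :: 'a \<Rightarrow> ennreal) \<in> borel_measurable M" for m
  proof -
    have "(\<lambda>\<omega>. indicator {m} (N h \<omega>) :: ennreal) \<in> borel_measurable M"
      by (rule measurable_compose[OF Nm]) simp
    also have "(\<lambda>\<omega>. indicator {m} (N h \<omega>) :: ennreal) = indicator {\<omega>. N h \<omega> = m}" by (auto simp: indicator_def)
    finally show ?thesis .
  qed
  have term_eq: "(\<integral>\<^sup>+\<omega>. ?E m \<omega> \<partial>M) = ennreal (exp (b * c * h + (b * \<sigma>)\<^sup>2 * h / 2 - lam * h) * ((lam * h * claim_laplace b) ^ m / fact m))" for m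
  proof -
    define f :: "nat + nat + nat \<Rightarrow> real \<Rightarrow> ennreal" where
      "f k = (case k of Inl _ \<Rightarrow> indicator {real m} | Inr (Inl _) \<Rightarrow> (\<lambda>u. ennreal (exp (- b * u))) | Inr (Inr _) \<Rightarrow> (\<lambda>u. ennreal (exp (b * \<sigma> * u))))" for k
    \<comment> \<open>The coordinates involved when \<open>N h = m\<close>: the first counting
      increment, the first Brownian increment and the first \<open>m\<close> claims. The event is
      itself a function of the first of these, so it becomes one more factor.\<close>
    define J :: "(nat + nat + nat) set" where "J = insert (Inl 0) (insert (Inr (Inr 0)) ((Inr \<circ> Inl) ` {..<m}))"
    have fm: "f k \<in> borel_measurable borel" for k
      by (auto simp: f_def split: sum.splits)
    have iv: "indep_vars (\<lambda>_. borel) (\<lambda>k \<omega>. f k (noise h k \<omega>)) J"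
      using h by (intro indep_vars_subset[OF indep_vars_compose2[OF noise_indep[of h]]] fm) auto
    have prodJ: "(\<Prod>k\<in>J. F k) = F (Inl 0) * (F (Inr (Inr 0)) * (\<Prod>j<m. F (Inr (Inl j))))" for F :: "nat + nat + nat \<Rightarrow> ennreal"
      unfolding J_def by (subst prod.insert; (subst prod.insert)?) (auto simp: prod.reindex inj_on_def)
    have "(\<integral>\<^sup>+\<omega>. ?E m \<omega> \<partial>M) = (\<integral>\<^sup>+\<omega>. ennreal (exp (b * c * h)) * (\<Prod>k\<in>J. f k (noise h k \<omega>)) \<partial>M)"
    proof (rule nn_integral_cong)
      fix \<omega> assume \<omega>: "\<omega> \<in> space M"
      show "?E m \<omega> = ennreal (exp (b * c * h)) * (\<Prod>k\<in>J. f k (noise h k \<omega>))"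
      proof (cases "N h \<omega> = m")
        case True
        have "(\<Prod>j<m. ennreal (exp (- b * Y (Suc j) \<omega>))) = ennreal (exp (- b * (\<Sum>j<m. Y (Suc j) \<omega>)))"
          by (simp add: prod_ennreal exp_sum sum_distrib_left)
        moreover have "b * surplus h \<omega> = b * c * h + (b * \<sigma> * B h \<omega> + - b * (\<Sum>j<m. Y (Suc j) \<omega>))"
          unfolding surplus_def claims_sum True by (simp add: algebra_simps)
        ultimately show ?thesis
          unfolding prodJ using True \<omega>
          by (simp del: noise_simps add: f_def noise_0 noise_simps(2) ennreal_exp_add[symmetric])
      qed (unfold prodJ, simp add: f_def noise_0 \<omega> del: noise_simps)
    qed
    also have "\<dots> = ennreal (exp (b * c * h)) * (\<integral>\<^sup>+\<omega>. (\<Prod>k\<in>J. f k (noise h k \<omega>)) \<partial>M)"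
      using iv by (intro nn_integral_cmult borel_measurable_prod_ennreal) (auto simp: indep_vars_def)
    also have "(\<integral>\<^sup>+\<omega>. (\<Prod>k\<in>J. f k (noise h k \<omega>)) \<partial>M) = (\<Prod>k\<in>J. \<integral>\<^sup>+\<omega>. f k (noise h k \<omega>) \<partial>M)"
      by (rule indep_vars_nn_integral[OF _ iv]) (auto simp: J_def)
    also have "\<dots> = (\<integral>\<^sup>+\<omega>. f (Inl 0) (noise h (Inl 0) \<omega>) \<partial>M) * ((\<integral>\<^sup>+\<omega>. f (Inr (Inr 0)) (noise h (Inr (Inr 0)) \<omega>) \<partial>M) *
       (\<Prod>j<m. \<integral>\<^sup>+\<omega>. f (Inr (Inl j)) (noise h (Inr (Inl j)) \<omega>) \<partial>M))"
      by (rule prodJ)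
    also have "(\<integral>\<^sup>+\<omega>. f (Inl 0) (noise h (Inl 0) \<omega>) \<partial>M) = ennreal ((lam * h) ^ m / fact m * exp (- (lam * h)))"
    proof -
      have "(\<integral>\<^sup>+\<omega>. f (Inl 0) (noise h (Inl 0) \<omega>) \<partial>M) = (\<integral>\<^sup>+\<omega>. indicator {\<omega>\<in>space M. N h \<omega> = m} \<omega> \<partial>M)"
        by (intro nn_integral_cong) (simp del: noise_simps add: f_def noise_0 indicator_def)
      also have "\<dots> = emeasure M {\<omega>\<in>space M. N h \<omega> = m}" by (rule nn_integral_indicator) measurable
      finally show ?thesis by (simp add: emeasure_eq_measure N_prob[OF h])
    qed
    also have "(\<integral>\<^sup>+\<omega>. f (Inr (Inr 0)) (noise h (Inr (Inr 0)) \<omega>) \<partial>M) = ennreal (exp ((b * \<sigma>)\<^sup>2 * h / 2))"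
    proof -
      have "(\<integral>\<^sup>+\<omega>. f (Inr (Inr 0)) (noise h (Inr (Inr 0)) \<omega>) \<partial>M) = (\<integral>\<^sup>+\<omega>. ennreal (exp (b * \<sigma> * B h \<omega>)) \<partial>M)"
        by (intro nn_integral_cong) (simp del: noise_simps add: f_def noise_0)
      then show ?thesis by (simp add: brownian_exp[OF h])
    qed
    also have "(\<lambda>j. \<integral>\<^sup>+\<omega>. f (Inr (Inl j)) (noise h (Inr (Inl j)) \<omega>) \<partial>M) = (\<lambda>j. ennreal (claim_laplace b))"
      using claim_exp[OF b] by (simp add: f_def fun_eq_iff)
    also have "ennreal (exp (b * c * h)) * (ennreal ((lam * h) ^ m / fact m * exp (- (lam * h))) * (ennreal (exp ((b * \<sigma>)\<^sup>2 * h / 2)) * (\<Prod>j<m. ennreal (claim_laplace b))))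
      = ennreal (exp (b * c * h) * ((lam * h) ^ m / fact m * exp (- (lam * h)) * (exp ((b * \<sigma>)\<^sup>2 * h / 2) * claim_laplace b ^ m)))"
    proof -
      have "ennreal x * (ennreal y * (ennreal z * ennreal w)) = ennreal (x * (y * (z * w)))" if "0 \<le> x" "0 \<le> y" "0 \<le> z" "0 \<le> w" for x y z w
        using that by (simp add: ennreal_mult)
      moreover have "(\<Prod>j<m. ennreal (claim_laplace b)) = ennreal (claim_laplace b ^ m)"
        using claim_laplace_nonneg[of b] by (simp add: ennreal_power)
      ultimately show ?thesis using h lam_pos claim_laplace_nonneg[of b] by (simp only:) simp
    qed
    also have "exp (b * c * h) * ((lam * h) ^ m / fact m * exp (- (lam * h)) * (exp ((b * \<sigma>)\<^sup>2 * h / 2) * claim_laplace b ^ m))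
       = exp (b * c * h + (b * \<sigma>)\<^sup>2 * h / 2 - lam * h) * ((lam * h * claim_laplace b) ^ m / fact m)"
    proof -
      have e: "exp (b * c * h + (b * \<sigma>)\<^sup>2 * h / 2 - lam * h) = exp (b * c * h) * exp ((b * \<sigma>)\<^sup>2 * h / 2) * exp (- (lam * h))"
        by (simp only: exp_add[symmetric]) simp
      have *: "x * (y / z * u * (v * w)) = x * v * u * (y * w / z)" for x y z u v w :: real by simp
      show ?thesis unfolding e power_mult_distrib[of "lam * h" "claim_laplace b" m] by (rule *)
    qed
    finally show ?thesis .
  qed
  have "(\<integral>\<^sup>+u. ennreal (exp (b * u)) \<partial>step_distr h) = (\<integral>\<^sup>+\<omega>. ennreal (exp (b * surplus h \<omega>)) \<partial>M)"
    unfolding step_distr_def by (rule nn_integral_distr) measurable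
  also have "\<dots> = (\<integral>\<^sup>+\<omega>. (\<Sum>m. ?E m \<omega>) \<partial>M)"
  proof (rule nn_integral_cong)
    fix \<omega>
    have "(\<Sum>m. ?E m \<omega>) = (\<Sum>m\<in>{N h \<omega>}. ?E m \<omega>)" by (rule suminf_finite) auto
    then show "ennreal (exp (b * surplus h \<omega>)) = (\<Sum>m. ?E m \<omega>)" by simp
  qed
  also have "\<dots> = (\<Sum>m. \<integral>\<^sup>+\<omega>. ?E m \<omega> \<partial>M)" by (rule nn_integral_suminf) measurable
  also have "\<dots> = (\<Sum>m. ennreal (exp (b * c * h + (b * \<sigma>)\<^sup>2 * h / 2 - lam * h) * ((lam * h * claim_laplace b) ^ m / fact m)))"
    by (simp only: term_eq)
  also have "\<dots> = ennreal (exp (b * c * h + (b * \<sigma>)\<^sup>2 * h / 2 - lam * h) * exp (lam * h * claim_laplace b))"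
  proof (rule suminf_ennreal_eq)
    show "(\<lambda>m. exp (b * c * h + (b * \<sigma>)\<^sup>2 * h / 2 - lam * h) * ((lam * h * claim_laplace b) ^ m / fact m)) sums (exp (b * c * h + (b * \<sigma>)\<^sup>2 * h / 2 - lam * h) * exp (lam * h * claim_laplace b))"
    proof (rule sums_mult)
      show "(\<lambda>m. (lam * h * claim_laplace b) ^ m / fact m) sums exp (lam * h * claim_laplace b)"
        using exp_converges[of "lam * h * claim_laplace b"] by (simp add: divide_inverse_commute)
    qed
  qed (use h lam_pos claim_laplace_nonneg in auto)
  also have "exp (b * c * h + (b * \<sigma>)\<^sup>2 * h / 2 - lam * h) * exp (lam * h * claim_laplace b) = exp (h * lexp b)"
  proof -
    have "b * c * h + (b * \<sigma>)\<^sup>2 * h / 2 - lam * h + lam * h * claim_laplace b = h * lexp b"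
      unfolding lexp_eq power_mult_distrib by (simp add: algebra_simps)
    then show ?thesis by (simp only: exp_add[symmetric])
  qed
  finally show ?thesis .
qed


text \<open>Split into no claim, one claim, and at least two. Without a claim the Brownian motion
  must fall by \<open>del\<close>, which gives the first term. One claim gives the rate: the first
  \<open>lam\<^sup>2 * h\<close> pays for replacing \<open>exp (- lam * h)\<close> by 1, and the
  term with \<open>K\<close> for neglecting drift and Brownian motion. Two or more claims give the
  last term. No error depends on \<open>z \<ge> del\<close>.\<close>

lemma surplus_small_jump:
  assumes kap: "\<And>z. 0 \<le> kap z" "\<And>z. kap z \<le> 1" "\<And>z. 0 \<le> z \<Longrightarrow> kap z = 0"
    and K: "0 \<le> K" "\<And>y z. \<bar>kap y - kap z\<bar> \<le> K * \<bar>y - z\<bar>" and del: "0 < del" and h: "0 < h" and z: "del \<le> z"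
  shows "\<bar>(\<integral>u. kap (z + u) \<partial>step_distr h) / h - lam * (\<integral>y. kap (z - y) \<partial>claim_law)\<bar>
    \<le> exp (\<sigma>\<^sup>2 / 2) * (exp (- del * h powr (-1/2)) / h) + lam\<^sup>2 * h + lam * K * (c * h + 2 * \<sigma> * exp (1/2) * sqrt h) + lam\<^sup>2 * h"
proof -
  have Nm[measurable]: "N h \<in> M \<rightarrow>\<^sub>M count_space UNIV" and Bm[measurable]: "B h \<in> borel_measurable M"
    and Sm[measurable]: "surplus h \<in> borel_measurable M"
    using h by (auto intro: N_measurable B_measurable surplus_measurable)
  have km[measurable]: "kap \<in> borel_measurable borel"
    by (intro borel_measurable_continuous_onI lipschitz_on_continuous_on[of K]) (use K in \<open>auto simp: lipschitz_on_def dist_real_def\<close>)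
  define a where "a = lam * h"
  have a: "0 < a" using lam_pos h by (simp add: a_def)
  \<comment> \<open>The exponent on the Brownian scale, \<open>k\<^sup>2 * h = 1\<close>:
    exponential moments of \<open>k * B h\<close> stay bounded while \<open>del * k\<close> tends to
    infinity.\<close>
  define k where "k = h powr (-1/2)"
  have k: "0 < k" using h by (simp add: k_def)
  have kk: "k\<^sup>2 = h powr (-1)" unfolding k_def power2_eq_square powr_add[symmetric] by simp
  then have k2: "k\<^sup>2 * h = 1" using h by (simp add: powr_minus_divide)
  have k1: "1 / k = sqrt h" using h by (simp add: k_def powr_minus_divide powr_half_sqrt)
  let ?E = "\<lambda>m. {\<omega>\<in>space M. N h \<omega> = m}"
  have Em[measurable]: "?E m \<in> sets M" for m by measurable
  have pE: "prob (?E m) = a ^ m / fact m * exp (- a)" for m using N_prob[OF h, of m] by (simp add: a_def)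
  let ?G = "\<lambda>\<omega>. kap (z + c * h + \<sigma> * B h \<omega> - Y (Suc 0) \<omega>)"
  let ?D = "\<lambda>\<omega>. kap (z - Y (Suc 0) \<omega>)"
  let ?H = "\<lambda>\<omega>. kap (z + c * h + \<sigma> * B h \<omega>)"
  let ?R = "{\<omega>\<in>space M. 2 \<le> N h \<omega>}"
  have bint: "integrable M (\<lambda>\<omega>. kap (f \<omega>))" if [measurable]: "f \<in> borel_measurable M" for f
    using kap by (intro integrable_const_bound[where B=1]) auto
  have iint: "integrable M (\<lambda>\<omega>. indicator A \<omega> * kap (f \<omega>))" if [measurable]: "A \<in> sets M" "f \<in> borel_measurable M" for A f
    using kap by (intro integrable_const_bound[where B=1]) (auto simp: indicator_def)
  have L1: "(\<integral>u. kap (z + u) \<partial>step_distr h) = (\<integral>\<omega>. kap (z + surplus h \<omega>) \<partial>M)"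
    unfolding step_distr_def by (rule integral_distr) measurable
  have L2: "(\<integral>y. kap (z - y) \<partial>claim_law) = (\<integral>\<omega>. ?D \<omega> \<partial>M)"
  proof -
    have "claim_law = distr M lborel (Y (Suc 0))"
      using distributed_distr_eq_density[OF distY[of "Suc 0"]] by (simp add: claim_law_def)
    then show ?thesis by (simp add: integral_distr)
  qed
  have split: "(\<integral>\<omega>. kap (z + surplus h \<omega>) \<partial>M) = (\<integral>\<omega>. indicator (?E 0) \<omega> * ?H \<omega> \<partial>M) + (\<integral>\<omega>. indicator (?E 1) \<omega> * ?G \<omega> \<partial>M) + (\<integral>\<omega>. indicator ?R \<omega> * kap (z + surplus h \<omega>) \<partial>M)"
  proof -
    have "(\<integral>\<omega>. kap (z + surplus h \<omega>) \<partial>M) = (\<integral>\<omega>. indicator (?E 0) \<omega> * ?H \<omega> + indicator (?E 1) \<omega> * ?G \<omega> + indicator ?R \<omega> * kap (z + surplus h \<omega>) \<partial>M)"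
    proof (rule Bochner_Integration.integral_cong[OF refl])
      fix \<omega> assume \<omega>: "\<omega> \<in> space M"
      consider "N h \<omega> = 0" | "N h \<omega> = 1" | "2 \<le> N h \<omega>" by linarith
      then show "kap (z + surplus h \<omega>) = indicator (?E 0) \<omega> * ?H \<omega> + indicator (?E 1) \<omega> * ?G \<omega> + indicator ?R \<omega> * kap (z + surplus h \<omega>)"
        using \<omega> by cases (auto simp: surplus_def algebra_simps)
    qed
    also have "\<dots> = (\<integral>\<omega>. indicator (?E 0) \<omega> * ?H \<omega> \<partial>M) + (\<integral>\<omega>. indicator (?E 1) \<omega> * ?G \<omega> \<partial>M) + (\<integral>\<omega>. indicator ?R \<omega> * kap (z + surplus h \<omega>) \<partial>M)"
      by (subst Bochner_Integration.integral_add, (intro Bochner_Integration.integrable_add iint; measurable), intro iint; measurable?)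
         (subst Bochner_Integration.integral_add; (intro iint)?; measurable?)
    finally show ?thesis .
  qed
  \<comment> \<open>The premium only helps, so a negative value without claims forces
    \<open>\<sigma> * B h \<le> - del\<close>; the rest is a Chernoff bound with exponent
    \<open>k\<close>.\<close>
  have H_le: "0 \<le> (\<integral>\<omega>. indicator (?E 0) \<omega> * ?H \<omega> \<partial>M)" "(\<integral>\<omega>. indicator (?E 0) \<omega> * ?H \<omega> \<partial>M) \<le> exp (\<sigma>\<^sup>2 / 2) * exp (- del * k)"
  proof -
    show "0 \<le> (\<integral>\<omega>. indicator (?E 0) \<omega> * ?H \<omega> \<partial>M)" using kap by (intro integral_nonneg_AE) auto
    have "ennreal (\<integral>\<omega>. indicator (?E 0) \<omega> * ?H \<omega> \<partial>M) = (\<integral>\<^sup>+\<omega>. ennreal (indicator (?E 0) \<omega> * ?H \<omega>) \<partial>M)"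
      using kap by (intro nn_integral_eq_integral[symmetric] iint) auto
    also have "\<dots> \<le> (\<integral>\<^sup>+\<omega>. ennreal (exp (- del * k)) * ennreal (exp (- k * \<sigma> * B h \<omega>)) \<partial>M)"
    proof (rule nn_integral_mono)
      fix \<omega>
      have "?H \<omega> \<le> exp (- del * k + - k * \<sigma> * B h \<omega>)"
      proof (cases "0 \<le> z + c * h + \<sigma> * B h \<omega>")
        case False
        then have "del + \<sigma> * B h \<omega> \<le> 0" using z mult_pos_pos[OF c_pos h] by linarith
        then have "k * (del + \<sigma> * B h \<omega>) \<le> 0" using k by (simp add: mult_nonneg_nonpos)
        then have "1 \<le> exp (- del * k + - k * \<sigma> * B h \<omega>)" by (simp add: algebra_simps)
        then show ?thesis using kap(2) order_trans by blast
      qed (simp add: kap(3))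
      then have "indicator (?E 0) \<omega> * ?H \<omega> \<le> exp (- del * k + - k * \<sigma> * B h \<omega>)"
        using kap(1) by (auto simp: indicator_def)
      then show "ennreal (indicator (?E 0) \<omega> * ?H \<omega>) \<le> ennreal (exp (- del * k)) * ennreal (exp (- k * \<sigma> * B h \<omega>))"
        unfolding ennreal_exp_add[symmetric] by (rule ennreal_leI)
    qed
    also have "\<dots> = ennreal (exp (- del * k)) * ennreal (exp ((- k * \<sigma>)\<^sup>2 * h / 2))"
      unfolding brownian_exp[OF h, symmetric] by (rule nn_integral_cmult) measurable
    also have "(- k * \<sigma>)\<^sup>2 * h / 2 = (k\<^sup>2 * h) * \<sigma>\<^sup>2 / 2" by (simp add: power_mult_distrib)
    also have "ennreal (exp (- del * k)) * ennreal (exp ((k\<^sup>2 * h) * \<sigma>\<^sup>2 / 2)) = ennreal (exp (\<sigma>\<^sup>2 / 2) * exp (- del * k))"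
      unfolding k2 by (simp add: ennreal_mult mult.commute)
    finally show "(\<integral>\<omega>. indicator (?E 0) \<omega> * ?H \<omega> \<partial>M) \<le> exp (\<sigma>\<^sup>2 / 2) * exp (- del * k)"
      by (simp add: ennreal_le_iff)
  qed
  have R_le: "0 \<le> (\<integral>\<omega>. indicator ?R \<omega> * kap (z + surplus h \<omega>) \<partial>M)" "(\<integral>\<omega>. indicator ?R \<omega> * kap (z + surplus h \<omega>) \<partial>M) \<le> a\<^sup>2"
  proof -
    show "0 \<le> (\<integral>\<omega>. indicator ?R \<omega> * kap (z + surplus h \<omega>) \<partial>M)" using kap by (intro integral_nonneg_AE) auto
    have Rm[measurable]: "?R \<in> sets M" by measurable
    have "(\<integral>\<omega>. indicator ?R \<omega> * kap (z + surplus h \<omega>) \<partial>M) \<le> (\<integral>\<omega>. indicator ?R \<omega> \<partial>M)"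
    proof (rule integral_mono)
      show "integrable M (indicator ?R :: 'a \<Rightarrow> real)"
        by (rule integrable_real_indicator[OF Rm]) (simp add: emeasure_eq_measure)
      show "integrable M (\<lambda>\<omega>. indicator ?R \<omega> * kap (z + surplus h \<omega>))" by (rule iint) measurable
    qed (use kap in \<open>auto simp: indicator_def\<close>)
    also have "\<dots> = prob ?R" by simp
    also have "prob ?R = 1 - prob (?E 0) - prob (?E 1)"
    proof -
      have "space M = ?R \<union> (?E 0 \<union> ?E 1)" by auto
      then have "1 = prob (?R \<union> (?E 0 \<union> ?E 1))" using prob_space by simp
      also have "\<dots> = prob ?R + prob (?E 0 \<union> ?E 1)" by (rule finite_measure_Union) auto
      also have "prob (?E 0 \<union> ?E 1) = prob (?E 0) + prob (?E 1)" by (rule finite_measure_Union) auto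
      finally show ?thesis by simp
    qed
    also have "\<dots> = 1 - (1 + a) * exp (- a)" unfolding pE by (simp add: algebra_simps)
    also have "\<dots> \<le> 1 - (1 + a) * (1 - a)"
      using a exp_ge_add_one_self[of "- a"] by (intro diff_left_mono mult_left_mono) auto
    also have "\<dots> = a\<^sup>2" by (simp add: power2_eq_square algebra_simps)
    finally show "(\<integral>\<omega>. indicator ?R \<omega> * kap (z + surplus h \<omega>) \<partial>M) \<le> a\<^sup>2" .
  qed
  \<comment> \<open>Having exactly one claim is decided by the counting increment alone, whereas the
    integrand uses only the first claim and the Brownian increment.\<close>
  have indep: "(\<integral>\<omega>. indicator (?E 1) \<omega> * ?G \<omega> \<partial>M) = a * exp (- a) * (\<integral>\<omega>. ?G \<omega> \<partial>M)"
  proof -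
    let ?A = "{Inl 0} :: (nat + nat + nat) set" and ?B = "{Inr (Inl 0), Inr (Inr 0)} :: (nat + nat + nat) set"
    have "indep_var (Pi\<^sub>M ?A (\<lambda>_. borel)) (\<lambda>\<omega>. restrict (\<lambda>k. noise h k \<omega>) ?A) (Pi\<^sub>M ?B (\<lambda>_. borel)) (\<lambda>\<omega>. restrict (\<lambda>k. noise h k \<omega>) ?B)"
      using h by (intro indep_var_restrict[OF noise_indep]) auto
    then have "indep_var borel ((\<lambda>r. indicator {1::real} (r (Inl 0))) \<circ> (\<lambda>\<omega>. restrict (\<lambda>k. noise h k \<omega>) ?A))
       borel ((\<lambda>r. kap (z + c * h + \<sigma> * r (Inr (Inr 0)) - r (Inr (Inl 0)))) \<circ> (\<lambda>\<omega>. restrict (\<lambda>k. noise h k \<omega>) ?B))"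
    proof (rule indep_var_compose)
      have [measurable]: "(\<lambda>r. r (Inl 0)) \<in> borel_measurable (Pi\<^sub>M ?A (\<lambda>_. borel :: real measure))"
        by (rule measurable_component_singleton) simp
      show "(\<lambda>r. indicator {1::real} (r (Inl 0)) :: real) \<in> borel_measurable (Pi\<^sub>M ?A (\<lambda>_. borel :: real measure))" by measurable
      have [measurable]: "(\<lambda>r. r (Inr (Inl 0))) \<in> borel_measurable (Pi\<^sub>M ?B (\<lambda>_. borel :: real measure))"
        "(\<lambda>r. r (Inr (Inr 0))) \<in> borel_measurable (Pi\<^sub>M ?B (\<lambda>_. borel :: real measure))"
        by (rule measurable_component_singleton; simp)+
      show "(\<lambda>r. kap (z + c * h + \<sigma> * r (Inr (Inr 0)) - r (Inr (Inl 0)))) \<in> borel_measurable (Pi\<^sub>M ?B (\<lambda>_. borel :: real measure))" by measurable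
    qed
    then have iv: "indep_var borel (\<lambda>\<omega>. indicator {1::real} (noise h (Inl 0) \<omega>)) borel (\<lambda>\<omega>. kap (z + c * h + \<sigma> * noise h (Inr (Inr 0)) \<omega> - noise h (Inr (Inl 0)) \<omega>))"
      by (simp del: noise_simps add: comp_def)
    have nm: "noise h j \<in> borel_measurable M" for j using h by (intro noise_measurable) simp
    have "(\<integral>\<omega>. indicator {1::real} (noise h (Inl 0) \<omega>) * kap (z + c * h + \<sigma> * noise h (Inr (Inr 0)) \<omega> - noise h (Inr (Inl 0)) \<omega>) \<partial>M)
      = (\<integral>\<omega>. indicator {1::real} (noise h (Inl 0) \<omega>) \<partial>M) * (\<integral>\<omega>. kap (z + c * h + \<sigma> * noise h (Inr (Inr 0)) \<omega> - noise h (Inr (Inl 0)) \<omega>) \<partial>M)"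
    proof (rule indep_var_lebesgue_integral[OF iv])
      have [measurable]: "noise h j \<in> borel_measurable M" for j by (rule nm)
      show "integrable M (\<lambda>\<omega>. indicator {1::real} (noise h (Inl 0) \<omega>) :: real)"
        by (intro integrable_const_bound[where B=1]) (auto simp: indicator_def simp del: noise_simps)
      show "integrable M (\<lambda>\<omega>. kap (z + c * h + \<sigma> * noise h (Inr (Inr 0)) \<omega> - noise h (Inr (Inl 0)) \<omega>))"
        by (rule bint) measurable
    qed
    moreover have "(\<integral>\<omega>. indicator {1::real} (noise h (Inl 0) \<omega>) * kap (z + c * h + \<sigma> * noise h (Inr (Inr 0)) \<omega> - noise h (Inr (Inl 0)) \<omega>) \<partial>M)
      = (\<integral>\<omega>. indicator (?E 1) \<omega> * ?G \<omega> \<partial>M)"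
      by (rule Bochner_Integration.integral_cong[OF refl]) (simp del: noise_simps add: noise_0 noise_simps(2) indicator_def)
    moreover have "(\<integral>\<omega>. kap (z + c * h + \<sigma> * noise h (Inr (Inr 0)) \<omega> - noise h (Inr (Inl 0)) \<omega>) \<partial>M) = (\<integral>\<omega>. ?G \<omega> \<partial>M)"
      by (rule Bochner_Integration.integral_cong[OF refl]) (simp del: noise_simps add: noise_0 noise_simps(2))
    moreover have "(\<integral>\<omega>. indicator {1::real} (noise h (Inl 0) \<omega>) \<partial>M) = (\<integral>\<omega>. (indicator (?E 1) \<omega> :: real) \<partial>M)"
      by (rule Bochner_Integration.integral_cong[OF refl]) (simp del: noise_simps add: noise_0 indicator_def)
    moreover have "(\<integral>\<omega>. (indicator (?E 1) \<omega> :: real) \<partial>M) = a * exp (- a)" using pE[of 1] by simp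
    ultimately show ?thesis by (simp only:)
  qed
  have G01: "0 \<le> (\<integral>\<omega>. ?G \<omega> \<partial>M)" "(\<integral>\<omega>. ?G \<omega> \<partial>M) \<le> 1"
  proof -
    show "0 \<le> (\<integral>\<omega>. ?G \<omega> \<partial>M)" using kap by (intro integral_nonneg_AE) auto
    have "(\<integral>\<omega>. ?G \<omega> \<partial>M) \<le> (\<integral>\<omega>. 1 \<partial>M)" using kap by (intro integral_mono bint) auto
    then show "(\<integral>\<omega>. ?G \<omega> \<partial>M) \<le> 1" using prob_space by simp
  qed
  have Babs: "integrable M (\<lambda>\<omega>. \<bar>B h \<omega>\<bar>)" "(\<integral>\<omega>. \<bar>B h \<omega>\<bar> \<partial>M) \<le> 2 * exp (1/2) * sqrt h"
  proof -
    have "(\<integral>\<^sup>+\<omega>. ennreal \<bar>B h \<omega>\<bar> \<partial>M) \<le> (\<integral>\<^sup>+\<omega>. ennreal (1 / k) * (ennreal (exp (k * B h \<omega>)) + ennreal (exp (- k * B h \<omega>))) \<partial>M)"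
    proof (rule nn_integral_mono)
      fix \<omega>
      \<comment> \<open>A crude moment bound without the half-normal law:
        \<open>v \<le> exp v\<close> and splitting by sign leave two exponential moments, each equal
        to \<open>exp (1/2)\<close> because \<open>k\<^sup>2 * h = 1\<close>; dividing by
        \<open>k\<close> gives the factor \<open>sqrt h\<close>.\<close>
      have "k * \<bar>B h \<omega>\<bar> \<le> exp (k * \<bar>B h \<omega>\<bar>)" using exp_ge_add_one_self[of "k * \<bar>B h \<omega>\<bar>"] by linarith
      also have "\<dots> \<le> exp (k * B h \<omega>) + exp (- k * B h \<omega>)" by (cases "0 \<le> B h \<omega>") auto
      finally have "\<bar>B h \<omega>\<bar> \<le> 1 / k * (exp (k * B h \<omega>) + exp (- k * B h \<omega>))" using k by (simp add: field_simps)
      then have "ennreal \<bar>B h \<omega>\<bar> \<le> ennreal (1 / k * (exp (k * B h \<omega>) + exp (- k * B h \<omega>)))" by (rule ennreal_leI)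
      also have "\<dots> = ennreal (1 / k) * (ennreal (exp (k * B h \<omega>)) + ennreal (exp (- k * B h \<omega>)))"
        using k by (subst ennreal_mult) (auto intro: add_nonneg_nonneg)
      finally show "ennreal \<bar>B h \<omega>\<bar> \<le> ennreal (1 / k) * (ennreal (exp (k * B h \<omega>)) + ennreal (exp (- k * B h \<omega>)))" .
    qed
    also have "\<dots> = ennreal (1 / k) * ((\<integral>\<^sup>+\<omega>. ennreal (exp (k * B h \<omega>)) \<partial>M) + (\<integral>\<^sup>+\<omega>. ennreal (exp (- k * B h \<omega>)) \<partial>M))"
      by (subst nn_integral_cmult, measurable, subst nn_integral_add, measurable)
    also have "\<dots> = ennreal (2 * exp (1/2) * sqrt h)"
      using k k1 k2 h by (simp only: brownian_exp[OF h]) (simp add: ennreal_mult[symmetric] flip: ennreal_plus)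
    finally have *: "(\<integral>\<^sup>+\<omega>. ennreal \<bar>B h \<omega>\<bar> \<partial>M) \<le> ennreal (2 * exp (1/2) * sqrt h)" .
    then have "(\<integral>\<^sup>+\<omega>. ennreal \<bar>B h \<omega>\<bar> \<partial>M) < \<infinity>" using le_less_trans by fastforce
    then show int: "integrable M (\<lambda>\<omega>. \<bar>B h \<omega>\<bar>)" by (intro integrableI_nonneg) auto
    show "(\<integral>\<omega>. \<bar>B h \<omega>\<bar> \<partial>M) \<le> 2 * exp (1/2) * sqrt h"
      using * h by (subst (asm) nn_integral_eq_integral[OF int]) (auto simp: ennreal_le_iff)
  qed
  have GG: "\<bar>(\<integral>\<omega>. ?G \<omega> \<partial>M) - (\<integral>\<omega>. ?D \<omega> \<partial>M)\<bar> \<le> K * (c * h + 2 * \<sigma> * exp (1/2) * sqrt h)"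
  proof -
    have i: "integrable M ?G" "integrable M ?D" by (rule bint; measurable)+
    have "\<bar>(\<integral>\<omega>. ?G \<omega> \<partial>M) - (\<integral>\<omega>. ?D \<omega> \<partial>M)\<bar> = \<bar>\<integral>\<omega>. ?G \<omega> - ?D \<omega> \<partial>M\<bar>" using i by simp
    also have "\<dots> \<le> (\<integral>\<omega>. \<bar>?G \<omega> - ?D \<omega>\<bar> \<partial>M)" by (rule integral_abs_bound)
    also have "\<dots> \<le> (\<integral>\<omega>. K * (c * h + \<sigma> * \<bar>B h \<omega>\<bar>) \<partial>M)"
    proof (rule integral_mono)
      fix \<omega>
      have "\<bar>?G \<omega> - ?D \<omega>\<bar> \<le> K * \<bar>(z + c * h + \<sigma> * B h \<omega> - Y (Suc 0) \<omega>) - (z - Y (Suc 0) \<omega>)\<bar>" by (rule K(2))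
      also have "(z + c * h + \<sigma> * B h \<omega> - Y (Suc 0) \<omega>) - (z - Y (Suc 0) \<omega>) = c * h + \<sigma> * B h \<omega>" by simp
      also have "K * \<bar>c * h + \<sigma> * B h \<omega>\<bar> \<le> K * (c * h + \<sigma> * \<bar>B h \<omega>\<bar>)"
      proof (rule mult_left_mono[OF _ K(1)])
        have "\<bar>c * h + \<sigma> * B h \<omega>\<bar> \<le> \<bar>c * h\<bar> + \<bar>\<sigma> * B h \<omega>\<bar>" by (rule abs_triangle_ineq)
        then show "\<bar>c * h + \<sigma> * B h \<omega>\<bar> \<le> c * h + \<sigma> * \<bar>B h \<omega>\<bar>" using c_pos h sigma_nonneg by (simp add: abs_mult)
      qed
      finally show "\<bar>?G \<omega> - ?D \<omega>\<bar> \<le> K * (c * h + \<sigma> * \<bar>B h \<omega>\<bar>)" .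
    qed (use i Babs(1) in auto)
    also have "\<dots> = K * (c * h + \<sigma> * (\<integral>\<omega>. \<bar>B h \<omega>\<bar> \<partial>M))" using Babs(1) prob_space by simp
    also have "\<dots> \<le> K * (c * h + \<sigma> * (2 * exp (1/2) * sqrt h))"
      using K(1) sigma_nonneg Babs(2) by (intro mult_left_mono add_left_mono) auto
    finally show ?thesis by (simp add: ac_simps)
  qed
  define g where "g = (\<integral>\<omega>. ?G \<omega> \<partial>M)"
  define g0 where "g0 = (\<integral>\<omega>. ?D \<omega> \<partial>M)"
  define Kb where "Kb = K * (c * h + 2 * \<sigma> * exp (1/2) * sqrt h)"
  define e0 where "e0 = exp (\<sigma>\<^sup>2 / 2) * exp (- del * k)"
  \<comment> \<open>The two replacements in the one-claim term: \<open>exp (- a)\<close> by 1, at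
    cost \<open>a\<^sup>2\<close>, and the displaced mean \<open>g\<close> by \<open>g0\<close>, at
    cost \<open>a * Kb\<close>.\<close>
  have "\<bar>a * exp (- a) * g - a * g0\<bar> \<le> a\<^sup>2 + a * Kb"
  proof -
    have "a * exp (- a) * g - a * g0 = - (a * (1 - exp (- a)) * g) + a * (g - g0)" by (simp add: algebra_simps)
    moreover have "0 \<le> a * (1 - exp (- a)) * g" using a G01 by (simp add: g_def)
    moreover have "a * (1 - exp (- a)) * g \<le> a * a * 1"
      using a G01 exp_ge_add_one_self[of "- a"] by (intro mult_mono) (auto simp: g_def)
    moreover have "\<bar>a * (g - g0)\<bar> \<le> a * Kb"
      using a GG by (simp add: abs_mult g_def g0_def Kb_def)
    ultimately show ?thesis by (simp add: power2_eq_square abs_le_iff)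
  qed
  then have "\<bar>(\<integral>\<omega>. kap (z + surplus h \<omega>) \<partial>M) - a * g0\<bar> \<le> e0 + (a\<^sup>2 + a * Kb) + a\<^sup>2"
    using H_le R_le unfolding split indep g_def[symmetric] e0_def[symmetric] by linarith
  then have "\<bar>(\<integral>\<omega>. kap (z + surplus h \<omega>) \<partial>M) - a * g0\<bar> / h \<le> (e0 + (a\<^sup>2 + a * Kb) + a\<^sup>2) / h"
    using h by (intro divide_right_mono) auto
  moreover have "\<bar>(\<integral>\<omega>. kap (z + surplus h \<omega>) \<partial>M) - a * g0\<bar> / h = \<bar>(\<integral>\<omega>. kap (z + surplus h \<omega>) \<partial>M) / h - lam * g0\<bar>"
  proof -
    have "(\<integral>\<omega>. kap (z + surplus h \<omega>) \<partial>M) / h - lam * g0 = ((\<integral>\<omega>. kap (z + surplus h \<omega>) \<partial>M) - a * g0) / h"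
      using h by (simp add: a_def field_simps)
    then show ?thesis using h by (simp add: abs_divide)
  qed
  moreover have "(e0 + (a\<^sup>2 + a * Kb) + a\<^sup>2) / h = exp (\<sigma>\<^sup>2 / 2) * (exp (- del * k) / h) + lam\<^sup>2 * h + lam * Kb + lam\<^sup>2 * h"
    using h by (simp add: a_def e0_def power2_eq_square field_simps)
  ultimately show ?thesis
    unfolding L1 L2 g0_def[symmetric] k_def[symmetric] by (simp add: Kb_def ac_simps)
qed


section \<open>The surplus as an instance of the abstract setting\<close>

lemma claim_law_distr: "claim_law = distr M borel (Y (Suc j))"
proof -
  have "distr M borel (Y (Suc j)) = distr M lborel (Y (Suc j))" by (rule distr_cong) auto
  then show ?thesis
    using distributed_distr_eq_density[OF distY[of "Suc j"]] by (simp add: claim_law_def)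
qed

lemma surplus_step_family: "step_family step_distr lexp c (\<sigma>\<^sup>2 / 2) (c - lam * mu)"
proof (rule step_family.intro)
  fix h :: real assume h: "0 < h"
  have Sm[measurable]: "surplus h \<in> borel_measurable M" using h by (intro surplus_measurable) simp
  show "step_law (step_distr h)"
    unfolding step_law_def step_law_axioms_def step_distr_def by (auto intro: prob_space_distr)
  show "(\<integral>\<^sup>+u. ennreal (exp (b * u)) \<partial>step_distr h) = ennreal (exp (h * lexp b))" if "0 \<le> b" for b
    by (rule surplus_mgf[OF h that])
next
  show "lexp 0 = 0" by (simp add: lexp_eq claim_laplace_0)
  show "continuous_on {0..} lexp" by (rule lexp_cont)
  show "0 \<le> \<sigma>\<^sup>2 / 2" by simp
  show "lexp b \<le> c * b + \<sigma>\<^sup>2 / 2 * b\<^sup>2" if "0 \<le> b" for b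
    using claim_laplace_le_1[OF that] lam_pos by (simp add: lexp_eq mult_nonneg_nonpos)
  show "0 < c - lam * mu" using safety by simp
  show "(c - lam * mu) * (b - a) \<le> lexp b - lexp a" if "0 \<le> a" "a \<le> b" for a b
  proof -
    have "lam * (claim_laplace a - claim_laplace b) \<le> lam * (mu * (b - a))"
      using claim_laplace_diff[OF that] lam_pos by (intro mult_left_mono) auto
    moreover have "\<sigma>\<^sup>2 / 2 * a\<^sup>2 \<le> \<sigma>\<^sup>2 / 2 * b\<^sup>2"
      using that by (intro mult_left_mono power_mono) auto
    ultimately show ?thesis unfolding lexp_eq by (simp add: algebra_simps)
  qed
qed

lemma surplus_skeleton_process: "skeleton_process M step_distr lexp c (\<sigma>\<^sup>2 / 2) (c - lam * mu) surplus"
proof (intro skeleton_process.intro skeleton_process_axioms.intro prob_space_axioms surplus_step_family)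
  show "surplus t \<in> borel_measurable M" if "0 \<le> t" for t by (rule surplus_measurable[OF that])
  show "surplus 0 \<omega> = 0" if "\<omega> \<in> space M" for \<omega> by (rule surplus_0[OF that])
  show "((\<lambda>s. surplus s \<omega>) \<longlongrightarrow> surplus t \<omega>) (at_right t)" if "\<omega> \<in> space M" "0 \<le> t" for t \<omega>
    by (rule surplus_right[OF that])
  show "\<exists>l. ((\<lambda>s. surplus s \<omega>) \<longlongrightarrow> l) (at_left t)" if "\<omega> \<in> space M" "0 < t" for t \<omega>
    by (rule surplus_left[OF that])
  show "(\<integral>\<^sup>+\<omega>. w (\<lambda>k\<in>{..i}. surplus (real k * h) \<omega>, surplus (real (Suc i) * h) \<omega> - surplus (real i * h) \<omega>) \<partial>M) =
      (\<integral>\<^sup>+\<omega>. \<integral>\<^sup>+u. w (\<lambda>k\<in>{..i}. surplus (real k * h) \<omega>, u) \<partial>step_distr h \<partial>M)"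
    if h: "0 < h" and that: "w \<in> borel_measurable (Pi\<^sub>M {..i} (\<lambda>_. borel) \<Otimes>\<^sub>M borel)" for w i h
    by (rule surplus_markov[OF h that])
qed

lemma surplus_jump_process: "jump_process M step_distr lexp c (\<sigma>\<^sup>2 / 2) (c - lam * mu) surplus lam claim_law"
proof (intro jump_process.intro jump_process_axioms.intro surplus_skeleton_process)
  show "0 < lam" by (rule lam_pos)
  show "real_distribution claim_law"
    unfolding claim_law_distr[of 0] real_distribution_def real_distribution_axioms_def
    by (auto intro: prob_space_distr)
  fix kap :: "real \<Rightarrow> real" and K del e
  assume kap: "\<And>z. 0 \<le> kap z" "\<And>z. kap z \<le> 1" "\<And>z. 0 \<le> z \<Longrightarrow> kap z = 0"
    and K: "0 \<le> K" "\<And>y z. \<bar>kap y - kap z\<bar> \<le> K * \<bar>y - z\<bar>" and del: "0 < (del::real)" and e: "0 < (e::real)"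
  define bd where "bd h = exp (\<sigma>\<^sup>2 / 2) * (exp (- del * h powr (-1/2)) / h) + lam\<^sup>2 * h + lam * K * (c * h + 2 * \<sigma> * exp (1/2) * sqrt h) + lam\<^sup>2 * h" for h
  have "((\<lambda>h. exp (- del * h powr (-1/2)) / h) \<longlongrightarrow> 0) (at_right 0)"
    using del by real_asymp
  moreover have "((\<lambda>h::real. h) \<longlongrightarrow> 0) (at_right 0)" "(sqrt \<longlongrightarrow> 0) (at_right 0)" by real_asymp+
  ultimately have "(bd \<longlongrightarrow> exp (\<sigma>\<^sup>2 / 2) * 0 + lam\<^sup>2 * 0 + lam * K * (c * 0 + 2 * \<sigma> * exp (1/2) * 0) + lam\<^sup>2 * 0) (at_right 0)"
    unfolding bd_def by (intro tendsto_intros)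
  then have "(bd \<longlongrightarrow> 0) (at_right 0)" by simp
  then have "eventually (\<lambda>h. bd h < e) (at_right 0)" using e by (rule order_tendstoD(2))
  moreover have "eventually (\<lambda>h::real. 0 < h) (at_right 0)" by (simp add: eventually_at_right_less)
  ultimately show "eventually (\<lambda>h. \<forall>z\<ge>del. \<bar>(\<integral>u. kap (z + u) \<partial>step_distr h) / h - lam * (\<integral>y. kap (z - y) \<partial>claim_law)\<bar> \<le> e) (at_right 0)"
  proof eventually_elim
    case (elim h)
    show ?case
    proof (intro allI impI)
      fix z assume "del \<le> z"
      from surplus_small_jump[OF kap K del elim(2) this, folded bd_def] elim(1)
      show "\<bar>(\<integral>u. kap (z + u) \<partial>step_distr h) / h - lam * (\<integral>y. kap (z - y) \<partial>claim_law)\<bar> \<le> e" by linarith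
    qed
  qed
qed

end

section \<open>Path space\<close>

lemma space_path_space: "space path_space = cadlag_paths"
  unfolding path_space_def space_restrict_space space_PiM cadlag_paths_def by (auto simp: PiE_def)

lemma coordinate_measurable: "0 \<le> t \<Longrightarrow> (\<lambda>\<omega>. \<omega> t) \<in> borel_measurable path_space"
  unfolding path_space_def by (rule measurable_restrict_space1) (auto intro: measurable_component_singleton)

lemma cadlag_path_of_paths: "\<omega> \<in> cadlag_paths \<Longrightarrow> cadlag_path \<omega>"
  by unfold_locales (auto simp: cadlag_paths_def)

text \<open>The index \<open>\<lceil>t / mesh n\<rceil> - 1\<close> is that of the last grid point
  strictly before \<open>t\<close>, also when \<open>t\<close> itself lies on the grid; so left
  limits can be read off along the grids.\<close>

lemma filterlim_mesh_left:
  assumes t: "0 < t"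
  shows "filterlim (\<lambda>n. real (nat \<lceil>t / mesh n\<rceil> - 1) * mesh n) (at_left t) sequentially"
proof -
  define s where "s n = real (nat \<lceil>t / mesh n\<rceil> - 1) * mesh n" for n
  have b: "t - mesh n \<le> s n" "s n < t" for n
  proof -
    have p: "0 < t / mesh n" using t by simp
    then have "real (nat \<lceil>t / mesh n\<rceil> - 1) = of_int \<lceil>t / mesh n\<rceil> - 1" by linarith
    then have *: "t / mesh n - 1 \<le> real (nat \<lceil>t / mesh n\<rceil> - 1)" "real (nat \<lceil>t / mesh n\<rceil> - 1) < t / mesh n" by linarith+
    have "(t / mesh n - 1) * mesh n \<le> real (nat \<lceil>t / mesh n\<rceil> - 1) * mesh n"
      using *(1) by (intro mult_right_mono) (auto simp: less_imp_le)
    then show "t - mesh n \<le> s n"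
      using mesh_pos[of n] by (simp add: s_def left_diff_distrib del: mesh_pos)
    show "s n < t"
      using *(2) mesh_pos[of n] by (simp add: s_def less_divide_eq del: mesh_pos)
  qed
  have "s \<longlonglongrightarrow> t"
    by (rule tendsto_sandwich[of "\<lambda>n. t - mesh n" _ _ "\<lambda>_. t"])
       (auto simp: b less_imp_le intro!: tendsto_eq_intros mesh_tendsto)
  then show ?thesis
    unfolding filterlim_at s_def[abs_def, symmetric] using b(2) by (auto intro!: always_eventually less_imp_neq)
qed

context cadlag_path
begin

lemma ruin_time_mesh:
  "ruin_time X = (INF nk. if X (real (snd nk) * mesh (fst nk)) < 0 then ereal (real (snd nk) * mesh (fst nk)) else \<infinity>)"
  (is "_ = ?I")
proof (rule antisym)
  show "ruin_time X \<le> ?I"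
    by (rule INF_greatest) (auto intro!: ruin_le simp: less_imp_le)
  show "?I \<le> ruin_time X"
    unfolding ruin_time_def
  proof (rule Inf_greatest)
    fix e assume "e \<in> {ereal t |t. 0 \<le> t \<and> X t < 0}"
    then obtain t where t: "e = ereal t" "0 \<le> t" "X t < 0" by auto
    have "(\<lambda>n. X (mesh_up n t)) \<longlonglongrightarrow> X t"
      by (rule tendsto_mesh_up[OF t(2)])
    then have "eventually (\<lambda>n. X (mesh_up n t) < 0) sequentially" using t(3) by (rule order_tendstoD(2))
    then have "eventually (\<lambda>n. ?I \<le> ereal (mesh_up n t)) sequentially"
    proof eventually_elim
      case (elim n)
      show ?case
        by (rule INF_lower2[where i="(n, Suc (nat \<lfloor>t / mesh n\<rfloor>))"]) (use elim in \<open>simp_all add: mesh_up_def\<close>)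
    qed
    moreover have "(\<lambda>n. ereal (mesh_up n t)) \<longlonglongrightarrow> ereal t" using mesh_up_tendsto[OF t(2)] by simp
    ultimately show "?I \<le> e"
      unfolding t(1) by (rule tendsto_lowerbound[OF _ _ trivial_limit_sequentially, rotated])
  qed
qed

lemma tendsto_before_ruin:
  assumes "0 < T"
  shows "(\<lambda>n. X (real (nat \<lceil>T / mesh n\<rceil> - 1) * mesh n)) \<longlonglongrightarrow> Lim (at_left T) X"
proof -
  obtain l where l: "(X \<longlongrightarrow> l) (at_left T)" using left[OF assms] by auto
  then have "Lim (at_left T) X = l" by (intro tendsto_Lim) (auto simp: trivial_limit_at_left_real)
  then show ?thesis using filterlim_compose[OF l filterlim_mesh_left[OF assms]] by simp
qed

end

lemma ruin_time_measurable: "ruin_time \<in> borel_measurable path_space"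
proof -
  note coordinate_measurable[measurable]
  have [measurable]: "(\<lambda>\<omega>. \<omega> (real (snd nk) * mesh (fst nk))) \<in> borel_measurable path_space" for nk :: "nat \<times> nat"
    by (rule coordinate_measurable) (simp add: less_imp_le)
  have "(\<lambda>\<omega>. INF nk. if \<omega> (real (snd nk) * mesh (fst nk)) < 0 then ereal (real (snd nk) * mesh (fst nk)) else \<infinity>)
    \<in> borel_measurable path_space"
    by measurable
  then show ?thesis
    by (rule measurable_cong[THEN iffD1, rotated])
       (simp add: space_path_space cadlag_path.ruin_time_mesh[OF cadlag_path_of_paths])
qed

text \<open>For ruin at time \<open>0\<close> the left limit in \<open>ruin_law\<close> is a junk value; it does not depend
  on the path, so measurability survives.\<close>

lemma Lim_at_left_0:
  assumes "\<omega> \<in> cadlag_paths" shows "Lim (at_left 0) \<omega> = undefined"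
proof (rule tendsto_Lim)
  have "eventually (\<lambda>t. t \<in> {- 1<..<0::real}) (at_left 0)" by (rule eventually_at_left_real) simp
  then have "eventually (\<lambda>t. undefined = \<omega> t) (at_left 0)"
    by eventually_elim (use assms in \<open>auto simp: cadlag_paths_def extensional_def\<close>)
  then show "(\<omega> \<longlongrightarrow> undefined) (at_left 0)" by (rule Lim_transform_eventually[OF tendsto_const])
qed (simp add: trivial_limit_at_left_real)

section \<open>From the ruin triple to discounted ruin values\<close>

definition ruin_triple :: "(real \<Rightarrow> real) \<Rightarrow> real \<times> real \<times> real" where
  "ruin_triple \<omega> = (let T = real_of_ereal (ruin_time \<omega>) in (Lim (at_left T) \<omega>, \<bar>\<omega> T\<bar>, T))"

text \<open>The value at ruin and the value just before it are limits along grid points to the right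
  and to the left of \<open>T\<close>. Rounding \<open>T\<close> to the grid leaves countably many
  coordinates at a time.\<close>

lemma ruin_triple_measurable:
  "ruin_triple \<in> borel_measurable (restrict_space path_space {\<omega>. ruin_time \<omega> < \<infinity>})" (is "_ \<in> borel_measurable ?R")
proof -
  define T where "T \<omega> = real_of_ereal (ruin_time \<omega>)" for \<omega>
  have cm: "(\<lambda>\<omega>. \<omega> t) \<in> borel_measurable ?R" if "0 \<le> t" for t
    by (rule measurable_restrict_space1[OF coordinate_measurable[OF that]])
  have Tm[measurable]: "T \<in> borel_measurable ?R"
    unfolding T_def[abs_def]
    by (rule borel_measurable_real_of_ereal[OF measurable_restrict_space1[OF ruin_time_measurable]])
  have sp: "cadlag_path \<omega>" "0 \<le> T \<omega>" "\<omega> \<in> cadlag_paths" if "\<omega> \<in> space ?R" for \<omega>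
  proof -
    show *: "\<omega> \<in> cadlag_paths" using that by (auto simp: space_restrict_space space_path_space)
    show "cadlag_path \<omega>" by (rule cadlag_path_of_paths[OF *])
    show "0 \<le> T \<omega>" unfolding T_def by (rule real_of_ereal_pos[OF cadlag_path.ruin_time_nonneg[OF cadlag_path_of_paths[OF *]]])
  qed
  have um: "(\<lambda>\<omega>. \<omega> (mesh_up n (T \<omega>))) \<in> borel_measurable ?R" for n
    unfolding mesh_up_def
  proof (rule measurable_compose_countable[where f="\<lambda>i \<omega>. \<omega> (real (Suc i) * mesh n)"])
    show "(\<lambda>\<omega>. \<omega> (real (Suc i) * mesh n)) \<in> borel_measurable ?R" for i
      by (rule cm) (simp add: less_imp_le del: of_nat_Suc)
  qed measurable
  have 1[measurable]: "(\<lambda>\<omega>. \<omega> (T \<omega>)) \<in> borel_measurable ?R"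
    by (rule borel_measurable_LIMSEQ_real[OF _ um]) (rule cadlag_path.tendsto_mesh_up[OF sp(1) sp(2)])
  have [measurable]: "(\<lambda>\<omega>. \<omega> (real (nat \<lceil>T \<omega> / mesh n\<rceil> - 1) * mesh n)) \<in> borel_measurable ?R" for n
  proof (rule measurable_compose_countable[where f="\<lambda>i \<omega>. \<omega> (real (i - 1) * mesh n)"])
    show "(\<lambda>\<omega>. \<omega> (real (i - 1) * mesh n)) \<in> borel_measurable ?R" for i
      by (rule cm) (simp add: less_imp_le)
  qed measurable
  have 2[measurable]: "(\<lambda>\<omega>. Lim (at_left (T \<omega>)) \<omega>) \<in> borel_measurable ?R"
  proof (rule borel_measurable_LIMSEQ_real)
    fix \<omega> assume w: "\<omega> \<in> space ?R"
    show "(\<lambda>n. if T \<omega> = 0 then undefined else \<omega> (real (nat \<lceil>T \<omega> / mesh n\<rceil> - 1) * mesh n)) \<longlonglongrightarrow> Lim (at_left (T \<omega>)) \<omega>"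
      using cadlag_path.tendsto_before_ruin[OF sp(1)[OF w], of "T \<omega>"] sp(2)[OF w] Lim_at_left_0[OF sp(3)[OF w]]
      by (cases "T \<omega> = 0") auto
  qed measurable
  have "(\<lambda>\<omega>. (Lim (at_left (T \<omega>)) \<omega>, \<bar>\<omega> (T \<omega>)\<bar>, T \<omega>)) \<in> ?R \<rightarrow>\<^sub>M borel \<Otimes>\<^sub>M (borel \<Otimes>\<^sub>M borel)"
    by measurable
  then show ?thesis by (simp add: borel_prod ruin_triple_def[abs_def] Let_def T_def)
qed

text \<open>The restriction to the positive octant is already contained in the two indicators:
  \<open>a \<ge> 0\<close> makes the prior surplus positive, \<open>X T \<le> 0\<close> makes a
  positive deficit the same as \<open>X T < 0\<close>, and \<open>X 0 \<ge> 0\<close> then excludes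
  \<open>T = 0\<close>.\<close>

lemma (in cadlag_path) ruin_value_triple:
  assumes X0: "0 \<le> X 0" and a: "0 \<le> a"
  shows "((case ruin_triple X of (y, z, t) \<Rightarrow> ennreal (exp (- q * t)) * indicator positive_octant (y, z, t))
        * indicator (fst -` {a<..}) (ruin_triple X)) * indicator {\<omega>. ruin_time \<omega> < \<infinity>} X
    = ennreal (ruin_value X q (indicator {a<..}) (indicator {..<0}))"
proof (cases "ruin_time X < \<infinity>")
  case True
  then obtain T where T: "ruin_time X = ereal T" using ruin_time_nonneg by (cases "ruin_time X") auto
  have T0: "0 \<le> T" and XT: "X T \<le> 0" using ruin_value_nonpos[OF T] by auto
  have "0 < T" if "X T < 0" using that X0 T0 by (cases "T = 0") auto
  moreover have "0 < \<bar>X T\<bar> \<longleftrightarrow> X T < 0" using XT by auto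
  ultimately show ?thesis
    using a by (auto simp: ruin_triple_def ruin_value_def T indicator_def)
qed (simp add: ruin_value_def)

text \<open>Restriction alters the path only at negative times, which could affect the left limit
  only at \<open>T = 0\<close>. There \<open>X 0 = 0\<close>, and \<open>kap 0 = 0\<close> removes
  the contribution.\<close>

lemma ruin_value_restrict:
  assumes "cadlag_path X" and X0: "0 \<le> X 0" and kap: "kap 0 = 0"
  shows "ruin_value (restrict X {0..}) q g kap = ruin_value X q g kap"
proof -
  interpret cadlag_path X by fact
  have eq: "ruin_time (restrict X {0..}) = ruin_time X"
    unfolding ruin_time_def by (rule arg_cong[where f=Inf]) auto
  show ?thesis
  proof (cases "ruin_time X < \<infinity>")
    case True
    then obtain T where T: "ruin_time X = ereal T" using ruin_time_nonneg by (cases "ruin_time X") auto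
    have T0: "0 \<le> T" and XT: "X T \<le> 0" using ruin_value_nonpos[OF T] by auto
    show ?thesis
    proof (cases "T = 0")
      case True
      then show ?thesis using XT X0 kap by (simp add: ruin_value_def eq T)
    next
      case False
      then have "eventually (\<lambda>t. t \<in> {0<..<T}) (at_left T)" using T0 by (intro eventually_at_left_real) simp
      then have ev: "eventually (\<lambda>t. X t = restrict X {0..} t) (at_left T)"
        by eventually_elim simp
      obtain l where l: "(X \<longlongrightarrow> l) (at_left T)" using left[of T] False T0 by auto
      have "Lim (at_left T) (restrict X {0..}) = l"
        by (rule tendsto_Lim[OF _ Lim_transform_eventually[OF l ev]]) (simp add: trivial_limit_at_left_real)
      moreover have "Lim (at_left T) X = l"
        by (rule tendsto_Lim[OF _ l]) (simp add: trivial_limit_at_left_real)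
      ultimately have "Lim (at_left T) (restrict X {0..}) = Lim (at_left T) X" by simp
      then show ?thesis using T0 by (simp add: ruin_value_def eq T)
    qed
  qed (simp add: ruin_value_def eq)
qed

lemma emeasure_discounted_pre_ruin_measure:
  assumes L: "sets L = sets path_space" and A: "A \<in> sets borel"
  shows "emeasure (discounted_pre_ruin_measure q L) A =
    (\<integral>\<^sup>+\<omega>. ((case ruin_triple \<omega> of (y, z, t) \<Rightarrow> ennreal (exp (- q * t)) * indicator positive_octant (y, z, t))
        * indicator (fst -` A) (ruin_triple \<omega>)) * indicator {\<omega>. ruin_time \<omega> < \<infinity>} \<omega> \<partial>L)"
    and "(\<lambda>\<omega>. ((case ruin_triple \<omega> of (y, z, t) \<Rightarrow> ennreal (exp (- q * t)) * indicator positive_octant (y, z, t))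
        * indicator (fst -` A) (ruin_triple \<omega>)) * indicator {\<omega>. ruin_time \<omega> < \<infinity>} \<omega>) \<in> borel_measurable L"
proof -
  let ?w = "\<lambda>(y::real, z::real, t::real). ennreal (exp (- q * t)) * indicator positive_octant (y, z, t)"
  let ?A = "{\<omega>. ruin_time \<omega> < \<infinity>}"
  let ?R = "restrict_space L ?A"
  have Om[measurable]: "positive_octant \<in> sets borel"
    by (intro borel_open open_Times) auto
  have em[measurable]: "(\<lambda>v::real \<times> real \<times> real. ennreal (exp (- q * snd (snd v)))) \<in> borel_measurable borel"
    by (intro measurable_compose[OF _ measurable_ennreal] borel_measurable_continuous_onI continuous_intros)
  have wm: "?w \<in> borel_measurable borel"
    unfolding case_prod_beta' prod.collapse
    by (rule borel_measurable_times_ennreal[OF em borel_measurable_indicator[OF Om]])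
  have fm: "(fst :: real \<times> real \<times> real \<Rightarrow> real) \<in> borel_measurable borel"
    by (intro borel_measurable_continuous_onI continuous_intros)
  have Am: "fst -` A \<in> sets (borel :: (real \<times> real \<times> real) measure)"
    using measurable_sets[OF fm A] by simp
  have Lm: "borel_measurable L = borel_measurable path_space" by (rule measurable_cong_sets[OF L refl])
  have spL: "space L = space path_space" by (rule sets_eq_imp_space_eq[OF L])
  have rm: "ruin_time \<in> borel_measurable L" unfolding Lm by (rule ruin_time_measurable)
  have Lset: "?A \<inter> space L \<in> sets L"
    using rm by measurable
  have "sets ?R = sets (restrict_space path_space ?A)" by (rule sets_restrict_space_cong[OF L])
  from measurable_cong_sets[OF this refl] have tm: "ruin_triple \<in> borel_measurable ?R"
    using ruin_triple_measurable by blast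
  have RL: "ruin_law L = distr ?R borel ruin_triple"
    by (simp add: ruin_law_def ruin_triple_def[abs_def])
  have m: "(\<lambda>v. ?w v * indicator (fst -` A) v) \<in> borel_measurable borel"
    using wm Am by (intro borel_measurable_times_ennreal borel_measurable_indicator) auto
  have sb: "sets (ruin_law L) = sets borel" "space (ruin_law L) = UNIV" by (simp_all add: ruin_law_def)
  have mR: "borel_measurable (ruin_law L) = borel_measurable borel"
    by (rule measurable_cong_sets[OF sb(1) refl])
  have "emeasure (discounted_pre_ruin_measure q L) A = emeasure (density (ruin_law L) ?w) (fst -` A)"
    unfolding discounted_pre_ruin_measure_def
    by (subst emeasure_distr) (use A fm in \<open>simp_all add: sb measurable_cong_sets[OF sb(1) refl]\<close>)
  also have "\<dots> = (\<integral>\<^sup>+v. ?w v * indicator (fst -` A) v \<partial>ruin_law L)"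
    by (rule emeasure_density) (simp_all only: mR wm sb Am)
  also have "\<dots> = (\<integral>\<^sup>+\<omega>. ?w (ruin_triple \<omega>) * indicator (fst -` A) (ruin_triple \<omega>) \<partial>?R)"
    unfolding RL by (rule nn_integral_distr[OF tm]) (simp only: measurable_distr_eq1 m)
  also have "\<dots> = (\<integral>\<^sup>+\<omega>. (?w (ruin_triple \<omega>) * indicator (fst -` A) (ruin_triple \<omega>)) * indicator ?A \<omega> \<partial>L)"
    by (rule nn_integral_restrict_space[OF Lset])
  finally show "emeasure (discounted_pre_ruin_measure q L) A =
    (\<integral>\<^sup>+\<omega>. (?w (ruin_triple \<omega>) * indicator (fst -` A) (ruin_triple \<omega>)) * indicator ?A \<omega> \<partial>L)" .
  have "(\<lambda>\<omega>. ?w (ruin_triple \<omega>) * indicator (fst -` A) (ruin_triple \<omega>)) \<in> borel_measurable ?R"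
    by (rule measurable_compose[OF tm m])
  then show "(\<lambda>\<omega>. (?w (ruin_triple \<omega>) * indicator (fst -` A) (ruin_triple \<omega>)) * indicator ?A \<omega>) \<in> borel_measurable L"
    by (subst (asm) borel_measurable_restrict_space_iff_ennreal[OF Lset])
qed

lemma sets_discounted_pre_ruin_measure: "sets (discounted_pre_ruin_measure q L) = sets borel"
  by (simp add: discounted_pre_ruin_measure_def)

text \<open>The octant excludes a nonpositive prior surplus. This extends comparisons on half-lines
  with \<open>a \<ge> 0\<close> to all half-lines, as needed for equality of measures on the real
  line.\<close>

lemma discounted_tail_nonpos:
  assumes L: "sets L = sets path_space" and a: "a < 0"
  shows "emeasure (discounted_pre_ruin_measure q L) {a<..} = emeasure (discounted_pre_ruin_measure q L) {0<..}"
  by (subst (1 2) emeasure_discounted_pre_ruin_measure[OF L])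
     (use a in \<open>auto intro!: nn_integral_cong simp: indicator_def split: prod.splits\<close>)

text \<open>Path version of \<open>alive\<close>. Testing only dyadic times strictly before
  \<open>s\<close> makes it an event of the filtration at time \<open>s\<close>, so the density of
  the change of measure is available for it.\<close>

definition survives :: "real \<Rightarrow> (real \<Rightarrow> real) set" where
  "survives s = {\<omega> \<in> cadlag_paths. \<forall>n k. real k * mesh n < s \<longrightarrow> 0 \<le> \<omega> (real k * mesh n)}"

section \<open>Survival events and the change of measure\<close>

lemma space_path_filtration: "space (path_filtration s) = cadlag_paths"
  by (simp add: path_filtration_def)

lemma coordinate_path_filtration:
  assumes "0 \<le> t" "t \<le> s" shows "(\<lambda>\<omega>. \<omega> t) \<in> borel_measurable (path_filtration s)"
proof -
  have "(\<lambda>\<omega>. restrict \<omega> {0..s}) \<in> path_filtration s \<rightarrow>\<^sub>M Pi\<^sub>M {0..s} (\<lambda>_. borel :: real measure)"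
    unfolding path_filtration_def by (rule measurable_vimage_algebra1) (auto simp: space_PiM)
  from measurable_compose[OF this measurable_component_singleton[of t]] assms show ?thesis by simp
qed

lemma subalgebra_path_filtration:
  assumes L: "sets L = sets path_space" shows "subalgebra L (path_filtration s)"
  unfolding subalgebra_def
proof
  have sp: "space L = cadlag_paths" using sets_eq_imp_space_eq[OF L] by (simp add: space_path_space)
  show "space (path_filtration s) = space L" by (simp add: sp space_path_filtration)
  show "sets (path_filtration s) \<subseteq> sets L"
    unfolding path_filtration_def
  proof (rule sets_image_in_sets[OF sp])
    have "(\<lambda>\<omega>. \<lambda>t\<in>{0..s}. \<omega> t) \<in> path_space \<rightarrow>\<^sub>M Pi\<^sub>M {0..s} (\<lambda>_. borel)"
      by (rule measurable_restrict) (auto intro: coordinate_measurable)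
    then show "(\<lambda>\<omega>. restrict \<omega> {0..s}) \<in> L \<rightarrow>\<^sub>M Pi\<^sub>M {0..s} (\<lambda>_. borel)"
      using measurable_cong_sets[OF L refl] by blast
  qed
qed

lemma survives_filtration: "survives s \<in> sets (path_filtration s)"
proof -
  have "{\<omega> \<in> space (path_filtration s). real k * mesh n < s \<longrightarrow> 0 \<le> \<omega> (real k * mesh n)} \<in> sets (path_filtration s)" for n k
  proof (cases "real k * mesh n < s")
    case True
    have "(\<lambda>\<omega>. \<omega> (real k * mesh n)) \<in> borel_measurable (path_filtration s)"
      using True by (intro coordinate_path_filtration) (auto simp: less_imp_le)
    then have "{\<omega> \<in> space (path_filtration s). 0 \<le> \<omega> (real k * mesh n)} \<in> sets (path_filtration s)" by measurable
    then show ?thesis using True by simp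
  qed simp
  then have "(\<Inter>n. \<Inter>k. {\<omega> \<in> space (path_filtration s). real k * mesh n < s \<longrightarrow> 0 \<le> \<omega> (real k * mesh n)}) \<in> sets (path_filtration s)"
    by blast
  also have "(\<Inter>n. \<Inter>k. {\<omega> \<in> space (path_filtration s). real k * mesh n < s \<longrightarrow> 0 \<le> \<omega> (real k * mesh n)}) = survives s"
    by (auto simp: survives_def space_path_filtration)
  finally show ?thesis .
qed

lemma survives_antimono: "s \<le> s' \<Longrightarrow> survives s' \<subseteq> survives s"
  by (auto simp: survives_def)

lemma survives_forever: "(\<Inter>i. survives (real i)) = {\<omega> \<in> space path_space. ruin_time \<omega> = \<infinity>}"
proof (intro set_eqI iffI)
  fix \<omega> assume *: "\<omega> \<in> (\<Inter>i. survives (real i))"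
  then have w: "\<omega> \<in> cadlag_paths" by (auto simp: survives_def)
  have "0 \<le> \<omega> (real k * mesh n)" for k n
  proof -
    obtain i where "real k * mesh n < real i" using reals_Archimedean2 by blast
    moreover have "\<omega> \<in> survives (real i)" using * by simp
    ultimately show ?thesis by (simp add: survives_def)
  qed
  then have "ruin_time \<omega> = \<infinity>"
    by (simp add: cadlag_path.ruin_time_mesh[OF cadlag_path_of_paths[OF w]] not_less[symmetric] top_ereal_def)
  then show "\<omega> \<in> {\<omega> \<in> space path_space. ruin_time \<omega> = \<infinity>}" using w by (simp add: space_path_space)
next
  fix \<omega> assume *: "\<omega> \<in> {\<omega> \<in> space path_space. ruin_time \<omega> = \<infinity>}"
  then have w: "\<omega> \<in> cadlag_paths" by (simp add: space_path_space)
  show "\<omega> \<in> (\<Inter>i. survives (real i))"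
    using * w cadlag_path.before_ruin[OF cadlag_path_of_paths[OF w]] by (auto simp: survives_def less_imp_le)
qed

text \<open>The events decrease to \<open>survives_forever\<close>, so continuity from above gives
  the limit along the integers, and monotonicity fills in the real times.\<close>

lemma survival_limit:
  assumes "prob_space Q" and Q: "sets Q = sets path_space"
  shows "((\<lambda>s. measure Q (survives s)) \<longlongrightarrow> measure Q {\<omega> \<in> space path_space. ruin_time \<omega> = \<infinity>}) at_top"
    (is "(?f \<longlongrightarrow> ?l) at_top")
proof -
  interpret prob_space Q by fact
  have ev: "survives s \<in> events" for s
    using survives_filtration subalgebra_path_filtration[OF Q] by (auto simp: subalgebra_def)
  have anti: "?f s' \<le> ?f s" if "s \<le> s'" for s s'
    by (rule finite_measure_mono[OF survives_antimono[OF that] ev])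
  have lim: "(\<lambda>i. ?f (real i)) \<longlonglongrightarrow> ?l"
    unfolding survives_forever[symmetric]
    by (rule finite_Lim_measure_decseq) (use ev survives_antimono in \<open>auto simp: decseq_def\<close>)
  have ge: "?l \<le> ?f s" for s
  proof -
    obtain i where i: "s \<le> real i" using real_arch_simple by blast
    have "?l \<le> ?f (real i)"
      by (rule finite_measure_mono[OF _ ev]) (use survives_forever in blast)
    then show ?thesis using anti[OF i] by simp
  qed
  show ?thesis
  proof (rule order_tendstoI)
    fix a assume "a < ?l"
    then show "eventually (\<lambda>s. a < ?f s) at_top"
      by (intro always_eventually allI less_le_trans[OF _ ge])
  next
    fix a assume "?l < a"
    then have "eventually (\<lambda>i. ?f (real i) < a) sequentially" by (rule order_tendstoD(2)[OF lim])
    then obtain i where i: "?f (real i) < a" by (auto simp: eventually_sequentially)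
    show "eventually (\<lambda>s. ?f s < a) at_top"
      using eventually_ge_at_top[of "real i"] by eventually_elim (use anti i in \<open>auto intro: le_less_trans\<close>)
  qed
qed

text \<open>The density relation holds only between restrictions to the filtration at a finite time.
  An event of that filtration has the same measure before and after restriction; eternal survival
  does not fall under this and has to be reached as a limit.\<close>

lemma exponential_tilt_emeasure:
  assumes tilt: "exponential_tilt \<phi> \<theta> x L Q" and L: "sets L = sets path_space" and s: "0 \<le> s"
    and A: "A \<in> sets (path_filtration s)"
  shows "emeasure Q A = (\<integral>\<^sup>+\<omega>. ennreal (exp (\<theta> * (\<omega> s - x) - \<phi> \<theta> * s)) * indicator A \<omega> \<partial>L)"
proof -
  let ?F = "path_filtration s" and ?g = "\<lambda>\<omega>. ennreal (exp (\<theta> * (\<omega> s - x) - \<phi> \<theta> * s))"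
  have Q: "sets Q = sets path_space" and eq: "restr_to_subalg Q ?F = density (restr_to_subalg L ?F) ?g"
    using tilt s by (auto simp: exponential_tilt_def)
  have g: "?g \<in> borel_measurable ?F"
    using coordinate_path_filtration[OF s order_refl] by measurable
  have m: "borel_measurable (restr_to_subalg L ?F) = borel_measurable ?F"
    by (rule measurable_cong_sets[OF sets_restr_to_subalg[OF subalgebra_path_filtration[OF L]] refl])
  have "emeasure Q A = emeasure (density (restr_to_subalg L ?F) ?g) A"
    unfolding eq[symmetric] by (rule emeasure_restr_to_subalg[OF subalgebra_path_filtration[OF Q] A, symmetric])
  also have "\<dots> = (\<integral>\<^sup>+\<omega>. ?g \<omega> * indicator A \<omega> \<partial>restr_to_subalg L ?F)"
    by (rule emeasure_density) (simp_all add: m g A sets_restr_to_subalg[OF subalgebra_path_filtration[OF L]])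
  also have "\<dots> = (\<integral>\<^sup>+\<omega>. ?g \<omega> * indicator A \<omega> \<partial>L)"
    by (rule nn_integral_subalgebra2[OF subalgebra_path_filtration[OF L]])
       (intro borel_measurable_times_ennreal g borel_measurable_indicator A)
  finally show ?thesis .
qed

context risk_model
begin

section \<open>Transfer to the path laws\<close>

definition surplus_path :: "real \<Rightarrow> 'a \<Rightarrow> real \<Rightarrow> real" where
  "surplus_path x \<omega> = restrict (\<lambda>t. x + surplus t \<omega>) {0..}"

lemma risk_law_eq: "risk_law M N Y B c \<sigma> x = distr M path_space (surplus_path x)"
  unfolding risk_law_def surplus_path_def surplus_def by (simp add: algebra_simps)

lemma surplus_cadlag: "\<omega> \<in> space M \<Longrightarrow> cadlag_path (\<lambda>t. x + surplus t \<omega>)"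
  by (rule jump_process.cadlag[OF surplus_jump_process])

lemma surplus_path_cadlag: assumes w: "\<omega> \<in> space M" shows "surplus_path x \<omega> \<in> cadlag_paths"
  unfolding cadlag_paths_def
proof (intro CollectI conjI allI impI)
  interpret cadlag_path "\<lambda>t. x + surplus t \<omega>" by (rule surplus_cadlag[OF w])
  show "surplus_path x \<omega> \<in> extensional {0..}" by (simp add: surplus_path_def)
  show "(surplus_path x \<omega> \<longlongrightarrow> surplus_path x \<omega> t) (at_right t)" if t: "0 \<le> t" for t
  proof -
    have "eventually (\<lambda>s. x + surplus s \<omega> = surplus_path x \<omega> s) (at_right t)"
      using eventually_at_right_less[of t] by eventually_elim (use t in \<open>simp add: surplus_path_def\<close>)
    from Lim_transform_eventually[OF right[OF t] this] show ?thesis using t by (simp only: surplus_path_def restrict_apply' atLeast_iff)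
  qed
  show "\<exists>l. (surplus_path x \<omega> \<longlongrightarrow> l) (at_left t)" if t: "0 < t" for t
  proof -
    obtain l where l: "((\<lambda>t. x + surplus t \<omega>) \<longlongrightarrow> l) (at_left t)" using left[OF t] by auto
    have "eventually (\<lambda>s. s \<in> {0<..<t}) (at_left t)" using t by (rule eventually_at_left_real)
    then have "eventually (\<lambda>s. x + surplus s \<omega> = surplus_path x \<omega> s) (at_left t)"
      by eventually_elim (simp add: surplus_path_def)
    from Lim_transform_eventually[OF l this] show ?thesis by blast
  qed
qed

lemma surplus_path_measurable: "surplus_path x \<in> M \<rightarrow>\<^sub>M path_space"
  unfolding path_space_def
proof (rule measurable_restrict_space2)
  show "surplus_path x \<in> space M \<rightarrow> cadlag_paths" using surplus_path_cadlag by auto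
  show "surplus_path x \<in> M \<rightarrow>\<^sub>M Pi\<^sub>M {0..} (\<lambda>_. borel)"
    unfolding surplus_path_def[abs_def]
    by (rule measurable_restrict) (auto intro!: borel_measurable_add surplus_measurable)
qed

text \<open>Instead of a process under the tilted measure only its survival probabilities are used:
  up to a finite time they are weighted expectations of the untilted surplus, and
  \<open>survival_limit\<close> supplies the limit. Hence the abstract argument never leaves
  \<open>M\<close>.\<close>

lemma tilted_survival_surplus:
  assumes th: "0 \<le> th" and m: "0 < m" "(lexp has_real_derivative m) (at th within {0..})"
    and tilt: "\<And>x. 0 \<le> x \<Longrightarrow> exponential_tilt lexp th x (risk_law M N Y B c \<sigma> x) (Q x)"
  shows "tilted_survival M step_distr lexp c (\<sigma>\<^sup>2 / 2) (c - lam * mu) surplus th m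
    (\<lambda>x s. measure (Q x) (survives s)) (\<lambda>x. measure (Q x) {\<omega> \<in> space path_space. ruin_time \<omega> = \<infinity>})"
proof -
  interpret skeleton_process M step_distr lexp c "\<sigma>\<^sup>2 / 2" "c - lam * mu" surplus
    by (rule surplus_skeleton_process)
  have Q: "prob_space (Q x)" "sets (Q x) = sets path_space" if "0 \<le> x" for x
    using tilt[OF that] by (auto simp: exponential_tilt_def)
  have ev: "survives s \<in> sets (Q x)" if "0 \<le> x" for s x
    using survives_filtration subalgebra_path_filtration[OF Q(2)[OF that]] by (auto simp: subalgebra_def)
  show ?thesis
  proof (intro tilted_survival.intro tilted_survival_axioms.intro surplus_skeleton_process th m)
    fix x s :: real assume x: "0 \<le> x"
    show "((\<lambda>s. measure (Q x) (survives s)) \<longlongrightarrow> measure (Q x) {\<omega> \<in> space path_space. ruin_time \<omega> = \<infinity>}) at_top"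
      by (rule survival_limit[OF Q[OF x]])
    interpret Qx: prob_space "Q x" by (rule Q(1)[OF x])
    show "0 \<le> measure (Q x) (survives s) \<and> measure (Q x) (survives s) \<le> 1" by simp
    show "measure (Q x) (survives s') \<le> measure (Q x) (survives s)" if "s \<le> s'" for s'
      by (rule Qx.finite_measure_mono[OF survives_antimono[OF that] ev[OF x]])
    assume s: "0 \<le> s"
    let ?g = "\<lambda>w. ennreal (exp (th * (w s - x) - lexp th * s)) * indicator (survives s) w"
    have L: "sets (risk_law M N Y B c \<sigma> x) = sets path_space" by (simp add: risk_law_eq)
    have gm: "?g \<in> borel_measurable path_space"
      using coordinate_measurable[OF s] survives_filtration[of s] subalgebra_path_filtration[OF refl, of s]
      by (auto simp: subalgebra_def)
    have "(\<integral>\<^sup>+\<omega>. ennreal (exp (th * surplus s \<omega> - lexp th * s)) * indicator {\<omega>. alive x s \<omega>} \<omega> \<partial>M)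
      = (\<integral>\<^sup>+\<omega>. ?g (surplus_path x \<omega>) \<partial>M)"
    proof (rule nn_integral_cong)
      fix \<omega> assume w: "\<omega> \<in> space M"
      have "surplus_path x \<omega> \<in> survives s \<longleftrightarrow> alive x s \<omega>"
        using surplus_path_cadlag[OF w, of x] by (simp add: survives_def alive_def surplus_path_def less_imp_le)
      then show "ennreal (exp (th * surplus s \<omega> - lexp th * s)) * indicator {\<omega>. alive x s \<omega>} \<omega> = ?g (surplus_path x \<omega>)"
        using s by (simp add: indicator_def surplus_path_def)
    qed
    also have "\<dots> = (\<integral>\<^sup>+w. ?g w \<partial>risk_law M N Y B c \<sigma> x)"
      unfolding risk_law_eq
      by (rule nn_integral_distr[OF surplus_path_measurable, symmetric]) (simp only: measurable_distr_eq1 gm)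
    also have "\<dots> = emeasure (Q x) (survives s)"
      by (rule exponential_tilt_emeasure[OF tilt[OF x] L s survives_filtration, symmetric])
    also have "\<dots> = ennreal (measure (Q x) (survives s))" by (rule Qx.emeasure_eq_measure)
    finally show "(\<integral>\<^sup>+\<omega>. ennreal (exp (th * surplus s \<omega> - lexp th * s)) * indicator {\<omega>. alive x s \<omega>} \<omega> \<partial>M)
      = ennreal (measure (Q x) (survives s))" .
  qed
qed

text \<open>\<open>ruin_tail\<close> identifies the measure with \<open>density lborel ?f\<close> on
  half-lines, hence altogether; the Radon-Nikodym derivative is then determined almost everywhere.
  The conditional in \<open>y \<le> x\<close> is the convention \<open>W = 0\<close> on the negative
  axis made explicit.\<close>

lemma discounted_pre_ruin_density:
  assumes th: "0 \<le> th" and m: "0 < m" "(lexp has_real_derivative m) (at th within {0..})"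
    and tilt: "\<And>x. 0 \<le> x \<Longrightarrow> exponential_tilt lexp th x (risk_law M N Y B c \<sigma> x) (Q x)"
    and x: "0 \<le> x"
  shows "absolutely_continuous lborel (discounted_pre_ruin_measure (lexp th) (risk_law M N Y B c \<sigma> x))"
    and "AE y in lborel. 0 < y \<longrightarrow> discounted_density (lexp th) (risk_law M N Y B c \<sigma> x) y =
      lam * measure claim_law {y<..} * (exp (th * (x - y)) / m) *
        (measure (Q x) {\<omega> \<in> space path_space. ruin_time \<omega> = \<infinity>}
          - (if y \<le> x then measure (Q (x - y)) {\<omega> \<in> space path_space. ruin_time \<omega> = \<infinity>} else 0))"
proof -
  let ?sv = "\<lambda>x. measure (Q x) {\<omega> \<in> space path_space. ruin_time \<omega> = \<infinity>}"
  interpret R: ruin_model M step_distr lexp c "\<sigma>\<^sup>2 / 2" "c - lam * mu" surplus lam claim_law th m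
      "\<lambda>x s. measure (Q x) (survives s)" ?sv
    by (intro ruin_model.intro surplus_jump_process tilted_survival_surplus th m tilt)
  let ?L = "risk_law M N Y B c \<sigma> x"
  let ?K = "discounted_pre_ruin_measure (lexp th) ?L"
  let ?f = "\<lambda>y. ennreal (R.ruin_density x y) * indicator {0<..} y"
  have fm: "?f \<in> borel_measurable borel" by (rule R.ruin_tail(3)[OF x order_refl])
  have L: "sets ?L = sets path_space" by (simp add: risk_law_eq)
  let ?g = "\<lambda>A w. ((case ruin_triple w of (y, z, t) \<Rightarrow> ennreal (exp (- lexp th * t)) * indicator positive_octant (y, z, t))
        * indicator (fst -` A) (ruin_triple w)) * indicator {w. ruin_time w < \<infinity>} w"
  have path_value: "?g {a<..} (surplus_path x \<omega>) =
      ennreal (ruin_value (\<lambda>t. x + surplus t \<omega>) (lexp th) (indicator {a<..}) (indicator {..<0}))"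
    if a: "0 \<le> a" and w: "\<omega> \<in> space M" for a \<omega>
  proof -
    have 0: "surplus_path x \<omega> 0 = x" "x + surplus 0 \<omega> = x" using surplus_0[OF w] by (simp_all add: surplus_path_def)
    have "?g {a<..} (surplus_path x \<omega>) = ennreal (ruin_value (surplus_path x \<omega>) (lexp th) (indicator {a<..}) (indicator {..<0}))"
      by (rule cadlag_path.ruin_value_triple[OF cadlag_path_of_paths[OF surplus_path_cadlag[OF w]]]) (use x a 0 in simp_all)
    also have "ruin_value (surplus_path x \<omega>) (lexp th) (indicator {a<..}) (indicator {..<0})
      = ruin_value (\<lambda>t. x + surplus t \<omega>) (lexp th) (indicator {a<..}) (indicator {..<0})"
      unfolding surplus_path_def
      by (rule ruin_value_restrict[OF surplus_cadlag[OF w]]) (use x 0 in simp_all)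
    finally show ?thesis .
  qed
  have Kint: "emeasure ?K {a<..} = (\<integral>\<^sup>+\<omega>. ennreal (ruin_value (\<lambda>t. x + surplus t \<omega>) (lexp th) (indicator {a<..}) (indicator {..<0})) \<partial>M)"
    if a: "0 \<le> a" for a
  proof -
    have A: "{a<..} \<in> sets borel" by simp
    have gm: "?g {a<..} \<in> borel_measurable path_space"
      using emeasure_discounted_pre_ruin_measure(2)[OF L A] measurable_cong_sets[OF L refl] by blast
    have "emeasure ?K {a<..} = (\<integral>\<^sup>+w. ?g {a<..} w \<partial>?L)"
      by (rule emeasure_discounted_pre_ruin_measure(1)[OF L A])
    also have "\<dots> = (\<integral>\<^sup>+\<omega>. ?g {a<..} (surplus_path x \<omega>) \<partial>M)"
      unfolding risk_law_eq
      by (rule nn_integral_distr[OF surplus_path_measurable]) (simp only: measurable_distr_eq1 gm)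
    also have "\<dots> = (\<integral>\<^sup>+\<omega>. ennreal (ruin_value (\<lambda>t. x + surplus t \<omega>) (lexp th) (indicator {a<..}) (indicator {..<0})) \<partial>M)"
      by (rule nn_integral_cong) (rule path_value[OF a])
    finally show ?thesis .
  qed
  have K: "emeasure ?K {a<..} = (\<integral>\<^sup>+y. ennreal (R.ruin_density x y) * indicator {a<..} y \<partial>lborel)" if a: "0 \<le> a" for a
    unfolding Kint[OF a] by (rule R.ruin_tail(2)[OF x a])
  \<comment> \<open>Agreement on half-lines determines the measure only if these have finite mass;
    this holds since the discount is at most 1 at the nonnegative level
    \<open>lexp th\<close>.\<close>
  have Kfin: "emeasure ?K {a<..} < \<infinity>" for a
  proof -
    have *: "emeasure ?K {a<..} < \<infinity>" if a: "0 \<le> a" for a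
    proof -
      have q: "0 \<le> lexp th" by (rule R.phi_nonneg[OF th])
      have "ruin_value X (lexp th) (indicator {a<..}) (indicator {..<0}) \<le> 1" for X
      proof -
        have T: "0 \<le> real_of_ereal (ruin_time X)"
          by (intro real_of_ereal_pos) (auto simp: ruin_time_def intro!: Inf_greatest)
        show ?thesis using q T by (auto simp: ruin_value_def indicator_def Let_def)
      qed
      then have "emeasure ?K {a<..} \<le> (\<integral>\<^sup>+\<omega>. ennreal 1 \<partial>M)"
        unfolding Kint[OF a] by (intro nn_integral_mono ennreal_leI)
      also have "\<dots> = 1" by (simp add: emeasure_space_1)
      finally show ?thesis using le_less_trans by fastforce
    qed
    show ?thesis using *[of a] *[of 0] discounted_tail_nonpos[OF L, of a "lexp th"] by (cases "0 \<le> a") auto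
  qed
  have eq: "?K = density lborel ?f"
  proof (rule measure_eqI_lessThan)
    fix a :: real
    have "emeasure (density lborel ?f) {a<..} = (\<integral>\<^sup>+y. ?f y * indicator {a<..} y \<partial>lborel)"
      by (rule emeasure_density) (use fm in auto)
    also have "\<dots> = (\<integral>\<^sup>+y. ennreal (R.ruin_density x y) * indicator {max a 0<..} y \<partial>lborel)"
      by (rule nn_integral_cong) (auto simp: indicator_def)
    also have "\<dots> = emeasure ?K {max a 0<..}" by (rule K[symmetric]) simp
    also have "\<dots> = emeasure ?K {a<..}"
      using discounted_tail_nonpos[OF L, of a "lexp th"] by (cases "0 \<le> a") (auto simp: max_def)
    finally show "emeasure ?K {a<..} = emeasure (density lborel ?f) {a<..}" by simp
  qed (use Kfin in \<open>auto simp: sets_discounted_pre_ruin_measure\<close>)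
  have fl: "?f \<in> borel_measurable lborel" using fm by simp
  show "absolutely_continuous lborel ?K"
    unfolding eq by (rule absolutely_continuousI_density[OF fl])
  have "AE y in lborel. ?f y = RN_deriv lborel ?K y"
    by (rule sigma_finite_measure.RN_deriv_unique[OF sigma_finite_lborel fl eq[symmetric]])
  then show "AE y in lborel. 0 < y \<longrightarrow> discounted_density (lexp th) ?L y =
      lam * measure claim_law {y<..} * (exp (th * (x - y)) / m) * (?sv x - (if y \<le> x then ?sv (x - y) else 0))"
  proof eventually_elim
    case (elim y)
    show ?case
    proof
      assume y: "0 < y"
      have "discounted_density (lexp th) ?L y = R.ruin_density x y"
        using y R.ruin_density_nonneg[OF x, of y] by (simp add: discounted_density_def elim[symmetric])
      also have "\<dots> = lam * measure claim_law {y<..} * (exp (th * (x - y)) / m) * (?sv x - (if y \<le> x then ?sv (x - y) else 0))"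
      proof -
        have "exp (- th * y) * exp (th * x) = exp (th * (x - y))"
          by (simp add: exp_add[symmetric] right_diff_distrib)
        then have "exp (- th * y) * R.W x = exp (th * (x - y)) / m * ?sv x" using x by (simp add: R.W_def)
        then show ?thesis by (simp add: R.ruin_density_def R.W_def right_diff_distrib)
      qed
      finally show "discounted_density (lexp th) ?L y =
        lam * measure claim_law {y<..} * (exp (th * (x - y)) / m) * (?sv x - (if y \<le> x then ?sv (x - y) else 0))" .
    qed
  qed
qed

text \<open>\<open>lexp\<close> lies above the line of slope \<open>c - lam * mu\<close>, so the
  level \<open>q\<close> is attained on \<open>[0, q / (c - lam * mu)]\<close>. Strict monotonicity
  makes the solution set a singleton, so its supremum is this solution.\<close>

lemma lexp_level:
  assumes q: "0 \<le> q"
  obtains th where "0 \<le> th" "lexp th = q" "right_inverse lexp q = th"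
proof -
  interpret step_family step_distr lexp c "\<sigma>\<^sup>2 / 2" "c - lam * mu" by (rule surplus_step_family)
  let ?b = "q / (c - lam * mu)"
  have b: "0 \<le> ?b" using q d_pos by simp
  have "q \<le> lexp ?b" using phi_diff[OF order_refl b] d_pos phi_0 by simp
  then obtain th where th: "0 \<le> th" "th \<le> ?b" "lexp th = q"
    using IVT'[of lexp 0 q ?b] q b phi_0 continuous_on_subset[OF phi_cont, of "{0..?b}"] by auto
  have "{\<alpha>. 0 \<le> \<alpha> \<and> lexp \<alpha> = q} = {th}"
  proof (intro set_eqI iffI)
    fix \<alpha> assume "\<alpha> \<in> {\<alpha>. 0 \<le> \<alpha> \<and> lexp \<alpha> = q}"
    then show "\<alpha> \<in> {th}" using phi_strict[of \<alpha> th] phi_strict[of th \<alpha>] th by (cases \<alpha> th rule: linorder_cases) auto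
  qed (use th in auto)
  then have "right_inverse lexp q = th" by (simp add: right_inverse_def)
  then show ?thesis using that th by blast
qed

end

text \<open>\<open>vector_derivative\<close> is defined by choice, so its value is determined only
  where the filter is nontrivial; points to the right of \<open>a\<close> ensure this even for
  \<open>a = 0\<close>.\<close>

lemma deriv_nonneg_eq:
  assumes "0 \<le> a" "(f has_real_derivative m) (at a within {0..})" shows "deriv_nonneg f a = m"
  unfolding deriv_nonneg_def
proof (rule vector_derivative_within)
  have "at_right a \<le> at a within {0..}" using assms(1) by (intro at_le) auto
  then show "at a within {0..} \<noteq> bot" using trivial_limit_at_right_real[of a] by (metis bot.extremum_uniqueI)
  show "(f has_vector_derivative m) (at a within {0..})"
    using assms(2) by (simp add: has_real_derivative_iff_has_vector_derivative)
qed

theorem mainTheorem4: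
  fixes M :: "'a measure"
    and N :: "real \<Rightarrow> 'a \<Rightarrow> nat"
    and Y :: "nat \<Rightarrow> 'a \<Rightarrow> real"
    and B :: "real \<Rightarrow> 'a \<Rightarrow> real"
    and P p :: "real \<Rightarrow> real"
    and c \<sigma> lam \<mu> x q :: real
    and Q :: "real \<Rightarrow> real \<Rightarrow> (real \<Rightarrow> real) measure"
  defines "law \<equiv> risk_law M N Y B c \<sigma>"
    and "\<phi> \<equiv> laplace_exponent c \<sigma> lam p"
    and "\<Phi> \<equiv> right_inverse (laplace_exponent c \<sigma> lam p)"
  assumes "prob_space M"
    and "poisson_process M lam N"
    and "brownian_motion M B"
    and "prob_space.indep_vars M (\<lambda>_. borel) Y {1..}"
    and "\<And>k. k \<ge> 1 \<Longrightarrow> cdf (distr M borel (Y k)) = P"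
    and "p \<in> borel_measurable borel" and "\<And>u. 0 \<le> p u"
    and "\<And>k. k \<ge> 1 \<Longrightarrow> distributed M lborel (Y k) (\<lambda>u. ennreal (p u))"
    and "P 0 = 0"
    and "integrable M (Y 1)" and "prob_space.expectation M (Y 1) = \<mu>"
    and "three_independent M N Y B"
    and "0 \<le> \<sigma>" and "c > lam * \<mu>"
    and tilt: "\<And>\<theta> x. 0 \<le> \<theta> \<Longrightarrow> 0 \<le> x \<Longrightarrow> exponential_tilt \<phi> \<theta> x (law x) (Q \<theta> x)"
    and "0 \<le> x" and "0 \<le> q"
  shows "absolutely_continuous lborel (discounted_pre_ruin_measure q (law x)) \<and>
    (AE y in lborel.
      (y > x \<longrightarrow>
        discounted_density q (law x) y =
          lam * (1 - P y) * (exp (\<Phi> q * (x - y)) / deriv_nonneg \<phi> (\<Phi> q))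
            * measure (Q (\<Phi> q) x) {\<omega> \<in> space path_space. ruin_time \<omega> = \<infinity>}) \<and>
      (0 < y \<and> y \<le> x \<longrightarrow>
        discounted_density q (law x) y =
          lam * (1 - P y) * (exp (\<Phi> q * (x - y)) / deriv_nonneg \<phi> (\<Phi> q))
            * (measure (Q (\<Phi> q) x) {\<omega> \<in> space path_space. ruin_time \<omega> = \<infinity>}
               - measure (Q (\<Phi> q) (x - y)) {\<omega> \<in> space path_space. ruin_time \<omega> = \<infinity>})))"
proof -
  interpret prob_space M by fact
  have distY: "distributed M lborel (Y k) (\<lambda>u. ennreal (p u))" if "1 \<le> k" for k using assms(11) that .
  have Y1: "distributed M lborel (Y 1) (\<lambda>u. ennreal (p u))" by (rule distY) simp
  have pm: "p \<in> borel_measurable borel" and p0: "\<And>u. 0 \<le> p u" using assms(9,10) .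
  note pm[measurable]
  have YP: "cdf (distr M borel (Y 1)) = P" using assms(8)[of 1] by simp
  have Ym[measurable]: "Y 1 \<in> borel_measurable M" using distributed_measurable[OF Y1] by simp
  have dY: "density lborel (\<lambda>u. ennreal (p u)) = distr M borel (Y 1)"
    using distributed_distr_eq_density[OF Y1] by (simp cong: distr_cong)
  have p_mass: "(\<integral>\<^sup>+u. ennreal (p u) \<partial>lborel) = 1"
  proof -
    have "(\<integral>\<^sup>+u. ennreal (p u) \<partial>lborel) = emeasure (density lborel (\<lambda>u. ennreal (p u))) UNIV"
      by (simp add: emeasure_density)
    also have "\<dots> = 1"
      unfolding dY using prob_space.emeasure_space_1[OF prob_space_distr[OF Ym]] by simp
    finally show ?thesis .
  qed
  have p_int: "integrable lborel p"
    using p_mass p0 by (intro integrableI_nonneg) auto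
  have p_1: "(\<integral>u. p u \<partial>lborel) = 1"
    using p_mass p0 by (subst integral_eq_nn_integral) auto
  \<comment> \<open>\<open>P 0 = 0\<close> says that the claim law has no mass on
    \<open>{..0}\<close>, so its density vanishes there almost everywhere. This identifies the
    integral over \<open>{0<..}\<close> in the Laplace exponent with the full transform of the claim
    law.\<close>
  have p_pos: "AE u in lborel. u \<le> 0 \<longrightarrow> p u = 0"
  proof -
    interpret D: prob_space "distr M borel (Y 1)" by (rule prob_space_distr) (rule Ym)
    have "D.prob {..0} = 0" using fun_cong[OF YP, of 0] \<open>P 0 = 0\<close> by (simp only: cdf_def)
    then have "emeasure (density lborel (\<lambda>u. ennreal (p u))) {..0} = 0"
      unfolding dY D.emeasure_eq_measure by simp
    then have "(\<integral>\<^sup>+u. ennreal (p u) * indicator {..0} u \<partial>lborel) = 0"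
      by (simp add: emeasure_density)
    then have "AE u in lborel. ennreal (p u) * indicator {..0} u = 0"
      by (subst (asm) nn_integral_0_iff_AE) auto
    then show ?thesis
      by eventually_elim (use p0 in \<open>auto simp: indicator_def split: if_splits intro: antisym\<close>)
  qed
  interpret risk_model M N Y B c \<sigma> lam p \<mu>
  proof (intro risk_model.intro risk_data.intro risk_data_axioms.intro risk_model_axioms.intro)
    show "integrable lborel (\<lambda>u. p u * u)"
      using distributed_integrable[OF Y1, of "\<lambda>u. u"] p0 \<open>integrable M (Y 1)\<close> by simp
    show "(\<integral>u. p u * u \<partial>lborel) = \<mu>"
      using distributed_integral[OF Y1, of "\<lambda>u. u"] p0 \<open>expectation (Y 1) = \<mu>\<close> by simp
  qed (use assms distY pm p0 p_pos p_int p_1 in auto)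
  obtain th where th: "0 \<le> th" "lexp th = q" "right_inverse lexp q = th"
    using lexp_level[OF \<open>0 \<le> q\<close>] by blast
  obtain m where m: "(lexp has_real_derivative m) (at th within {0..})" "c - lam * \<mu> \<le> m"
    using lexp_deriv[OF th(1)] by blast
  have m0: "0 < m" using m(2) safety by simp
  have tilt': "exponential_tilt lexp th x (risk_law M N Y B c \<sigma> x) (Q th x)" if "0 \<le> x" for x
    using tilt[OF th(1) that] by (simp add: law_def \<phi>_def lexp_def)
  have d: "deriv_nonneg \<phi> th = m" and Phi: "\<Phi> q = th" and law: "law x = risk_law M N Y B c \<sigma> x"
    using deriv_nonneg_eq[OF th(1) m(1)] th(3) by (simp_all add: \<phi>_def \<Phi>_def law_def lexp_def)
  have tail: "measure claim_law {y<..} = 1 - P y" for y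
  proof -
    interpret C: prob_space claim_law unfolding claim_law_distr[of 0] by (rule prob_space_distr) simp
    have "P y = measure claim_law {..y}"
      using YP by (auto simp: cdf_def claim_law_distr[of 0])
    moreover have "{y<..} = space claim_law - {..y}" by (auto simp: claim_law_distr[of 0])
    ultimately show ?thesis
      using C.prob_compl[of "{..y}"] by (simp add: claim_law_distr[of 0])
  qed
  have dens: "absolutely_continuous lborel (discounted_pre_ruin_measure (lexp th) (risk_law M N Y B c \<sigma> x))"
    "AE y in lborel. 0 < y \<longrightarrow> discounted_density (lexp th) (risk_law M N Y B c \<sigma> x) y =
      lam * measure claim_law {y<..} * (exp (th * (x - y)) / m) *
        (measure (Q th x) {\<omega> \<in> space path_space. ruin_time \<omega> = \<infinity>}
          - (if y \<le> x then measure (Q th (x - y)) {\<omega> \<in> space path_space. ruin_time \<omega> = \<infinity>} else 0))"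
    using discounted_pre_ruin_density[where Q="Q th", OF th(1) m0 m(1)] tilt' \<open>0 \<le> x\<close> by blast+
  show ?thesis
  proof
    show "absolutely_continuous lborel (discounted_pre_ruin_measure q (law x))"
      using dens(1) by (simp add: law th(2))
    show "AE y in lborel.
      (y > x \<longrightarrow>
        discounted_density q (law x) y =
          lam * (1 - P y) * (exp (\<Phi> q * (x - y)) / deriv_nonneg \<phi> (\<Phi> q))
            * measure (Q (\<Phi> q) x) {\<omega> \<in> space path_space. ruin_time \<omega> = \<infinity>}) \<and>
      (0 < y \<and> y \<le> x \<longrightarrow>
        discounted_density q (law x) y =
          lam * (1 - P y) * (exp (\<Phi> q * (x - y)) / deriv_nonneg \<phi> (\<Phi> q))
            * (measure (Q (\<Phi> q) x) {\<omega> \<in> space path_space. ruin_time \<omega> = \<infinity>}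
               - measure (Q (\<Phi> q) (x - y)) {\<omega> \<in> space path_space. ruin_time \<omega> = \<infinity>}))"
      \<comment> \<open>The two cases of the formula are the two values of the conditional;
        \<open>x \<ge> 0\<close> ensures that \<open>y > x\<close> implies
        \<open>y > 0\<close>.\<close>
      using dens(2) unfolding th(2) Phi d law tail
      by eventually_elim (use \<open>0 \<le> x\<close> in auto)
  qed
qed

end
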